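(* Let $X$ be a locally compact Hausdorff space. For any vector bundle $\mathcal{V}$ over $X$ and any hermitian metric $\beta$ on $\mathcal{V}$, the right Hilbert $C_0(X)$-module $\Gamma_0(\mathcal{V})$ is $\sigma$-finitely generated and $\sigma$-projective. Conversely, every full $\sigma$-finitely generated and $\sigma$-projective right Hilbert $C_0(X)$-module is isomorphic to a module of the form $\Gamma_0(\mathcal{V})$ for some vector bundle $\mathcal{V}$ over $X$ and some hermitian metric $\beta$ on $\mathcal{V}$.
   Context: Vector bundles are complex, locally trivial, of finite (locally constant) rank, with every fiber at least one-dimensional. A hermitian metric $\beta$ on $\mathcal{V}$ is a continuous map from the total space of $\mathcal{V}\oplus\mathcal{V}$ to $\mathbb{C}$ restricting to an inner product on each fiber. $\Gamma_0(\mathcal{V})$ is the space of continuous sections $\xi$ of $\mathcal{V}$ such that $x\mapsto\beta(\xi(x),\xi(x))$ vanishes at infinity, with right action $(\xi f)(x)=\xi(x)f(x)$ and inner product $\langle\xi,\eta\rangle(x)=\beta(\xi(x),\eta(x))$; it is a right Hilbert $C_0(X)$-module. A right Hilbert $A$-module $\mathcal{E}$ is full if the closed linear span of $\{\langle\xi,\eta\rangle:\xi,\eta\in\mathcal{E}\}$ is $A$. It is finitely generated if there is a finite subset $S$ whose $A$-linear span is dense in $\mathcal{E}$, and projective if it is projective as an $A$-module, i.e. an (algebraic) direct summand of some free $A$-module. Isomorphism of Hilbert $A$-modules means a bijective $A$-linear map preserving the $A$-valued inner products. For a right Hilbert $C_0(X)$-module $\mathcal{E}$ and compact $K\subset X$,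 let $\mathcal{E}_{C_0(X\setminus K)}=\mathcal{E}/\mathcal{E}C_0(X\setminus K)$, which is a right Hilbert module over $C_0(X)/C_0(X\setminus K)\cong C(K)$ with $\langle[\xi],[\eta]\rangle=[\langle\xi,\eta\rangle]$. $\mathcal{E}$ is $\sigma$-finitely generated (respectively $\sigma$-projective) if for every compact $K\subset X$ the Hilbert $C(K)$-module $\mathcal{E}_{C_0(X\setminus K)}$ is finitely generated (respectively projective). *)

theory Defs
  imports "HOL-Analysis.Analysis" "HOL-Algebra.Module" "HOL-Algebra.AbelCoset"
begin

section \<open>Complex vector spaces on a carrier set\<close>

definition complex_ring :: "complex ring" where
  "complex_ring = \<lparr>carrier = UNIV, mult = (*), one = 1, zero = 0, add = (+)\<rparr>"

definition cvector_space ::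
  "'v set \<Rightarrow> ('v \<Rightarrow> 'v \<Rightarrow> 'v) \<Rightarrow> 'v \<Rightarrow> (complex \<Rightarrow> 'v \<Rightarrow> 'v) \<Rightarrow> bool" where
  "cvector_space C a z sm \<longleftrightarrow>
     Module.module complex_ring
       \<lparr>carrier = C, mult = undefined, one = undefined, zero = z, add = a, smult = sm\<rparr>"


section \<open>The algebras of continuous functions vanishing at infinity\<close>

definition vanishes_at_infinity :: "'a topology \<Rightarrow> ('a \<Rightarrow> complex) \<Rightarrow> bool" where
  "vanishes_at_infinity X f \<longleftrightarrow>
     (\<forall>\<epsilon>>0. \<exists>K. compactin X K \<and> (\<forall>x \<in> topspace X - K. cmod (f x) < \<epsilon>))"

text \<open>
  Functions on a space are normalised to be \<open>0\<close> outside its carrier. Hence, for a compact subset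
  \<open>K\<close> of a Hausdorff space \<open>X\<close>, the set \<open>C0 (subtopology X (topspace X - K))\<close> is literally the
  ideal of all functions in \<open>C0 X\<close> that vanish on \<open>K\<close>, and \<open>C0 (subtopology X K)\<close> is \<open>C(K)\<close>.
\<close>

definition C0 :: "'a topology \<Rightarrow> ('a \<Rightarrow> complex) set" where
  "C0 X = {f. continuous_map X euclidean f \<and> vanishes_at_infinity X f \<and>
              (\<forall>x. x \<notin> topspace X \<longrightarrow> f x = 0)}"

definition sup_norm :: "('a \<Rightarrow> complex) \<Rightarrow> real" where
  "sup_norm f = (SUP x. cmod (f x))"

text \<open>The ring \<open>C(X)\<close>; meant for compact \<open>X\<close> only, since otherwise \<open>one\<close> is not in the carrier.\<close>

definition C_ring :: "'a topology \<Rightarrow> ('a \<Rightarrow> complex) ring" where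
  "C_ring X = \<lparr>carrier = C0 X, mult = (\<lambda>f g x. f x * g x), one = indicator (topspace X),
               zero = (\<lambda>x. 0), add = (\<lambda>f g x. f x + g x)\<rparr>"


section \<open>Hilbert modules over \<open>C0 X\<close>\<close>

text \<open>
  The fields \<open>mult\<close> and \<open>one\<close> inherited from the record \<open>module\<close> are not used. The algebras are
  commutative, so the right action \<open>\<xi> f\<close> is written \<open>f \<odot> \<xi>\<close>.
\<close>

record ('a, 'e) hmodule = "('a \<Rightarrow> complex, 'e) module" +
  cscale :: "complex \<Rightarrow> 'e \<Rightarrow> 'e"
  hinner :: "'e \<Rightarrow> 'e \<Rightarrow> 'a \<Rightarrow> complex"

definition hnorm :: "('a, 'e, 'm) hmodule_scheme \<Rightarrow> 'e \<Rightarrow> real" where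
  "hnorm E \<xi> = sqrt (sup_norm (hinner E \<xi> \<xi>))"

locale hilbert_module = abelian_group E
  for X :: "'a topology" and E :: "('a, 'e, 'm) hmodule_scheme" (structure) +
  assumes vector_space: "cvector_space (carrier E) (add E) (zero E) (cscale E)"
    and act_closed: "\<lbrakk>f \<in> C0 X; \<xi> \<in> carrier E\<rbrakk> \<Longrightarrow> f \<odot> \<xi> \<in> carrier E"
    and act_add_left: "\<lbrakk>f \<in> C0 X; g \<in> C0 X; \<xi> \<in> carrier E\<rbrakk> \<Longrightarrow>
          (\<lambda>x. f x + g x) \<odot> \<xi> = f \<odot> \<xi> \<oplus> g \<odot> \<xi>"
    and act_add_right: "\<lbrakk>f \<in> C0 X; \<xi> \<in> carrier E; \<eta> \<in> carrier E\<rbrakk> \<Longrightarrow>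
          f \<odot> (\<xi> \<oplus> \<eta>) = f \<odot> \<xi> \<oplus> f \<odot> \<eta>"
    and act_assoc: "\<lbrakk>f \<in> C0 X; g \<in> C0 X; \<xi> \<in> carrier E\<rbrakk> \<Longrightarrow>
          (\<lambda>x. f x * g x) \<odot> \<xi> = f \<odot> (g \<odot> \<xi>)"
    and act_cscale_left: "\<lbrakk>f \<in> C0 X; \<xi> \<in> carrier E\<rbrakk> \<Longrightarrow>
          (\<lambda>x. c * f x) \<odot> \<xi> = cscale E c (f \<odot> \<xi>)"
    and act_cscale_right: "\<lbrakk>f \<in> C0 X; \<xi> \<in> carrier E\<rbrakk> \<Longrightarrow>
          f \<odot> cscale E c \<xi> = cscale E c (f \<odot> \<xi>)"
    and hinner_closed: "\<lbrakk>\<xi> \<in> carrier E; \<eta> \<in> carrier E\<rbrakk> \<Longrightarrow> hinner E \<xi> \<eta> \<in> C0 X"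
    and hinner_add: "\<lbrakk>\<xi> \<in> carrier E; \<eta> \<in> carrier E; \<zeta> \<in> carrier E\<rbrakk> \<Longrightarrow>
          hinner E \<xi> (\<eta> \<oplus> \<zeta>) x = hinner E \<xi> \<eta> x + hinner E \<xi> \<zeta> x"
    and hinner_cscale: "\<lbrakk>\<xi> \<in> carrier E; \<eta> \<in> carrier E\<rbrakk> \<Longrightarrow>
          hinner E \<xi> (cscale E c \<eta>) x = c * hinner E \<xi> \<eta> x"
    and hinner_act: "\<lbrakk>\<xi> \<in> carrier E; \<eta> \<in> carrier E; f \<in> C0 X\<rbrakk> \<Longrightarrow>
          hinner E \<xi> (f \<odot> \<eta>) x = hinner E \<xi> \<eta> x * f x"
    and hinner_commute: "\<lbrakk>\<xi> \<in> carrier E; \<eta> \<in> carrier E\<rbrakk> \<Longrightarrow>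
          hinner E \<eta> \<xi> x = cnj (hinner E \<xi> \<eta> x)"
    and hinner_nonneg: "\<xi> \<in> carrier E \<Longrightarrow> hinner E \<xi> \<xi> x \<in> \<real> \<and> 0 \<le> Re (hinner E \<xi> \<xi> x)"
    and hinner_definite: "\<lbrakk>\<xi> \<in> carrier E; \<And>x. hinner E \<xi> \<xi> x = 0\<rbrakk> \<Longrightarrow> \<xi> = \<zero>"
    and complete: "\<lbrakk>\<And>n::nat. s n \<in> carrier E;
          \<And>\<epsilon>. \<epsilon> > 0 \<Longrightarrow> \<exists>N. \<forall>m\<ge>N. \<forall>n\<ge>N. hnorm E (s m \<ominus> s n) < \<epsilon>\<rbrakk> \<Longrightarrow>
          \<exists>\<xi> \<in> carrier E. (\<lambda>n. hnorm E (s n \<ominus> \<xi>)) \<longlonglongrightarrow> 0"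

text \<open>
  Fullness: the linear span of the inner products, which is contained in \<open>C0 X\<close> in any case, is
  dense in \<open>C0 X\<close>.
\<close>

definition full :: "'a topology \<Rightarrow> ('a, 'e, 'm) hmodule_scheme \<Rightarrow> bool" where
  "full X E \<longleftrightarrow>
     (\<forall>f \<in> C0 X. \<forall>\<epsilon>>0. \<exists>(n::nat) c \<xi> \<eta>.
        (\<forall>i<n. \<xi> i \<in> carrier E \<and> \<eta> i \<in> carrier E) \<and>
        sup_norm (\<lambda>x. f x - (\<Sum>i<n. c i * hinner E (\<xi> i) (\<eta> i) x)) < \<epsilon>)"

definition hmodule_iso ::
  "'a topology \<Rightarrow> ('a, 'e, 'm) hmodule_scheme \<Rightarrow> ('a, 'f, 'n) hmodule_scheme \<Rightarrow> bool" where
  "hmodule_iso X E F \<longleftrightarrow>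
     (\<exists>T. bij_betw T (carrier E) (carrier F) \<and>
        (\<forall>\<xi>\<in>carrier E. \<forall>\<eta>\<in>carrier E. T (\<xi> \<oplus>\<^bsub>E\<^esub> \<eta>) = T \<xi> \<oplus>\<^bsub>F\<^esub> T \<eta>) \<and>
        (\<forall>c. \<forall>\<xi>\<in>carrier E. T (cscale E c \<xi>) = cscale F c (T \<xi>)) \<and>
        (\<forall>f\<in>C0 X. \<forall>\<xi>\<in>carrier E. T (f \<odot>\<^bsub>E\<^esub> \<xi>) = f \<odot>\<^bsub>F\<^esub> T \<xi>) \<and>
        (\<forall>\<xi>\<in>carrier E. \<forall>\<eta>\<in>carrier E. hinner F (T \<xi>) (T \<eta>) = hinner E \<xi> \<eta>))"

definition C0_span :: "'a topology \<Rightarrow> ('a, 'e, 'm) hmodule_scheme \<Rightarrow> 'e set \<Rightarrow> 'e set" where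
  "C0_span X E S = {finsum E (\<lambda>s. f s \<odot>\<^bsub>E\<^esub> s) S | f. f \<in> S \<rightarrow> C0 X}"

definition finitely_generated :: "'a topology \<Rightarrow> ('a, 'e, 'm) hmodule_scheme \<Rightarrow> bool" where
  "finitely_generated X E \<longleftrightarrow>
     (\<exists>S. finite S \<and> S \<subseteq> carrier E \<and>
        (\<forall>\<xi>\<in>carrier E. \<forall>\<epsilon>>0. \<exists>\<eta>\<in>C0_span X E S. hnorm E (\<xi> \<ominus>\<^bsub>E\<^esub> \<eta>) < \<epsilon>))"


section \<open>Projective modules over a commutative ring\<close>

definition free_module :: "('r, 'k) ring_scheme \<Rightarrow> 'i set \<Rightarrow> ('r, 'i \<Rightarrow> 'r) module" where
  "free_module R I =
     \<lparr>carrier = {c. (\<forall>i. c i \<in> carrier R) \<and> (\<forall>i. i \<notin> I \<longrightarrow> c i = \<zero>\<^bsub>R\<^esub>) \<and> finite {i. c i \<noteq> \<zero>\<^bsub>R\<^esub>}},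
      mult = undefined, one = undefined, zero = (\<lambda>i. \<zero>\<^bsub>R\<^esub>),
      add = (\<lambda>c d i. c i \<oplus>\<^bsub>R\<^esub> d i), smult = (\<lambda>r c i. r \<otimes>\<^bsub>R\<^esub> c i)\<rparr>"

definition direct_summand ::
  "('r, 'k) ring_scheme \<Rightarrow> ('r, 'e, 'm) module_scheme \<Rightarrow> ('r, 'f, 'n) module_scheme \<Rightarrow> bool" where
  "direct_summand R M F \<longleftrightarrow>
     (\<exists>N N'. submodule N R F \<and> submodule N' R F \<and> N \<inter> N' = {\<zero>\<^bsub>F\<^esub>} \<and> N <+>\<^bsub>F\<^esub> N' = carrier F \<and>
        (\<exists>\<phi>. bij_betw \<phi> (carrier M) N \<and>
           (\<forall>x\<in>carrier M. \<forall>y\<in>carrier M. \<phi> (x \<oplus>\<^bsub>M\<^esub> y) = \<phi> x \<oplus>\<^bsub>F\<^esub> \<phi> y) \<and>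
           (\<forall>r\<in>carrier R. \<forall>x\<in>carrier M. \<phi> (r \<odot>\<^bsub>M\<^esub> x) = r \<odot>\<^bsub>F\<^esub> \<phi> x)))"

text \<open>
  The index set of the free module has to live in some fixed type. The element type of the module
  itself is no restriction, see the lemma \<open>projective_if_direct_summand_free\<close> below.
\<close>

definition projective :: "('r, 'k) ring_scheme \<Rightarrow> ('r, 'e, 'm) module_scheme \<Rightarrow> bool" where
  "projective R M \<longleftrightarrow> (\<exists>I :: 'e set. direct_summand R M (free_module R I))"


subsection \<open>Independence of the type of the index set\<close>

definition linmap ::
  "('r, 'k) ring_scheme \<Rightarrow> ('r, 'e, 'm) module_scheme \<Rightarrow> ('r, 'f, 'n) module_scheme \<Rightarrow> ('e \<Rightarrow> 'f) \<Rightarrow> bool" where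
  "linmap R M F f \<longleftrightarrow> f \<in> carrier M \<rightarrow> carrier F \<and>
     (\<forall>x\<in>carrier M. \<forall>y\<in>carrier M. f (x \<oplus>\<^bsub>M\<^esub> y) = f x \<oplus>\<^bsub>F\<^esub> f y) \<and>
     (\<forall>r\<in>carrier R. \<forall>x\<in>carrier M. f (r \<odot>\<^bsub>M\<^esub> x) = r \<odot>\<^bsub>F\<^esub> f x)"

lemma linmap_comp: "linmap R M F f \<Longrightarrow> linmap R F G g \<Longrightarrow> linmap R M G (g \<circ> f)"
  by (auto simp: linmap_def Pi_iff)

lemma linmap_zero:
  assumes "Module.module R M" "Module.module R F" "linmap R M F f"
  shows "f \<zero>\<^bsub>M\<^esub> = \<zero>\<^bsub>F\<^esub>"
proof -
  interpret M: Module.module R M by fact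
  interpret F: Module.module R F by fact
  have "f (\<zero>\<^bsub>R\<^esub> \<odot>\<^bsub>M\<^esub> \<zero>\<^bsub>M\<^esub>) = \<zero>\<^bsub>R\<^esub> \<odot>\<^bsub>F\<^esub> f \<zero>\<^bsub>M\<^esub>"
    using assms(3) M.R.zero_closed M.M.zero_closed unfolding linmap_def by blast
  moreover have "f \<zero>\<^bsub>M\<^esub> \<in> carrier F"
    using assms(3) by (auto simp: linmap_def)
  ultimately show ?thesis by simp
qed

lemma linmap_minus:
  assumes "Module.module R M" "Module.module R F" "linmap R M F f" "x \<in> carrier M"
  shows "f (\<ominus>\<^bsub>M\<^esub> x) = \<ominus>\<^bsub>F\<^esub> f x"
proof -
  interpret M: Module.module R M by fact
  interpret F: Module.module R F by fact
  have 1: "f (\<ominus>\<^bsub>M\<^esub> x) \<in> carrier F" "f x \<in> carrier F"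
    using assms(3,4) by (auto simp: linmap_def)
  have "f (\<ominus>\<^bsub>M\<^esub> x) \<oplus>\<^bsub>F\<^esub> f x = f (\<ominus>\<^bsub>M\<^esub> x \<oplus>\<^bsub>M\<^esub> x)"
    using assms(3,4) by (simp add: linmap_def)
  also have "\<dots> = \<zero>\<^bsub>F\<^esub>" using linmap_zero[OF assms(1-3)] assms(4) by (simp add: M.M.l_neg)
  finally show ?thesis using F.M.minus_equality 1 by simp
qed

lemma module_free_module:
  fixes R :: "('r, 'k) ring_scheme" and I :: "'i set"
  assumes "cring R"
  shows "Module.module R (free_module R I)"
proof -
  interpret R: cring R by fact
  have fin: "finite {i. c i \<oplus>\<^bsub>R\<^esub> d i \<noteq> \<zero>\<^bsub>R\<^esub>}"
    if "finite {i. c i \<noteq> \<zero>\<^bsub>R\<^esub>}" "finite {i. d i \<noteq> \<zero>\<^bsub>R\<^esub>}" for c d :: "'i \<Rightarrow> 'r"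
    by (rule finite_subset[OF _ finite_UnI[OF that]]) auto
  have fin2: "finite {i. r \<otimes>\<^bsub>R\<^esub> c i \<noteq> \<zero>\<^bsub>R\<^esub>}"
    if "finite {i. c i \<noteq> \<zero>\<^bsub>R\<^esub>}" "r \<in> carrier R" for c :: "'i \<Rightarrow> 'r" and r
    by (rule finite_subset[OF _ that(1)]) (use that in auto)
  have fin3: "finite {i. \<ominus>\<^bsub>R\<^esub> c i \<noteq> \<zero>\<^bsub>R\<^esub>}"
    if "finite {i. c i \<noteq> \<zero>\<^bsub>R\<^esub>}" for c :: "'i \<Rightarrow> 'r"
    by (rule finite_subset[OF _ that(1)]) auto
  show ?thesis
  proof (rule moduleI)
    show "abelian_group (free_module R I)"
    proof (rule abelian_groupI)
      fix c assume "c \<in> carrier (free_module R I)"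
      then show "\<exists>d\<in>carrier (free_module R I). d \<oplus>\<^bsub>free_module R I\<^esub> c = \<zero>\<^bsub>free_module R I\<^esub>"
        by (intro bexI[of _ "\<lambda>i. \<ominus>\<^bsub>R\<^esub> c i"]) (auto simp: free_module_def R.l_neg fin3)
    qed (auto simp: free_module_def fin R.a_ac)
  qed (use assms in \<open>auto simp: free_module_def fin2 R.l_distr R.r_distr R.m_assoc\<close>)
qed

definition unitvec :: "('r, 'k) ring_scheme \<Rightarrow> 'i \<Rightarrow> 'i \<Rightarrow> 'r" where
  "unitvec R i = (\<lambda>j. if j = i then \<one>\<^bsub>R\<^esub> else \<zero>\<^bsub>R\<^esub>)"

lemma unitvec_carrier:
  assumes "cring R" "i \<in> I"
  shows "unitvec R i \<in> carrier (free_module R I)"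
proof -
  interpret R: cring R by fact
  have "finite {j. unitvec R i j \<noteq> \<zero>\<^bsub>R\<^esub>}"
    by (rule finite_subset[of _ "{i}"]) (auto simp: unitvec_def)
  then show ?thesis using assms by (auto simp: free_module_def unitvec_def)
qed

lemma free_module_ext_unique:
  assumes R: "cring R" and "Module.module R M"
    and f: "linmap R (free_module R I) M f" and g: "linmap R (free_module R I) M g"
    and eq: "\<And>i. i \<in> I \<Longrightarrow> f (unitvec R i) = g (unitvec R i)"
    and c: "c \<in> carrier (free_module R I)"
  shows "f c = g c"
proof -
  interpret R: cring R by fact
  have mod: "Module.module R (free_module R I)" by (rule module_free_module[OF R])
  have "\<forall>c\<in>carrier (free_module R I). {i. c i \<noteq> \<zero>\<^bsub>R\<^esub>} \<subseteq> T \<longrightarrow> f c = g c" if "finite T" for T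
    using that
  proof (induction T)
    case empty
    have "f \<zero>\<^bsub>free_module R I\<^esub> = g \<zero>\<^bsub>free_module R I\<^esub>"
      using linmap_zero[OF mod assms(2) f] linmap_zero[OF mod assms(2) g] by simp
    then show ?case by (auto simp: free_module_def)
  next
    case (insert i T)
    show ?case
    proof (intro ballI impI)
      fix c assume c: "c \<in> carrier (free_module R I)" and sup: "{i. c i \<noteq> \<zero>\<^bsub>R\<^esub>} \<subseteq> insert i T"
      show "f c = g c"
      proof (cases "i \<in> I")
        case False
        then have "{i. c i \<noteq> \<zero>\<^bsub>R\<^esub>} \<subseteq> T" using c sup by (auto simp: free_module_def)
        then show ?thesis using insert.IH c by blast
      next
        case True
        define c' where "c' = c(i := \<zero>\<^bsub>R\<^esub>)"
        have fin: "finite {j. c' j \<noteq> \<zero>\<^bsub>R\<^esub>}"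
          by (rule finite_subset[of _ "{i. c i \<noteq> \<zero>\<^bsub>R\<^esub>}"]) (use c in \<open>auto simp: c'_def free_module_def\<close>)
        have c': "c' \<in> carrier (free_module R I)"
          using c fin by (auto simp: c'_def free_module_def)
        have "{j. c' j \<noteq> \<zero>\<^bsub>R\<^esub>} \<subseteq> T" using sup by (auto simp: c'_def)
        then have fc': "f c' = g c'" using insert.IH c' by blast
        have ci: "c i \<in> carrier R" using c by (auto simp: free_module_def)
        have u: "unitvec R i \<in> carrier (free_module R I)" by (rule unitvec_carrier[OF R True])
        have su: "c i \<odot>\<^bsub>free_module R I\<^esub> unitvec R i \<in> carrier (free_module R I)"
          using Module.module.smult_closed[OF mod ci u] .
        have c_eq: "c = c' \<oplus>\<^bsub>free_module R I\<^esub> (c i \<odot>\<^bsub>free_module R I\<^esub> unitvec R i)"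
          using c by (auto simp: c'_def free_module_def unitvec_def fun_eq_iff)
        have "f (c' \<oplus>\<^bsub>free_module R I\<^esub> (c i \<odot>\<^bsub>free_module R I\<^esub> unitvec R i)) = g (c' \<oplus>\<^bsub>free_module R I\<^esub> (c i \<odot>\<^bsub>free_module R I\<^esub> unitvec R i))"
          using f g fc' eq[OF True] c' u su ci by (simp add: linmap_def)
        then show ?thesis by (rule box_equals[OF _ arg_cong[OF c_eq, of f, symmetric] arg_cong[OF c_eq, of g, symmetric]])
      qed
    qed
  qed
  then show ?thesis using c by (auto simp: free_module_def)
qed

lemma free_module_ext_exists:
  assumes R: "cring R" and "Module.module R M" and h: "h \<in> I \<rightarrow> carrier M"
  shows "\<exists>f. linmap R (free_module R I) M f \<and> (\<forall>i\<in>I. f (unitvec R i) = h i)"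
proof -
  interpret R: cring R by fact
  interpret M: Module.module R M by fact
  define f where "f c = finsum M (\<lambda>i. c i \<odot>\<^bsub>M\<^esub> h i) {i. c i \<noteq> \<zero>\<^bsub>R\<^esub>}" for c
  have mem: "c i \<odot>\<^bsub>M\<^esub> h i \<in> carrier M" if "c \<in> carrier (free_module R I)" "i \<in> I" for c i
    using that h by (auto simp: free_module_def)
  have f_eq: "f c = finsum M (\<lambda>i. c i \<odot>\<^bsub>M\<^esub> h i) T"
    if "c \<in> carrier (free_module R I)" "finite T" "{i. c i \<noteq> \<zero>\<^bsub>R\<^esub>} \<subseteq> T" "T \<subseteq> I" for c T
    unfolding f_def
    by (rule M.add.finprod_mono_neutral_cong_left) (use that mem h in \<open>auto simp: Pi_iff\<close>)
  have supp: "finite {i. c i \<noteq> \<zero>\<^bsub>R\<^esub>}" "{i. c i \<noteq> \<zero>\<^bsub>R\<^esub>} \<subseteq> I"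
    if "c \<in> carrier (free_module R I)" for c
    using that by (auto simp: free_module_def)
  interpret F: Module.module R "free_module R I" by (rule module_free_module[OF R])
  have "linmap R (free_module R I) M f"
    unfolding linmap_def
  proof (intro conjI ballI funcsetI)
    fix c assume c: "c \<in> carrier (free_module R I)"
    show "f c \<in> carrier M"
      unfolding f_def using supp(2)[OF c] mem[OF c] by (intro M.finsum_closed) blast
  next
    fix c d assume cd: "c \<in> carrier (free_module R I)" "d \<in> carrier (free_module R I)"
    let ?T = "{i. c i \<noteq> \<zero>\<^bsub>R\<^esub>} \<union> {i. d i \<noteq> \<zero>\<^bsub>R\<^esub>}"
    let ?e = "c \<oplus>\<^bsub>free_module R I\<^esub> d"
    have T: "finite ?T" "?T \<subseteq> I" using supp cd by auto
    have e: "?e i = c i \<oplus>\<^bsub>R\<^esub> d i" for i by (simp add: free_module_def)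
    have cr: "c i \<in> carrier R" "d i \<in> carrier R" for i using cd by (auto simp: free_module_def)
    have "f ?e = finsum M (\<lambda>i. ?e i \<odot>\<^bsub>M\<^esub> h i) ?T"
      by (rule f_eq) (use T cd e in auto)
    also have "\<dots> = finsum M (\<lambda>i. c i \<odot>\<^bsub>M\<^esub> h i \<oplus>\<^bsub>M\<^esub> d i \<odot>\<^bsub>M\<^esub> h i) ?T"
    proof (rule M.finsum_cong')
      fix i assume "i \<in> ?T"
      then have "i \<in> I" using T by blast
      then show "?e i \<odot>\<^bsub>M\<^esub> h i = c i \<odot>\<^bsub>M\<^esub> h i \<oplus>\<^bsub>M\<^esub> d i \<odot>\<^bsub>M\<^esub> h i"
        unfolding e using M.smult_l_distr[OF cr(1) cr(2) funcset_mem[OF h]] by blast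
    qed (use T mem cd in auto)
    also have "\<dots> = finsum M (\<lambda>i. c i \<odot>\<^bsub>M\<^esub> h i) ?T \<oplus>\<^bsub>M\<^esub> finsum M (\<lambda>i. d i \<odot>\<^bsub>M\<^esub> h i) ?T"
      by (rule M.finsum_addf) (use T mem cd in auto)
    also have "\<dots> = f c \<oplus>\<^bsub>M\<^esub> f d"
      using f_eq[OF cd(1) T(1) _ T(2)] f_eq[OF cd(2) T(1) _ T(2)] by auto
    finally show "f ?e = f c \<oplus>\<^bsub>M\<^esub> f d" .
  next
    fix r c assume rc: "r \<in> carrier R" "c \<in> carrier (free_module R I)"
    let ?T = "{i. c i \<noteq> \<zero>\<^bsub>R\<^esub>}"
    let ?e = "r \<odot>\<^bsub>free_module R I\<^esub> c"
    have T: "finite ?T" "?T \<subseteq> I" using supp rc by auto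
    have e: "?e i = r \<otimes>\<^bsub>R\<^esub> c i" for i by (simp add: free_module_def)
    have cr: "c i \<in> carrier R" for i using rc by (auto simp: free_module_def)
    have "f ?e = finsum M (\<lambda>i. ?e i \<odot>\<^bsub>M\<^esub> h i) ?T"
      by (rule f_eq) (use T rc e in auto)
    also have "\<dots> = finsum M (\<lambda>i. r \<odot>\<^bsub>M\<^esub> (c i \<odot>\<^bsub>M\<^esub> h i)) ?T"
    proof (rule M.finsum_cong')
      fix i assume "i \<in> ?T"
      then have "i \<in> I" using T by blast
      then show "?e i \<odot>\<^bsub>M\<^esub> h i = r \<odot>\<^bsub>M\<^esub> (c i \<odot>\<^bsub>M\<^esub> h i)"
        unfolding e using M.smult_assoc1[OF rc(1) cr funcset_mem[OF h]] by blast
    qed (use T mem rc in auto)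
    also have "\<dots> = r \<odot>\<^bsub>M\<^esub> f c"
      unfolding f_def by (rule M.finsum_smult_ldistr[symmetric]) (use T mem rc in auto)
    finally show "f ?e = r \<odot>\<^bsub>M\<^esub> f c" .
  qed
  moreover have "f (unitvec R i) = h i" if i: "i \<in> I" for i
  proof -
    have "f (unitvec R i) = finsum M (\<lambda>j. unitvec R i j \<odot>\<^bsub>M\<^esub> h j) {i}"
      by (rule f_eq) (use unitvec_carrier[OF R i] i in \<open>auto simp: unitvec_def\<close>)
    also have "\<dots> = h i" using i h by (auto simp: unitvec_def Pi_iff)
    finally show ?thesis .
  qed
  ultimately show ?thesis by blast
qed

lemma direct_summand_imp_retract:
  assumes M: "Module.module R M" and F: "Module.module R F" and "direct_summand R M F"
  shows "\<exists>s p. linmap R M F s \<and> linmap R F M p \<and> (\<forall>x\<in>carrier M. p (s x) = x)"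
proof -
  interpret M: Module.module R M by fact
  interpret F: Module.module R F by fact
  obtain N N' s where N: "submodule N R F" "submodule N' R F" and int: "N \<inter> N' = {\<zero>\<^bsub>F\<^esub>}"
    and sum: "N <+>\<^bsub>F\<^esub> N' = carrier F" and bij: "bij_betw s (carrier M) N"
    and sadd: "\<forall>x\<in>carrier M. \<forall>y\<in>carrier M. s (x \<oplus>\<^bsub>M\<^esub> y) = s x \<oplus>\<^bsub>F\<^esub> s y"
    and ssm: "\<forall>r\<in>carrier R. \<forall>x\<in>carrier M. s (r \<odot>\<^bsub>M\<^esub> x) = r \<odot>\<^bsub>F\<^esub> s x"
    using assms(3) unfolding direct_summand_def by blast
  note NE = F.submoduleE[OF N(1)] and NE' = F.submoduleE[OF N(2)]
  have s_in: "s x \<in> N" if "x \<in> carrier M" for x using bij that by (auto simp: bij_betw_def)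
  have sN: "linmap R M F s"
    using s_in sadd ssm NE(1) by (auto simp: linmap_def)
  have ex: "\<exists>x. x \<in> carrier M \<and> (\<exists>b\<in>N'. v = s x \<oplus>\<^bsub>F\<^esub> b)" if "v \<in> carrier F" for v
  proof -
    have "v \<in> N <+>\<^bsub>F\<^esub> N'" using that sum by simp
    then obtain a b where "a \<in> N" "b \<in> N'" "v = a \<oplus>\<^bsub>F\<^esub> b"
      by (auto simp: set_add_defs)
    moreover obtain x where "x \<in> carrier M" "a = s x"
      using bij \<open>a \<in> N\<close> by (auto simp: bij_betw_def)
    ultimately show ?thesis by blast
  qed
  define p where "p v = (SOME x. x \<in> carrier M \<and> (\<exists>b\<in>N'. v = s x \<oplus>\<^bsub>F\<^esub> b))" for v
  have p: "p v \<in> carrier M \<and> (\<exists>b\<in>N'. v = s (p v) \<oplus>\<^bsub>F\<^esub> b)" if "v \<in> carrier F" for v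
    unfolding p_def by (rule someI_ex[OF ex[OF that]])
  have uniq: "x = y" if xy: "x \<in> carrier M" "y \<in> carrier M" "a \<in> N'" "b \<in> N'"
      "s x \<oplus>\<^bsub>F\<^esub> a = s y \<oplus>\<^bsub>F\<^esub> b" for x y a b
  proof -
    have car: "s x \<in> carrier F" "s y \<in> carrier F" "a \<in> carrier F" "b \<in> carrier F"
      using xy s_in NE(1) NE'(1) by auto
    have "s x \<oplus>\<^bsub>F\<^esub> \<ominus>\<^bsub>F\<^esub> s y = b \<oplus>\<^bsub>F\<^esub> \<ominus>\<^bsub>F\<^esub> a"
    proof -
      have "s x \<oplus>\<^bsub>F\<^esub> \<ominus>\<^bsub>F\<^esub> s y = (s x \<oplus>\<^bsub>F\<^esub> a) \<oplus>\<^bsub>F\<^esub> (\<ominus>\<^bsub>F\<^esub> a \<oplus>\<^bsub>F\<^esub> \<ominus>\<^bsub>F\<^esub> s y)"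
        using car by (simp add: F.M.a_assoc F.M.r_neg2)
      also have "\<dots> = (s y \<oplus>\<^bsub>F\<^esub> b) \<oplus>\<^bsub>F\<^esub> (\<ominus>\<^bsub>F\<^esub> a \<oplus>\<^bsub>F\<^esub> \<ominus>\<^bsub>F\<^esub> s y)" using xy(5) by simp
      also have "\<dots> = (s y \<oplus>\<^bsub>F\<^esub> \<ominus>\<^bsub>F\<^esub> s y) \<oplus>\<^bsub>F\<^esub> (b \<oplus>\<^bsub>F\<^esub> \<ominus>\<^bsub>F\<^esub> a)"
        using car by (simp add: F.M.a_ac)
      finally show ?thesis using car by (simp add: F.M.r_neg)
    qed
    moreover have "s x \<oplus>\<^bsub>F\<^esub> \<ominus>\<^bsub>F\<^esub> s y \<in> N" "b \<oplus>\<^bsub>F\<^esub> \<ominus>\<^bsub>F\<^esub> a \<in> N'"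
      using xy s_in NE NE' by auto
    ultimately have "s x \<oplus>\<^bsub>F\<^esub> \<ominus>\<^bsub>F\<^esub> s y = \<zero>\<^bsub>F\<^esub>" using int by auto
    from F.M.minus_equality[OF this] have "s x = s y" using car by simp
    then show ?thesis using bij xy(1,2) by (auto simp: bij_betw_def inj_on_def)
  qed
  have p_eq: "p v = x" if v: "x \<in> carrier M" "b \<in> N'" "v = s x \<oplus>\<^bsub>F\<^esub> b" for v x b
  proof -
    have "v \<in> carrier F" using v s_in NE(1) NE'(1) by auto
    from p[OF this] obtain b' where "p v \<in> carrier M" "b' \<in> N'" "v = s (p v) \<oplus>\<^bsub>F\<^esub> b'" by blast
    then show ?thesis using uniq[of "p v" x b' b] v by auto
  qed
  have "linmap R F M p"
    unfolding linmap_def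
  proof (intro conjI ballI funcsetI)
    fix v w assume vw: "v \<in> carrier F" "w \<in> carrier F"
    obtain a b where ab: "a \<in> N'" "v = s (p v) \<oplus>\<^bsub>F\<^esub> a" "b \<in> N'" "w = s (p w) \<oplus>\<^bsub>F\<^esub> b"
      using p vw by blast
    have car: "s (p v) \<in> carrier F" "s (p w) \<in> carrier F" "a \<in> carrier F" "b \<in> carrier F"
      using p vw s_in NE(1) NE'(1) ab by auto
    have "v \<oplus>\<^bsub>F\<^esub> w = (s (p v) \<oplus>\<^bsub>F\<^esub> a) \<oplus>\<^bsub>F\<^esub> (s (p w) \<oplus>\<^bsub>F\<^esub> b)" 
      by (rule arg_cong2[of _ _ _ _ "add F", OF ab(2) ab(4)])
    also have "\<dots> = s (p v \<oplus>\<^bsub>M\<^esub> p w) \<oplus>\<^bsub>F\<^esub> (a \<oplus>\<^bsub>F\<^esub> b)"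
      using sadd p vw car by (simp add: F.M.a_ac)
    finally show "p (v \<oplus>\<^bsub>F\<^esub> w) = p v \<oplus>\<^bsub>M\<^esub> p w"
      by (rule p_eq[rotated 2]) (use p vw ab NE' in auto)
  next
    fix r v assume rv: "r \<in> carrier R" "v \<in> carrier F"
    obtain a where a: "a \<in> N'" "v = s (p v) \<oplus>\<^bsub>F\<^esub> a" using p rv by blast
    have car: "s (p v) \<in> carrier F" "a \<in> carrier F" using p rv s_in NE(1) NE'(1) a by auto
    have "r \<odot>\<^bsub>F\<^esub> v = r \<odot>\<^bsub>F\<^esub> (s (p v) \<oplus>\<^bsub>F\<^esub> a)" 
      by (rule arg_cong[of _ _ "smult F r", OF a(2)])
    also have "\<dots> = s (r \<odot>\<^bsub>M\<^esub> p v) \<oplus>\<^bsub>F\<^esub> r \<odot>\<^bsub>F\<^esub> a"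
      using ssm p rv car by (simp add: F.smult_r_distr)
    finally show "p (r \<odot>\<^bsub>F\<^esub> v) = r \<odot>\<^bsub>M\<^esub> p v"
      by (rule p_eq[rotated 2]) (use p rv a NE' in auto)
  qed (use p in auto)
  moreover have "p (s x) = x" if "x \<in> carrier M" for x
  proof (rule p_eq[OF that])
    show "\<zero>\<^bsub>F\<^esub> \<in> N'" using int by blast
    show "s x = s x \<oplus>\<^bsub>F\<^esub> \<zero>\<^bsub>F\<^esub>" using NE(1) s_in[OF that] F.M.r_zero[of "s x"] by auto
  qed
  ultimately show ?thesis using sN by blast
qed

lemma retract_imp_direct_summand:
  assumes M: "Module.module R M" and F: "Module.module R F"
    and s: "linmap R M F s" and p: "linmap R F M p" and ps: "\<forall>x\<in>carrier M. p (s x) = x"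
  shows "direct_summand R M F"
proof -
  interpret M: Module.module R M by fact
  interpret F: Module.module R F by fact
  let ?N = "s ` carrier M" and ?N' = "{v \<in> carrier F. p v = \<zero>\<^bsub>M\<^esub>}"
  have s0: "s \<zero>\<^bsub>M\<^esub> = \<zero>\<^bsub>F\<^esub>" and p0: "p \<zero>\<^bsub>F\<^esub> = \<zero>\<^bsub>M\<^esub>"
    using linmap_zero[OF M F s] linmap_zero[OF F M p] by auto
  have sc: "s x \<in> carrier F" if "x \<in> carrier M" for x using s that by (auto simp: linmap_def)
  have pc: "p x \<in> carrier M" if "x \<in> carrier F" for x using p that by (auto simp: linmap_def)
  have "submodule ?N R F"
  proof (rule F.submoduleI)
    show "\<zero>\<^bsub>F\<^esub> \<in> ?N" using imageI[OF M.M.zero_closed, of s] s0 by simp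
    show "\<ominus>\<^bsub>F\<^esub> a \<in> ?N" if "a \<in> ?N" for a
    proof -
      from that obtain x where x: "x \<in> carrier M" "a = s x" by blast
      have "\<ominus>\<^bsub>F\<^esub> a = s (\<ominus>\<^bsub>M\<^esub> x)" unfolding x(2) by (rule linmap_minus[OF M F s x(1), symmetric])
      then show ?thesis using M.M.a_inv_closed[OF x(1)] by blast
    qed
    show "a \<oplus>\<^bsub>F\<^esub> b \<in> ?N" if "a \<in> ?N" "b \<in> ?N" for a b
    proof -
      from that obtain x y where x: "x \<in> carrier M" "y \<in> carrier M" and "a = s x" "b = s y" by blast
      then have "a \<oplus>\<^bsub>F\<^esub> b = s (x \<oplus>\<^bsub>M\<^esub> y)" using s by (simp add: linmap_def)
      then show ?thesis using M.M.a_closed[OF x] by blast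
    qed
    show "r \<odot>\<^bsub>F\<^esub> b \<in> ?N" if "r \<in> carrier R" "b \<in> ?N" for r b
    proof -
      from that obtain x where x: "x \<in> carrier M" and "b = s x" by blast
      then have "r \<odot>\<^bsub>F\<^esub> b = s (r \<odot>\<^bsub>M\<^esub> x)" using s that(1) by (simp add: linmap_def)
      then show ?thesis using M.smult_closed[OF that(1) x] by blast
    qed
  qed (use sc in auto)
  moreover have "submodule ?N' R F"
    by (rule F.submoduleI) (use p p0 linmap_minus[OF F M p] in \<open>auto simp: linmap_def\<close>)
  moreover have "?N \<inter> ?N' = {\<zero>\<^bsub>F\<^esub>}"
  proof
    show "?N \<inter> ?N' \<subseteq> {\<zero>\<^bsub>F\<^esub>}" using ps s0 by auto
    show "{\<zero>\<^bsub>F\<^esub>} \<subseteq> ?N \<inter> ?N'" using p0 s0 by (auto intro!: image_eqI[of _ _ "\<zero>\<^bsub>M\<^esub>"])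
  qed
  moreover have "?N <+>\<^bsub>F\<^esub> ?N' = carrier F"
  proof
    show "?N <+>\<^bsub>F\<^esub> ?N' \<subseteq> carrier F" using sc by (auto simp: set_add_defs)
    show "carrier F \<subseteq> ?N <+>\<^bsub>F\<^esub> ?N'"
    proof
      fix v assume v: "v \<in> carrier F"
      let ?w = "\<ominus>\<^bsub>F\<^esub> s (p v) \<oplus>\<^bsub>F\<^esub> v"
      have "p ?w = \<ominus>\<^bsub>M\<^esub> p (s (p v)) \<oplus>\<^bsub>M\<^esub> p v"
        using v sc pc p linmap_minus[OF F M p, of "s (p v)"] by (auto simp: linmap_def)
      also have "\<dots> = \<zero>\<^bsub>M\<^esub>" using ps pc v by (simp add: M.M.l_neg)
      finally have "?w \<in> ?N'" using v sc pc by auto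
      moreover have "v = s (p v) \<oplus>\<^bsub>F\<^esub> ?w" using v sc pc by (simp add: F.M.r_neg2)
      ultimately show "v \<in> ?N <+>\<^bsub>F\<^esub> ?N'" using pc v by (auto simp: set_add_defs)
    qed
  qed
  moreover have "bij_betw s (carrier M) ?N"
    using ps by (auto simp: bij_betw_def intro!: inj_on_inverseI[of _ p])
  moreover have "\<forall>x\<in>carrier M. \<forall>y\<in>carrier M. s (x \<oplus>\<^bsub>M\<^esub> y) = s x \<oplus>\<^bsub>F\<^esub> s y"
    and "\<forall>r\<in>carrier R. \<forall>x\<in>carrier M. s (r \<odot>\<^bsub>M\<^esub> x) = r \<odot>\<^bsub>F\<^esub> s x"
    using s unfolding linmap_def by simp_all
  ultimately show ?thesis
    unfolding direct_summand_def by blast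
qed

lemma projective_if_direct_summand_free:
  fixes M :: "('r, 'e, 'm) module_scheme" and I :: "'i set"
  assumes "Module.module R M" and "direct_summand R M (free_module R I)"
  shows "projective R M"
proof -
  have R: "cring R" using assms(1) by (simp add: Module.module_def)
  let ?F = "free_module R I" and ?G = "free_module R (carrier M)"
  note FM = module_free_module[OF R]
  obtain s p where s: "linmap R M ?F s" and p: "linmap R ?F M p"
    and ps: "\<forall>x\<in>carrier M. p (s x) = x"
    using direct_summand_imp_retract[OF assms(1) FM assms(2)] by blast
  have pI: "p (unitvec R i) \<in> carrier M" if "i \<in> I" for i
    using p unitvec_carrier[OF R that] by (auto simp: linmap_def)
  obtain q where q: "linmap R ?G M q" and qe: "\<forall>x\<in>carrier M. q (unitvec R x) = x"
    using free_module_ext_exists[OF R assms(1), of "\<lambda>x. x" "carrier M"] by auto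
  obtain t where t: "linmap R ?F ?G t"
    and te: "\<forall>i\<in>I. t (unitvec R i) = unitvec R (p (unitvec R i))"
    using free_module_ext_exists[OF R FM, of "\<lambda>i. unitvec R (p (unitvec R i))" I "carrier M"]
      unitvec_carrier[OF R pI] by auto
  have "(q \<circ> t) c = p c" if "c \<in> carrier ?F" for c
    by (rule free_module_ext_unique[OF R assms(1) linmap_comp[OF t q] p _ that])
      (use te qe pI in auto)
  moreover have "s x \<in> carrier ?F" if "x \<in> carrier M" for x
    using s that by (auto simp: linmap_def)
  ultimately have "\<forall>x\<in>carrier M. q ((t \<circ> s) x) = x"
    using ps by simp
  then have "direct_summand R M ?G"
    by (rule retract_imp_direct_summand[OF assms(1) FM linmap_comp[OF s t] q])
  then show ?thesis unfolding projective_def by blast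
qed


section \<open>Restriction to compact subsets\<close>

definition C0_ideal_submodule ::
  "'a topology \<Rightarrow> ('a, 'e, 'm) hmodule_scheme \<Rightarrow> 'a set \<Rightarrow> 'e set" where
  "C0_ideal_submodule X E K =
     {finsum E (\<lambda>i. f i \<odot>\<^bsub>E\<^esub> \<xi> i) {..<n} | (n::nat) f \<xi>.
        (\<forall>i<n. f i \<in> C0 (subtopology X (topspace X - K)) \<and> \<xi> i \<in> carrier E)}"

text \<open>
  The quotient of \<open>E\<close> by \<open>E C\<^sub>0(X - K)\<close>, as a module over \<open>C(K)\<close>: the algebra
  \<open>C\<^sub>0(X) / C\<^sub>0(X - K)\<close> is identified with \<open>C(K)\<close> by restriction, so that \<open>g \<in> C(K)\<close> acts by any
  \<open>f \<in> C\<^sub>0(X)\<close> extending it.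
\<close>

definition restrict_hmodule ::
  "'a topology \<Rightarrow> ('a, 'e, 'm) hmodule_scheme \<Rightarrow> 'a set \<Rightarrow> ('a, 'e set) hmodule" where
  "restrict_hmodule X E K =
     (let N = C0_ideal_submodule X E K in
      \<lparr>carrier = a_rcosets\<^bsub>E\<^esub> N, mult = undefined, one = undefined,
       zero = N, add = set_add E,
       smult = (\<lambda>g A. \<Union>f\<in>{f \<in> C0 X. \<forall>x\<in>K. f x = g x}. \<Union>\<xi>\<in>A. N +>\<^bsub>E\<^esub> (f \<odot>\<^bsub>E\<^esub> \<xi>)),
       cscale = (\<lambda>c A. \<Union>\<xi>\<in>A. N +>\<^bsub>E\<^esub> cscale E c \<xi>),
       hinner = (\<lambda>A B x. if x \<in> K then hinner E (SOME \<xi>. \<xi> \<in> A) (SOME \<eta>. \<eta> \<in> B) x else 0)\<rparr>)"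

definition sigma_finitely_generated :: "'a topology \<Rightarrow> ('a, 'e, 'm) hmodule_scheme \<Rightarrow> bool" where
  "sigma_finitely_generated X E \<longleftrightarrow>
     (\<forall>K. compactin X K \<longrightarrow> finitely_generated (subtopology X K) (restrict_hmodule X E K))"

definition sigma_projective :: "'a topology \<Rightarrow> ('a, 'e, 'm) hmodule_scheme \<Rightarrow> bool" where
  "sigma_projective X E \<longleftrightarrow>
     (\<forall>K. compactin X K \<longrightarrow> projective (C_ring (subtopology X K)) (restrict_hmodule X E K))"


section \<open>Hermitian vector bundles\<close>

record ('a, 't) vbundle =
  total :: "'t topology"
  proj :: "'t \<Rightarrow> 'a"
  vadd :: "'t \<Rightarrow> 't \<Rightarrow> 't"
  vzero :: "'a \<Rightarrow> 't"
  vscale :: "complex \<Rightarrow> 't \<Rightarrow> 't"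

definition fiber :: "('a, 't) vbundle \<Rightarrow> 'a \<Rightarrow> 't set" where
  "fiber V x = {v \<in> topspace (total V). proj V v = x}"

text \<open>\<open>\<complex>\<^sup>n\<close> is the product of copies of \<open>\<complex>\<close> indexed by \<open>{..<n}\<close>.\<close>

definition complex_space :: "nat \<Rightarrow> (nat \<Rightarrow> complex) topology" where
  "complex_space n = product_topology (\<lambda>_. euclidean) {..<n}"

definition local_trivialization ::
  "'a topology \<Rightarrow> ('a, 't) vbundle \<Rightarrow> 'a set \<Rightarrow> nat \<Rightarrow> ('t \<Rightarrow> 'a \<times> (nat \<Rightarrow> complex)) \<Rightarrow> bool" where
  "local_trivialization X V U n \<phi> \<longleftrightarrow>
     homeomorphic_map (subtopology (total V) {v. proj V v \<in> U})
       (prod_topology (subtopology X U) (complex_space n)) \<phi> \<and>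
     (\<forall>x\<in>U. \<forall>v\<in>fiber V x. fst (\<phi> v) = x) \<and>
     (\<forall>x\<in>U. \<forall>v\<in>fiber V x. \<forall>w\<in>fiber V x. \<forall>i<n.
        snd (\<phi> (vadd V v w)) i = snd (\<phi> v) i + snd (\<phi> w) i) \<and>
     (\<forall>x\<in>U. \<forall>c. \<forall>v\<in>fiber V x. \<forall>i<n. snd (\<phi> (vscale V c v)) i = c * snd (\<phi> v) i)"

definition vector_bundle :: "'a topology \<Rightarrow> ('a, 't) vbundle \<Rightarrow> bool" where
  "vector_bundle X V \<longleftrightarrow>
     continuous_map (total V) X (proj V) \<and>
     (\<forall>x\<in>topspace X. cvector_space (fiber V x) (vadd V) (vzero V x) (vscale V)) \<and>
     (\<forall>x\<in>topspace X. \<exists>U n \<phi>. openin X U \<and> x \<in> U \<and> n \<ge> 1 \<and> local_trivialization X V U n \<phi>)"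

text \<open>The total space of \<open>V \<oplus> V\<close> is the fibre product of the total space of \<open>V\<close> with itself.\<close>

definition hermitian_metric :: "'a topology \<Rightarrow> ('a, 't) vbundle \<Rightarrow> ('t \<Rightarrow> 't \<Rightarrow> complex) \<Rightarrow> bool" where
  "hermitian_metric X V \<beta> \<longleftrightarrow>
     continuous_map
       (subtopology (prod_topology (total V) (total V)) {(v, w). proj V v = proj V w})
       euclidean (\<lambda>(v, w). \<beta> v w) \<and>
     (\<forall>x\<in>topspace X. \<forall>u\<in>fiber V x. \<forall>v\<in>fiber V x. \<forall>w\<in>fiber V x. \<forall>c.
        \<beta> u (vadd V v w) = \<beta> u v + \<beta> u w \<and>
        \<beta> u (vscale V c v) = c * \<beta> u v \<and>
        \<beta> v u = cnj (\<beta> u v)) \<and>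
     (\<forall>x\<in>topspace X. \<forall>v\<in>fiber V x. v \<noteq> vzero V x \<longrightarrow> \<beta> v v \<in> \<real> \<and> 0 < Re (\<beta> v v))"

definition Gamma0 ::
  "'a topology \<Rightarrow> ('a, 't) vbundle \<Rightarrow> ('t \<Rightarrow> 't \<Rightarrow> complex) \<Rightarrow> ('a, 'a \<Rightarrow> 't) hmodule" where
  "Gamma0 X V \<beta> =
     \<lparr>carrier = {\<xi> \<in> extensional (topspace X).
                  continuous_map X (total V) \<xi> \<and> (\<forall>x\<in>topspace X. proj V (\<xi> x) = x) \<and>
                  vanishes_at_infinity X (\<lambda>x. \<beta> (\<xi> x) (\<xi> x))},
      mult = undefined, one = undefined,
      zero = (\<lambda>x\<in>topspace X. vzero V x),
      add = (\<lambda>\<xi> \<eta>. \<lambda>x\<in>topspace X. vadd V (\<xi> x) (\<eta> x)),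
      smult = (\<lambda>f \<xi>. \<lambda>x\<in>topspace X. vscale V (f x) (\<xi> x)),
      cscale = (\<lambda>c \<xi>. \<lambda>x\<in>topspace X. vscale V c (\<xi> x)),
      hinner = (\<lambda>\<xi> \<eta> x. if x \<in> topspace X then \<beta> (\<xi> x) (\<eta> x) else 0)\<rparr>"

end

(*
  Write |xi|(x) for the square root of <xi,xi>(x).  Every element of a Hilbert C_0(X)-module factors
  as xi = f zeta with f = |xi|^(1/2), so that E C_0(X - K) consists of the elements whose norm function
  vanishes on K.  Hence over a compact set K, being finitely generated and projective amounts to having
  a finite frame: elements eta_i with C(K)-linear coordinate functions s_i such that
  xi = Sum_i s_i(xi) eta_i on K.

  For a bundle, such a frame comes from local trivializations cut off by square roots of a partition of
  unity.  Conversely, let the fibre of V at x be E / E C_0(X - {x}).  A minimal subfamily of a frame that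
  spans the fibre at x_0 stays linearly independent nearby because its Gram matrix is positive definite,
  and stays spanning by Nakayama's argument, so V is locally trivial.  The image of the isometry
  E -> Gamma_0(V) is complete, and dense by a partition of unity; hence it is everything.
*)
theory Submission
  imports Defs
begin

section \<open>Continuous functions on a locally compact Hausdorff space\<close>

text \<open>Two weak finiteness notions have to be combined. Projectivity gives a free module of
  possibly infinite rank and coordinate maps about which no continuity is assumed; finite generation
  gives finitely many elements whose span is only dense. The link is that C(K)-linear coordinates
  are pointwise: if \<open>\<zeta>\<close> vanishes at \<open>x\<close>, then
  \<open>\<zeta> = f \<odot> z\<close> with \<open>f x = 0\<close>, so every coordinate of
  \<open>\<zeta>\<close> vanishes at \<open>x\<close>. Finitely many vectors have closed span in the
  fibre at \<open>x\<close>, so generators with dense span already span that fibre exactly, and only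
  the finitely many indices in the supports of their coordinate vectors carry a nonzero coordinate.

  Equality at a point is tested throughout by pairing with all elements of \<open>E\<close>.
  Quotients and fibres can thus be handled by identities between complex numbers before they are
  available as spaces.

  Fullness is what makes every fibre nonzero, that is, what gives rank at least one.\<close>

lemma continuous_map_mult:
  fixes f g :: "'a \<Rightarrow> 'b::real_normed_algebra"
  shows "continuous_map X euclidean f \<Longrightarrow> continuous_map X euclidean g \<Longrightarrow>
    continuous_map X euclidean (\<lambda>x. f x * g x)"
  by (simp add: continuous_map_atin tendsto_mult)

lemma continuous_map_comp_continuous_on:
  assumes "continuous_map X euclidean f" "continuous_on UNIV g"
  shows "continuous_map X euclidean (\<lambda>x. g (f x))"
  using continuous_map_compose[OF assms(1), of euclidean g] assms(2) by (simp add: o_def)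

lemma continuous_map_of_real:
  assumes "continuous_map X euclidean f"
  shows "continuous_map X euclidean (\<lambda>x. of_real (f x) :: 'b::real_normed_algebra_1)"
  by (rule continuous_map_comp_continuous_on[OF assms]) (intro continuous_intros)

lemma continuous_map_Re:
  assumes "continuous_map X euclidean f" shows "continuous_map X euclidean (\<lambda>x. Re (f x))"
  by (rule continuous_map_comp_continuous_on[OF assms]) (intro continuous_intros)

lemma continuous_map_Im:
  assumes "continuous_map X euclidean f" shows "continuous_map X euclidean (\<lambda>x. Im (f x))"
  by (rule continuous_map_comp_continuous_on[OF assms]) (intro continuous_intros)

lemma continuous_map_sqrt:
  assumes "continuous_map X euclidean f" shows "continuous_map X euclidean (\<lambda>x. sqrt (f x))"
  by (rule continuous_map_comp_continuous_on[OF assms]) (intro continuous_intros)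

text \<open>\<open>X\<close> carries no metric, so the domain side keeps open sets while the target
  side uses distances. This is the form in which continuity is extracted and proved below.\<close>

lemma continuous_map_eps:
  fixes f :: "'a \<Rightarrow> 'b::metric_space"
  shows "continuous_map X euclidean f \<longleftrightarrow>
    (\<forall>x\<in>topspace X. \<forall>e>0. \<exists>U. openin X U \<and> x \<in> U \<and> (\<forall>y\<in>U. dist (f y) (f x) < e))"
  (is "_ \<longleftrightarrow> ?R")
proof
  assume L: "continuous_map X euclidean f"
  show ?R
  proof (intro ballI allI impI)
    fix x e assume "x \<in> topspace X" "(e::real) > 0"
    have "openin X {y \<in> topspace X. f y \<in> ball (f x) e}" (is "openin X ?U")
      by (rule openin_continuous_map_preimage[OF L]) simp
    moreover have "x \<in> ?U" using \<open>x \<in> topspace X\<close> \<open>e > 0\<close> by simp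
    moreover have "\<forall>y\<in>?U. dist (f y) (f x) < e" by (metis (no_types, lifting) dist_commute mem_Collect_eq mem_ball)
    ultimately show "\<exists>U. openin X U \<and> x \<in> U \<and> (\<forall>y\<in>U. dist (f y) (f x) < e)" by blast
  qed
next
  assume R: ?R
  show "continuous_map X euclidean f"
    unfolding continuous_map_def
  proof (intro conjI allI impI)
    fix V :: "'b set" assume "openin euclidean V"
    then have V: "open V" by simp
    show "openin X {x \<in> topspace X. f x \<in> V}"
    proof (subst openin_subopen, intro ballI)
      fix x assume x: "x \<in> {x \<in> topspace X. f x \<in> V}"
      then obtain e where e: "e > 0" "ball (f x) e \<subseteq> V" using openE[OF V] by blast
      have "x \<in> topspace X" using x by blast
      from R[rule_format, OF this e(1)] obtain U where U: "openin X U" "x \<in> U" "\<forall>y\<in>U. dist (f y) (f x) < e" by blast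
      have "U \<subseteq> {x \<in> topspace X. f x \<in> V}"
      proof
        fix y assume "y \<in> U"
        then have "f y \<in> ball (f x) e" using U(3) by (metis dist_commute mem_ball)
        then show "y \<in> {x \<in> topspace X. f x \<in> V}"
          using \<open>y \<in> U\<close> e(2) openin_subset[OF U(1)] by blast
      qed
      then show "\<exists>T. openin X T \<and> x \<in> T \<and> T \<subseteq> {x \<in> topspace X. f x \<in> V}" using U by blast
    qed
  qed auto
qed

text \<open>Continuity is local. This is what allows a section to be checked on one trivializing
  neighbourhood at a time, and a section extended by zero to be checked on two open sets.\<close>

lemma continuous_map_locally:
  assumes "\<And>x. x \<in> topspace X \<Longrightarrow> \<exists>U. openin X U \<and> x \<in> U \<and> continuous_map (subtopology X U) Y f"
  shows "continuous_map X Y f"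
  unfolding continuous_map_def
proof (intro conjI allI impI)
  show "f \<in> topspace X \<rightarrow> topspace Y"
  proof
    fix x assume "x \<in> topspace X"
    then obtain U where "openin X U" "x \<in> U" "continuous_map (subtopology X U) Y f" using assms by blast
    then show "f x \<in> topspace Y" using \<open>x \<in> topspace X\<close> by (auto simp: continuous_map_def Pi_iff)
  qed
  fix V assume V: "openin Y V"
  show "openin X {x \<in> topspace X. f x \<in> V}"
  proof (subst openin_subopen, intro ballI)
    fix x assume x: "x \<in> {x \<in> topspace X. f x \<in> V}"
    then obtain U where U: "openin X U" "x \<in> U" "continuous_map (subtopology X U) Y f" using assms by blast
    have "openin (subtopology X U) {x \<in> topspace (subtopology X U). f x \<in> V}"
      by (rule openin_continuous_map_preimage[OF U(3) V])
    then have "openin X {x \<in> topspace (subtopology X U). f x \<in> V}"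
      by (rule openin_trans_full[OF _ U(1)])
    then show "\<exists>T. openin X T \<and> x \<in> T \<and> T \<subseteq> {x \<in> topspace X. f x \<in> V}"
      using x U by (intro exI[of _ "{x \<in> topspace (subtopology X U). f x \<in> V}"]) auto
  qed
qed

section \<open>Vanishing at infinity and the algebra \<open>C0 X\<close>\<close>

lemma vanishes_at_infinity_mono:
  assumes "vanishes_at_infinity X f" "\<And>x. x \<in> topspace X \<Longrightarrow> cmod (g x) \<le> cmod (f x)"
  shows "vanishes_at_infinity X g"
  unfolding vanishes_at_infinity_def
proof (intro allI impI)
  fix e :: real assume "e > 0"
  then obtain K where K: "compactin X K" "\<forall>x\<in>topspace X - K. cmod (f x) < e"
    using assms(1) unfolding vanishes_at_infinity_def by blast
  then show "\<exists>K. compactin X K \<and> (\<forall>x\<in>topspace X - K. cmod (g x) < e)"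
    using assms(2) by (intro exI[of _ K]) (auto intro: le_less_trans)
qed

lemma vanishes_at_infinity_add:
  assumes "vanishes_at_infinity X f" "vanishes_at_infinity X g"
  shows "vanishes_at_infinity X (\<lambda>x. f x + g x)"
  unfolding vanishes_at_infinity_def
proof (intro allI impI)
  fix e :: real assume "e > 0"
  then have e: "e/2 > 0" by simp
  obtain K where K: "compactin X K" "\<forall>x\<in>topspace X - K. cmod (f x) < e/2"
    using assms(1) e unfolding vanishes_at_infinity_def by blast
  obtain L where L: "compactin X L" "\<forall>x\<in>topspace X - L. cmod (g x) < e/2"
    using assms(2) e unfolding vanishes_at_infinity_def by blast
  have "cmod (f x + g x) < e" if "x \<in> topspace X - (K \<union> L)" for x
  proof -
    have "cmod (f x) < e/2" "cmod (g x) < e/2" using K L that by auto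
    then show ?thesis using norm_triangle_ineq[of "f x" "g x"] by linarith
  qed
  then show "\<exists>K. compactin X K \<and> (\<forall>x\<in>topspace X - K. cmod (f x + g x) < e)"
    using compactin_Un[OF K(1) L(1)] by blast
qed

text \<open>Off a compact set the values of \<open>f\<close> are close to \<open>0\<close>, so only
  the behaviour of \<open>h\<close> near \<open>0\<close> matters.\<close>

lemma vanishes_at_infinity_comp:
  assumes "vanishes_at_infinity X f" "isCont h 0" "h 0 = 0"
  shows "vanishes_at_infinity X (\<lambda>x. h (f x))"
  unfolding vanishes_at_infinity_def
proof (intro allI impI)
  fix e :: real assume "e > 0"
  then obtain d where d: "d > 0" "\<And>z. cmod z < d \<Longrightarrow> cmod (h z) < e"
    using assms(2,3) unfolding continuous_at_eps_delta by (auto simp: dist_norm)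
  then obtain K where "compactin X K" "\<forall>x\<in>topspace X - K. cmod (f x) < d"
    using assms(1) unfolding vanishes_at_infinity_def by blast
  then show "\<exists>K. compactin X K \<and> (\<forall>x\<in>topspace X - K. cmod (h (f x)) < e)"
    using d(2) by blast
qed

lemma C0_comp:
  assumes "f \<in> C0 X" "continuous_on UNIV h" "h 0 = 0"
  shows "(\<lambda>x. h (f x)) \<in> C0 X"
  using assms continuous_map_comp_continuous_on[of X f h] vanishes_at_infinity_comp[of X f h]
  by (auto simp: C0_def continuous_on_eq_continuous_at)

lemma C0_zero [simp]: "(\<lambda>x. 0) \<in> C0 X"
  by (auto simp: C0_def vanishes_at_infinity_def intro: exI[of _ "{}"])

lemma C0_add: "f \<in> C0 X \<Longrightarrow> g \<in> C0 X \<Longrightarrow> (\<lambda>x. f x + g x) \<in> C0 X"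
  by (auto simp: C0_def intro: continuous_map_add vanishes_at_infinity_add)

lemma C0_cmult: "f \<in> C0 X \<Longrightarrow> (\<lambda>x. c * f x) \<in> C0 X"
  by (rule C0_comp[of f X "\<lambda>z. c * z"]) (auto intro: continuous_intros)

lemma C0_uminus: "f \<in> C0 X \<Longrightarrow> (\<lambda>x. - f x) \<in> C0 X"
  using C0_cmult[of f X "-1"] by simp

lemma C0_diff: "f \<in> C0 X \<Longrightarrow> g \<in> C0 X \<Longrightarrow> (\<lambda>x. f x - g x) \<in> C0 X"
  using C0_add[of f X "\<lambda>x. - g x"] C0_uminus[of g X] by simp

lemma C0_mult_bounded:
  assumes "f \<in> C0 X" "continuous_map X euclidean g" "\<And>x. x \<in> topspace X \<Longrightarrow> cmod (g x) \<le> B"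
  shows "(\<lambda>x. f x * g x) \<in> C0 X"
proof -
  have "vanishes_at_infinity X (\<lambda>x. f x * g x)"
  proof (rule vanishes_at_infinity_mono)
    show "vanishes_at_infinity X (\<lambda>x. complex_of_real B * f x)"
      using C0_cmult[OF assms(1), of "of_real B"] by (simp add: C0_def)
    show "cmod (f x * g x) \<le> cmod (complex_of_real B * f x)" if "x \<in> topspace X" for x
    proof -
      have "cmod (f x) * cmod (g x) \<le> cmod (f x) * \<bar>B\<bar>"
        using assms(3)[OF that] by (intro mult_left_mono) auto
      then show ?thesis by (simp add: norm_mult mult.commute)
    qed
  qed
  then show ?thesis using assms by (auto simp: C0_def intro: continuous_map_mult)
qed

lemma C0_bounded:
  assumes "f \<in> C0 X" shows "\<exists>B>0. \<forall>x. cmod (f x) \<le> B"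
proof -
  obtain K where K: "compactin X K" "\<forall>x\<in>topspace X - K. cmod (f x) < 1"
    using assms unfolding C0_def vanishes_at_infinity_def by (auto dest: spec[of _ 1])
  have "compactin euclidean (f ` K)"
    using assms by (intro image_compactin[OF K(1)]) (auto simp: C0_def)
  then have "bounded (f ` K)" by (simp add: compact_imp_bounded)
  then obtain B where B: "\<And>x. x \<in> K \<Longrightarrow> cmod (f x) \<le> B" unfolding bounded_iff by auto
  have "cmod (f x) \<le> max B 1" for x
  proof (cases "x \<in> topspace X")
    case True
    show ?thesis
    proof (cases "x \<in> K")
      case True
      then show ?thesis using B[of x] by simp
    next
      case False
      then have "cmod (f x) < 1" using K(2) \<open>x \<in> topspace X\<close> by blast
      then show ?thesis by simp
    qed
  next
    case False
    then show ?thesis using assms by (simp add: C0_def)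
  qed
  then show ?thesis by (intro exI[of _ "max B 1"]) auto
qed

lemma C0_mult: "f \<in> C0 X \<Longrightarrow> g \<in> C0 X \<Longrightarrow> (\<lambda>x. f x * g x) \<in> C0 X"
  using C0_bounded[of g X] C0_mult_bounded[of f X g] by (auto simp: C0_def)

lemma C0_sum: "(\<And>i. i \<in> A \<Longrightarrow> f i \<in> C0 X) \<Longrightarrow> (\<lambda>x. \<Sum>i\<in>A. f i x) \<in> C0 X"
proof (induction A rule: infinite_finite_induct)
  case (insert i A)
  then show ?case by (auto simp: intro: C0_add)
qed auto

text \<open>Membership in \<open>C0 X\<close> supplies the upper bound without which the supremum
  would be an unspecified real.\<close>

lemma norm_le_sup_norm: "f \<in> C0 X \<Longrightarrow> cmod (f x) \<le> sup_norm f"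
proof -
  assume "f \<in> C0 X"
  then obtain B where "\<And>x. cmod (f x) \<le> B" using C0_bounded by blast
  then have "bdd_above (range (\<lambda>x. cmod (f x)))" by (intro bdd_aboveI[of _ B]) auto
  then show ?thesis unfolding sup_norm_def by (intro cSUP_upper) auto
qed

lemma sup_norm_le: "(\<And>x. cmod (f x) \<le> B) \<Longrightarrow> sup_norm f \<le> B"
  unfolding sup_norm_def by (intro cSUP_least) auto

lemma sup_norm_nonneg: "f \<in> C0 X \<Longrightarrow> 0 \<le> sup_norm f"
  using norm_le_sup_norm[of f X undefined] norm_ge_zero[of "f undefined"] by linarith

lemma C0_compact_support:
  assumes "continuous_map X euclidean f" "compactin X L" "\<And>x. x \<notin> L \<Longrightarrow> f x = 0"
  shows "f \<in> C0 X"
  using assms compactin_subset_topspace[OF assms(2)]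
  by (auto simp: C0_def vanishes_at_infinity_def intro!: exI[of _ L])

lemma C0_subtopology_compact:
  assumes "compactin X K"
  shows "f \<in> C0 (subtopology X K) \<longleftrightarrow>
    continuous_map (subtopology X K) euclidean f \<and> (\<forall>x. x \<notin> K \<longrightarrow> f x = 0)"
proof -
  have "K \<subseteq> topspace X" using assms compactin_subset_topspace by blast
  then have "topspace (subtopology X K) = K" by auto
  moreover have "compactin (subtopology X K) K" using assms by (simp add: compactin_subtopology)
  ultimately show ?thesis
    by (auto simp: C0_def vanishes_at_infinity_def intro!: exI[of _ K])
qed

text \<open>A function vanishing at infinity on the complement of \<open>K\<close> is small off a
  compact set disjoint from \<open>K\<close>, hence small on a neighbourhood of \<open>K\<close>; so
  its extension by zero is continuous there. Conversely, if \<open>f\<close> vanishes on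
  \<open>K\<close>, the set where \<open>cmod f \<ge> e\<close> is compact and misses
  \<open>K\<close>.\<close>

lemma C0_subtopology_compl:
  assumes "Hausdorff_space X" "compactin X K"
  shows "C0 (subtopology X (topspace X - K)) = {f \<in> C0 X. \<forall>x\<in>K. f x = 0}"
proof -
  let ?Y = "subtopology X (topspace X - K)"
  have KX: "K \<subseteq> topspace X" using assms compactin_subset_topspace by blast
  have opn: "openin X (topspace X - K)" using compactin_imp_closedin[OF assms] by blast
  show ?thesis
  proof (intro equalityI subsetI)
    fix f assume f: "f \<in> C0 ?Y"
    have f0: "f x = 0" if "x \<notin> topspace X - K" for x using f that by (auto simp: C0_def)
    have van: "\<exists>L. compactin X L \<and> L \<inter> K = {} \<and> (\<forall>x\<in>topspace X - L. cmod (f x) < e)" if "e > 0" for e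
    proof -
      obtain L where L: "compactin ?Y L" "\<forall>x\<in>topspace ?Y - L. cmod (f x) < e"
        using f \<open>e > 0\<close> unfolding C0_def vanishes_at_infinity_def by blast
      then show ?thesis
        using f0 \<open>e > 0\<close> by (intro exI[of _ L]) (force simp: compactin_subtopology)
    qed
    have "continuous_map X euclidean f"
    proof (subst continuous_map_eps, intro ballI allI impI)
      fix x e assume x: "x \<in> topspace X" and e: "(e::real) > 0"
      show "\<exists>U. openin X U \<and> x \<in> U \<and> (\<forall>y\<in>U. dist (f y) (f x) < e)"
      proof (cases "x \<in> K")
        case True
        obtain L where L: "compactin X L" "L \<inter> K = {}" "\<forall>x\<in>topspace X - L. cmod (f x) < e"
          using van[OF e] by blast
        then have "openin X (topspace X - L)" using assms(1) compactin_imp_closedin by blast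
        then show ?thesis using L True x f0[of x] by (intro exI[of _ "topspace X - L"]) auto
      next
        case False
        have "continuous_map ?Y euclidean f" using f by (simp add: C0_def)
        then obtain U where "openin ?Y U" "x \<in> U" "\<forall>y\<in>U. dist (f y) (f x) < e"
          using x False e unfolding continuous_map_eps topspace_subtopology by blast
        then show ?thesis using openin_trans_full[OF _ opn] by blast
      qed
    qed
    then show "f \<in> {f \<in> C0 X. \<forall>x\<in>K. f x = 0}"
      using f0 van unfolding C0_def vanishes_at_infinity_def by blast
  next
    fix f assume f: "f \<in> {f \<in> C0 X. \<forall>x\<in>K. f x = 0}"
    have "vanishes_at_infinity ?Y f" unfolding vanishes_at_infinity_def
    proof (intro allI impI)
      fix e :: real assume e: "e > 0"
      obtain L where L: "compactin X L" "\<forall>x\<in>topspace X - L. cmod (f x) < e"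
        using f e unfolding C0_def vanishes_at_infinity_def by blast
      \<comment> \<open>\<open>L\<close> may meet \<open>K\<close> and then is not a subset of the
        complement; the closed superlevel set inside \<open>L\<close> avoids \<open>K\<close>
        because \<open>f\<close> is zero there.\<close>
      let ?C = "{x \<in> topspace X. f x \<in> {z. cmod z \<ge> e}}"
      have "closedin euclidean {z. cmod z \<ge> e}"
        unfolding closed_closedin[symmetric] by (intro closed_Collect_le continuous_intros)
      then have "closedin X ?C"
        by (rule closedin_continuous_map_preimage[of X euclidean f, rotated]) (use f in \<open>auto simp: C0_def\<close>)
      moreover have "?C \<subseteq> L" using L by force
      ultimately have "compactin X ?C" using L(1) closed_compactin by blast
      then show "\<exists>K'. compactin ?Y K' \<and> (\<forall>x\<in>topspace ?Y - K'. cmod (f x) < e)"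
        using f e by (intro exI[of _ ?C]) (auto simp: compactin_subtopology)
    qed
    then show "f \<in> C0 ?Y" using f by (auto simp: C0_def continuous_map_from_subtopology)
  qed
qed

section \<open>Bump functions, partitions of unity and extension from compact sets\<close>

lemma bump_function:
  assumes "locally_compact_space X" "Hausdorff_space X" "openin X U" "x \<in> U"
  shows "\<exists>(f::'a \<Rightarrow> real) L. continuous_map X euclidean f \<and> (\<forall>y. 0 \<le> f y) \<and> f x = 1 \<and>
    compactin X L \<and> L \<subseteq> U \<and> (\<forall>y. y \<notin> L \<longrightarrow> f y = 0)"
proof -
  have "neighbourhood_base_of (\<lambda>C. compactin X C \<and> closedin X C) X"
    using assms(1,2) locally_compact_space_neighbourhood_base_closedin by blast
  then obtain V L where VL: "openin X V" "compactin X L" "x \<in> V" "V \<subseteq> L" "L \<subseteq> U"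
    using assms(3,4) unfolding neighbourhood_base_of by (meson subset_trans)
  have "completely_regular_space X"
    using assms(1,2) locally_compact_regular_imp_completely_regular_space by blast
  then obtain f where f: "continuous_map X euclideanreal f" "f x = 1" "f ` (topspace X - V) \<subseteq> {0}"
    using completely_regular_space_gen_alt'[OF zero_neq_one[symmetric], where X = X] VL by blast
  \<comment> \<open>The separating function \<open>f\<close> comes without a sign and without
    control outside the carrier; truncation repairs both. The support lies in \<open>L\<close>
    because \<open>f\<close> was separated from the complement of
    \<open>V \<subseteq> L\<close>.\<close>
  define g where "g y = (if y \<in> topspace X then max 0 (f y) else 0)" for y
  have "continuous_map X euclidean g"
    by (rule continuous_map_eq[of _ _ "\<lambda>y. max 0 (f y)"]) (auto simp: g_def intro!: continuous_intros f)
  moreover have "x \<in> topspace X" using VL openin_subset by blast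
  moreover have "g y = 0" if "y \<notin> L" for y
  proof (cases "y \<in> topspace X")
    case True
    then have "f y = 0" using f(3) VL(4) that by blast
    then show ?thesis by (simp add: g_def)
  qed (simp add: g_def)
  ultimately show ?thesis using VL f(2) by (intro exI[of _ g] exI[of _ L]) (auto simp: g_def)
qed

text \<open>\<open>X\<close> is not assumed paracompact, so the sum is normalised to
  \<open>1\<close> on \<open>K\<close> only and merely bounded by \<open>1\<close> elsewhere. The
  index set consists of points of \<open>K\<close>, so that whatever was chosen at \<open>p\<close>
  to define \<open>W p\<close> can be addressed by the index.\<close>

lemma partition_on_compact:
  fixes X :: "'a topology"
  assumes X: "locally_compact_space X" "Hausdorff_space X" and K: "compactin X K"
    and W: "\<And>x. x \<in> K \<Longrightarrow> openin X (W x) \<and> x \<in> W x"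
  shows "\<exists>P (\<rho> :: 'a \<Rightarrow> 'a \<Rightarrow> real) L. finite P \<and> P \<subseteq> K \<and>
    (\<forall>p\<in>P. continuous_map X euclidean (\<rho> p)) \<and> (\<forall>p x. 0 \<le> \<rho> p x) \<and>
    (\<forall>p\<in>P. compactin X (L p) \<and> L p \<subseteq> W p \<and> (\<forall>x. x \<notin> L p \<longrightarrow> \<rho> p x = 0)) \<and>
    (\<forall>x. (\<Sum>p\<in>P. \<rho> p x) \<le> 1) \<and> (\<forall>x\<in>K. (\<Sum>p\<in>P. \<rho> p x) = 1)"
proof -
  have "\<forall>x\<in>K. \<exists>(f::'a \<Rightarrow> real) L. continuous_map X euclidean f \<and> (\<forall>y. 0 \<le> f y) \<and> f x = 1 \<and>
    compactin X L \<and> L \<subseteq> W x \<and> (\<forall>y. y \<notin> L \<longrightarrow> f y = 0)"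
    using bump_function[OF X] W by blast
  then obtain f L where fL: "\<And>x. x \<in> K \<Longrightarrow> continuous_map X euclidean (f x) \<and>
      (\<forall>y. (0::real) \<le> f x y) \<and> f x x = 1 \<and>
      compactin X (L x) \<and> L x \<subseteq> W x \<and> (\<forall>y. y \<notin> L x \<longrightarrow> f x y = 0)" by metis
  have KX: "K \<subseteq> topspace X" using K compactin_subset_topspace by blast
  define O' where "O' x = {y \<in> topspace X. f x y \<in> {1/2<..}}" for x
  have O': "openin X (O' x)" if "x \<in> K" for x
    unfolding O'_def by (rule openin_continuous_map_preimage[of X euclidean]) (use fL[OF that] in auto)
  have "x \<in> O' x" if "x \<in> K" for x using fL[OF that] KX that by (auto simp: O'_def)
  then have "K \<subseteq> \<Union>(O' ` K)" by blast
  moreover have "\<forall>U\<in>O' ` K. openin X U" using O' by blast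
  ultimately obtain \<F> where \<F>: "finite \<F>" "\<F> \<subseteq> O' ` K" "K \<subseteq> \<Union>\<F>"
    using K unfolding compactin_def by meson
  then obtain P where P: "P \<subseteq> K" "finite P" "\<F> = O' ` P"
    by (meson finite_subset_image)
  define S where "S x = (\<Sum>p\<in>P. f p x)" for x
  \<comment> \<open>The sum \<open>S\<close> may vanish off \<open>K\<close>. It is at least
    \<open>1/2\<close> on \<open>K\<close>, since the sets \<open>O' p\<close> cover
    \<open>K\<close>; so the maximum changes nothing on \<open>K\<close> and keeps the denominator
    positive everywhere.\<close>
  define \<rho> where "\<rho> p x = (if p \<in> P then f p x / max (S x) (1/2) else 0)" for p x
  have S1: "S x \<ge> 1/2" if x: "x \<in> K" for x
  proof -
    obtain p where p: "p \<in> P" "x \<in> O' p" using \<F>(3) P(3) x by auto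
    have "1/2 \<le> f p x" using p by (simp add: O'_def)
    also have "\<dots> \<le> S x" unfolding S_def
      by (rule member_le_sum) (use p P fL in auto)
    finally show ?thesis .
  qed
  have S0: "S x \<ge> 0" for x unfolding S_def using fL P by (intro sum_nonneg) auto
  have sum: "(\<Sum>p\<in>P. \<rho> p x) = S x / max (S x) (1/2)" for x
    by (simp add: \<rho>_def S_def sum_divide_distrib)
  show ?thesis
  proof (intro exI[of _ P] exI[of _ \<rho>] exI[of _ L] conjI ballI allI impI)
    show "finite P" "P \<subseteq> K" using P by auto
    show "continuous_map X euclidean (\<rho> p)" if "p \<in> P" for p
    proof -
      have "continuous_map X euclidean S" unfolding S_def using P fL by (intro continuous_map_sum) auto
      then have "continuous_map X euclidean (\<lambda>x. f p x / max (S x) (1/2))"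
        using fL P that by (intro continuous_map_real_divide continuous_map_real_max) auto
      then show ?thesis using that by (simp add: \<rho>_def[abs_def])
    qed
    show "0 \<le> \<rho> p x" for p x using fL P by (auto simp: \<rho>_def le_max_iff_disj)
    show "compactin X (L p)" "L p \<subseteq> W p" if "p \<in> P" for p using fL that P by blast+
    show "\<rho> p x = 0" if "p \<in> P" "x \<notin> L p" for p x using fL that P by (auto simp: \<rho>_def)
    show "(\<Sum>p\<in>P. \<rho> p x) \<le> 1" for x unfolding sum using S0[of x] by (simp add: divide_le_eq max_def)
    show "(\<Sum>p\<in>P. \<rho> p x) = 1" if "x \<in> K" for x unfolding sum using S1[OF that] by (simp add: max_def)
  qed
qed

text \<open>The sum of a partition of unity for the constant cover by \<open>U\<close>.\<close>

lemma cutoff_function: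
  fixes X :: "'a topology"
  assumes X: "locally_compact_space X" "Hausdorff_space X" and K: "compactin X K"
    and U: "openin X U" "K \<subseteq> U"
  obtains \<rho> :: "'a \<Rightarrow> real" and L where "continuous_map X euclidean \<rho>" "\<And>x. 0 \<le> \<rho> x" "\<And>x. \<rho> x \<le> 1"
    "compactin X L" "L \<subseteq> U" "\<And>x. x \<notin> L \<Longrightarrow> \<rho> x = 0" "\<And>x. x \<in> K \<Longrightarrow> \<rho> x = 1"
proof -
  have UK: "openin X U \<and> x \<in> U" if "x \<in> K" for x using U that by blast
  obtain P \<rho> L where P: "finite P" "P \<subseteq> K"
    "\<forall>p\<in>P. continuous_map X euclidean (\<rho> p)" "\<forall>p x. 0 \<le> (\<rho> p x :: real)"
    "\<forall>p\<in>P. compactin X (L p) \<and> L p \<subseteq> U \<and> (\<forall>x. x \<notin> L p \<longrightarrow> \<rho> p x = 0)"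
    "\<forall>x. (\<Sum>p\<in>P. \<rho> p x) \<le> 1" "\<forall>x\<in>K. (\<Sum>p\<in>P. \<rho> p x) = 1"
    using partition_on_compact[OF X K, of "\<lambda>_. U", OF UK] by blast
  show ?thesis
  proof (rule that[of "\<lambda>x. \<Sum>p\<in>P. \<rho> p x" "\<Union>p\<in>P. L p"])
    show "continuous_map X euclidean (\<lambda>x. \<Sum>p\<in>P. \<rho> p x)" 
      by (rule continuous_map_sum[OF P(1)]) (use P(3) in blast)
    show "compactin X (\<Union>p\<in>P. L p)" by (rule compactin_Union) (use P(1,5) in blast)+
    show "(\<Union>p\<in>P. L p) \<subseteq> U" using P(5) by blast
    show "0 \<le> (\<Sum>p\<in>P. \<rho> p x)" for x using P(4) by (simp add: sum_nonneg)
    show "(\<Sum>p\<in>P. \<rho> p x) \<le> 1" for x using P(6) by blast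
    show "(\<Sum>p\<in>P. \<rho> p x) = 0" if "x \<notin> (\<Union>p\<in>P. L p)" for x using P(5) that by (intro sum.neutral) blast
    show "(\<Sum>p\<in>P. \<rho> p x) = 1" if "x \<in> K" for x using P(7) that by blast
  qed
qed

text \<open>Tietze extension of the real and imaginary parts, followed by a cutoff that produces
  compact support. This is the surjectivity behind the identification of C(K) with a quotient of
  \<open>C0 X\<close>.\<close>

lemma C0_extension:
  assumes X: "locally_compact_space X" "Hausdorff_space X" and K: "compactin X K"
    and g: "continuous_map (subtopology X K) euclidean g"
  shows "\<exists>f\<in>C0 X. \<forall>x\<in>K. f x = (g x :: complex)"
proof -
  have cr: "completely_regular_space X"
    using X locally_compact_regular_imp_completely_regular_space by blast
  have ext: "\<exists>g'. continuous_map X euclideanreal g' \<and> (\<forall>x\<in>K. g' x = h x)"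
    if "continuous_map (subtopology X K) euclidean h" for h :: "'a \<Rightarrow> real"
    using Tietze_extension_completely_regular[OF cr K is_interval_univ UNIV_not_empty that subset_UNIV] by metis
  obtain u where u: "continuous_map X euclideanreal u" "\<forall>x\<in>K. u x = Re (g x)"
    using ext[OF continuous_map_Re[OF g]] by blast
  obtain v where v: "continuous_map X euclideanreal v" "\<forall>x\<in>K. v x = Im (g x)"
    using ext[OF continuous_map_Im[OF g]] by blast
  have KX: "K \<subseteq> topspace X" using K compactin_subset_topspace by blast
  obtain \<rho> L where \<rho>: "continuous_map X euclideanreal \<rho>" "compactin X L"
     "\<And>x. x \<notin> L \<Longrightarrow> \<rho> x = 0" "\<And>x. x \<in> K \<Longrightarrow> \<rho> x = 1"
    using cutoff_function[OF X K openin_topspace KX] by metis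
  let ?f = "\<lambda>x. complex_of_real (\<rho> x) * (of_real (u x) + \<i> * of_real (v x))"
  have "continuous_map X euclidean ?f"
    by (intro continuous_map_mult continuous_map_add continuous_map_of_real \<rho> u v continuous_map_canonical_const)
  then have "?f \<in> C0 X" by (rule C0_compact_support[OF _ \<rho>(2)]) (simp add: \<rho>(3))
  then show ?thesis using u v \<rho> by (intro bexI[of _ ?f]) (auto simp: complex_eq_iff)
qed

section \<open>Pointwise geometry of a Hilbert module\<close>

text \<open>The hypothesis is the nonnegativity of the squared norm of
  \<open>\<xi> + t \<eta>\<close>, with \<open>p\<close> the pairing of \<open>\<xi>\<close> and
  \<open>\<eta>\<close>. Kept scalar so that it serves both the inner product of a module at a
  point, where \<open>b\<close> can be zero for a nonzero element, and the metric on the fibres of a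
  bundle.\<close>

lemma cauchy_schwarz_scalar:
  fixes a b :: real and p :: complex
  assumes b: "b \<ge> 0" and pos: "\<And>t. 0 \<le> a + 2 * Re (t * p) + (cmod t)\<^sup>2 * b"
  shows "(cmod p)\<^sup>2 \<le> a * b"
proof (cases "b = 0")
  case True
  have "p = 0"
  proof (rule ccontr)
    assume "p \<noteq> 0"
    \<comment> \<open>Scaled so that the linear term equals
      \<open>- 2 * (\<bar>a\<bar> + 1)\<close>, which outweighs \<open>a\<close>; the quadratic term
      is absent because \<open>b = 0\<close>.\<close>
    define s where "s = (\<bar>a\<bar> + 1) / (cmod p)\<^sup>2"
    have "Re (- complex_of_real s * cnj p * p) = - (s * (cmod p)\<^sup>2)"
      unfolding cmod_power2 by (simp add: power2_eq_square algebra_simps)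
    then have "Re (- complex_of_real s * cnj p * p) = - (\<bar>a\<bar> + 1)"
      using \<open>p \<noteq> 0\<close> by (simp add: s_def)
    then show False using pos[of "- complex_of_real s * cnj p"] True by (simp del: mult_minus_left)
  qed
  then show ?thesis using True by simp
next
  case False
  then have b: "b > 0" using b by simp
  \<comment> \<open>The minimiser of the quadratic expression in \<open>t\<close>.\<close>
  let ?t = "- cnj p / complex_of_real b"
  have "Re (?t * p) = - ((cmod p)\<^sup>2 / b)"
  proof -
    have "?t * p = - complex_of_real ((cmod p)\<^sup>2 / b)"
      using complex_norm_square[of p] by (simp add: mult.commute)
    then show ?thesis unfolding of_real_minus[symmetric] by (simp only: Re_complex_of_real)
  qed
  moreover have "(cmod ?t)\<^sup>2 * b = (cmod p)\<^sup>2 / b"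
    using b by (simp add: norm_divide power_divide power2_eq_square)
  ultimately have "(cmod p)\<^sup>2 / b \<le> a" using pos[of ?t] by linarith
  then show ?thesis using b by (simp add: field_simps)
qed

text \<open>For a Hilbert module this is a seminorm at each \<open>x\<close>; the quotient by its
  null space will be the fibre of the bundle over \<open>x\<close>.\<close>

definition pnorm :: "('a, 'e, 'm) hmodule_scheme \<Rightarrow> 'e \<Rightarrow> 'a \<Rightarrow> real" where
  "pnorm E \<xi> x = sqrt (Re (hinner E \<xi> \<xi> x))"

lemma complex_ring_simps [simp]:
  "carrier complex_ring = UNIV" "mult complex_ring = (*)" "one complex_ring = 1"
  "zero complex_ring = 0" "add complex_ring = (+)"
  by (simp_all add: complex_ring_def)

lemma cring_complex_ring: "cring complex_ring"
  by (rule cringI, rule abelian_groupI, simp_all add: algebra_simps comm_monoidI)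
    (auto simp: algebra_simps intro!: comm_monoidI exI[of _ "- x" for x])

context hilbert_module
begin

section \<open>Pairings, Cauchy-Schwarz and the pointwise seminorms\<close>

lemma cscale_closed [simp, intro]: "\<xi> \<in> carrier E \<Longrightarrow> cscale E c \<xi> \<in> carrier E"
  using Module.module.smult_closed[OF vector_space[unfolded cvector_space_def], of c \<xi>] by simp

declare act_closed [simp, intro]

lemma hinner_outside:
  "\<xi> \<in> carrier E \<Longrightarrow> \<eta> \<in> carrier E \<Longrightarrow> x \<notin> topspace X \<Longrightarrow> hinner E \<xi> \<eta> x = 0"
  using hinner_closed[of \<xi> \<eta>] by (simp add: C0_def)

lemma hinner_add_left:
  assumes "\<eta> \<in> carrier E" "\<zeta> \<in> carrier E" "\<xi> \<in> carrier E"
  shows "hinner E (\<eta> \<oplus> \<zeta>) \<xi> x = hinner E \<eta> \<xi> x + hinner E \<zeta> \<xi> x"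
  using assms hinner_commute[of \<xi> "\<eta> \<oplus> \<zeta>"] hinner_commute[of \<xi> \<eta>] hinner_commute[of \<xi> \<zeta>]
  by (simp add: hinner_add)

lemma hinner_cscale_left:
  assumes "\<eta> \<in> carrier E" "\<xi> \<in> carrier E"
  shows "hinner E (cscale E c \<eta>) \<xi> x = cnj c * hinner E \<eta> \<xi> x"
  using assms hinner_commute[of \<xi> "cscale E c \<eta>"] hinner_commute[of \<xi> \<eta>] by (simp add: hinner_cscale)

lemma hinner_act_left:
  assumes "\<eta> \<in> carrier E" "\<xi> \<in> carrier E" "f \<in> C0 X"
  shows "hinner E (f \<odot> \<eta>) \<xi> x = cnj (f x) * hinner E \<eta> \<xi> x"
  using assms hinner_commute[of \<xi> "f \<odot> \<eta>"] hinner_commute[of \<xi> \<eta>] by (simp add: hinner_act)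

lemma hinner_zero_right: "\<xi> \<in> carrier E \<Longrightarrow> hinner E \<xi> \<zero> x = 0"
  using hinner_add[of \<xi> \<zero> \<zero> x] by simp

lemma hinner_zero_left: "\<xi> \<in> carrier E \<Longrightarrow> hinner E \<zero> \<xi> x = 0"
  using hinner_add_left[of \<zero> \<zero> \<xi> x] by simp

lemma hinner_minus_right:
  assumes "\<xi> \<in> carrier E" "\<eta> \<in> carrier E" shows "hinner E \<xi> (\<ominus> \<eta>) x = - hinner E \<xi> \<eta> x"
  using assms hinner_add[of \<xi> \<eta> "\<ominus> \<eta>" x]
  by (simp add: r_neg hinner_zero_right add_eq_0_iff)

lemma hinner_diff_right:
  "\<xi> \<in> carrier E \<Longrightarrow> \<eta> \<in> carrier E \<Longrightarrow> \<zeta> \<in> carrier E \<Longrightarrow>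
    hinner E \<xi> (\<eta> \<ominus> \<zeta>) x = hinner E \<xi> \<eta> x - hinner E \<xi> \<zeta> x"
  by (simp add: a_minus_def hinner_add hinner_minus_right)

lemma hinner_diff_left:
  assumes "\<eta> \<in> carrier E" "\<zeta> \<in> carrier E" "\<xi> \<in> carrier E"
  shows "hinner E (\<eta> \<ominus> \<zeta>) \<xi> x = hinner E \<eta> \<xi> x - hinner E \<zeta> \<xi> x"
  using assms hinner_commute[of \<xi> "\<eta> \<ominus> \<zeta>"] hinner_commute[of \<xi> \<eta>] hinner_commute[of \<xi> \<zeta>]
  by (simp add: hinner_diff_right)

lemma hinner_finsum:
  "finite A \<Longrightarrow> g \<in> A \<rightarrow> carrier E \<Longrightarrow> \<xi> \<in> carrier E \<Longrightarrow>
    hinner E \<xi> (finsum E g A) x = (\<Sum>i\<in>A. hinner E \<xi> (g i) x)"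
proof (induction A rule: finite_induct)
  case (insert i A)
  then have "g \<in> A \<rightarrow> carrier E" "g i \<in> carrier E" by auto
  then show ?case using insert by (simp add: hinner_add)
qed (simp add: hinner_zero_right)

lemmas hinner_simps = hinner_add hinner_add_left hinner_cscale hinner_cscale_left hinner_act
  hinner_act_left hinner_zero_right hinner_zero_left hinner_minus_right hinner_diff_right hinner_diff_left

text \<open>Definiteness applied to the difference. It reduces module identities to scalar ones,
  which \<open>hinner_simps\<close> can then compute.\<close>

lemma hinner_ext:
  assumes "\<xi> \<in> carrier E" "\<eta> \<in> carrier E"
    and "\<And>\<zeta> x. \<zeta> \<in> carrier E \<Longrightarrow> hinner E \<zeta> \<xi> x = hinner E \<zeta> \<eta> x"
  shows "\<xi> = \<eta>"
proof -
  have "\<xi> \<ominus> \<eta> = \<zero>"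
    using assms by (intro hinner_definite) (auto simp: hinner_diff_right)
  moreover have "\<xi> = (\<xi> \<ominus> \<eta>) \<oplus> \<eta>" using assms(1,2) by (simp add: a_minus_def a_assoc l_neg)
  ultimately show ?thesis using assms(2) by simp
qed

lemma pnorm_nonneg [simp]: "\<xi> \<in> carrier E \<Longrightarrow> 0 \<le> pnorm E \<xi> x"
  using hinner_nonneg[of \<xi> x] by (simp add: pnorm_def)

lemma hinner_self: "\<xi> \<in> carrier E \<Longrightarrow> hinner E \<xi> \<xi> x = complex_of_real ((pnorm E \<xi> x)\<^sup>2)"
  using hinner_nonneg[of \<xi> x] by (auto simp: pnorm_def complex_is_Real_iff complex_eq_iff)

lemma pnorm_sq: "\<xi> \<in> carrier E \<Longrightarrow> (pnorm E \<xi> x)\<^sup>2 = Re (hinner E \<xi> \<xi> x)"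
  using hinner_nonneg[of \<xi> x] by (simp add: pnorm_def)

lemma cauchy_schwarz:
  assumes "\<xi> \<in> carrier E" "\<eta> \<in> carrier E"
  shows "cmod (hinner E \<xi> \<eta> x) \<le> pnorm E \<xi> x * pnorm E \<eta> x"
proof -
  have "(cmod (hinner E \<xi> \<eta> x))\<^sup>2 \<le> (pnorm E \<xi> x)\<^sup>2 * (pnorm E \<eta> x)\<^sup>2"
  proof (rule cauchy_schwarz_scalar)
    fix t
    have "0 \<le> Re (hinner E (\<xi> \<oplus> cscale E t \<eta>) (\<xi> \<oplus> cscale E t \<eta>) x)"
      using assms hinner_nonneg by simp
    also have "hinner E (\<xi> \<oplus> cscale E t \<eta>) (\<xi> \<oplus> cscale E t \<eta>) x =
        hinner E \<xi> \<xi> x + (t * hinner E \<xi> \<eta> x + cnj (t * hinner E \<xi> \<eta> x)) + (cnj t * t) * hinner E \<eta> \<eta> x"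
      using assms hinner_commute[OF assms] by (simp add: hinner_simps algebra_simps)
    also have "Re \<dots> = (pnorm E \<xi> x)\<^sup>2 + 2 * Re (t * hinner E \<xi> \<eta> x) + (cmod t)\<^sup>2 * (pnorm E \<eta> x)\<^sup>2"
    proof -
      have "cnj t * t = complex_of_real ((cmod t)\<^sup>2)" using complex_norm_square[of t] by (simp add: mult.commute)
      then show ?thesis
        using assms by (simp only: hinner_self of_real_mult[symmetric] plus_complex.sel Re_complex_of_real complex_cnj) simp
    qed
    finally show "0 \<le> (pnorm E \<xi> x)\<^sup>2 + 2 * Re (t * hinner E \<xi> \<eta> x) + (cmod t)\<^sup>2 * (pnorm E \<eta> x)\<^sup>2" .
  qed simp
  then have "(cmod (hinner E \<xi> \<eta> x))\<^sup>2 \<le> (pnorm E \<xi> x * pnorm E \<eta> x)\<^sup>2" by (simp add: power_mult_distrib)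
  then show ?thesis by (rule power2_le_imp_le) (use assms in simp)
qed

lemma pnorm_triangle:
  assumes "\<xi> \<in> carrier E" "\<eta> \<in> carrier E"
  shows "pnorm E (\<xi> \<oplus> \<eta>) x \<le> pnorm E \<xi> x + pnorm E \<eta> x"
proof (rule power2_le_imp_le)
  have "hinner E (\<xi> \<oplus> \<eta>) (\<xi> \<oplus> \<eta>) x =
      hinner E \<xi> \<xi> x + (hinner E \<xi> \<eta> x + cnj (hinner E \<xi> \<eta> x)) + hinner E \<eta> \<eta> x"
    using assms hinner_commute[OF assms] by (simp add: hinner_simps algebra_simps)
  then have "(pnorm E (\<xi> \<oplus> \<eta>) x)\<^sup>2 = (pnorm E \<xi> x)\<^sup>2 + 2 * Re (hinner E \<xi> \<eta> x) + (pnorm E \<eta> x)\<^sup>2"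
    using assms by (simp add: pnorm_sq)
  also have "\<dots> \<le> (pnorm E \<xi> x)\<^sup>2 + 2 * (pnorm E \<xi> x * pnorm E \<eta> x) + (pnorm E \<eta> x)\<^sup>2"
    using cauchy_schwarz[OF assms, of x] complex_Re_le_cmod[of "hinner E \<xi> \<eta> x"] by linarith
  finally show "(pnorm E (\<xi> \<oplus> \<eta>) x)\<^sup>2 \<le> (pnorm E \<xi> x + pnorm E \<eta> x)\<^sup>2"
    by (simp add: power2_sum)
qed (use assms in simp)

lemma pnorm_act: "f \<in> C0 X \<Longrightarrow> \<xi> \<in> carrier E \<Longrightarrow> pnorm E (f \<odot> \<xi>) x = cmod (f x) * pnorm E \<xi> x"
proof -
  assume a: "f \<in> C0 X" "\<xi> \<in> carrier E"
  have "hinner E (f \<odot> \<xi>) (f \<odot> \<xi>) x = ((f x) * cnj (f x)) * hinner E \<xi> \<xi> x"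
    using a by (simp add: hinner_simps mult_ac)
  also have "\<dots> = complex_of_real ((cmod (f x) * pnorm E \<xi> x)\<^sup>2)"
    using a complex_norm_square[of "(f x)"] by (simp add: hinner_self power_mult_distrib)
  finally have "hinner E (f \<odot> \<xi>) (f \<odot> \<xi>) x = complex_of_real ((cmod (f x) * pnorm E \<xi> x)\<^sup>2)" .
  then show ?thesis using a pnorm_def[of E "f \<odot> \<xi>" x] by simp
qed

lemma pnorm_cscale: "\<xi> \<in> carrier E \<Longrightarrow> pnorm E (cscale E c \<xi>) x = cmod c * pnorm E \<xi> x"
proof -
  assume a: "\<xi> \<in> carrier E"
  have "hinner E (cscale E c \<xi>) (cscale E c \<xi>) x = (c * cnj c) * hinner E \<xi> \<xi> x"
    using a by (simp add: hinner_simps mult_ac)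
  also have "\<dots> = complex_of_real ((cmod c * pnorm E \<xi> x)\<^sup>2)"
    using a complex_norm_square[of "c"] by (simp add: hinner_self power_mult_distrib)
  finally have "hinner E (cscale E c \<xi>) (cscale E c \<xi>) x = complex_of_real ((cmod c * pnorm E \<xi> x)\<^sup>2)" .
  then show ?thesis using a pnorm_def[of E "cscale E c \<xi>" x] by simp
qed

lemma pnorm_zero [simp]: "pnorm E \<zero> x = 0"
  by (simp add: pnorm_def hinner_zero_left)

lemma pnorm_diff_commute:
  "\<xi> \<in> carrier E \<Longrightarrow> \<eta> \<in> carrier E \<Longrightarrow> pnorm E (\<xi> \<ominus> \<eta>) x = pnorm E (\<eta> \<ominus> \<xi>) x"
  by (simp add: pnorm_def hinner_simps algebra_simps)

lemma pnorm_triangle_diff: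
  assumes "\<xi> \<in> carrier E" "\<eta> \<in> carrier E" "\<zeta> \<in> carrier E"
  shows "pnorm E (\<xi> \<ominus> \<zeta>) x \<le> pnorm E (\<xi> \<ominus> \<eta>) x + pnorm E (\<eta> \<ominus> \<zeta>) x"
proof -
  have "\<xi> \<ominus> \<zeta> = (\<xi> \<ominus> \<eta>) \<oplus> (\<eta> \<ominus> \<zeta>)"
    using assms by (intro hinner_ext) (simp_all add: hinner_simps)
  then show ?thesis using pnorm_triangle[of "\<xi> \<ominus> \<eta>" "\<eta> \<ominus> \<zeta>"] assms by simp
qed

lemma pnorm_le_add_diff:
  assumes "\<xi> \<in> carrier E" "\<eta> \<in> carrier E"
  shows "pnorm E \<xi> x \<le> pnorm E \<eta> x + pnorm E (\<xi> \<ominus> \<eta>) x"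
proof -
  have "\<xi> = \<eta> \<oplus> (\<xi> \<ominus> \<eta>)"
    using assms by (intro hinner_ext) (simp_all add: hinner_simps)
  then show ?thesis using pnorm_triangle[of \<eta> "\<xi> \<ominus> \<eta>"] assms by simp
qed

lemma pnorm_finsum_le:
  "finite A \<Longrightarrow> g \<in> A \<rightarrow> carrier E \<Longrightarrow> pnorm E (finsum E g A) x \<le> (\<Sum>i\<in>A. pnorm E (g i) x)"
proof (induction A rule: finite_induct)
  case (insert i A)
  then have g: "g \<in> A \<rightarrow> carrier E" "g i \<in> carrier E" by auto
  then show ?case using insert pnorm_triangle[of "g i" "finsum E g A" x] by simp
qed simp

text \<open>Cauchy-Schwarz in one direction, the choice
  \<open>\<zeta> = \<xi> \<ominus> \<eta>\<close> in the other. This is the bridge between smallness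
  in the seminorm at \<open>x\<close> and equality of pairings at \<open>x\<close>.\<close>

lemma pnorm_diff_eq_0_iff:
  assumes "\<xi> \<in> carrier E" "\<eta> \<in> carrier E"
  shows "pnorm E (\<xi> \<ominus> \<eta>) x = 0 \<longleftrightarrow> (\<forall>\<zeta>\<in>carrier E. hinner E \<zeta> \<xi> x = hinner E \<zeta> \<eta> x)"
proof
  assume 0: "pnorm E (\<xi> \<ominus> \<eta>) x = 0"
  show "\<forall>\<zeta>\<in>carrier E. hinner E \<zeta> \<xi> x = hinner E \<zeta> \<eta> x"
  proof
    fix \<zeta> assume "\<zeta> \<in> carrier E"
    then show "hinner E \<zeta> \<xi> x = hinner E \<zeta> \<eta> x"
      using 0 cauchy_schwarz[of \<zeta> "\<xi> \<ominus> \<eta>" x] assms by (simp add: hinner_simps)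
  qed
next
  assume "\<forall>\<zeta>\<in>carrier E. hinner E \<zeta> \<xi> x = hinner E \<zeta> \<eta> x"
  then show "pnorm E (\<xi> \<ominus> \<eta>) x = 0"
    using assms by (simp add: pnorm_def hinner_diff_right)
qed

lemma pnorm_continuous:
  assumes "\<xi> \<in> carrier E" shows "continuous_map X euclidean (pnorm E \<xi>)"
  using hinner_closed[OF assms assms] continuous_map_sqrt[OF continuous_map_Re, of X "hinner E \<xi> \<xi>"]
  by (simp add: C0_def pnorm_def[abs_def])

text \<open>With \<open>hnorm_le\<close>, this makes \<open>hnorm\<close> the supremum of the
  pointwise seminorms, so that uniform pointwise estimates can feed the completeness of
  \<open>E\<close>.\<close>

lemma pnorm_le_hnorm:
  assumes "\<xi> \<in> carrier E" shows "pnorm E \<xi> x \<le> hnorm E \<xi>"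
  unfolding pnorm_def hnorm_def
  using norm_le_sup_norm[OF hinner_closed[OF assms assms], of x] complex_Re_le_cmod[of "hinner E \<xi> \<xi> x"]
  by simp

lemma hnorm_le:
  assumes "\<xi> \<in> carrier E" "\<And>x. pnorm E \<xi> x \<le> B" shows "hnorm E \<xi> \<le> B"
proof -
  have "0 \<le> B" using assms(2)[of undefined] pnorm_nonneg[OF assms(1), of undefined] by linarith
  have "sup_norm (hinner E \<xi> \<xi>) \<le> B\<^sup>2"
  proof (rule sup_norm_le)
    fix x
    have "cmod (hinner E \<xi> \<xi> x) = (pnorm E \<xi> x)\<^sup>2" using assms(1) by (simp add: hinner_self del: of_real_power)
    then show "cmod (hinner E \<xi> \<xi> x) \<le> B\<^sup>2" using assms by (simp add: power_mono)
  qed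
  then show ?thesis using \<open>0 \<le> B\<close> by (simp add: hnorm_def real_le_lsqrt)
qed

text \<open>
  The factor \<open>\<zeta>\<close> is \<open>\<xi> / \<bar>\<xi>\<bar>\<^sup>1\<^sup>/\<^sup>2\<close>; it is obtained by completeness, as the limit of the
  elements \<open>(r / (r\<^sup>2 + \<delta>\<^sup>2)) \<odot> \<xi>\<close> with \<open>r = \<bar>\<xi>\<bar>\<^sup>1\<^sup>/\<^sup>2\<close> and \<open>\<delta> \<rightarrow> 0\<close>.
\<close>

lemma factorization:
  assumes \<xi>: "\<xi> \<in> carrier E"
  shows "\<exists>f\<in>C0 X. \<exists>\<zeta>\<in>carrier E. \<xi> = f \<odot> \<zeta> \<and> (\<forall>x. pnorm E \<xi> x = 0 \<longrightarrow> f x = 0)"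
proof -
  define r where "r x = sqrt (pnorm E \<xi> x)" for x
  have r0: "0 \<le> r x" and r2: "pnorm E \<xi> x = (r x)\<^sup>2" for x using \<xi> by (simp_all add: r_def)
  define d where "d n = 1 / real (Suc n)" for n
  have d: "d n > 0" for n by (simp add: d_def)
  define f where "f x = complex_of_real (r x)" for x
  define g where "g n x = complex_of_real (r x / ((r x)\<^sup>2 + (d n)\<^sup>2))" for n x
  have den: "t\<^sup>2 + (d n)\<^sup>2 > 0" for t n using d[of n] by (simp add: add_nonneg_pos)
  have fC: "f \<in> C0 X"
    unfolding f_def[abs_def] r_def pnorm_def
    by (rule C0_comp[OF hinner_closed[OF \<xi> \<xi>], of "\<lambda>z. complex_of_real (sqrt (sqrt (Re z)))"])
      (auto intro!: continuous_intros)
  have gC: "g n \<in> C0 X" for n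
    unfolding g_def[abs_def] r_def pnorm_def
    by (rule C0_comp[OF hinner_closed[OF \<xi> \<xi>], of "\<lambda>z. complex_of_real (sqrt (sqrt (Re z)) / ((sqrt (sqrt (Re z)))\<^sup>2 + (d n)\<^sup>2))"])
      (intro continuous_intros ballI den[THEN less_imp_neq, THEN not_sym], simp)
  define s where "s n = g n \<odot> \<xi>" for n
  have sC: "s n \<in> carrier E" for n using gC \<xi> by (simp add: s_def)
  \<comment> \<open>With \<open>t = r x\<close>, the second term is the norm of \<open>s n\<close>
    at \<open>x\<close>, and \<open>t\<close> is the norm that the limit should have. The bound does
    not depend on \<open>t\<close>, hence is uniform in \<open>x\<close>, also near the zeros of
    \<open>\<xi>\<close> where dividing by \<open>r\<close> makes no sense.\<close>
  have key: "\<bar>t - t ^ 3 / (t\<^sup>2 + (d n)\<^sup>2)\<bar> \<le> d n" if "t \<ge> 0" for t n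
  proof -
    have "t - t ^ 3 / (t\<^sup>2 + (d n)\<^sup>2) = t * (d n)\<^sup>2 / (t\<^sup>2 + (d n)\<^sup>2)"
    proof -
      have "t - t ^ 3 / (t\<^sup>2 + (d n)\<^sup>2) = (t * (t\<^sup>2 + (d n)\<^sup>2) - t ^ 3) / (t\<^sup>2 + (d n)\<^sup>2)"
        using den[of t n] by (simp add: diff_divide_distrib)
      also have "t * (t\<^sup>2 + (d n)\<^sup>2) - t ^ 3 = t * (d n)\<^sup>2" by (simp add: algebra_simps power2_eq_square power3_eq_cube)
      finally show ?thesis .
    qed
    moreover have "t * (d n)\<^sup>2 \<le> d n * (t\<^sup>2 + (d n)\<^sup>2)"
    proof -
      have "t * d n \<le> t\<^sup>2 + (d n)\<^sup>2"
        using sum_squares_bound[of t "d n"] mult_nonneg_nonneg[OF that less_imp_le[OF d[of n]]] by linarith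
      then have "d n * (t * d n) \<le> d n * (t\<^sup>2 + (d n)\<^sup>2)" using d[of n] by (intro mult_left_mono) auto
      then show ?thesis by (simp add: power2_eq_square mult.commute mult.left_commute)
    qed
    moreover have "0 \<le> t * (d n)\<^sup>2 / (t\<^sup>2 + (d n)\<^sup>2)" using that den[of t n] by simp
    moreover have "t * (d n)\<^sup>2 / (t\<^sup>2 + (d n)\<^sup>2) \<le> d n"
      using den[of t n] calculation(2) by (simp add: divide_le_eq)
    ultimately show ?thesis by linarith
  qed
  have diff: "pnorm E (s m \<ominus> s n) x \<le> d m + d n" for m n x
  proof -
    have "s m \<ominus> s n = (\<lambda>x. g m x - g n x) \<odot> \<xi>"
      using \<xi> gC sC C0_diff[OF gC gC] unfolding s_def
      by (intro hinner_ext) (simp_all add: hinner_simps algebra_simps)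
    then have "pnorm E (s m \<ominus> s n) x = cmod (g m x - g n x) * (r x)\<^sup>2"
      using pnorm_act[OF C0_diff[OF gC gC] \<xi>] r2 by simp
    also have "\<dots> = \<bar>(r x)^3 / ((r x)\<^sup>2 + (d m)\<^sup>2) - (r x)^3 / ((r x)\<^sup>2 + (d n)\<^sup>2)\<bar>"
    proof -
      have "(r x / ((r x)\<^sup>2 + (d m)\<^sup>2) - r x / ((r x)\<^sup>2 + (d n)\<^sup>2)) * (r x)\<^sup>2
        = (r x)^3 / ((r x)\<^sup>2 + (d m)\<^sup>2) - (r x)^3 / ((r x)\<^sup>2 + (d n)\<^sup>2)"
        by (simp add: left_diff_distrib power3_eq_cube power2_eq_square)
      then show ?thesis
        unfolding g_def of_real_diff[symmetric] norm_of_real by (metis abs_mult abs_power2)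
    qed
    also have "\<dots> \<le> d m + d n" using key[OF r0[of x], of m] key[OF r0[of x], of n] by linarith
    finally show ?thesis .
  qed
  have d0: "d \<longlonglongrightarrow> 0" unfolding d_def by (rule LIMSEQ_Suc[OF lim_1_over_n])
  have "\<exists>N. \<forall>m\<ge>N. \<forall>n\<ge>N. hnorm E (s m \<ominus> s n) < e" if "e > 0" for e
  proof -
    from that have "e/3 > 0" by simp
    from LIMSEQ_D[OF d0 this] obtain N where N: "\<And>n. n \<ge> N \<Longrightarrow> \<bar>d n\<bar> < e/3" by auto
    show ?thesis
    proof (intro exI[of _ N] allI impI)
      fix m n assume "N \<le> m" "N \<le> n"
      then have "d m + d n \<le> 2*e/3" using N[of m] N[of n] by linarith
      then have "hnorm E (s m \<ominus> s n) \<le> 2*e/3"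
        by (rule hnorm_le[OF minus_closed[OF sC sC] order_trans[OF diff[of m n]]])
      then show "hnorm E (s m \<ominus> s n) < e" using that by linarith
    qed
  qed
  then obtain \<zeta> where \<zeta>: "\<zeta> \<in> carrier E" and lim: "(\<lambda>n. hnorm E (s n \<ominus> \<zeta>)) \<longlonglongrightarrow> 0"
    using complete[of s] sC by blast
  have "pnorm E (\<xi> \<ominus> f \<odot> \<zeta>) x \<le> 0" for x
  proof -
    have bd: "pnorm E (\<xi> \<ominus> f \<odot> \<zeta>) x \<le> (d n)\<^sup>2 + r x * hnorm E (s n \<ominus> \<zeta>)" for n
    proof -
      have fs: "f \<odot> s n \<in> carrier E" "f \<odot> \<zeta> \<in> carrier E" using fC sC \<zeta> by auto
      have C: "(\<lambda>x. f x * g n x) \<in> C0 X" using C0_mult[OF fC gC] .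
      \<comment> \<open>The factor \<open>1 - f g\<close> equals
        \<open>d\<^sup>2 / (r\<^sup>2 + d\<^sup>2)\<close>, and the weight \<open>r\<^sup>2\<close>
        is exactly the seminorm of \<open>\<xi>\<close>; the product is at most
        \<open>d\<^sup>2\<close>.\<close>
      have "pnorm E (\<xi> \<ominus> f \<odot> s n) x = cmod (1 - f x * g n x) * (r x)\<^sup>2"
      proof -
        have "hinner E (\<xi> \<ominus> f \<odot> s n) (\<xi> \<ominus> f \<odot> s n) x = complex_of_real ((cmod (1 - f x * g n x) * (r x)\<^sup>2)\<^sup>2)"
        proof -
          have "hinner E (\<xi> \<ominus> f \<odot> s n) (\<xi> \<ominus> f \<odot> s n) x = (1 - f x * g n x) * cnj (1 - f x * g n x) * hinner E \<xi> \<xi> x"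
            using \<xi> fC gC sC unfolding s_def by (simp add: hinner_simps algebra_simps)
          also have "\<dots> = complex_of_real ((cmod (1 - f x * g n x))\<^sup>2) * complex_of_real (((r x)\<^sup>2)\<^sup>2)"
            using hinner_self[OF \<xi>, of x] r2[of x] complex_norm_square[of "1 - f x * g n x"] by simp
          finally show ?thesis by (simp add: power_mult_distrib)
        qed
        then show ?thesis by (simp add: pnorm_def)
      qed
      also have "\<dots> \<le> (d n)\<^sup>2"
      proof -
        have "1 - f x * g n x = complex_of_real ((d n)\<^sup>2 / ((r x)\<^sup>2 + (d n)\<^sup>2))"
        proof -
          have "1 - r x * (r x / ((r x)\<^sup>2 + (d n)\<^sup>2)) = (d n)\<^sup>2 / ((r x)\<^sup>2 + (d n)\<^sup>2)"
          proof -
            have "(d n)\<^sup>2 = ((r x)\<^sup>2 + (d n)\<^sup>2) - r x * r x" by (simp add: power2_eq_square)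
            then have "(d n)\<^sup>2 / ((r x)\<^sup>2 + (d n)\<^sup>2) =
                ((r x)\<^sup>2 + (d n)\<^sup>2) / ((r x)\<^sup>2 + (d n)\<^sup>2) - r x * r x / ((r x)\<^sup>2 + (d n)\<^sup>2)"
              by (metis diff_divide_distrib)
            then show ?thesis using d[of n] by simp
          qed
          then show ?thesis unfolding f_def g_def by (metis of_real_1 of_real_diff of_real_mult)
        qed
        then have "cmod (1 - f x * g n x) = (d n)\<^sup>2 / ((r x)\<^sup>2 + (d n)\<^sup>2)"
          using den[of "r x" n] by (simp only: norm_of_real) simp
        then have "cmod (1 - f x * g n x) * (r x)\<^sup>2 = (d n)\<^sup>2 * ((r x)\<^sup>2 / ((r x)\<^sup>2 + (d n)\<^sup>2))" by simp
        also have "\<dots> \<le> (d n)\<^sup>2 * 1"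
          using den[of "r x" n] by (intro mult_left_mono) (auto simp: divide_le_eq)
        finally show ?thesis by simp
      qed
      finally have 1: "pnorm E (\<xi> \<ominus> f \<odot> s n) x \<le> (d n)\<^sup>2" .
      have "f \<odot> s n \<ominus> f \<odot> \<zeta> = f \<odot> (s n \<ominus> \<zeta>)"
        using fC sC \<zeta> by (intro hinner_ext) (simp_all add: hinner_simps algebra_simps)
      then have "pnorm E (f \<odot> s n \<ominus> f \<odot> \<zeta>) x = r x * pnorm E (s n \<ominus> \<zeta>) x"
        using pnorm_act[OF fC, of "s n \<ominus> \<zeta>" x] sC \<zeta> r0[of x] by (simp add: f_def)
      also have "\<dots> \<le> r x * hnorm E (s n \<ominus> \<zeta>)"
        using sC \<zeta> r0[of x] by (intro mult_left_mono pnorm_le_hnorm) auto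
      finally show ?thesis using pnorm_triangle_diff[OF \<xi> fs, of x] 1 by linarith
    qed
    have "(\<lambda>n. (d n)\<^sup>2 + r x * hnorm E (s n \<ominus> \<zeta>)) \<longlonglongrightarrow> 0\<^sup>2 + r x * 0"
      by (intro tendsto_intros d0 lim)
    then show ?thesis using bd by (intro LIMSEQ_le_const[of _ 0]) auto
  qed
  then have "pnorm E (\<xi> \<ominus> f \<odot> \<zeta>) x = 0" for x using \<xi> fC \<zeta> by (simp add: antisym)
  then have "\<xi> = f \<odot> \<zeta>"
    using pnorm_diff_eq_0_iff[of \<xi> "f \<odot> \<zeta>"] \<xi> fC \<zeta> by (intro hinner_ext) auto
  then show ?thesis using fC \<zeta> by (intro bexI[of _ f] bexI[of _ \<zeta>]) (auto simp: f_def r_def)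
qed

lemma hinner_lincomb:
  assumes "finite A" "v \<in> A \<rightarrow> carrier E" "\<zeta> \<in> carrier E"
  shows "hinner E \<zeta> (finsum E (\<lambda>i. cscale E (c i) (v i)) A) x = (\<Sum>i\<in>A. c i * hinner E \<zeta> (v i) x)"
proof -
  have "hinner E \<zeta> (finsum E (\<lambda>i. cscale E (c i) (v i)) A) x = (\<Sum>i\<in>A. hinner E \<zeta> (cscale E (c i) (v i)) x)"
    using assms by (intro hinner_finsum) auto
  also have "\<dots> = (\<Sum>i\<in>A. c i * hinner E \<zeta> (v i) x)"
    using assms by (intro sum.cong) (auto simp: hinner_cscale Pi_iff)
  finally show ?thesis .
qed

lemma lincomb_closed:
  "v \<in> A \<rightarrow> carrier E \<Longrightarrow> finsum E (\<lambda>i. cscale E (c i) (v i)) A \<in> carrier E"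
  by (intro finsum_closed) auto

text \<open>Gram-Schmidt at the single point \<open>x\<close>: both \<open>\<xi>\<close> and the new
  vector \<open>v k\<close> are first made orthogonal to the old ones, giving \<open>w\<close> and
  \<open>u\<close>, and then a multiple of \<open>u\<close> is subtracted from \<open>w\<close>. The
  form at \<open>x\<close> is only semidefinite and the \<open>v i\<close> may be dependent there,
  so coefficients exist but need not be unique.\<close>

lemma orthogonal_projection:
  assumes "finite A"
  shows "v \<in> A \<rightarrow> carrier E \<Longrightarrow> \<xi> \<in> carrier E \<Longrightarrow>
    \<exists>c. \<forall>j\<in>A. hinner E (v j) (\<xi> \<ominus> finsum E (\<lambda>i. cscale E (c i) (v i)) A) x = 0"
  using assms
proof (induction A arbitrary: \<xi> rule: finite_induct)
  case (insert k A)
  let ?L = "\<lambda>c B. finsum E (\<lambda>i. cscale E (c i) (v i)) B"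
  have v: "v \<in> A \<rightarrow> carrier E" "v k \<in> carrier E" "v \<in> insert k A \<rightarrow> carrier E" using insert.prems by auto
  obtain c where c: "\<forall>j\<in>A. hinner E (v j) (\<xi> \<ominus> ?L c A) x = 0" using insert.IH[OF v(1) insert.prems(2)] by blast
  obtain d where d: "\<forall>j\<in>A. hinner E (v j) (v k \<ominus> ?L d A) x = 0" using insert.IH[OF v(1) v(2)] by blast
  define w where "w = \<xi> \<ominus> ?L c A"
  define u where "u = v k \<ominus> ?L d A"
  have [simp]: "w \<in> carrier E" "u \<in> carrier E"
    using insert.prems(2) lincomb_closed[OF v(1)] v(2) by (auto simp: w_def u_def)
  \<comment> \<open>Against vectors orthogonal to the old family, \<open>u\<close> and
    \<open>v k\<close> are indistinguishable; this settles the case \<open>j = k\<close> at the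
    end.\<close>
  have u_eq: "hinner E u z x = hinner E (v k) z x"
    if z: "z \<in> carrier E" "\<forall>j\<in>A. hinner E (v j) z x = 0" for z
  proof -
    have "hinner E (?L d A) z x = cnj (hinner E z (?L d A) x)"
      by (rule hinner_commute[OF z(1) lincomb_closed[OF v(1)]])
    also have "\<dots> = cnj (\<Sum>i\<in>A. d i * hinner E z (v i) x)"
      using hinner_lincomb[OF insert.hyps(1) v(1) z(1)] by simp
    also have "\<dots> = 0"
    proof -
      have "hinner E z (v i) x = 0" if "i \<in> A" for i
        using z that v(1) hinner_commute[of "v i" z x] by (auto simp: Pi_iff)
      then show ?thesis by simp
    qed
    finally show ?thesis unfolding u_def
      using z v lincomb_closed[OF v(1)] by (simp add: hinner_diff_left)
  qed
  \<comment> \<open>If \<open>u\<close> is null at \<open>x\<close>, it pairs to zero with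
    \<open>w\<close> by Cauchy-Schwarz, and any \<open>t\<close> would do.\<close>
  define t where "t = (if hinner E u u x = 0 then 0 else hinner E u w x / hinner E u u x)"
  \<comment> \<open>These are the coefficients for which the remainder of \<open>\<xi>\<close>
    becomes \<open>w - t u\<close>.\<close>
  define c' where "c' i = (if i = k then t else c i - t * d i)" for i
  have uw: "hinner E u w x - t * hinner E u u x = 0"
  proof (cases "hinner E u u x = 0")
    case True
    then have "pnorm E u x = 0" by (simp add: pnorm_def)
    then have "hinner E u w x = 0" using cauchy_schwarz[of u w x] by simp
    then show ?thesis using True by simp
  qed (simp add: t_def)
  have "hinner E (v j) (\<xi> \<ominus> ?L c' (insert k A)) x = 0" if j: "j \<in> insert k A" for j
  proof -
    have vj: "v j \<in> carrier E" using j v by auto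
    have "hinner E (v j) (\<xi> \<ominus> ?L c' (insert k A)) x = hinner E (v j) \<xi> x - (\<Sum>i\<in>insert k A. c' i * hinner E (v j) (v i) x)"
      using vj insert.prems(2) lincomb_closed[OF v(3)] hinner_lincomb[OF _ v(3) vj] insert.hyps(1)
      by (simp add: hinner_diff_right)
    also have "(\<Sum>i\<in>insert k A. c' i * hinner E (v j) (v i) x)
       = t * hinner E (v j) (v k) x + (\<Sum>i\<in>A. (c i - t * d i) * hinner E (v j) (v i) x)"
    proof -
      have "(\<Sum>i\<in>A. c' i * hinner E (v j) (v i) x) = (\<Sum>i\<in>A. (c i - t * d i) * hinner E (v j) (v i) x)"
        using insert.hyps(2) by (intro sum.cong) (auto simp: c'_def)
      then show ?thesis using insert.hyps by (simp add: c'_def)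
    qed
    also have "(\<Sum>i\<in>A. (c i - t * d i) * hinner E (v j) (v i) x)
       = (\<Sum>i\<in>A. c i * hinner E (v j) (v i) x) - t * (\<Sum>i\<in>A. d i * hinner E (v j) (v i) x)"
      by (simp add: left_diff_distrib sum_subtractf sum_distrib_left mult.assoc)
    also have "hinner E (v j) \<xi> x - (t * hinner E (v j) (v k) x + ((\<Sum>i\<in>A. c i * hinner E (v j) (v i) x)
        - t * (\<Sum>i\<in>A. d i * hinner E (v j) (v i) x))) = hinner E (v j) w x - t * hinner E (v j) u x"
      unfolding w_def u_def using vj insert.prems(2) v lincomb_closed[OF v(1)]
        hinner_lincomb[OF insert.hyps(1) v(1) vj]
      by (simp add: hinner_diff_right algebra_simps)
    also have "\<dots> = 0"
    proof (cases "j = k")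
      case True
      then show ?thesis using uw u_eq[of u] u_eq[of w] c d by (simp add: w_def[symmetric] u_def[symmetric])
    next
      case False
      then show ?thesis using c d j by (simp add: w_def[symmetric] u_def[symmetric])
    qed
    finally show ?thesis .
  qed
  then show ?case by blast
qed auto

end

section \<open>Restriction of a Hilbert module to a compact set\<close>

lemma cring_C_ring:
  assumes "compact_space Y"
  shows "cring (C_ring Y)"
proof (rule cringI)
  have ind: "indicator (topspace Y) \<in> C0 Y"
  proof (rule C0_compact_support)
    show "continuous_map Y euclidean (indicator (topspace Y))"
      by (rule continuous_map_eq[of _ _ "\<lambda>_. 1"]) auto
    show "compactin Y (topspace Y)" using assms by (simp add: compact_space_def)
  qed auto
  show "abelian_group (C_ring Y)"
  proof (rule abelian_groupI)
    fix f assume "f \<in> carrier (C_ring Y)"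
    then show "\<exists>g\<in>carrier (C_ring Y). g \<oplus>\<^bsub>C_ring Y\<^esub> f = \<zero>\<^bsub>C_ring Y\<^esub>"
      by (intro bexI[of _ "\<lambda>x. - f x"]) (auto simp: C_ring_def C0_uminus)
  qed (auto simp: C_ring_def C0_add algebra_simps)
  show "Group.comm_monoid (C_ring Y)"
  proof (rule comm_monoidI)
    fix f assume "f \<in> carrier (C_ring Y)"
    then show "\<one>\<^bsub>C_ring Y\<^esub> \<otimes>\<^bsub>C_ring Y\<^esub> f = f"
      by (auto simp: C_ring_def C0_def fun_eq_iff indicator_def)
  qed (use ind in \<open>auto simp: C_ring_def C0_mult algebra_simps\<close>)
qed (auto simp: C_ring_def algebra_simps)

lemma C_ring_simps [simp]:
  "carrier (C_ring Y) = C0 Y" "f \<otimes>\<^bsub>C_ring Y\<^esub> g = (\<lambda>x. f x * g x)"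
  "\<one>\<^bsub>C_ring Y\<^esub> = indicator (topspace Y)" "\<zero>\<^bsub>C_ring Y\<^esub> = (\<lambda>x. 0)"
  "f \<oplus>\<^bsub>C_ring Y\<^esub> g = (\<lambda>x. f x + g x)"
  by (simp_all add: C_ring_def)

lemma free_module_simps [simp]:
  "\<zero>\<^bsub>free_module R I\<^esub> = (\<lambda>i. \<zero>\<^bsub>R\<^esub>)" "c \<oplus>\<^bsub>free_module R I\<^esub> d = (\<lambda>i. c i \<oplus>\<^bsub>R\<^esub> d i)"
  "r \<odot>\<^bsub>free_module R I\<^esub> c = (\<lambda>i. r \<otimes>\<^bsub>R\<^esub> c i)"
  by (simp_all add: free_module_def)

locale hilbert_module_restriction = hilbert_module X E
  for X :: "'a topology" and E :: "('a, 'e, 'm) hmodule_scheme" (structure) +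
  fixes K :: "'a set"
  assumes locally_compact: "locally_compact_space X" and Hausdorff: "Hausdorff_space X"
    and compact: "compactin X K"
begin

text \<open>Congruence modulo \<open>N\<close>, expressed by pairings over \<open>K\<close>;
  \<open>quot_eq\<close> shows that its classes are the cosets.\<close>

definition agree :: "'e \<Rightarrow> 'e \<Rightarrow> bool" where
  "agree \<xi> \<eta> \<longleftrightarrow> (\<forall>\<zeta>\<in>carrier E. \<forall>x\<in>K. hinner E \<zeta> \<xi> x = hinner E \<zeta> \<eta> x)"

abbreviation ideal_submodule :: "'e set" ("N") where "N \<equiv> C0_ideal_submodule X E K"

abbreviation restriction :: "('a, 'e set) hmodule" ("M") where "M \<equiv> restrict_hmodule X E K"

abbreviation compact_ring :: "('a \<Rightarrow> complex) ring" ("R") where "R \<equiv> C_ring (subtopology X K)"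

definition quot :: "'e \<Rightarrow> 'e set" where "quot \<xi> = N +> \<xi>"

text \<open>An arbitrary choice, neither additive nor multiplicative as a function of
  \<open>g\<close>; algebraic identities involving it are recovered on \<open>K\<close>, that is,
  after applying \<open>quot\<close>.\<close>

definition extend :: "('a \<Rightarrow> complex) \<Rightarrow> 'a \<Rightarrow> complex" where
  "extend g = (SOME f. f \<in> C0 X \<and> (\<forall>x\<in>K. f x = g x))"

lemma K_subset: "K \<subseteq> topspace X"
  using compact compactin_subset_topspace by blast

lemma extend:
  assumes "g \<in> C0 (subtopology X K)" shows "extend g \<in> C0 X" "x \<in> K \<Longrightarrow> extend g x = g x"
proof -
  have "\<exists>f. f \<in> C0 X \<and> (\<forall>x\<in>K. f x = g x)"
    using C0_extension[OF locally_compact Hausdorff compact, of g] assms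
    by (auto simp: C0_subtopology_compact[OF compact])
  then have "extend g \<in> C0 X \<and> (\<forall>x\<in>K. extend g x = g x)" unfolding extend_def by (rule someI_ex)
  then show "extend g \<in> C0 X" "x \<in> K \<Longrightarrow> extend g x = g x" by blast+
qed

section \<open>The quotient as a module over C(K)\<close>

lemma agree_iff_pnorm:
  "\<xi> \<in> carrier E \<Longrightarrow> \<eta> \<in> carrier E \<Longrightarrow> agree \<xi> \<eta> \<longleftrightarrow> (\<forall>x\<in>K. pnorm E (\<xi> \<ominus> \<eta>) x = 0)"
  unfolding agree_def using pnorm_diff_eq_0_iff by blast

lemma ideal_submodule_eq: "N = {\<xi> \<in> carrier E. \<forall>x\<in>K. pnorm E \<xi> x = 0}"
proof (intro equalityI subsetI)
  fix \<xi> assume "\<xi> \<in> N"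
  then obtain n f z where \<xi>: "\<xi> = finsum E (\<lambda>i. f i \<odot> z i) {..<n::nat}"
    and fz: "\<forall>i<n. f i \<in> C0 (subtopology X (topspace X - K)) \<and> z i \<in> carrier E"
    unfolding C0_ideal_submodule_def by blast
  have f: "f i \<in> C0 X" "x \<in> K \<Longrightarrow> f i x = 0" "z i \<in> carrier E" if "i < n" for i x
    using fz that unfolding C0_subtopology_compl[OF Hausdorff compact] by auto
  have "pnorm E \<xi> x = 0" if "x \<in> K" for x
  proof -
    have "pnorm E \<xi> x \<le> (\<Sum>i<n. pnorm E (f i \<odot> z i) x)"
      unfolding \<xi> by (rule pnorm_finsum_le) (use f in auto)
    also have "\<dots> = 0" using f that by (simp add: pnorm_act)
    finally show ?thesis using f by (intro antisym) (auto simp: \<xi> intro!: pnorm_nonneg finsum_closed)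
  qed
  moreover have "\<xi> \<in> carrier E" unfolding \<xi> by (rule finsum_closed) (use f in auto)
  ultimately show "\<xi> \<in> {\<xi> \<in> carrier E. \<forall>x\<in>K. pnorm E \<xi> x = 0}" by blast
next
  fix \<xi> assume \<xi>: "\<xi> \<in> {\<xi> \<in> carrier E. \<forall>x\<in>K. pnorm E \<xi> x = 0}"
  then obtain f \<zeta> where f: "f \<in> C0 X" "\<zeta> \<in> carrier E" "\<xi> = f \<odot> \<zeta>" "\<forall>x. pnorm E \<xi> x = 0 \<longrightarrow> f x = 0"
    using factorization by blast
  then have "f \<in> C0 (subtopology X (topspace X - K))"
    using \<xi> unfolding C0_subtopology_compl[OF Hausdorff compact] by auto
  moreover have "\<xi> = finsum E (\<lambda>i. f \<odot> \<zeta>) {..<1::nat}" using f by (simp add: lessThan_Suc)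
  ultimately show "\<xi> \<in> N" unfolding C0_ideal_submodule_def using f(2)
    by (intro CollectI exI[of _ 1] exI[of _ "\<lambda>_. f"] exI[of _ "\<lambda>_. \<zeta>"]) auto
qed

lemma quot_eq:
  assumes "\<xi> \<in> carrier E" shows "quot \<xi> = {\<eta> \<in> carrier E. agree \<eta> \<xi>}"
proof (intro equalityI subsetI)
  fix \<eta> assume "\<eta> \<in> quot \<xi>"
  then obtain h where h: "h \<in> carrier E" "\<forall>x\<in>K. pnorm E h x = 0" and \<eta>: "\<eta> = h \<oplus> \<xi>"
    unfolding quot_def a_r_coset_def' ideal_submodule_eq by blast
  have "h \<oplus> \<xi> \<ominus> \<xi> = h" using h assms by (simp add: a_minus_def a_assoc r_neg)
  then show "\<eta> \<in> {\<eta> \<in> carrier E. agree \<eta> \<xi>}" unfolding \<eta> using h assms by (simp add: agree_iff_pnorm)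
next
  fix \<eta> assume \<eta>: "\<eta> \<in> {\<eta> \<in> carrier E. agree \<eta> \<xi>}"
  then have "\<eta> \<ominus> \<xi> \<in> N" using assms by (auto simp: ideal_submodule_eq agree_iff_pnorm)
  moreover have "\<eta> = (\<eta> \<ominus> \<xi>) \<oplus> \<xi>" using \<eta> assms by (simp add: a_minus_def a_assoc l_neg)
  ultimately show "\<eta> \<in> quot \<xi>" unfolding quot_def a_r_coset_def' by blast
qed

lemma agree_refl [simp]: "agree \<xi> \<xi>" and agree_sym: "agree \<xi> \<eta> \<Longrightarrow> agree \<eta> \<xi>"
  and agree_trans: "agree \<xi> \<eta> \<Longrightarrow> agree \<eta> \<zeta> \<Longrightarrow> agree \<xi> \<zeta>"
  by (auto simp: agree_def)

lemma quot_eq_iff: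
  assumes "\<xi> \<in> carrier E" "\<eta> \<in> carrier E" shows "quot \<xi> = quot \<eta> \<longleftrightarrow> agree \<xi> \<eta>"
proof
  assume "quot \<xi> = quot \<eta>"
  moreover have "\<xi> \<in> quot \<xi>" using assms by (simp add: quot_eq)
  ultimately show "agree \<xi> \<eta>" using assms by (simp add: quot_eq)
next
  assume "agree \<xi> \<eta>"
  then show "quot \<xi> = quot \<eta>" using assms by (auto simp: quot_eq intro: agree_trans agree_sym)
qed

lemma carrier_M: "carrier M = quot ` carrier E"
  by (auto simp: restrict_hmodule_def Let_def A_RCOSETS_def' quot_def)

lemma quot_closed [simp]: "\<xi> \<in> carrier E \<Longrightarrow> quot \<xi> \<in> carrier M"
  by (simp add: carrier_M)

lemma zero_M: "\<zero>\<^bsub>M\<^esub> = quot \<zero>"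
proof -
  have "\<xi> \<ominus> \<zero> = \<xi>" if "\<xi> \<in> carrier E" for \<xi>
    using that by (intro hinner_ext) (simp_all add: hinner_simps)
  then have "N = quot \<zero>" by (auto simp: quot_eq ideal_submodule_eq agree_iff_pnorm)
  then show ?thesis by (simp add: restrict_hmodule_def Let_def)
qed

lemma add_M:
  assumes "\<xi> \<in> carrier E" "\<eta> \<in> carrier E"
  shows "quot \<xi> \<oplus>\<^bsub>M\<^esub> quot \<eta> = quot (\<xi> \<oplus> \<eta>)"
proof -
  have "set_add E (quot \<xi>) (quot \<eta>) = quot (\<xi> \<oplus> \<eta>)"
  proof (intro equalityI subsetI)
    fix z assume "z \<in> set_add E (quot \<xi>) (quot \<eta>)"
    then obtain a b where "a \<in> quot \<xi>" "b \<in> quot \<eta>" "z = a \<oplus> b" by (auto simp: set_add_def')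
    then show "z \<in> quot (\<xi> \<oplus> \<eta>)" using assms by (auto simp: quot_eq agree_def hinner_add)
  next
    fix z assume z: "z \<in> quot (\<xi> \<oplus> \<eta>)"
    then have zc: "z \<in> carrier E" using assms by (simp add: quot_eq)
    have "z \<ominus> \<eta> \<in> quot \<xi>" using z zc assms by (auto simp: quot_eq agree_def hinner_simps)
    moreover have "\<eta> \<in> quot \<eta>" using assms by (simp add: quot_eq)
    moreover have "z = (z \<ominus> \<eta>) \<oplus> \<eta>" using zc assms by (simp add: a_minus_def a_assoc l_neg)
    ultimately show "z \<in> set_add E (quot \<xi>) (quot \<eta>)" unfolding set_add_def' by blast
  qed
  then show ?thesis by (simp add: restrict_hmodule_def Let_def)
qed

text \<open>All sets in the union that defines the action coincide, because two extensions of
  \<open>g\<close> agree on \<open>K\<close> and two representatives have the same pairings there.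
  The extension \<open>f\<close> is left free so that a convenient one can be used instead of
  \<open>extend g\<close>.\<close>

lemma smult_M:
  assumes "g \<in> C0 (subtopology X K)" "f \<in> C0 X" "\<And>x. x \<in> K \<Longrightarrow> f x = g x" "\<xi> \<in> carrier E"
  shows "g \<odot>\<^bsub>M\<^esub> quot \<xi> = quot (f \<odot> \<xi>)"
proof -
  have "N +> (f' \<odot> \<xi>') = quot (f \<odot> \<xi>)"
    if "f' \<in> C0 X" "\<forall>x\<in>K. f' x = g x" "\<xi>' \<in> quot \<xi>" for f' \<xi>'
    using that assms unfolding quot_def[symmetric]
    by (subst quot_eq_iff) (auto simp: quot_eq agree_def hinner_act)
  moreover have "\<xi> \<in> quot \<xi>" using assms by (simp add: quot_eq)
  moreover have "f \<in> {f \<in> C0 X. \<forall>x\<in>K. f x = g x}" using assms by blast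
  ultimately have "(\<Union>f\<in>{f \<in> C0 X. \<forall>x\<in>K. f x = g x}. \<Union>\<xi>\<in>quot \<xi>. N +> (f \<odot> \<xi>)) = quot (f \<odot> \<xi>)"
    by blast
  then show ?thesis by (simp add: restrict_hmodule_def Let_def)
qed

lemma smult_M_extend:
  assumes "g \<in> C0 (subtopology X K)" "\<xi> \<in> carrier E"
  shows "g \<odot>\<^bsub>M\<^esub> quot \<xi> = quot (extend g \<odot> \<xi>)"
  using smult_M[OF assms(1) extend[OF assms(1)] assms(2)] .

text \<open>Independence of the representatives picked by \<open>SOME\<close>: they are replaced one
  argument at a time, the left one after conjugation, since \<open>agree\<close> speaks about the
  right argument.\<close>

lemma hinner_M:
  assumes "\<xi> \<in> carrier E" "\<eta> \<in> carrier E"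
  shows "hinner M (quot \<xi>) (quot \<eta>) x = (if x \<in> K then hinner E \<xi> \<eta> x else 0)"
proof -
  define a where "a = (SOME z. z \<in> quot \<xi>)"
  define b where "b = (SOME z. z \<in> quot \<eta>)"
  have "\<xi> \<in> quot \<xi>" "\<eta> \<in> quot \<eta>" using assms by (simp_all add: quot_eq)
  then have "a \<in> quot \<xi>" "b \<in> quot \<eta>" unfolding a_def b_def by (metis someI)+
  then have ab: "a \<in> carrier E" "agree a \<xi>" "b \<in> carrier E" "agree b \<eta>" using assms by (simp_all add: quot_eq)
  have "hinner E a b x = hinner E \<xi> \<eta> x" if "x \<in> K"
  proof -
    have "hinner E a b x = hinner E a \<eta> x" using ab that by (simp add: agree_def)
    also have "\<dots> = cnj (hinner E \<eta> a x)" using ab assms hinner_commute by blast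
    also have "hinner E \<eta> a x = hinner E \<eta> \<xi> x" using ab assms that by (simp add: agree_def)
    also have "cnj \<dots> = hinner E \<xi> \<eta> x" using hinner_commute[OF assms(2,1)] by simp
    finally show ?thesis .
  qed
  then show ?thesis by (simp add: restrict_hmodule_def Let_def flip: a_def b_def)
qed

lemma topspace_K [simp]: "topspace (subtopology X K) = K" "topspace X \<inter> K = K"
  using K_subset by auto

lemma cring_R: "cring R"
  by (rule cring_C_ring) (simp add: compact compact_space_subtopology)

lemma module_M: "Module.module R M"
proof (rule moduleI[OF cring_R])
  show "abelian_group M"
  proof (rule abelian_groupI)
    fix A assume "A \<in> carrier M"
    then obtain \<xi> where \<xi>: "\<xi> \<in> carrier E" "A = quot \<xi>" by (auto simp: carrier_M)
    then show "\<exists>B\<in>carrier M. B \<oplus>\<^bsub>M\<^esub> A = \<zero>\<^bsub>M\<^esub>"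
      by (intro bexI[of _ "quot (\<ominus> \<xi>)"]) (auto simp: add_M zero_M l_neg)
  qed (auto simp: carrier_M add_M zero_M a_ac)
  fix g A assume "g \<in> carrier R" "A \<in> carrier M"
  then show "g \<odot>\<^bsub>M\<^esub> A \<in> carrier M" by (auto simp: carrier_M smult_M_extend extend)
next
  fix g h A assume gh: "g \<in> carrier R" "h \<in> carrier R" and A: "A \<in> carrier M"
  then obtain \<xi> where \<xi>: "\<xi> \<in> carrier E" "A = quot \<xi>" by (auto simp: carrier_M)
  note e = extend[of g] extend[of h] gh[simplified]
  \<comment> \<open>The sum of the two chosen extensions serves as an extension of
    \<open>g + h\<close>; it may differ from the chosen one off \<open>K\<close>. The product below
    is treated in the same way.\<close>
  have "(\<lambda>x. g x + h x) \<odot>\<^bsub>M\<^esub> quot \<xi> = quot ((\<lambda>x. extend g x + extend h x) \<odot> \<xi>)"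
    by (rule smult_M) (use e \<xi> in \<open>auto intro: C0_add\<close>)
  then show "(g \<oplus>\<^bsub>R\<^esub> h) \<odot>\<^bsub>M\<^esub> A = (g \<odot>\<^bsub>M\<^esub> A) \<oplus>\<^bsub>M\<^esub> (h \<odot>\<^bsub>M\<^esub> A)"
    using e \<xi> by (simp add: smult_M_extend add_M act_add_left)
  have "(\<lambda>x. g x * h x) \<odot>\<^bsub>M\<^esub> quot \<xi> = quot ((\<lambda>x. extend g x * extend h x) \<odot> \<xi>)"
    by (rule smult_M) (use e \<xi> in \<open>auto intro: C0_mult\<close>)
  then show "(g \<otimes>\<^bsub>R\<^esub> h) \<odot>\<^bsub>M\<^esub> A = g \<odot>\<^bsub>M\<^esub> (h \<odot>\<^bsub>M\<^esub> A)"
    using e \<xi> by (simp add: smult_M_extend act_assoc)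
next
  fix g A B assume g: "g \<in> carrier R" and AB: "A \<in> carrier M" "B \<in> carrier M"
  then obtain \<xi> \<eta> where "\<xi> \<in> carrier E" "A = quot \<xi>" "\<eta> \<in> carrier E" "B = quot \<eta>" by (auto simp: carrier_M)
  then show "g \<odot>\<^bsub>M\<^esub> (A \<oplus>\<^bsub>M\<^esub> B) = (g \<odot>\<^bsub>M\<^esub> A) \<oplus>\<^bsub>M\<^esub> (g \<odot>\<^bsub>M\<^esub> B)"
    using g extend[of g] by (simp add: smult_M_extend add_M act_add_right)
next
  fix A assume "A \<in> carrier M"
  then obtain \<xi> where \<xi>: "\<xi> \<in> carrier E" "A = quot \<xi>" by (auto simp: carrier_M)
  have 1: "\<one>\<^bsub>R\<^esub> \<in> C0 (subtopology X K)" using monoid.one_closed[OF cring.axioms(1)[OF cring_R, THEN ring.is_monoid]] by simp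
  have "quot (extend \<one>\<^bsub>R\<^esub> \<odot> \<xi>) = quot \<xi>"
    using \<xi> extend[OF 1] by (subst quot_eq_iff) (auto simp: agree_def hinner_act)
  then show "\<one>\<^bsub>R\<^esub> \<odot>\<^bsub>M\<^esub> A = A" using smult_M_extend[OF 1 \<xi>(1)] \<xi>(2) by simp
qed

sublocale M: Module.module R M by (rule module_M)

section \<open>Finite frames and retracts of free modules\<close>

lemma finsum_M:
  "finite A \<Longrightarrow> g \<in> A \<rightarrow> carrier E \<Longrightarrow> finsum M (\<lambda>i. quot (g i)) A = quot (finsum E g A)"
proof (induction A rule: finite_induct)
  case (insert i A)
  then have g: "g i \<in> carrier E" "g \<in> A \<rightarrow> carrier E" by auto
  then have "(\<lambda>i. quot (g i)) \<in> A \<rightarrow> carrier M" by (intro funcsetI quot_closed) (auto simp: Pi_iff)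
  then show ?case using insert g by (simp add: add_M)
qed (simp add: zero_M)

text \<open>The linear map that sends the i-th unit vector to the class of \<open>\<eta> i\<close>.
  The sum is formed in \<open>E\<close> before passing to the quotient, so that its pairings over
  \<open>K\<close> can be computed there.\<close>

definition synthesis :: "'i set \<Rightarrow> ('i \<Rightarrow> 'e) \<Rightarrow> ('i \<Rightarrow> 'a \<Rightarrow> complex) \<Rightarrow> 'e set" where
  "synthesis I \<eta> c = quot (finsum E (\<lambda>i. extend (c i) \<odot> \<eta> i) I)"

lemma hinner_act_finsum:
  assumes "finite I" "\<eta> \<in> I \<rightarrow> carrier E" "c \<in> I \<rightarrow> C0 X" "\<zeta> \<in> carrier E"
  shows "hinner E \<zeta> (finsum E (\<lambda>i. c i \<odot> \<eta> i) I) x = (\<Sum>i\<in>I. c i x * hinner E \<zeta> (\<eta> i) x)"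
proof -
  have "(\<lambda>i. c i \<odot> \<eta> i) \<in> I \<rightarrow> carrier E" using assms by auto
  then have "hinner E \<zeta> (finsum E (\<lambda>i. c i \<odot> \<eta> i) I) x = (\<Sum>i\<in>I. hinner E \<zeta> (c i \<odot> \<eta> i) x)"
    using assms by (intro hinner_finsum) auto
  also have "\<dots> = (\<Sum>i\<in>I. c i x * hinner E \<zeta> (\<eta> i) x)"
    using assms by (intro sum.cong) (auto simp: hinner_act Pi_iff)
  finally show ?thesis .
qed

lemma free_module_R_D: "c \<in> carrier (free_module R I) \<Longrightarrow> c i \<in> C0 (subtopology X K)"
  by (auto simp: free_module_def)

lemma hinner_synthesis:
  assumes "finite I" "\<eta> \<in> I \<rightarrow> carrier E" "c \<in> carrier (free_module R I)" "\<zeta> \<in> carrier E" "x \<in> K"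
  shows "hinner E \<zeta> (finsum E (\<lambda>i. extend (c i) \<odot> \<eta> i) I) x = (\<Sum>i\<in>I. c i x * hinner E \<zeta> (\<eta> i) x)"
  using assms extend[OF free_module_R_D[OF assms(3)]]
  by (subst hinner_act_finsum) (auto intro!: sum.cong)

lemma synthesis_elem_closed:
  assumes "\<eta> \<in> I \<rightarrow> carrier E" "c \<in> carrier (free_module R I)"
  shows "finsum E (\<lambda>i. extend (c i) \<odot> \<eta> i) I \<in> carrier E"
  using assms extend[OF free_module_R_D[OF assms(2)]] by (intro finsum_closed) auto

lemma linmap_synthesis:
  fixes I :: "'i set"
  assumes I: "finite I" and \<eta>: "\<eta> \<in> I \<rightarrow> carrier E"
  shows "linmap R (free_module R I) M (synthesis I \<eta>)"
  unfolding linmap_def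
proof (intro conjI ballI funcsetI)
  note cl = synthesis_elem_closed[OF \<eta>]
  interpret F: Module.module R "free_module R I" by (rule module_free_module[OF cring_R])
  show "synthesis I \<eta> c \<in> carrier M" if "c \<in> carrier (free_module R I)" for c
    using cl[OF that] by (simp add: synthesis_def)
  show "synthesis I \<eta> (c \<oplus>\<^bsub>free_module R I\<^esub> d) = synthesis I \<eta> c \<oplus>\<^bsub>M\<^esub> synthesis I \<eta> d"
    if cd: "c \<in> carrier (free_module R I)" "d \<in> carrier (free_module R I)" for c d
  proof -
    note cd' = F.M.a_closed[OF cd]
    have "agree (finsum E (\<lambda>i. extend ((c \<oplus>\<^bsub>free_module R I\<^esub> d) i) \<odot> \<eta> i) I)
      (finsum E (\<lambda>i. extend (c i) \<odot> \<eta> i) I \<oplus> finsum E (\<lambda>i. extend (d i) \<odot> \<eta> i) I)"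
      unfolding agree_def
    proof (intro ballI)
      fix \<zeta> x assume z: "\<zeta> \<in> carrier E" "x \<in> K"
      show "hinner E \<zeta> (finsum E (\<lambda>i. extend ((c \<oplus>\<^bsub>free_module R I\<^esub> d) i) \<odot> \<eta> i) I) x =
        hinner E \<zeta> (finsum E (\<lambda>i. extend (c i) \<odot> \<eta> i) I \<oplus> finsum E (\<lambda>i. extend (d i) \<odot> \<eta> i) I) x"
        unfolding hinner_synthesis[OF I \<eta> cd' z] hinner_add[OF z(1) cl[OF cd(1)] cl[OF cd(2)]]
          hinner_synthesis[OF I \<eta> cd(1) z] hinner_synthesis[OF I \<eta> cd(2) z]
        by (simp add: distrib_right sum.distrib)
    qed
    then show ?thesis
      unfolding synthesis_def add_M[OF cl[OF cd(1)] cl[OF cd(2)]]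
      using quot_eq_iff[OF cl[OF cd'] a_closed[OF cl[OF cd(1)] cl[OF cd(2)]]] by blast
  qed
  show "synthesis I \<eta> (g \<odot>\<^bsub>free_module R I\<^esub> c) = g \<odot>\<^bsub>M\<^esub> synthesis I \<eta> c"
    if g: "g \<in> carrier R" and c: "c \<in> carrier (free_module R I)" for g c
  proof -
    note gc = F.smult_closed[OF g c]
    have g': "g \<in> C0 (subtopology X K)" using g by simp
    have "agree (finsum E (\<lambda>i. extend ((g \<odot>\<^bsub>free_module R I\<^esub> c) i) \<odot> \<eta> i) I)
      (extend g \<odot> finsum E (\<lambda>i. extend (c i) \<odot> \<eta> i) I)"
      unfolding agree_def
    proof (intro ballI)
      fix \<zeta> x assume z: "\<zeta> \<in> carrier E" "x \<in> K"
      show "hinner E \<zeta> (finsum E (\<lambda>i. extend ((g \<odot>\<^bsub>free_module R I\<^esub> c) i) \<odot> \<eta> i) I) x =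
        hinner E \<zeta> (extend g \<odot> finsum E (\<lambda>i. extend (c i) \<odot> \<eta> i) I) x"
        unfolding hinner_synthesis[OF I \<eta> gc z] hinner_act[OF z(1) cl[OF c] extend(1)[OF g']]
          hinner_synthesis[OF I \<eta> c z]
        using extend(2)[OF g' z(2)] by (simp add: sum_distrib_left mult_ac)
    qed
    then show ?thesis
      unfolding synthesis_def smult_M_extend[OF g' cl[OF c]]
      using quot_eq_iff[OF cl[OF gc] act_closed[OF extend(1)[OF g'] cl[OF c]]] by blast
  qed
qed

text \<open>\<open>C0_span\<close> assigns one coefficient to each element of the set
  \<open>S\<close>, whereas a family \<open>t\<close> may hit the same element several times; the
  induction collects the coefficients of equal elements. This matters because distinct frame vectors
  can have the same class over \<open>K\<close>.\<close>

lemma C0_span_finsum: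
  assumes S: "finite S" "S \<subseteq> carrier M" and "finite J" and gt: "g \<in> J \<rightarrow> C0 (subtopology X K)" "t \<in> J \<rightarrow> S"
  shows "finsum M (\<lambda>j. g j \<odot>\<^bsub>M\<^esub> t j) J \<in> C0_span (subtopology X K) M S"
  using \<open>finite J\<close> gt
proof (induction J rule: finite_induct)
  case empty
  have "finsum M (\<lambda>s. (\<lambda>x. 0) \<odot>\<^bsub>M\<^esub> s) S = \<zero>\<^bsub>M\<^esub>"
    using S M.smult_l_null by (intro M.add.finprod_one_eqI) auto
  then show ?case unfolding C0_span_def by (intro CollectI exI[of _ "\<lambda>_ _. 0"]) auto
next
  case (insert j J)
  then obtain f where f: "finsum M (\<lambda>j. g j \<odot>\<^bsub>M\<^esub> t j) J = finsum M (\<lambda>s. f s \<odot>\<^bsub>M\<^esub> s) S"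
      "f \<in> S \<rightarrow> C0 (subtopology X K)" unfolding C0_span_def by blast
  have gj: "g j \<in> C0 (subtopology X K)" "t j \<in> S" "t j \<in> carrier M" using insert.prems S by auto
  define f' where "f' s = (if s = t j then (\<lambda>x. f s x + g j x) else f s)" for s
  let ?d = "\<lambda>s. if s = t j then g j \<odot>\<^bsub>M\<^esub> t j else \<zero>\<^bsub>M\<^esub>"
  have fs: "(\<lambda>s. f s \<odot>\<^bsub>M\<^esub> s) \<in> S \<rightarrow> carrier M" using f(2) S(2) by (auto intro!: M.smult_closed)
  have ds: "?d \<in> S \<rightarrow> carrier M" using gj by (auto intro!: M.smult_closed)
  have "finsum M (\<lambda>s. f' s \<odot>\<^bsub>M\<^esub> s) S = finsum M (\<lambda>s. f s \<odot>\<^bsub>M\<^esub> s \<oplus>\<^bsub>M\<^esub> ?d s) S"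
  proof (rule M.finsum_cong')
    fix s assume s: "s \<in> S"
    then have sc: "f s \<in> carrier R" "s \<in> carrier M" "g j \<in> carrier R" using f S gj by auto
    show "f' s \<odot>\<^bsub>M\<^esub> s = f s \<odot>\<^bsub>M\<^esub> s \<oplus>\<^bsub>M\<^esub> ?d s"
      using M.smult_l_distr[OF sc(1) sc(3) sc(2)] M.smult_closed[OF sc(1,2)] by (auto simp: f'_def)
  next
    show "(\<lambda>s. f s \<odot>\<^bsub>M\<^esub> s \<oplus>\<^bsub>M\<^esub> ?d s) \<in> S \<rightarrow> carrier M"
      using fs ds by (intro funcsetI M.M.a_closed) (auto simp: Pi_iff)
  qed simp
  also have "\<dots> = finsum M (\<lambda>s. f s \<odot>\<^bsub>M\<^esub> s) S \<oplus>\<^bsub>M\<^esub> finsum M ?d S"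
    by (rule M.finsum_addf[OF fs ds])
  also have "finsum M (\<lambda>s. if s = t j then g j \<odot>\<^bsub>M\<^esub> t j else \<zero>\<^bsub>M\<^esub>) S = g j \<odot>\<^bsub>M\<^esub> t j"
    using M.add.finprod_singleton[of "t j" S "\<lambda>_. g j \<odot>\<^bsub>M\<^esub> t j"] S gj by (auto simp: eq_commute[of _ "t j"])
  also have "finsum M (\<lambda>s. f s \<odot>\<^bsub>M\<^esub> s) S \<oplus>\<^bsub>M\<^esub> (g j \<odot>\<^bsub>M\<^esub> t j) = finsum M (\<lambda>j. g j \<odot>\<^bsub>M\<^esub> t j) (insert j J)"
  proof -
    have "(\<lambda>j. g j \<odot>\<^bsub>M\<^esub> t j) \<in> J \<rightarrow> carrier M" using insert.prems S by (auto intro!: M.smult_closed)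
    then show ?thesis
      using insert.hyps gj f(1)[symmetric] by (simp add: M.a_comm M.smult_closed)
  qed
  finally have "finsum M (\<lambda>j. g j \<odot>\<^bsub>M\<^esub> t j) (insert j J) = finsum M (\<lambda>s. f' s \<odot>\<^bsub>M\<^esub> s) S" by simp
  moreover have "f' s \<in> C0 (subtopology X K)" if "s \<in> S" for s
    using C0_add[OF funcset_mem[OF f(2) that] gj(1)] funcset_mem[OF f(2) that]
    by (cases "s = t j") (simp_all add: f'_def)
  ultimately show ?case unfolding C0_span_def by (intro CollectI exI[of _ f'] conjI funcsetI)
qed

lemma hnorm_M_zero: "hnorm M \<zero>\<^bsub>M\<^esub> = 0"
proof -
  have "hinner M \<zero>\<^bsub>M\<^esub> \<zero>\<^bsub>M\<^esub> = (\<lambda>x. 0)"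
    by (rule ext) (simp add: zero_M hinner_M hinner_zero_left)
  then show ?thesis by (simp add: hnorm_def sup_norm_def)
qed

text \<open>The coordinates descend to the quotient and form a linear right inverse of
  \<open>synthesis\<close>, so the quotient is a retract of a finite free module; the same
  reconstruction shows that the classes of the \<open>\<eta> i\<close> span it exactly, not only
  densely.\<close>

lemma frame_imp_finitely_generated_projective:
  fixes I :: "'i set"
  assumes I: "finite I" and \<eta>: "\<eta> \<in> I \<rightarrow> carrier E"
    and s_cont: "\<And>i \<zeta>. i \<in> I \<Longrightarrow> \<zeta> \<in> carrier E \<Longrightarrow> continuous_map (subtopology X K) euclidean (s i \<zeta>)"
    and s_add: "\<And>i \<zeta> \<zeta>' x. i \<in> I \<Longrightarrow> \<zeta> \<in> carrier E \<Longrightarrow> \<zeta>' \<in> carrier E \<Longrightarrow> x \<in> K \<Longrightarrow>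
      s i (\<zeta> \<oplus> \<zeta>') x = s i \<zeta> x + s i \<zeta>' x"
    and s_act: "\<And>i \<zeta> f x. i \<in> I \<Longrightarrow> \<zeta> \<in> carrier E \<Longrightarrow> f \<in> C0 X \<Longrightarrow> x \<in> K \<Longrightarrow> s i (f \<odot> \<zeta>) x = f x * s i \<zeta> x"
    and rec: "\<And>\<xi> \<zeta> x. \<xi> \<in> carrier E \<Longrightarrow> \<zeta> \<in> carrier E \<Longrightarrow> x \<in> K \<Longrightarrow>
      hinner E \<xi> \<zeta> x = (\<Sum>i\<in>I. s i \<zeta> x * hinner E \<xi> (\<eta> i) x)"
  shows "finitely_generated (subtopology X K) M" and "projective R M"
proof -
  \<comment> \<open>No bound on \<open>s i\<close> in terms of the norm is assumed, so the
    factorization takes its place: the difference is \<open>f \<odot> z\<close> with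
    \<open>f x = 0\<close>, and \<open>s i\<close> lets \<open>f x\<close> through.\<close>
  have s_agree: "s i \<zeta> x = s i \<zeta>' x" if a: "i \<in> I" "\<zeta> \<in> carrier E" "\<zeta>' \<in> carrier E" "agree \<zeta> \<zeta>'" "x \<in> K" for i \<zeta> \<zeta>' x
  proof -
    have "\<zeta> \<ominus> \<zeta>' \<in> carrier E" using a by simp
    then obtain f z where f: "f \<in> C0 X" "z \<in> carrier E" "\<zeta> \<ominus> \<zeta>' = f \<odot> z" "\<forall>x. pnorm E (\<zeta> \<ominus> \<zeta>') x = 0 \<longrightarrow> f x = 0"
      using factorization by blast
    have "\<zeta> = f \<odot> z \<oplus> \<zeta>'" using a f(3)[symmetric] by (simp add: a_minus_def a_assoc l_neg)
    then have "s i \<zeta> x = f x * s i z x + s i \<zeta>' x" using a f by (simp add: s_add s_act)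
    moreover have "f x = 0" using f(4) a by (simp add: agree_iff_pnorm)
    ultimately show ?thesis by simp
  qed
  \<comment> \<open>The values outside \<open>I\<close> and \<open>K\<close> are set to zero because
    the carriers of the free module and of C(K) are normalised that way.\<close>
  define S where "S A = (\<lambda>i x. if i \<in> I \<and> x \<in> K then s i (SOME \<xi>. \<xi> \<in> A) x else 0)" for A
  have S_quot: "S (quot \<zeta>) = (\<lambda>i x. if i \<in> I \<and> x \<in> K then s i \<zeta> x else 0)" if z: "\<zeta> \<in> carrier E" for \<zeta>
  proof -
    have "\<zeta> \<in> quot \<zeta>" using z by (simp add: quot_eq)
    then have "(SOME \<xi>. \<xi> \<in> quot \<zeta>) \<in> quot \<zeta>" by (rule someI)
    then have "(SOME \<xi>. \<xi> \<in> quot \<zeta>) \<in> carrier E" "agree (SOME \<xi>. \<xi> \<in> quot \<zeta>) \<zeta>"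
      unfolding quot_eq[OF z] by blast+
    from s_agree[OF _ this(1) z this(2)] show ?thesis unfolding S_def by (intro ext) simp
  qed
  have S_car: "S (quot \<zeta>) \<in> carrier (free_module R I)" if z: "\<zeta> \<in> carrier E" for \<zeta>
  proof -
    have "S (quot \<zeta>) i \<in> C0 (subtopology X K)" for i
    proof (cases "i \<in> I")
      case True
      have "continuous_map (subtopology X K) euclidean (S (quot \<zeta>) i)"
        by (rule continuous_map_eq[OF s_cont[OF True z]]) (use True in \<open>simp add: S_quot[OF z]\<close>)
      then show ?thesis by (simp add: C0_subtopology_compact[OF compact] S_quot[OF z])
    qed (simp add: S_quot[OF z])
    moreover have "S (quot \<zeta>) i = (\<lambda>x. 0)" if "i \<notin> I" for i using that by (simp add: S_quot[OF z])
    moreover from this have "finite {i. S (quot \<zeta>) i \<noteq> (\<lambda>x. 0)}"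
      by (intro finite_subset[OF _ I]) blast
    ultimately show ?thesis by (auto simp: free_module_def)
  qed
  have linS: "linmap R M (free_module R I) S"
    unfolding linmap_def
  proof (intro conjI ballI funcsetI)
    show "S A \<in> carrier (free_module R I)" if "A \<in> carrier M" for A
      using that S_car by (auto simp: carrier_M)
    show "S (A \<oplus>\<^bsub>M\<^esub> B) = S A \<oplus>\<^bsub>free_module R I\<^esub> S B" if "A \<in> carrier M" "B \<in> carrier M" for A B
      using that by (auto simp: carrier_M add_M S_quot s_add fun_eq_iff)
    show "S (g \<odot>\<^bsub>M\<^esub> A) = g \<odot>\<^bsub>free_module R I\<^esub> S A" if "g \<in> carrier R" "A \<in> carrier M" for g A
      using that extend[of g] by (auto simp: carrier_M smult_M_extend S_quot s_act fun_eq_iff)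
  qed
  have PS: "synthesis I \<eta> (S A) = A" if A: "A \<in> carrier M" for A
  proof -
    obtain \<zeta> where z: "\<zeta> \<in> carrier E" "A = quot \<zeta>" using A by (auto simp: carrier_M)
    have "agree (finsum E (\<lambda>i. extend (S A i) \<odot> \<eta> i) I) \<zeta>"
      unfolding agree_def
    proof (intro ballI)
      fix \<xi> x assume \<xi>: "\<xi> \<in> carrier E" "x \<in> K"
      have "hinner E \<xi> (finsum E (\<lambda>i. extend (S A i) \<odot> \<eta> i) I) x = (\<Sum>i\<in>I. S A i x * hinner E \<xi> (\<eta> i) x)"
        using hinner_synthesis[OF I \<eta> S_car[OF z(1)] \<xi>] z by simp
      also have "\<dots> = hinner E \<xi> \<zeta> x"
        using rec[OF \<xi>(1) z(1) \<xi>(2)] \<xi> z by (simp add: S_quot)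
      finally show "hinner E \<xi> (finsum E (\<lambda>i. extend (S A i) \<odot> \<eta> i) I) x = hinner E \<xi> \<zeta> x" .
    qed
    then show ?thesis unfolding synthesis_def
      using z synthesis_elem_closed[OF \<eta> S_car[OF z(1)]] by (simp add: quot_eq_iff)
  qed
  have "direct_summand R M (free_module R I)"
    by (rule retract_imp_direct_summand[OF module_M module_free_module[OF cring_R] linS linmap_synthesis[OF I \<eta>]])
      (use PS in blast)
  then show "projective R M" by (rule projective_if_direct_summand_free[OF module_M])
  show "finitely_generated (subtopology X K) M"
    unfolding finitely_generated_def
  proof (intro exI[of _ "(\<lambda>i. quot (\<eta> i)) ` I"] conjI ballI allI impI)
    show "finite ((\<lambda>i. quot (\<eta> i)) ` I)" using I by simp
    show sub: "(\<lambda>i. quot (\<eta> i)) ` I \<subseteq> carrier M" using \<eta> by (auto intro!: quot_closed)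
    fix A and e :: real assume A: "A \<in> carrier M" and "e > 0"
    obtain \<zeta> where z: "\<zeta> \<in> carrier E" "A = quot \<zeta>" using A by (auto simp: carrier_M)
    have SA: "S A i \<in> C0 (subtopology X K)" for i using S_car[OF z(1)] z(2) free_module_R_D by auto
    have "A = finsum M (\<lambda>i. quot (extend (S A i) \<odot> \<eta> i)) I"
      using PS[OF A] finsum_M[OF I, of "\<lambda>i. extend (S A i) \<odot> \<eta> i"] extend(1)[OF SA] \<eta>
      by (auto simp: synthesis_def Pi_iff)
    also have "\<dots> = finsum M (\<lambda>i. S A i \<odot>\<^bsub>M\<^esub> quot (\<eta> i)) I"
      using smult_M_extend[OF SA] \<eta> extend(1)[OF SA] by (intro M.finsum_cong') (auto simp: Pi_iff)
    also have "\<dots> \<in> C0_span (subtopology X K) M ((\<lambda>i. quot (\<eta> i)) ` I)"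
      by (rule C0_span_finsum) (use I sub SA in auto)
    finally have "A \<in> C0_span (subtopology X K) M ((\<lambda>i. quot (\<eta> i)) ` I)" .
    moreover have "hnorm M (A \<ominus>\<^bsub>M\<^esub> A) < e" using A \<open>e > 0\<close> by (simp add: a_minus_def M.r_neg hnorm_M_zero)
    ultimately show "\<exists>B\<in>C0_span (subtopology X K) M ((\<lambda>i. quot (\<eta> i)) ` I). hnorm M (A \<ominus>\<^bsub>M\<^esub> B) < e" by blast
  qed
qed

lemma diff_M:
  assumes "\<xi> \<in> carrier E" "\<eta> \<in> carrier E"
  shows "quot \<xi> \<ominus>\<^bsub>M\<^esub> quot \<eta> = quot (\<xi> \<ominus> \<eta>)"
proof -
  have "quot (\<ominus> \<eta>) \<oplus>\<^bsub>M\<^esub> quot \<eta> = \<zero>\<^bsub>M\<^esub>" using assms by (simp add: add_M zero_M l_neg)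
  then have "\<ominus>\<^bsub>M\<^esub> quot \<eta> = quot (\<ominus> \<eta>)" using assms by (intro M.M.minus_equality) auto
  then show ?thesis using assms by (simp add: a_minus_def add_M)
qed

lemma pnorm_le_hnorm_M:
  assumes z: "z \<in> carrier E" and x: "x \<in> K"
  shows "pnorm E z x \<le> hnorm M (quot z)"
proof -
  let ?h = "\<lambda>x. if x \<in> K then hinner E z z x else 0"
  have "continuous_map (subtopology X K) euclidean (hinner E z z)"
    using hinner_closed[OF z z] by (simp add: C0_def continuous_map_from_subtopology)
  then have "continuous_map (subtopology X K) euclidean ?h" by (rule continuous_map_eq) simp
  then have "?h \<in> C0 (subtopology X K)" by (simp add: C0_subtopology_compact[OF compact])
  then have "cmod (?h x) \<le> sup_norm ?h" by (rule norm_le_sup_norm)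
  moreover have "hinner M (quot z) (quot z) = ?h" using z by (intro ext) (simp add: hinner_M)
  ultimately show ?thesis using x complex_Re_le_cmod[of "hinner E z z x"]
    by (simp add: pnorm_def hnorm_def)
qed

text \<open>Only finitely many of the coordinates supplied by projectivity survive: those which are
  nonzero on some generator. The conclusion records just what the local analysis of fibres uses,
  namely continuity of the coordinates, their vanishing where the element vanishes, and
  reconstruction.\<close>

lemma finitely_generated_projective_imp_frame:
  assumes fg: "finitely_generated (subtopology X K) M" and pr: "projective R M"
  shows "\<exists>(F :: 'e set set) \<eta> s. finite F \<and> \<eta> \<in> F \<rightarrow> carrier E \<and>
    (\<forall>i\<in>F. \<forall>\<zeta>\<in>carrier E. continuous_map (subtopology X K) euclidean (s i \<zeta>)) \<and>
    (\<forall>i\<in>F. \<forall>\<zeta>\<in>carrier E. \<forall>x\<in>K. pnorm E \<zeta> x = 0 \<longrightarrow> s i \<zeta> x = 0) \<and>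
    (\<forall>\<xi>\<in>carrier E. \<forall>\<zeta>\<in>carrier E. \<forall>x\<in>K. hinner E \<xi> \<zeta> x = (\<Sum>i\<in>F. s i \<zeta> x * hinner E \<xi> (\<eta> i) x))"
proof -
  obtain I :: "'e set set" where ds: "direct_summand R M (free_module R I)"
    using pr unfolding projective_def by blast
  let ?G = "free_module R I"
  obtain S P where S: "linmap R M ?G S" and P: "linmap R ?G M P" and PS: "\<forall>A\<in>carrier M. P (S A) = A"
    using direct_summand_imp_retract[OF module_M module_free_module[OF cring_R] ds] by blast
  obtain T where T: "finite T" "T \<subseteq> carrier M"
    and dense: "\<And>A e. A \<in> carrier M \<Longrightarrow> e > 0 \<Longrightarrow> \<exists>B\<in>C0_span (subtopology X K) M T. hnorm M (A \<ominus>\<^bsub>M\<^esub> B) < e"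
    using fg unfolding finitely_generated_def by blast
  have S_car: "S A \<in> carrier ?G" if "A \<in> carrier M" for A using S that by (auto simp: linmap_def)
  \<comment> \<open>Finite, because \<open>T\<close> is finite and every vector of a free module has
    finite support. That all other coordinates vanish on the whole quotient, and not only on the
    algebraic span of \<open>T\<close>, is \<open>s_out\<close>.\<close>
  define F where "F = (\<Union>A\<in>T. {i. S A i \<noteq> (\<lambda>x. 0)})"
  have finF: "finite F" unfolding F_def using T S_car by (intro finite_UN_I) (auto simp: free_module_def)
  have FI: "F \<subseteq> I"
  proof
    fix i assume "i \<in> F"
    then obtain A where A: "A \<in> T" "S A i \<noteq> (\<lambda>x. 0)" unfolding F_def by blast
    then have "S A \<in> carrier ?G" using S_car T(2) by blast
    then show "i \<in> I" using A(2) by (auto simp: free_module_def)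
  qed
  define s where "s i \<zeta> = S (quot \<zeta>) i" for i \<zeta>
  have sC: "s i \<zeta> \<in> C0 (subtopology X K)" if "\<zeta> \<in> carrier E" for i \<zeta>
    unfolding s_def by (rule free_module_R_D[OF S_car[OF quot_closed[OF that]]])
  have s_add: "s i (\<zeta> \<oplus> \<zeta>') x = s i \<zeta> x + s i \<zeta>' x" if z: "\<zeta> \<in> carrier E" "\<zeta>' \<in> carrier E" for i \<zeta> \<zeta>' x
  proof -
    have "S (quot \<zeta> \<oplus>\<^bsub>M\<^esub> quot \<zeta>') = S (quot \<zeta>) \<oplus>\<^bsub>?G\<^esub> S (quot \<zeta>')"
      using S quot_closed[OF z(1)] quot_closed[OF z(2)] unfolding linmap_def by blast
    then show ?thesis using z by (simp add: s_def add_M)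
  qed
  have s_act: "s i (f \<odot> \<zeta>) x = f x * s i \<zeta> x" if f: "f \<in> C0 X" and z: "\<zeta> \<in> carrier E" and x: "x \<in> K" for i f \<zeta> x
  proof -
    let ?g = "\<lambda>x. if x \<in> K then f x else 0"
    have "continuous_map (subtopology X K) euclidean f" using f by (simp add: C0_def continuous_map_from_subtopology)
    then have "continuous_map (subtopology X K) euclidean ?g" by (rule continuous_map_eq) simp
    then have g: "?g \<in> C0 (subtopology X K)" by (simp add: C0_subtopology_compact[OF compact])
    then have "?g \<odot>\<^bsub>M\<^esub> quot \<zeta> = quot (f \<odot> \<zeta>)" using f z by (intro smult_M) auto
    moreover have "S (?g \<odot>\<^bsub>M\<^esub> quot \<zeta>) = ?g \<odot>\<^bsub>?G\<^esub> S (quot \<zeta>)"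
      using S g z unfolding linmap_def by (simp add: quot_closed)
    ultimately show ?thesis using x by (simp add: s_def)
  qed
  \<comment> \<open>The substitute for continuity of \<open>S\<close>: a coordinate at
    \<open>x\<close> depends on the value of the element at \<open>x\<close> alone.\<close>
  have s_null: "s i \<zeta> x = 0" if z: "\<zeta> \<in> carrier E" and x: "x \<in> K" and 0: "pnorm E \<zeta> x = 0" for i \<zeta> x
  proof -
    obtain f z' where "f \<in> C0 X" "z' \<in> carrier E" "\<zeta> = f \<odot> z'" "f x = 0"
      using factorization[OF z] 0 by blast
    then show ?thesis using s_act x by simp
  qed
  \<comment> \<open>\<open>linmap\<close> only knows scalars from C(K); a complex scalar enters as a
    function that is constant on \<open>K\<close>.\<close>
  have s_cscale: "s i (cscale E c \<zeta>) x = c * s i \<zeta> x" if z: "\<zeta> \<in> carrier E" and x: "x \<in> K" for i c \<zeta> x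
  proof -
    have "\<exists>f\<in>C0 X. \<forall>x\<in>K. f x = c"
      using C0_extension[OF locally_compact Hausdorff compact, of "\<lambda>_. c"] by simp
    then obtain f where f: "f \<in> C0 X" "\<forall>x\<in>K. f x = c" by blast
    have "quot (cscale E c \<zeta>) = quot (f \<odot> \<zeta>)"
      using f z by (subst quot_eq_iff) (auto simp: agree_def hinner_simps)
    then have "s i (cscale E c \<zeta>) = s i (f \<odot> \<zeta>)" by (simp add: s_def)
    then show ?thesis using s_act[OF f(1) z x] f(2) x by simp
  qed
  have s_lincomb: "s i (finsum E (\<lambda>j. cscale E (c j) (v j)) A) x = (\<Sum>j\<in>A. c j * s i (v j) x)"
    if "finite A" "v \<in> A \<rightarrow> carrier E" "x \<in> K" for i c x and v :: "'e set \<Rightarrow> 'e" and A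
    using that
  proof (induction A rule: finite_induct)
    case empty
    then show ?case using s_null[of \<zeta> x i] by (simp add: s_null)
  next
    case (insert j A)
    then have v: "v j \<in> carrier E" "v \<in> A \<rightarrow> carrier E" by auto
    then show ?case using insert s_add[OF cscale_closed[OF v(1)] lincomb_closed[OF v(2)]] s_cscale[OF v(1)]
      by (simp add: Pi_iff)
  qed
  \<comment> \<open>Fix \<open>x\<close> and split \<open>\<zeta> = w \<oplus> L\<close>, where
    \<open>L\<close> combines the generators and \<open>w\<close> is orthogonal to them at
    \<open>x\<close>. An element \<open>b\<close> of the span that is close to
    \<open>\<zeta>\<close> pairs to zero with \<open>w\<close> at \<open>x\<close>, so the squared
    norm of \<open>w\<close> is the pairing of \<open>w\<close> with
    \<open>\<zeta> \<ominus> b\<close> and hence arbitrarily small. Thus \<open>w\<close> vanishes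
    at \<open>x\<close>, and the i-th coordinate of \<open>\<zeta>\<close> at \<open>x\<close> is
    that of \<open>L\<close>, which is zero for \<open>i \<notin> F\<close>.\<close>
  have s_out: "s i \<zeta> x = 0" if i: "i \<notin> F" and z: "\<zeta> \<in> carrier E" and x: "x \<in> K" for i \<zeta> x
  proof -
    define v where "v A = (SOME z. z \<in> carrier E \<and> quot z = A)" for A
    have v: "v A \<in> carrier E \<and> quot (v A) = A" if "A \<in> T" for A
    proof -
      have "\<exists>z. z \<in> carrier E \<and> quot z = A" using that T(2) by (auto simp: carrier_M)
      then show ?thesis unfolding v_def by (rule someI_ex)
    qed
    then have vT: "v \<in> T \<rightarrow> carrier E" by blast
    obtain c where c: "\<forall>A\<in>T. hinner E (v A) (\<zeta> \<ominus> finsum E (\<lambda>A. cscale E (c A) (v A)) T) x = 0"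
      using orthogonal_projection[OF T(1) vT z] by blast
    define L where "L = finsum E (\<lambda>A. cscale E (c A) (v A)) T"
    define w where "w = \<zeta> \<ominus> L"
    have Lc: "L \<in> carrier E" unfolding L_def by (rule lincomb_closed[OF vT])
    then have wc: "w \<in> carrier E" using z by (simp add: w_def)
    have wv: "hinner E w (v A) x = 0" if "A \<in> T" for A
      using c that v[OF that] wc hinner_commute[of "v A" w x] by (simp add: w_def[symmetric] L_def[symmetric])
    have "pnorm E w x \<le> e" if e: "e > 0" for e
    proof -
      obtain B where "B \<in> C0_span (subtopology X K) M T" and B: "hnorm M (quot \<zeta> \<ominus>\<^bsub>M\<^esub> B) < e"
        using dense[OF quot_closed[OF z] e] by blast
      then obtain f where f: "f \<in> T \<rightarrow> C0 (subtopology X K)" and Bf: "B = finsum M (\<lambda>A. f A \<odot>\<^bsub>M\<^esub> A) T"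
        unfolding C0_span_def by blast
      have ef: "(\<lambda>A. extend (f A)) \<in> T \<rightarrow> C0 X" using f extend(1) by (auto simp: Pi_iff)
      have ev: "(\<lambda>A. extend (f A) \<odot> v A) \<in> T \<rightarrow> carrier E" using ef vT by (auto simp: Pi_iff)
      define b where "b = finsum E (\<lambda>A. extend (f A) \<odot> v A) T"
      have bc: "b \<in> carrier E" unfolding b_def by (rule finsum_closed[OF ev])
      have "B = finsum M (\<lambda>A. quot (extend (f A) \<odot> v A)) T"
        unfolding Bf
      proof (rule M.finsum_cong')
        fix A assume A: "A \<in> T"
        then show "f A \<odot>\<^bsub>M\<^esub> A = quot (extend (f A) \<odot> v A)"
          using smult_M_extend[of "f A" "v A"] f v[OF A] by (auto simp: Pi_iff)
      qed (use ev in \<open>auto intro!: quot_closed simp: Pi_iff\<close>)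
      also have "\<dots> = quot b" unfolding b_def by (rule finsum_M[OF T(1) ev])
      finally have "pnorm E (\<zeta> \<ominus> b) x < e"
        using B pnorm_le_hnorm_M[of "\<zeta> \<ominus> b" x] z bc x by (simp add: diff_M)
      moreover have "(pnorm E w x)\<^sup>2 \<le> pnorm E w x * pnorm E (\<zeta> \<ominus> b) x"
      proof -
        have "hinner E w L x = 0" unfolding L_def using hinner_lincomb[OF T(1) vT wc] wv by simp
        moreover have "hinner E w b x = 0" unfolding b_def using hinner_act_finsum[OF T(1) vT ef wc] wv by simp
        ultimately have "hinner E w w x = hinner E w (\<zeta> \<ominus> b) x"
          using hinner_diff_right[OF wc z Lc, of x, folded w_def] hinner_diff_right[OF wc z bc, of x] by simp
        then show ?thesis using cauchy_schwarz[OF wc, of "\<zeta> \<ominus> b" x] z bc wc hinner_self[OF wc, of x]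
          by (metis minus_closed norm_of_real abs_power2)
      qed
      ultimately show ?thesis
      proof (cases "pnorm E w x = 0")
        case False
        then have "pnorm E w x > 0" using pnorm_nonneg[OF wc, of x] by linarith
        then show ?thesis
          using \<open>(pnorm E w x)\<^sup>2 \<le> pnorm E w x * pnorm E (\<zeta> \<ominus> b) x\<close> \<open>pnorm E (\<zeta> \<ominus> b) x < e\<close>
          by (simp add: power2_eq_square)
      qed (use e in simp)
    qed
    then have "pnorm E w x \<le> 0" by (rule field_le_epsilon) simp
    then have "pnorm E w x = 0" using pnorm_nonneg[OF wc, of x] by linarith
    then have "s i w x = 0" using s_null[OF wc x] by blast
    moreover have "s i L x = 0"
    proof -
      have "s i (v A) x = 0" if "A \<in> T" for A using i v[OF that] that by (auto simp: s_def F_def)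
      then show ?thesis unfolding L_def s_lincomb[OF T(1) vT x] by simp
    qed
    moreover have "\<zeta> = w \<oplus> L" unfolding w_def using z Lc by (simp add: a_minus_def a_assoc l_neg)
    ultimately show ?thesis using s_add[OF wc Lc] by simp
  qed
  have S_F: "S (quot \<zeta>) \<in> carrier (free_module R F)" if z: "\<zeta> \<in> carrier E" for \<zeta>
  proof -
    have "S (quot \<zeta>) i = (\<lambda>x. 0)" if "i \<notin> F" for i
    proof
      fix x show "S (quot \<zeta>) i x = 0"
        using s_out[OF that z, of x] sC[OF z, of i] unfolding s_def
        by (cases "x \<in> K") (auto simp: C0_subtopology_compact[OF compact])
    qed
    then show ?thesis using S_car[OF quot_closed[OF z]] by (auto simp: free_module_def)
  qed
  have sub: "carrier (free_module R F) \<subseteq> carrier ?G" using FI by (auto simp: free_module_def)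
  have PF: "linmap R (free_module R F) M P"
    using P sub unfolding linmap_def by (auto simp: Pi_iff subset_iff)
  define \<eta> where "\<eta> i = (SOME z. z \<in> carrier E \<and> quot z = P (unitvec R i))" for i
  have \<eta>: "\<eta> i \<in> carrier E \<and> quot (\<eta> i) = P (unitvec R i)" if "i \<in> F" for i
  proof -
    have "P (unitvec R i) \<in> carrier M"
      using PF unitvec_carrier[OF cring_R that] by (auto simp: linmap_def)
    then have "\<exists>z. z \<in> carrier E \<and> quot z = P (unitvec R i)" by (auto simp: carrier_M)
    then show ?thesis unfolding \<eta>_def by (rule someI_ex)
  qed
  then have \<eta>F: "\<eta> \<in> F \<rightarrow> carrier E" by blast
  \<comment> \<open>A linear map on a free module is determined by its values on unit vectors, and
    the \<open>\<eta> i\<close> were chosen to represent the values of \<open>P\<close>. This turns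
    the abstract retraction into an explicit finite sum.\<close>
  have P_eq: "P c = synthesis F \<eta> c" if "c \<in> carrier (free_module R F)" for c
  proof (rule free_module_ext_unique[OF cring_R module_M PF linmap_synthesis[OF finF \<eta>F] _ that])
    fix i assume i: "i \<in> F"
    note u = unitvec_carrier[OF cring_R i]
    have "agree (finsum E (\<lambda>j. extend (unitvec R i j) \<odot> \<eta> j) F) (\<eta> i)"
      unfolding agree_def
    proof (intro ballI)
      fix \<zeta> x assume z: "\<zeta> \<in> carrier E" "x \<in> K"
      have "unitvec R i j x = (if j = i then 1 else 0)" for j using z by (simp add: unitvec_def)
      then have "(\<Sum>j\<in>F. unitvec R i j x * hinner E \<zeta> (\<eta> j) x) = (\<Sum>j\<in>F. if j = i then hinner E \<zeta> (\<eta> j) x else 0)"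
        by (intro sum.cong) auto
      then show "hinner E \<zeta> (finsum E (\<lambda>j. extend (unitvec R i j) \<odot> \<eta> j) F) x = hinner E \<zeta> (\<eta> i) x"
        using hinner_synthesis[OF finF \<eta>F u z] i finF by simp
    qed
    then show "P (unitvec R i) = synthesis F \<eta> (unitvec R i)"
      unfolding synthesis_def using quot_eq_iff[OF synthesis_elem_closed[OF \<eta>F u], of "\<eta> i"] \<eta>[OF i] by simp
  qed
  have rec: "hinner E \<xi> \<zeta> x = (\<Sum>i\<in>F. s i \<zeta> x * hinner E \<xi> (\<eta> i) x)"
    if \<xi>: "\<xi> \<in> carrier E" and z: "\<zeta> \<in> carrier E" and x: "x \<in> K" for \<xi> \<zeta> x
  proof -
    have "quot \<zeta> = synthesis F \<eta> (S (quot \<zeta>))"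
      using PS quot_closed[OF z] unfolding P_eq[OF S_F[OF z], symmetric] by simp
    then have "agree \<zeta> (finsum E (\<lambda>i. extend (S (quot \<zeta>) i) \<odot> \<eta> i) F)"
      unfolding synthesis_def using quot_eq_iff[OF z synthesis_elem_closed[OF \<eta>F S_F[OF z]]] by blast
    then show ?thesis
      using hinner_synthesis[OF finF \<eta>F S_F[OF z] \<xi> x] \<xi> x by (simp add: agree_def s_def)
  qed
  show ?thesis
  proof (intro exI[of _ F] exI[of _ \<eta>] exI[of _ s] conjI ballI impI)
    show "continuous_map (subtopology X K) euclidean (s i \<zeta>)" if "\<zeta> \<in> carrier E" for i \<zeta>
      using sC[OF that] by (simp add: C0_def)
  qed (use finF \<eta>F s_null rec in blast)+
qed

end

section \<open>Positive definite forms\<close>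

text \<open>In the applications \<open>G\<close> is the Gram matrix of vectors at a point, and the
  value is the squared norm of their combination with coefficients \<open>a\<close>.\<close>

definition sesq :: "nat \<Rightarrow> (nat \<Rightarrow> nat \<Rightarrow> complex) \<Rightarrow> (nat \<Rightarrow> complex) \<Rightarrow> complex" where
  "sesq n G a = (\<Sum>i<n. \<Sum>j<n. cnj (a i) * a j * G i j)"

lemma sesq_scale: "sesq n G (\<lambda>i. complex_of_real t * a i) = complex_of_real (t\<^sup>2) * sesq n G a"
  by (simp add: sesq_def sum_distrib_left power2_eq_square mult_ac)

text \<open>The constant is the minimum of the form on the unit sphere; homogeneity of degree two
  carries the bound to all \<open>a\<close>.\<close>

lemma posdef_lower_bound:
  assumes pos: "\<And>a. \<exists>i<n. a i \<noteq> 0 \<Longrightarrow> 0 < Re (sesq n G a)"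
  shows "\<exists>\<delta>>0. \<forall>a. \<delta> * (\<Sum>i<n. (cmod (a i))\<^sup>2) \<le> Re (sesq n G a)"
proof (cases "n = 0")
  \<comment> \<open>For \<open>n = 0\<close> the sphere is empty and both sides are zero, so any
    positive constant serves.\<close>
  case True
  then show ?thesis by (intro exI[of _ 1]) (simp add: sesq_def)
next
  case False
  \<comment> \<open>Vectors are modelled as sequences that vanish from \<open>n\<close> on. Fixing
    the tail makes \<open>C\<close> a product of compact sets, hence compact in the product topology
    of the function type.\<close>
  define C where "C = Pi\<^sub>E UNIV (\<lambda>i::nat. if i < n then cball (0::complex) 1 else {0})"
  have "compactin (product_topology (\<lambda>_. euclidean) UNIV) C"
    unfolding C_def compactin_PiE by auto
  then have "compact C" by (simp add: euclidean_product_topology)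
  define S where "S = C \<inter> {a. (\<Sum>i<n. (cmod (a i))\<^sup>2) = 1}"
  have "closed {a::nat \<Rightarrow> complex. (\<Sum>i<n. (cmod (a i))\<^sup>2) = 1}"
    by (intro closed_Collect_eq continuous_intros continuous_on_product_coordinates)
  then have "compact S" unfolding S_def using \<open>compact C\<close> by (rule compact_Int_closed[rotated])
  have SI: "(\<lambda>i. if i < n then a i else 0) \<in> S" if a: "(\<Sum>i<n. (cmod (a i))\<^sup>2) = 1" for a
  proof -
    have "cmod (a i) \<le> 1" if "i < n" for i
    proof -
      have "(cmod (a i))\<^sup>2 \<le> (\<Sum>i<n. (cmod (a i))\<^sup>2)" by (rule member_le_sum) (use that in auto)
      then show ?thesis using a by (simp add: power2_le_iff_abs_le[of 1 "cmod (a i)", simplified] abs_square_le_1)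
    qed
    then show ?thesis using a by (auto simp: S_def C_def)
  qed
  have "(\<Sum>i<n. (cmod (if i = 0 then 1 else 0 :: complex))\<^sup>2) = (\<Sum>i<n. if i = 0 then 1 else 0)"
    by (intro sum.cong) auto
  also have "\<dots> = 1" using False by simp
  finally have "S \<noteq> {}" using SI[of "\<lambda>i. if i = 0 then 1 else 0"] by auto
  have "continuous_on S (\<lambda>a. Re (sesq n G a))"
    unfolding sesq_def
    by (intro continuous_intros continuous_on_subset[OF continuous_on_product_coordinates]) auto
  then obtain a0 where a0: "a0 \<in> S" "\<forall>a\<in>S. Re (sesq n G a0) \<le> Re (sesq n G a)"
    using continuous_attains_inf[OF \<open>compact S\<close> \<open>S \<noteq> {}\<close>] by blast
  define \<delta> where "\<delta> = Re (sesq n G a0)"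
  have "\<exists>i<n. a0 i \<noteq> 0"
  proof (rule ccontr)
    assume "\<not> (\<exists>i<n. a0 i \<noteq> 0)"
    then have "(\<Sum>i<n. (cmod (a0 i))\<^sup>2) = 0" by simp
    then show False using a0(1) by (simp add: S_def)
  qed
  then have "\<delta> > 0" unfolding \<delta>_def by (rule pos)
  moreover have "\<delta> * (\<Sum>i<n. (cmod (a i))\<^sup>2) \<le> Re (sesq n G a)" for a
  proof -
    define s where "s = (\<Sum>i<n. (cmod (a i))\<^sup>2)"
    have s0: "s \<ge> 0" unfolding s_def by (intro sum_nonneg) auto
    show ?thesis
    proof (cases "s = 0")
      case True
      then have "\<forall>i\<in>{..<n}. (cmod (a i))\<^sup>2 = 0"
        unfolding s_def by (subst (asm) sum_nonneg_eq_0_iff) auto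
      then have "sesq n G a = 0" by (simp add: sesq_def)
      then show ?thesis using True by (simp add: s_def)
    next
      case False
      then have s: "s > 0" using s0 by simp
      define b where "b i = complex_of_real (1 / sqrt s) * a i" for i
      have "(\<Sum>i<n. (cmod (b i))\<^sup>2) = (\<Sum>i<n. (cmod (a i))\<^sup>2 / s)"
        using s by (intro sum.cong) (auto simp: b_def norm_mult norm_divide power_mult_distrib power_divide)
      also have "\<dots> = 1" using s by (simp add: s_def[symmetric] sum_divide_distrib[symmetric])
      finally have "(\<lambda>i. if i < n then b i else 0) \<in> S" by (rule SI)
      then have "\<delta> \<le> Re (sesq n G (\<lambda>i. if i < n then b i else 0))" using a0(2) by (simp add: \<delta>_def)
      also have "sesq n G (\<lambda>i. if i < n then b i else 0) = sesq n G b" by (simp add: sesq_def)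
      also have "\<dots> = complex_of_real ((1 / sqrt s)\<^sup>2) * sesq n G a" unfolding b_def by (rule sesq_scale)
      also have "Re \<dots> = Re (sesq n G a) / s" using s by (simp add: power_divide)
      finally show ?thesis using s by (simp add: s_def[symmetric] field_simps)
    qed
  qed
  ultimately show ?thesis by blast
qed

text \<open>The form changes by at most \<open>h x\<close> times the squared length of
  \<open>a\<close>, where \<open>h\<close> sums the changes of the matrix entries; so half of the
  constant at \<open>x0\<close> survives wherever \<open>h\<close> is below the other half. The
  bound is uniform in \<open>a\<close> on a whole neighbourhood.\<close>

lemma posdef_lower_bound_nbhd:
  fixes G :: "nat \<Rightarrow> nat \<Rightarrow> 'a \<Rightarrow> complex"
  assumes U: "openin X U" "x0 \<in> U"
    and cont: "\<And>i j. i < n \<Longrightarrow> j < n \<Longrightarrow> continuous_map (subtopology X U) euclidean (G i j)"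
    and pos: "\<And>a. \<exists>i<n. a i \<noteq> 0 \<Longrightarrow> 0 < Re (sesq n (\<lambda>i j. G i j x0) a)"
  shows "\<exists>W \<delta>. openin X W \<and> x0 \<in> W \<and> W \<subseteq> U \<and> \<delta> > 0 \<and>
    (\<forall>x\<in>W. \<forall>a. \<delta> * (\<Sum>i<n. (cmod (a i))\<^sup>2) \<le> Re (sesq n (\<lambda>i j. G i j x) a))"
proof -
  obtain d where d: "d > 0" "\<And>a. d * (\<Sum>i<n. (cmod (a i))\<^sup>2) \<le> Re (sesq n (\<lambda>i j. G i j x0) a)"
    using posdef_lower_bound[OF pos] by blast
  define h where "h x = (\<Sum>i<n. \<Sum>j<n. cmod (G i j x - G i j x0))" for x
  have hc: "continuous_map (subtopology X U) euclidean h" unfolding h_def[abs_def]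
    by (intro continuous_map_sum continuous_map_norm continuous_map_diff cont continuous_map_canonical_const) auto
  have x0: "x0 \<in> topspace (subtopology X U)" using U openin_subset[OF U(1)] by auto
  have d2: "d/2 > 0" using d(1) by simp
  obtain W where W: "openin (subtopology X U) W" "x0 \<in> W" "\<forall>y\<in>W. dist (h y) (h x0) < d/2"
    using continuous_map_eps[THEN iffD1, rule_format, OF hc x0 d2] by blast
  have WU: "W \<subseteq> U" "openin X W"
    using openin_subset[OF W(1)] openin_trans_full[OF W(1) U(1)] by auto
  have "d/2 * (\<Sum>i<n. (cmod (a i))\<^sup>2) \<le> Re (sesq n (\<lambda>i j. G i j x) a)" if x: "x \<in> W" for x a
  proof -
    define s where "s = (\<Sum>i<n. (cmod (a i))\<^sup>2)"
    have "h x < d/2" using W(3) x by (auto simp: h_def dist_real_def)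
    have ai: "cmod (a i) \<le> sqrt s" if "i < n" for i
      unfolding s_def by (rule real_le_rsqrt, rule member_le_sum) (use that in auto)
    have s0: "s \<ge> 0" unfolding s_def by (intro sum_nonneg) auto
    have "cmod (sesq n (\<lambda>i j. G i j x) a - sesq n (\<lambda>i j. G i j x0) a)
      = cmod (\<Sum>i<n. \<Sum>j<n. cnj (a i) * a j * (G i j x - G i j x0))"
      by (simp add: sesq_def sum_subtractf right_diff_distrib)
    also have "\<dots> \<le> (\<Sum>i<n. \<Sum>j<n. s * cmod (G i j x - G i j x0))"
    proof (intro order_trans[OF norm_sum] sum_mono)
      fix i j assume "i \<in> {..<n}" "j \<in> {..<n}"
      then have "cmod (a i) * cmod (a j) \<le> sqrt s * sqrt s" using s0 by (intro mult_mono ai) auto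
      then show "cmod (cnj (a i) * a j * (G i j x - G i j x0)) \<le> s * cmod (G i j x - G i j x0)"
        using s0 by (simp add: norm_mult mult_right_mono)
    qed
    also have "\<dots> = s * h x" by (simp add: h_def sum_distrib_left)
    also have "\<dots> \<le> s * (d/2)" using \<open>h x < d/2\<close> s0 by (intro mult_left_mono) auto
    finally have "cmod (sesq n (\<lambda>i j. G i j x) a - sesq n (\<lambda>i j. G i j x0) a) \<le> s * (d/2)" .
    then have "Re (sesq n (\<lambda>i j. G i j x0) a) - Re (sesq n (\<lambda>i j. G i j x) a) \<le> s * (d/2)"
      using abs_Re_le_cmod[of "sesq n (\<lambda>i j. G i j x) a - sesq n (\<lambda>i j. G i j x0) a"] by simp
    then show ?thesis using d(2)[of a] unfolding s_def[symmetric] by (simp add: field_simps)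
  qed
  then show ?thesis using W(2) WU d(1) by (intro exI[of _ W] exI[of _ "d/2"]) auto
qed

text \<open>The three-epsilon argument for uniform limits; it yields continuity of the coordinates
  of a limit of sections.\<close>

lemma continuous_map_uniform_approx:
  fixes g :: "'a \<Rightarrow> 'b::metric_space"
  assumes "\<And>e. e > 0 \<Longrightarrow> \<exists>f. continuous_map Y euclidean f \<and> (\<forall>y\<in>topspace Y. dist (f y) (g y) < e)"
  shows "continuous_map Y euclidean g"
  unfolding continuous_map_eps
proof (intro ballI allI impI)
  fix x e assume x: "x \<in> topspace Y" and e: "(e::real) > 0"
  then have "e/3 > 0" by simp
  then obtain f where f: "continuous_map Y euclidean f" "\<forall>y\<in>topspace Y. dist (f y) (g y) < e/3"
    using assms by blast
  obtain U where U: "openin Y U" "x \<in> U" "\<forall>y\<in>U. dist (f y) (f x) < e/3"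
    using continuous_map_eps[THEN iffD1, rule_format, OF f(1) x \<open>e/3 > 0\<close>] by blast
  have "dist (g y) (g x) < e" if "y \<in> U" for y
  proof -
    have "y \<in> topspace Y" using that openin_subset[OF U(1)] by blast
    then have "dist (f y) (g y) < e/3" "dist (f x) (g x) < e/3" "dist (f y) (f x) < e/3" using f x U that by auto
    then show ?thesis using dist_triangle3[of "g y" "g x" "f y"] dist_triangle[of "f y" "g x" "f x"] by linarith
  qed
  then show "\<exists>U. openin Y U \<and> x \<in> U \<and> (\<forall>y\<in>U. dist (g y) (g x) < e)" using U by blast
qed

section \<open>Sections of a hermitian vector bundle\<close>

locale hermitian_bundle =
  fixes X :: "'a topology" and V :: "('a, 't) vbundle" and \<beta> :: "'t \<Rightarrow> 't \<Rightarrow> complex"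
  assumes locally_compact: "locally_compact_space X" and Hausdorff: "Hausdorff_space X"
    and vector_bundle: "vector_bundle X V" and hermitian: "hermitian_metric X V \<beta>"
begin

section \<open>Linear algebra, norm and Cauchy-Schwarz in a single fibre\<close>

lemma fiber_module:
  assumes "x \<in> topspace X"
  shows "Module.module complex_ring
    \<lparr>carrier = fiber V x, mult = undefined, one = undefined, zero = vzero V x, add = vadd V, smult = vscale V\<rparr>"
  using vector_bundle assms unfolding vector_bundle_def cvector_space_def by blast

context
  fixes x assumes x: "x \<in> topspace X"
begin

interpretation F: Module.module complex_ring
  "\<lparr>carrier = fiber V x, mult = undefined, one = undefined, zero = vzero V x, add = vadd V, smult = vscale V\<rparr>"
  by (rule fiber_module[OF x])

lemma vadd_closed: "u \<in> fiber V x \<Longrightarrow> v \<in> fiber V x \<Longrightarrow> vadd V u v \<in> fiber V x"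
  using F.M.a_closed[of u v] by simp

lemma vzero_closed: "vzero V x \<in> fiber V x"
  using F.M.zero_closed by simp

lemma vscale_closed: "v \<in> fiber V x \<Longrightarrow> vscale V c v \<in> fiber V x"
  using F.smult_closed[of c v] by simp

lemma vadd_assoc: "u \<in> fiber V x \<Longrightarrow> v \<in> fiber V x \<Longrightarrow> w \<in> fiber V x \<Longrightarrow>
    vadd V (vadd V u v) w = vadd V u (vadd V v w)"
  using F.M.a_assoc[of u v w] by simp

lemma vadd_commute: "u \<in> fiber V x \<Longrightarrow> v \<in> fiber V x \<Longrightarrow> vadd V u v = vadd V v u"
  using F.M.a_comm[of u v] by simp

lemma vadd_zero_left: "v \<in> fiber V x \<Longrightarrow> vadd V (vzero V x) v = v"
  using F.M.l_zero[of v] by simp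

lemma vscale_add_left: "v \<in> fiber V x \<Longrightarrow> vscale V (c + d) v = vadd V (vscale V c v) (vscale V d v)"
  using F.smult_l_distr[of c d v] by simp

lemma vscale_add_right: "u \<in> fiber V x \<Longrightarrow> v \<in> fiber V x \<Longrightarrow>
    vscale V c (vadd V u v) = vadd V (vscale V c u) (vscale V c v)"
  using F.smult_r_distr[of c u v] by simp

lemma vscale_mult: "v \<in> fiber V x \<Longrightarrow> vscale V (c * d) v = vscale V c (vscale V d v)"
  using F.smult_assoc1[of c d v] by simp

lemma vscale_one: "v \<in> fiber V x \<Longrightarrow> vscale V 1 v = v"
  using F.smult_one[of v] by simp

lemma vscale_zero: "v \<in> fiber V x \<Longrightarrow> vscale V 0 v = vzero V x"
  using F.smult_l_null[of v] by simp

lemma metric_rules: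
  assumes "u \<in> fiber V x" "v \<in> fiber V x" "w \<in> fiber V x"
  shows "\<beta> u (vadd V v w) = \<beta> u v + \<beta> u w" "\<beta> u (vscale V c v) = c * \<beta> u v" "\<beta> v u = cnj (\<beta> u v)"
  using hermitian x assms unfolding hermitian_metric_def by blast+

lemma metric_add_left:
  assumes "u \<in> fiber V x" "v \<in> fiber V x" "w \<in> fiber V x"
  shows "\<beta> (vadd V v w) u = \<beta> v u + \<beta> w u"
  using metric_rules(3)[of u "vadd V v w" u] metric_rules(1)[OF assms] metric_rules(3)[of u v u]
    metric_rules(3)[of u w u] vadd_closed assms by simp

lemma metric_scale_left:
  assumes "u \<in> fiber V x" "v \<in> fiber V x"
  shows "\<beta> (vscale V c v) u = cnj c * \<beta> v u"
  using metric_rules(3)[of u "vscale V c v" u] metric_rules(2)[of u v u] metric_rules(3)[of u v u]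
    vscale_closed assms by simp

lemma metric_zero_right: "u \<in> fiber V x \<Longrightarrow> \<beta> u (vzero V x) = 0"
  using metric_rules(2)[of u "vzero V x" "vzero V x" 0] vscale_zero[of "vzero V x"] vzero_closed by simp

lemma metric_positive: "v \<in> fiber V x \<Longrightarrow> v \<noteq> vzero V x \<Longrightarrow> \<beta> v v \<in> \<real> \<and> 0 < Re (\<beta> v v)"
  using hermitian x unfolding hermitian_metric_def by blast

end

definition vnorm :: "'t \<Rightarrow> real" where "vnorm v = sqrt (Re (\<beta> v v))"

text \<open>A bundle record has no negation, so subtraction goes through the scalar
  \<open>-1\<close>.\<close>

definition vdiff :: "'t \<Rightarrow> 't \<Rightarrow> 't" where "vdiff v w = vadd V v (vscale V (-1) w)"

context
  fixes x assumes x: "x \<in> topspace X"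
begin

lemma metric_self: "v \<in> fiber V x \<Longrightarrow> \<beta> v v = complex_of_real ((vnorm v)\<^sup>2)"
  using metric_positive[OF x, of v] metric_zero_right[OF x, of v]
  by (cases "v = vzero V x") (auto simp: vnorm_def complex_is_Real_iff complex_eq_iff)

lemma vnorm_nonneg: "v \<in> fiber V x \<Longrightarrow> 0 \<le> vnorm v"
  using metric_positive[OF x, of v] metric_zero_right[OF x, of v]
  by (cases "v = vzero V x") (auto simp: vnorm_def)

lemma vnorm_eq_0: "v \<in> fiber V x \<Longrightarrow> vnorm v = 0 \<Longrightarrow> v = vzero V x"
  using metric_positive[OF x, of v] by (auto simp: vnorm_def)

lemma vdiff_closed: "v \<in> fiber V x \<Longrightarrow> w \<in> fiber V x \<Longrightarrow> vdiff v w \<in> fiber V x"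
  unfolding vdiff_def by (intro vadd_closed[OF x] vscale_closed[OF x])

lemma metric_cauchy_schwarz:
  assumes uv: "u \<in> fiber V x" "v \<in> fiber V x"
  shows "cmod (\<beta> u v) \<le> vnorm u * vnorm v"
proof -
  have "(cmod (\<beta> u v))\<^sup>2 \<le> (vnorm u)\<^sup>2 * (vnorm v)\<^sup>2"
  proof (rule cauchy_schwarz_scalar)
    fix t
    note c = vscale_closed[OF x uv(2), of t]
    note c' = vadd_closed[OF x uv(1) c]
    have "\<beta> (vadd V u (vscale V t v)) (vadd V u (vscale V t v)) =
        \<beta> u u + (t * \<beta> u v + cnj (t * \<beta> u v)) + (cnj t * t) * \<beta> v v"
      using metric_rules(1)[OF x c' uv(1) c] metric_add_left[OF x uv(1) uv(1) c] metric_add_left[OF x c uv(1) c]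
        metric_scale_left[OF x uv(1) uv(2)] metric_scale_left[OF x c uv(2)] metric_rules(2)[OF x uv(1) uv(2) uv(2)]
        metric_rules(2)[OF x uv(2) uv(2) uv(2)] metric_rules(3)[OF x uv(1) uv(2) uv(2)]
      by (simp add: algebra_simps)
    moreover have "cnj t * t = complex_of_real ((cmod t)\<^sup>2)" using complex_norm_square[of t] by (simp add: mult.commute)
    ultimately have "\<beta> (vadd V u (vscale V t v)) (vadd V u (vscale V t v)) =
        complex_of_real ((vnorm u)\<^sup>2) + (t * \<beta> u v + cnj (t * \<beta> u v)) + complex_of_real ((cmod t)\<^sup>2 * (vnorm v)\<^sup>2)"
      by (simp add: metric_self uv)
    then have "Re (\<beta> (vadd V u (vscale V t v)) (vadd V u (vscale V t v)))
        = (vnorm u)\<^sup>2 + 2 * Re (t * \<beta> u v) + (cmod t)\<^sup>2 * (vnorm v)\<^sup>2"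
      by (simp only: plus_complex.sel Re_complex_of_real complex_cnj) simp
    moreover have "0 \<le> Re (\<beta> (vadd V u (vscale V t v)) (vadd V u (vscale V t v)))"
      using metric_self[OF c'] by simp
    ultimately show "0 \<le> (vnorm u)\<^sup>2 + 2 * Re (t * \<beta> u v) + (cmod t)\<^sup>2 * (vnorm v)\<^sup>2" by linarith
  qed simp
  then have "(cmod (\<beta> u v))\<^sup>2 \<le> (vnorm u * vnorm v)\<^sup>2" by (simp add: power_mult_distrib)
  then show ?thesis by (rule power2_le_imp_le) (use vnorm_nonneg uv in simp)
qed

lemma vnorm_triangle:
  assumes uv: "u \<in> fiber V x" "v \<in> fiber V x"
  shows "vnorm (vadd V u v) \<le> vnorm u + vnorm v"
proof (rule power2_le_imp_le)
  note c = vadd_closed[OF x uv]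
  have "\<beta> (vadd V u v) (vadd V u v) = \<beta> u u + (\<beta> u v + cnj (\<beta> u v)) + \<beta> v v"
    using metric_rules(1)[OF x c uv] metric_add_left[OF x uv(1) uv] metric_add_left[OF x uv(2) uv]
      metric_rules(3)[OF x uv(1) uv(2) uv(2)] by simp
  then have "complex_of_real ((vnorm (vadd V u v))\<^sup>2) = complex_of_real ((vnorm u)\<^sup>2) + (\<beta> u v + cnj (\<beta> u v)) + complex_of_real ((vnorm v)\<^sup>2)"
    using metric_self[OF c] metric_self[OF uv(1)] metric_self[OF uv(2)] by simp
  from arg_cong[OF this, of Re] have "(vnorm (vadd V u v))\<^sup>2 = (vnorm u)\<^sup>2 + 2 * Re (\<beta> u v) + (vnorm v)\<^sup>2"
    by (simp only: plus_complex.sel Re_complex_of_real) simp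
  also have "\<dots> \<le> (vnorm u)\<^sup>2 + 2 * (vnorm u * vnorm v) + (vnorm v)\<^sup>2"
    using metric_cauchy_schwarz[OF uv] complex_Re_le_cmod[of "\<beta> u v"] by linarith
  finally show "(vnorm (vadd V u v))\<^sup>2 \<le> (vnorm u + vnorm v)\<^sup>2" by (simp add: power2_sum)
qed (use vnorm_nonneg uv in simp)

lemma vnorm_scale:
  assumes v: "v \<in> fiber V x" shows "vnorm (vscale V c v) = cmod c * vnorm v"
proof -
  note c = vscale_closed[OF x v, of c]
  have "\<beta> (vscale V c v) (vscale V c v) = (c * cnj c) * \<beta> v v"
    using metric_rules(2)[OF x c v v] metric_scale_left[OF x v v] by simp
  also have "\<dots> = complex_of_real ((cmod c * vnorm v)\<^sup>2)"
    using complex_norm_square[of c] by (simp add: metric_self[OF v] power_mult_distrib)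
  finally show ?thesis using vnorm_nonneg[OF v] by (simp add: vnorm_def[of "vscale V c v"])
qed

lemma vdiff_telescope:
  assumes "u \<in> fiber V x" "v \<in> fiber V x" "w \<in> fiber V x"
  shows "vdiff u w = vadd V (vdiff u v) (vdiff v w)"
proof -
  have a: "vscale V (-1) v \<in> fiber V x" "vscale V (-1) w \<in> fiber V x"
    using assms vscale_closed[OF x] by auto
  have "vadd V (vscale V (-1) v) v = vscale V (-1 + 1) v"
    unfolding vscale_add_left[OF x assms(2)] vscale_one[OF x assms(2)] ..
  then have 0: "vadd V (vscale V (-1) v) v = vzero V x" using vscale_zero[OF x assms(2)] by simp
  have "vadd V (vdiff u v) (vdiff v w) = vadd V u (vadd V (vadd V (vscale V (-1) v) v) (vscale V (-1) w))"
    unfolding vdiff_def using assms a vadd_closed[OF x] by (simp add: vadd_assoc[OF x])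
  then show ?thesis using 0 a by (simp add: vdiff_def vadd_zero_left[OF x])
qed

lemma vnorm_vdiff_triangle:
  assumes "u \<in> fiber V x" "v \<in> fiber V x" "w \<in> fiber V x"
  shows "vnorm (vdiff u w) \<le> vnorm (vdiff u v) + vnorm (vdiff v w)"
  unfolding vdiff_telescope[OF assms] using assms by (intro vnorm_triangle vdiff_closed)

lemma vdiff_zero: "v \<in> fiber V x \<Longrightarrow> vdiff v (vzero V x) = v"
  using vscale_mult[OF x vzero_closed[OF x], of "-1" 0] vscale_zero[OF x vzero_closed[OF x]]
    vadd_zero_left[OF x, of v] vadd_commute[OF x, of v "vzero V x"] vzero_closed[OF x]
  by (simp add: vdiff_def)

lemma vnorm_vdiff_commute:
  assumes "u \<in> fiber V x" "v \<in> fiber V x" shows "vnorm (vdiff u v) = vnorm (vdiff v u)"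
proof -
  have a: "vscale V (-1) v \<in> fiber V x" "vscale V (-1) u \<in> fiber V x" using assms vscale_closed[OF x] by auto
  have "vdiff v u = vscale V (-1) (vdiff u v)"
    unfolding vdiff_def vscale_add_right[OF x assms(1) a(1)] vscale_mult[OF x assms(2), symmetric]
    using vadd_commute[OF x a(2) assms(2)] by (simp add: vscale_one[OF x assms(2)])
  then show ?thesis using vnorm_scale[OF vdiff_closed[OF assms], of "-1"] by simp
qed

lemma vnorm_le_vdiff:
  assumes "u \<in> fiber V x" "v \<in> fiber V x" shows "vnorm u \<le> vnorm v + vnorm (vdiff u v)"
  using vnorm_vdiff_triangle[OF assms vzero_closed[OF x]] vdiff_zero assms by simp

end

section \<open>Coordinates in a local trivialization\<close>

definition triv :: "'a set \<Rightarrow> nat \<Rightarrow> ('t \<Rightarrow> 'a \<times> (nat \<Rightarrow> complex)) \<Rightarrow> ('a \<times> (nat \<Rightarrow> complex) \<Rightarrow> 't) \<Rightarrow> bool" where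
  "triv U n \<phi> \<psi> \<longleftrightarrow> openin X U \<and> local_trivialization X V U n \<phi> \<and>
     homeomorphic_maps (subtopology (total V) {v. proj V v \<in> U})
       (prod_topology (subtopology X U) (complex_space n)) \<phi> \<psi>"

lemma triv_exists: "x \<in> topspace X \<Longrightarrow> \<exists>U n \<phi> \<psi>. triv U n \<phi> \<psi> \<and> x \<in> U"
proof -
  assume "x \<in> topspace X"
  then obtain U n \<phi> where U: "openin X U" "x \<in> U" "local_trivialization X V U n \<phi>"
    using vector_bundle unfolding vector_bundle_def by blast
  moreover from U(3) obtain \<psi> where "homeomorphic_maps (subtopology (total V) {v. proj V v \<in> U})
       (prod_topology (subtopology X U) (complex_space n)) \<phi> \<psi>"
    unfolding local_trivialization_def homeomorphic_map_maps by blast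
  ultimately show ?thesis unfolding triv_def by blast
qed

text \<open>The standard basis vector, undefined beyond \<open>n\<close> because the points of
  \<open>complex_space n\<close> are extensional functions.\<close>

definition unit :: "nat \<Rightarrow> nat \<Rightarrow> nat \<Rightarrow> complex" where
  "unit n i = (\<lambda>j\<in>{..<n}. if j = i then 1 else 0)"

context
  fixes U n \<phi> \<psi> assumes T: "triv U n \<phi> \<psi>"
begin

lemma triv_subset: "U \<subseteq> topspace X" and triv_open: "openin X U"
  using T openin_subset unfolding triv_def by blast+

lemma triv_maps: "homeomorphic_maps (subtopology (total V) {v. proj V v \<in> U})
       (prod_topology (subtopology X U) (complex_space n)) \<phi> \<psi>"
  using T unfolding triv_def by blast

lemma topspace_model: "topspace (prod_topology (subtopology X U) (complex_space n)) = U \<times> extensional {..<n}"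
  using triv_subset by (auto simp: complex_space_def PiE_def)

lemma triv_\<phi>:
  assumes "x \<in> U" "v \<in> fiber V x"
  shows "fst (\<phi> v) = x" "snd (\<phi> v) \<in> extensional {..<n}" "\<psi> (x, snd (\<phi> v)) = v"
proof -
  show 1: "fst (\<phi> v) = x" using T assms unfolding triv_def local_trivialization_def by blast
  have v: "v \<in> topspace (subtopology (total V) {v. proj V v \<in> U})" using assms by (auto simp: fiber_def)
  then have "\<phi> v \<in> U \<times> extensional {..<n}"
    using triv_maps unfolding homeomorphic_maps_def continuous_map_def topspace_model by blast
  then show "snd (\<phi> v) \<in> extensional {..<n}" by auto
  have "\<psi> (\<phi> v) = v" using triv_maps v unfolding homeomorphic_maps_def by blast
  then show "\<psi> (x, snd (\<phi> v)) = v" using 1 by (metis prod.collapse)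
qed

lemma triv_\<psi>:
  assumes "x \<in> U" "a \<in> extensional {..<n}"
  shows "\<psi> (x, a) \<in> fiber V x" "\<phi> (\<psi> (x, a)) = (x, a)"
proof -
  have p: "(x, a) \<in> topspace (prod_topology (subtopology X U) (complex_space n))"
    unfolding topspace_model using assms by blast
  show 1: "\<phi> (\<psi> (x, a)) = (x, a)" using triv_maps p unfolding homeomorphic_maps_def by blast
  have "\<psi> (x, a) \<in> topspace (subtopology (total V) {v. proj V v \<in> U})"
    using triv_maps p unfolding homeomorphic_maps_def continuous_map_def by blast
  then have "\<psi> (x, a) \<in> fiber V (proj V (\<psi> (x, a)))" "proj V (\<psi> (x, a)) \<in> U" by (auto simp: fiber_def)
  moreover from this have "fst (\<phi> (\<psi> (x, a))) = proj V (\<psi> (x, a))" by (rule triv_\<phi>(1)[rotated])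
  ultimately show "\<psi> (x, a) \<in> fiber V x" using 1 by simp
qed

lemma triv_add:
  assumes "x \<in> U" "v \<in> fiber V x" "w \<in> fiber V x" "i < n"
  shows "snd (\<phi> (vadd V v w)) i = snd (\<phi> v) i + snd (\<phi> w) i"
  using T assms unfolding triv_def local_trivialization_def by blast

lemma triv_scale:
  assumes "x \<in> U" "v \<in> fiber V x" "i < n"
  shows "snd (\<phi> (vscale V c v)) i = c * snd (\<phi> v) i"
  using T assms unfolding triv_def local_trivialization_def by blast

lemma triv_zero:
  assumes "x \<in> U" "i < n" shows "snd (\<phi> (vzero V x)) i = 0"
proof -
  have x: "x \<in> topspace X" using assms triv_subset by blast
  show ?thesis using triv_scale[OF assms(1) vzero_closed[OF x] assms(2), of 0] vscale_zero[OF x vzero_closed[OF x]] by simp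
qed

lemma triv_ext:
  assumes "x \<in> U" "v \<in> fiber V x" "w \<in> fiber V x" "\<And>i. i < n \<Longrightarrow> snd (\<phi> v) i = snd (\<phi> w) i"
  shows "v = w"
proof -
  have "snd (\<phi> v) = snd (\<phi> w)"
    using triv_\<phi>(2)[OF assms(1,2)] triv_\<phi>(2)[OF assms(1,3)] assms(4) by (auto intro: extensionalityI)
  then have "\<psi> (x, snd (\<phi> v)) = \<psi> (x, snd (\<phi> w))" by (rule arg_cong)
  then show ?thesis unfolding triv_\<phi>(3)[OF assms(1,2)] triv_\<phi>(3)[OF assms(1,3)] .
qed

lemma coordinate_continuous:
  assumes "i < n" shows "continuous_map (subtopology (total V) {v. proj V v \<in> U}) euclidean (\<lambda>v. snd (\<phi> v) i)"
proof -
  have "continuous_map (subtopology (total V) {v. proj V v \<in> U}) (complex_space n) (snd \<circ> \<phi>)"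
    by (rule continuous_map_compose[OF _ continuous_map_snd])
      (use triv_maps in \<open>unfold homeomorphic_maps_def, blast\<close>)
  then show ?thesis using assms by (simp add: complex_space_def continuous_map_componentwise)
qed

lemma section_coordinate_continuous:
  assumes "continuous_map Y (total V) \<xi>" "\<And>y. y \<in> topspace Y \<Longrightarrow> proj V (\<xi> y) \<in> U" "i < n"
  shows "continuous_map Y euclidean (\<lambda>y. snd (\<phi> (\<xi> y)) i)"
proof -
  have "continuous_map Y (subtopology (total V) {v. proj V v \<in> U}) \<xi>"
    using assms(1,2) by (auto simp: continuous_map_in_subtopology)
  from continuous_map_compose[OF this coordinate_continuous[OF assms(3)]] show ?thesis by (simp add: o_def)
qed

text \<open>The section is recovered as \<open>\<psi> (x, coordinates)\<close>, and
  \<open>\<psi>\<close> is continuous; for this the inverse homeomorphism is kept explicitly in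
  \<open>triv\<close>.\<close>

lemma section_continuousI:
  assumes "W \<subseteq> U" "\<And>x. x \<in> W \<Longrightarrow> \<xi> x \<in> fiber V x"
    and "\<And>i. i < n \<Longrightarrow> continuous_map (subtopology X W) euclidean (\<lambda>x. snd (\<phi> (\<xi> x)) i)"
  shows "continuous_map (subtopology X W) (total V) \<xi>"
proof -
  have "continuous_map (subtopology X W) (complex_space n) (\<lambda>x. snd (\<phi> (\<xi> x)))"
    unfolding complex_space_def continuous_map_componentwise
    using assms triv_\<phi>(2) by (auto simp: subset_iff)
  moreover have "continuous_map (subtopology X W) (subtopology X U) (\<lambda>x. x)"
    using assms(1) by (auto simp: continuous_map_in_subtopology)
  ultimately have "continuous_map (subtopology X W) (prod_topology (subtopology X U) (complex_space n)) (\<lambda>x. (x, snd (\<phi> (\<xi> x))))"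
    by (intro continuous_map_pairedI)
  moreover have "continuous_map (prod_topology (subtopology X U) (complex_space n)) (total V) \<psi>"
    using triv_maps unfolding homeomorphic_maps_def by (simp add: continuous_map_in_subtopology)
  ultimately have "continuous_map (subtopology X W) (total V) (\<psi> \<circ> (\<lambda>x. (x, snd (\<phi> (\<xi> x)))))"
    by (rule continuous_map_compose)
  then show ?thesis
    by (rule continuous_map_eq) (use assms triv_\<phi>(3) in auto)
qed

lemma unit_ext: "unit n i \<in> extensional {..<n}"
  by (simp add: unit_def)

text \<open>Linearity of the metric applied to the expansion of \<open>v\<close> in the local basis
  \<open>\<psi> (x, unit n j)\<close>.\<close>

lemma metric_expand:
  assumes x: "x \<in> U" and u: "u \<in> fiber V x" and v: "v \<in> fiber V x"
  shows "\<beta> u v = (\<Sum>j<n. snd (\<phi> v) j * \<beta> u (\<psi> (x, unit n j)))"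
proof -
  have xX: "x \<in> topspace X" using x triv_subset by blast
  define a where "a = snd (\<phi> v)"
  \<comment> \<open>Partial coordinate vectors: the induction adds one basis vector at a time, which
    avoids finite sums inside the fibre.\<close>
  define p where "p m = (\<lambda>i\<in>{..<n}. if i < m then a i else 0)" for m
  have pe: "p m \<in> extensional {..<n}" for m by (simp add: p_def)
  have "m \<le> n \<Longrightarrow> \<beta> u (\<psi> (x, p m)) = (\<Sum>j<m. a j * \<beta> u (\<psi> (x, unit n j)))" for m
  proof (induction m)
    case 0
    have "\<psi> (x, p 0) = vzero V x"
      by (rule triv_ext[OF x triv_\<psi>(1)[OF x pe] vzero_closed[OF xX]])
        (simp add: triv_\<psi>(2)[OF x pe] triv_zero[OF x], simp add: p_def)
    then show ?case using metric_zero_right[OF xX u] by simp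
  next
    case (Suc m)
    have m: "m < n" using Suc by simp
    note c = triv_\<psi>(1)[OF x pe[of m]] triv_\<psi>(1)[OF x unit_ext[of m]]
    note c2 = vscale_closed[OF xX c(2), of "a m"]
    have "\<psi> (x, p (Suc m)) = vadd V (\<psi> (x, p m)) (vscale V (a m) (\<psi> (x, unit n m)))"
      by (rule triv_ext[OF x triv_\<psi>(1)[OF x pe] vadd_closed[OF xX c(1) c2]])
        (simp add: triv_add[OF x c(1) c2] triv_scale[OF x c(2)] triv_\<psi>(2)[OF x pe] triv_\<psi>(2)[OF x unit_ext],
         auto simp: p_def unit_def less_Suc_eq)
    then show ?case using Suc m metric_rules(1)[OF xX u c(1) c2] metric_rules(2)[OF xX u c(2) c(2)] by simp
  qed
  from this[of n] have "\<beta> u (\<psi> (x, p n)) = (\<Sum>j<n. a j * \<beta> u (\<psi> (x, unit n j)))" by simp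
  moreover have "p n = a"
    by (rule extensionalityI[OF pe]) (use triv_\<phi>(2)[OF x v] in \<open>auto simp: a_def p_def\<close>)
  ultimately show ?thesis using triv_\<phi>(3)[OF x v] by (simp add: a_def)
qed

lemma metric_sesq:
  assumes x: "x \<in> U" and v: "v \<in> fiber V x"
  shows "\<beta> v v = sesq n (\<lambda>i j. \<beta> (\<psi> (x, unit n i)) (\<psi> (x, unit n j))) (snd (\<phi> v))"
proof -
  have xX: "x \<in> topspace X" using x triv_subset by blast
  have "\<beta> v (\<psi> (x, unit n j)) = (\<Sum>i<n. cnj (snd (\<phi> v) i) * \<beta> (\<psi> (x, unit n i)) (\<psi> (x, unit n j)))" for j
  proof -
    note c = triv_\<psi>(1)[OF x unit_ext]
    have "\<beta> v (\<psi> (x, unit n j)) = cnj (\<beta> (\<psi> (x, unit n j)) v)" by (rule metric_rules(3)[OF xX c v v])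
    also have "\<dots> = (\<Sum>i<n. cnj (snd (\<phi> v) i) * cnj (\<beta> (\<psi> (x, unit n j)) (\<psi> (x, unit n i))))"
      using metric_expand[OF x c v] by simp
    also have "\<dots> = (\<Sum>i<n. cnj (snd (\<phi> v) i) * \<beta> (\<psi> (x, unit n i)) (\<psi> (x, unit n j)))"
      using metric_rules(3)[OF xX c c c] by (intro sum.cong) (auto simp flip: metric_rules(3)[OF xX c c c])
    finally show ?thesis .
  qed
  then have "\<beta> v v = (\<Sum>j<n. \<Sum>i<n. snd (\<phi> v) j * (cnj (snd (\<phi> v) i) * \<beta> (\<psi> (x, unit n i)) (\<psi> (x, unit n j))))"
    by (subst metric_expand[OF x v v]) (simp add: sum_distrib_left)
  also have "\<dots> = sesq n (\<lambda>i j. \<beta> (\<psi> (x, unit n i)) (\<psi> (x, unit n j))) (snd (\<phi> v))"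
    unfolding sesq_def by (subst sum.swap) (simp add: mult_ac)
  finally show ?thesis .
qed

end

lemma metric_continuous:
  assumes "continuous_map Y (total V) \<xi>" "continuous_map Y (total V) \<eta>"
    and "\<And>y. y \<in> topspace Y \<Longrightarrow> proj V (\<xi> y) = proj V (\<eta> y)"
  shows "continuous_map Y euclidean (\<lambda>y. \<beta> (\<xi> y) (\<eta> y))"
proof -
  have "continuous_map Y (subtopology (prod_topology (total V) (total V)) {(v, w). proj V v = proj V w}) (\<lambda>y. (\<xi> y, \<eta> y))"
    using assms by (auto simp: continuous_map_in_subtopology intro: continuous_map_pairedI)
  moreover have "continuous_map (subtopology (prod_topology (total V) (total V)) {(v, w). proj V v = proj V w})
      euclidean (\<lambda>(v, w). \<beta> v w)"
    using hermitian unfolding hermitian_metric_def by (rule conjunct1)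
  ultimately have "continuous_map Y euclidean ((\<lambda>(v, w). \<beta> v w) \<circ> (\<lambda>y. (\<xi> y, \<eta> y)))"
    by (rule continuous_map_compose)
  then show ?thesis by (simp add: o_def)
qed

text \<open>The Gram matrix of the local basis is continuous and positive definite at
  \<open>x0\<close>, so its form stays bounded below nearby. Convergence for the metric, uniform on
  \<open>W\<close>, therefore gives uniform convergence of coordinates; completeness rests on
  this.\<close>

lemma local_coordinate_bound:
  assumes x0: "x0 \<in> topspace X"
  shows "\<exists>U n \<phi> \<psi> W \<delta>. triv U n \<phi> \<psi> \<and> openin X W \<and> x0 \<in> W \<and> W \<subseteq> U \<and> \<delta> > 0 \<and>
    (\<forall>x\<in>W. \<forall>v\<in>fiber V x. \<forall>i<n. \<delta> * cmod (snd (\<phi> v) i) \<le> vnorm v)"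
proof -
  obtain U n \<phi> \<psi> where T: "triv U n \<phi> \<psi>" and x0U: "x0 \<in> U" using triv_exists[OF x0] by blast
  define G where "G i j x = \<beta> (\<psi> (x, unit n i)) (\<psi> (x, unit n j))" for i j x
  have cu: "continuous_map (subtopology X U) (total V) (\<lambda>x. \<psi> (x, unit n i))" for i
  proof (rule section_continuousI[OF T subset_refl])
    show "\<psi> (x, unit n i) \<in> fiber V x" if "x \<in> U" for x using triv_\<psi>(1)[OF T that unit_ext[OF T]] .
    show "continuous_map (subtopology X U) euclidean (\<lambda>x. snd (\<phi> (\<psi> (x, unit n i))) j)" for j
      by (rule continuous_map_eq[where f = "\<lambda>_. unit n i j"]) (use triv_\<psi>(2)[OF T _ unit_ext[OF T]] in auto)
  qed
  have pj: "proj V (\<psi> (x, unit n i)) = x" if "x \<in> U" for x i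
    using triv_\<psi>(1)[OF T that unit_ext[OF T]] by (simp add: fiber_def)
  have gc: "continuous_map (subtopology X U) euclidean (G i j)" for i j
    unfolding G_def[abs_def] by (rule metric_continuous[OF cu cu]) (use pj in auto)
  have gp: "0 < Re (sesq n (\<lambda>i j. G i j x0) a)" if a: "\<exists>i<n. a i \<noteq> 0" for a
  proof -
    define b where "b = restrict a {..<n}"
    have b: "b \<in> extensional {..<n}" by (simp add: b_def)
    note v = triv_\<psi>(1)[OF T x0U b]
    have "\<psi> (x0, b) \<noteq> vzero V x0"
    proof
      assume "\<psi> (x0, b) = vzero V x0"
      then have "b i = 0" if "i < n" for i using triv_zero[OF T x0U that] triv_\<psi>(2)[OF T x0U b] by simp
      then show False using a by (auto simp: b_def)
    qed
    then have "0 < Re (\<beta> (\<psi> (x0, b)) (\<psi> (x0, b)))" using metric_positive[OF x0 v] by blast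
    also have "\<beta> (\<psi> (x0, b)) (\<psi> (x0, b)) = sesq n (\<lambda>i j. G i j x0) b"
      unfolding metric_sesq[OF T x0U v] by (simp add: G_def triv_\<psi>(2)[OF T x0U b])
    also have "\<dots> = sesq n (\<lambda>i j. G i j x0) a" by (simp add: sesq_def b_def)
    finally show ?thesis .
  qed
  obtain W d where W: "openin X W" "x0 \<in> W" "W \<subseteq> U" "d > 0"
    "\<And>x a. x \<in> W \<Longrightarrow> d * (\<Sum>i<n. (cmod (a i))\<^sup>2) \<le> Re (sesq n (\<lambda>i j. G i j x) a)"
    using posdef_lower_bound_nbhd[OF triv_open[OF T] x0U gc gp] by blast
  \<comment> \<open>The form is a squared norm, so the constant for the norm itself is the root of
    \<open>d\<close>.\<close>
  have "sqrt d * cmod (snd (\<phi> v) i) \<le> vnorm v" if x: "x \<in> W" and v: "v \<in> fiber V x" and i: "i < n" for x v i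
  proof -
    have xU: "x \<in> U" using x W(3) by blast
    have "d * (cmod (snd (\<phi> v) i))\<^sup>2 \<le> d * (\<Sum>i<n. (cmod (snd (\<phi> v) i))\<^sup>2)"
      using W(4) i by (intro mult_left_mono member_le_sum) auto
    also have "\<dots> \<le> Re (\<beta> v v)" using W(5)[OF x] unfolding metric_sesq[OF T xU v] G_def .
    finally have "sqrt (d * (cmod (snd (\<phi> v) i))\<^sup>2) \<le> vnorm v" unfolding vnorm_def by (rule real_sqrt_le_mono)
    then show ?thesis by (simp add: real_sqrt_mult)
  qed
  then show ?thesis using T W(1-4)
    by (intro exI[of _ U] exI[of _ n] exI[of _ \<phi>] exI[of _ \<psi>] exI[of _ W] exI[of _ "sqrt d"] conjI ballI allI impI)
      simp_all
qed

end

section \<open>The Hilbert module of sections\<close>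

context hermitian_bundle
begin

abbreviation sections :: "('a, 'a \<Rightarrow> 't) hmodule" ("\<Gamma>") where "\<Gamma> \<equiv> Gamma0 X V \<beta>"

text \<open>Separates continuity from the condition at infinity and from extensionality, so that
  continuity of sums and multiples can be treated alone.\<close>

definition sec :: "('a \<Rightarrow> 't) \<Rightarrow> bool" where
  "sec \<xi> \<longleftrightarrow> continuous_map X (total V) \<xi> \<and> (\<forall>x\<in>topspace X. \<xi> x \<in> fiber V x)"

lemma Gamma_simps:
  "\<zero>\<^bsub>\<Gamma>\<^esub> = (\<lambda>x\<in>topspace X. vzero V x)"
  "\<xi> \<oplus>\<^bsub>\<Gamma>\<^esub> \<eta> = (\<lambda>x\<in>topspace X. vadd V (\<xi> x) (\<eta> x))"
  "f \<odot>\<^bsub>\<Gamma>\<^esub> \<xi> = (\<lambda>x\<in>topspace X. vscale V (f x) (\<xi> x))"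
  "cscale \<Gamma> c \<xi> = (\<lambda>x\<in>topspace X. vscale V c (\<xi> x))"
  "hinner \<Gamma> \<xi> \<eta> = (\<lambda>x. if x \<in> topspace X then \<beta> (\<xi> x) (\<eta> x) else 0)"
  by (simp_all add: Gamma0_def)

lemma carrier_Gamma:
  "\<xi> \<in> carrier \<Gamma> \<longleftrightarrow> \<xi> \<in> extensional (topspace X) \<and> sec \<xi> \<and> vanishes_at_infinity X (\<lambda>x. \<beta> (\<xi> x) (\<xi> x))"
  unfolding Gamma0_def sec_def fiber_def continuous_map_def by auto

lemma Gamma_fiber: "\<xi> \<in> carrier \<Gamma> \<Longrightarrow> x \<in> topspace X \<Longrightarrow> \<xi> x \<in> fiber V x"
  by (simp add: carrier_Gamma sec_def)

lemma Gamma_ext: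
  assumes "\<xi> \<in> extensional (topspace X)" "\<eta> \<in> extensional (topspace X)" "\<And>x. x \<in> topspace X \<Longrightarrow> \<xi> x = \<eta> x"
  shows "\<xi> = \<eta>"
  using assms by (rule extensionalityI)

lemma sec_coord:
  assumes T: "triv U n \<phi> \<psi>" and s: "sec \<xi>" and i: "i < n"
  shows "continuous_map (subtopology X U) euclidean (\<lambda>x. snd (\<phi> (\<xi> x)) i)"
proof (rule section_coordinate_continuous[OF T _ _ i])
  show "continuous_map (subtopology X U) (total V) \<xi>" using s by (simp add: sec_def continuous_map_from_subtopology)
  show "proj V (\<xi> x) \<in> U" if "x \<in> topspace (subtopology X U)" for x
    using s that by (auto simp: sec_def fiber_def)
qed

lemma sec_localI:
  assumes f: "\<And>x. x \<in> topspace X \<Longrightarrow> \<xi> x \<in> fiber V x"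
    and c: "\<And>U n \<phi> \<psi> i. triv U n \<phi> \<psi> \<Longrightarrow> i < n \<Longrightarrow>
      continuous_map (subtopology X U) euclidean (\<lambda>x. snd (\<phi> (\<xi> x)) i)"
  shows "sec \<xi>"
proof -
  have "continuous_map X (total V) \<xi>"
  proof (rule continuous_map_locally)
    fix x assume "x \<in> topspace X"
    then obtain U n \<phi> \<psi> where T: "triv U n \<phi> \<psi>" "x \<in> U" using triv_exists by blast
    have "continuous_map (subtopology X U) (total V) \<xi>"
      by (rule section_continuousI[OF T(1) subset_refl f c[OF T(1)]]) (use triv_subset[OF T(1)] in auto)
    then show "\<exists>U. openin X U \<and> x \<in> U \<and> continuous_map (subtopology X U) (total V) \<xi>"
      using triv_open[OF T(1)] T(2) by blast
  qed
  then show ?thesis using f by (simp add: sec_def)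
qed

lemma sec_add:
  assumes "sec \<xi>" "sec \<eta>" shows "sec (\<lambda>x\<in>topspace X. vadd V (\<xi> x) (\<eta> x))"
proof (rule sec_localI)
  show "(\<lambda>x\<in>topspace X. vadd V (\<xi> x) (\<eta> x)) x \<in> fiber V x" if "x \<in> topspace X" for x
    using assms that by (simp add: sec_def vadd_closed)
  fix U n \<phi> \<psi> i assume T: "triv U n \<phi> \<psi>" and i: "i < (n::nat)"
  have "continuous_map (subtopology X U) euclidean (\<lambda>x. snd (\<phi> (\<xi> x)) i + snd (\<phi> (\<eta> x)) i)"
    by (intro continuous_map_add sec_coord[OF T _ i] assms)
  then show "continuous_map (subtopology X U) euclidean (\<lambda>x. snd (\<phi> ((\<lambda>x\<in>topspace X. vadd V (\<xi> x) (\<eta> x)) x)) i)"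
    by (rule continuous_map_eq) (use assms triv_add[OF T _ _ _ i] in \<open>auto simp: sec_def\<close>)
qed

lemma sec_scale:
  assumes "continuous_map X euclidean f" "sec \<xi>" shows "sec (\<lambda>x\<in>topspace X. vscale V (f x) (\<xi> x))"
proof (rule sec_localI)
  show "(\<lambda>x\<in>topspace X. vscale V (f x) (\<xi> x)) x \<in> fiber V x" if "x \<in> topspace X" for x
    using assms that by (simp add: sec_def vscale_closed)
  fix U n \<phi> \<psi> i assume T: "triv U n \<phi> \<psi>" and i: "i < (n::nat)"
  have "continuous_map (subtopology X U) euclidean (\<lambda>x. f x * snd (\<phi> (\<xi> x)) i)"
    by (intro continuous_map_mult sec_coord[OF T _ i] assms continuous_map_from_subtopology)
  then show "continuous_map (subtopology X U) euclidean (\<lambda>x. snd (\<phi> ((\<lambda>x\<in>topspace X. vscale V (f x) (\<xi> x)) x)) i)"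
    by (rule continuous_map_eq) (use assms triv_scale[OF T _ _ i] in \<open>auto simp: sec_def\<close>)
qed

lemma sec_zero: "sec (\<lambda>x\<in>topspace X. vzero V x)"
proof (rule sec_localI)
  show "(\<lambda>x\<in>topspace X. vzero V x) x \<in> fiber V x" if "x \<in> topspace X" for x
    using that by (simp add: vzero_closed)
  fix U n \<phi> \<psi> i assume T: "triv U n \<phi> \<psi>" and i: "i < (n::nat)"
  show "continuous_map (subtopology X U) euclidean (\<lambda>x. snd (\<phi> ((\<lambda>x\<in>topspace X. vzero V x) x)) i)"
    by (rule continuous_map_eq[where f = "\<lambda>_. 0"]) (use triv_zero[OF T _ i] in auto)
qed

lemma norm_metric_self: "x \<in> topspace X \<Longrightarrow> v \<in> fiber V x \<Longrightarrow> cmod (\<beta> v v) = (vnorm v)\<^sup>2"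
  by (simp add: metric_self del: of_real_power)

lemma sec_metric_continuous: "sec \<xi> \<Longrightarrow> sec \<eta> \<Longrightarrow> continuous_map X euclidean (\<lambda>x. \<beta> (\<xi> x) (\<eta> x))"
  by (intro metric_continuous) (auto simp: sec_def fiber_def)

text \<open>The common criterion for sums, multiples and inner products of sections: each is
  dominated by the squared norms of two sections that vanish at infinity.\<close>

lemma vanishes_sum_squares:
  assumes "\<xi> \<in> carrier \<Gamma>" "\<eta> \<in> carrier \<Gamma>"
    and "\<And>x. x \<in> topspace X \<Longrightarrow> cmod (h x) \<le> C * ((vnorm (\<xi> x))\<^sup>2 + (vnorm (\<eta> x))\<^sup>2)"
  shows "vanishes_at_infinity X h"
proof (rule vanishes_at_infinity_mono)
  have "vanishes_at_infinity X (\<lambda>x. \<beta> (\<xi> x) (\<xi> x) + \<beta> (\<eta> x) (\<eta> x))"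
    using assms by (intro vanishes_at_infinity_add) (auto simp: carrier_Gamma)
  then show "vanishes_at_infinity X (\<lambda>x. complex_of_real C * (\<beta> (\<xi> x) (\<xi> x) + \<beta> (\<eta> x) (\<eta> x)))"
    by (rule vanishes_at_infinity_comp[where h = "\<lambda>z. complex_of_real C * z"]) (auto intro: continuous_intros)
  fix x assume x: "x \<in> topspace X"
  have "\<beta> (\<xi> x) (\<xi> x) + \<beta> (\<eta> x) (\<eta> x) = complex_of_real ((vnorm (\<xi> x))\<^sup>2 + (vnorm (\<eta> x))\<^sup>2)"
    using metric_self[OF x] Gamma_fiber[OF assms(1) x] Gamma_fiber[OF assms(2) x] by simp
  then have "cmod (complex_of_real C * (\<beta> (\<xi> x) (\<xi> x) + \<beta> (\<eta> x) (\<eta> x))) = \<bar>C\<bar> * \<bar>(vnorm (\<xi> x))\<^sup>2 + (vnorm (\<eta> x))\<^sup>2\<bar>"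
    by (simp only: norm_mult norm_of_real)
  then show "cmod (h x) \<le> cmod (complex_of_real C * (\<beta> (\<xi> x) (\<xi> x) + \<beta> (\<eta> x) (\<eta> x)))"
    using assms(3)[OF x] abs_ge_self[of "C * ((vnorm (\<xi> x))\<^sup>2 + (vnorm (\<eta> x))\<^sup>2)"] by (simp add: abs_mult)
qed

section \<open>The algebraic operations on sections\<close>

lemma Gamma_add_closed:
  assumes c: "\<xi> \<in> carrier \<Gamma>" "\<eta> \<in> carrier \<Gamma>" shows "\<xi> \<oplus>\<^bsub>\<Gamma>\<^esub> \<eta> \<in> carrier \<Gamma>"
proof -
  have "vanishes_at_infinity X (\<lambda>x. \<beta> ((\<xi> \<oplus>\<^bsub>\<Gamma>\<^esub> \<eta>) x) ((\<xi> \<oplus>\<^bsub>\<Gamma>\<^esub> \<eta>) x))"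
  proof (rule vanishes_sum_squares[OF c, where C = 2])
    fix x assume x: "x \<in> topspace X"
    note f = Gamma_fiber[OF c(1) x] Gamma_fiber[OF c(2) x]
    have "cmod (\<beta> ((\<xi> \<oplus>\<^bsub>\<Gamma>\<^esub> \<eta>) x) ((\<xi> \<oplus>\<^bsub>\<Gamma>\<^esub> \<eta>) x)) = (vnorm (vadd V (\<xi> x) (\<eta> x)))\<^sup>2"
      using x norm_metric_self[OF x vadd_closed[OF x f]] by (simp add: Gamma_simps)
    also have "\<dots> \<le> (vnorm (\<xi> x) + vnorm (\<eta> x))\<^sup>2"
      by (intro power_mono vnorm_triangle[OF x f] vnorm_nonneg[OF x vadd_closed[OF x f]])
    also have "\<dots> \<le> 2 * ((vnorm (\<xi> x))\<^sup>2 + (vnorm (\<eta> x))\<^sup>2)"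
      using sum_squares_bound[of "vnorm (\<xi> x)" "vnorm (\<eta> x)"] by (simp add: power2_sum)
    finally show "cmod (\<beta> ((\<xi> \<oplus>\<^bsub>\<Gamma>\<^esub> \<eta>) x) ((\<xi> \<oplus>\<^bsub>\<Gamma>\<^esub> \<eta>) x)) \<le> 2 * ((vnorm (\<xi> x))\<^sup>2 + (vnorm (\<eta> x))\<^sup>2)" .
  qed
  then show ?thesis using c sec_add by (simp add: carrier_Gamma Gamma_simps)
qed

text \<open>Boundedness of \<open>f\<close> is enough because the section already vanishes at
  infinity; this covers constants and elements of \<open>C0 X\<close> at once.\<close>

lemma Gamma_scale_closed:
  assumes c: "\<xi> \<in> carrier \<Gamma>" and f: "continuous_map X euclidean f" "\<And>x. x \<in> topspace X \<Longrightarrow> cmod (f x) \<le> B"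
  shows "(\<lambda>x\<in>topspace X. vscale V (f x) (\<xi> x)) \<in> carrier \<Gamma>" (is "?\<zeta> \<in> _")
proof -
  have "vanishes_at_infinity X (\<lambda>x. \<beta> (?\<zeta> x) (?\<zeta> x))"
  proof (rule vanishes_sum_squares[OF c c, where C = "B\<^sup>2"])
    fix x assume x: "x \<in> topspace X"
    note fb = Gamma_fiber[OF c x]
    have "cmod (\<beta> (?\<zeta> x) (?\<zeta> x)) = (cmod (f x))\<^sup>2 * (vnorm (\<xi> x))\<^sup>2"
      using x norm_metric_self[OF x vscale_closed[OF x fb]] vnorm_scale[OF x fb] by (simp add: power_mult_distrib)
    also have "\<dots> \<le> B\<^sup>2 * (vnorm (\<xi> x))\<^sup>2" by (intro mult_right_mono power_mono f x) auto
    also have "\<dots> \<le> B\<^sup>2 * ((vnorm (\<xi> x))\<^sup>2 + (vnorm (\<xi> x))\<^sup>2)" by (intro mult_left_mono) auto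
    finally show "cmod (\<beta> (?\<zeta> x) (?\<zeta> x)) \<le> B\<^sup>2 * ((vnorm (\<xi> x))\<^sup>2 + (vnorm (\<xi> x))\<^sup>2)" .
  qed
  then show ?thesis using c sec_scale[OF f(1)] by (simp add: carrier_Gamma)
qed

lemma Gamma_cscale_closed: "\<xi> \<in> carrier \<Gamma> \<Longrightarrow> cscale \<Gamma> c \<xi> \<in> carrier \<Gamma>"
  unfolding Gamma_simps by (rule Gamma_scale_closed[where B = "cmod c"]) auto

lemma Gamma_act_closed: "\<xi> \<in> carrier \<Gamma> \<Longrightarrow> f \<in> C0 X \<Longrightarrow> f \<odot>\<^bsub>\<Gamma>\<^esub> \<xi> \<in> carrier \<Gamma>"
  unfolding Gamma_simps using C0_bounded[of f X] by (auto intro: Gamma_scale_closed simp: C0_def)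

lemma Gamma_zero_closed: "\<zero>\<^bsub>\<Gamma>\<^esub> \<in> carrier \<Gamma>"
proof -
  have "vanishes_at_infinity X (\<lambda>x. \<beta> (\<zero>\<^bsub>\<Gamma>\<^esub> x) (\<zero>\<^bsub>\<Gamma>\<^esub> x))"
  proof (rule vanishes_at_infinity_mono)
    show "vanishes_at_infinity X (\<lambda>x. 0)" using C0_zero[of X] by (simp add: C0_def)
  qed (simp add: Gamma_simps metric_zero_right vzero_closed)
  then show ?thesis using sec_zero by (simp add: carrier_Gamma Gamma_simps)
qed

lemma abelian_group_Gamma: "abelian_group \<Gamma>"
proof (rule abelian_groupI)
  fix \<xi> \<eta> \<zeta> assume c: "\<xi> \<in> carrier \<Gamma>" "\<eta> \<in> carrier \<Gamma>" "\<zeta> \<in> carrier \<Gamma>"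
  show "(\<xi> \<oplus>\<^bsub>\<Gamma>\<^esub> \<eta>) \<oplus>\<^bsub>\<Gamma>\<^esub> \<zeta> = \<xi> \<oplus>\<^bsub>\<Gamma>\<^esub> (\<eta> \<oplus>\<^bsub>\<Gamma>\<^esub> \<zeta>)"
    by (rule Gamma_ext) (use c in \<open>auto simp: Gamma_simps vadd_assoc Gamma_fiber\<close>)
next
  fix \<xi> \<eta> assume c: "\<xi> \<in> carrier \<Gamma>" "\<eta> \<in> carrier \<Gamma>"
  show "\<xi> \<oplus>\<^bsub>\<Gamma>\<^esub> \<eta> = \<eta> \<oplus>\<^bsub>\<Gamma>\<^esub> \<xi>"
    by (rule Gamma_ext) (use c vadd_commute in \<open>auto simp: Gamma_simps Gamma_fiber\<close>)
next
  fix \<xi> assume c: "\<xi> \<in> carrier \<Gamma>"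
  show "\<zero>\<^bsub>\<Gamma>\<^esub> \<oplus>\<^bsub>\<Gamma>\<^esub> \<xi> = \<xi>"
    by (rule Gamma_ext) (use c in \<open>auto simp: Gamma_simps vadd_zero_left Gamma_fiber carrier_Gamma\<close>)
  have "vadd V (vscale V (-1) (\<xi> x)) (\<xi> x) = vzero V x" if x: "x \<in> topspace X" for x
    using vscale_add_left[OF x Gamma_fiber[OF c x], of "-1" 1] vscale_one[OF x Gamma_fiber[OF c x]]
      vscale_zero[OF x Gamma_fiber[OF c x]] by simp
  then have "cscale \<Gamma> (-1) \<xi> \<oplus>\<^bsub>\<Gamma>\<^esub> \<xi> = \<zero>\<^bsub>\<Gamma>\<^esub>"
    by (intro Gamma_ext) (auto simp: Gamma_simps)
  then show "\<exists>\<eta>\<in>carrier \<Gamma>. \<eta> \<oplus>\<^bsub>\<Gamma>\<^esub> \<xi> = \<zero>\<^bsub>\<Gamma>\<^esub>" using Gamma_cscale_closed[OF c] by blast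
qed (simp_all add: Gamma_add_closed Gamma_zero_closed)

lemma Gamma_diff:
  assumes c: "\<xi> \<in> carrier \<Gamma>" "\<eta> \<in> carrier \<Gamma>" and x: "x \<in> topspace X"
  shows "(\<xi> \<ominus>\<^bsub>\<Gamma>\<^esub> \<eta>) x = vdiff (\<xi> x) (\<eta> x)"
proof -
  interpret abelian_group \<Gamma> by (rule abelian_group_Gamma)
  have "vadd V (vscale V (-1) (\<eta> x)) (\<eta> x) = vzero V x" if x: "x \<in> topspace X" for x
    using vscale_add_left[OF x Gamma_fiber[OF c(2) x], of "-1" 1] vscale_one[OF x Gamma_fiber[OF c(2) x]]
      vscale_zero[OF x Gamma_fiber[OF c(2) x]] by simp
  then have "cscale \<Gamma> (-1) \<eta> \<oplus>\<^bsub>\<Gamma>\<^esub> \<eta> = \<zero>\<^bsub>\<Gamma>\<^esub>"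
    by (intro Gamma_ext) (auto simp: Gamma_simps)
  then have "\<ominus>\<^bsub>\<Gamma>\<^esub> \<eta> = cscale \<Gamma> (-1) \<eta>"
    using c Gamma_cscale_closed by (intro minus_equality) auto
  then show ?thesis using x by (simp add: a_minus_def Gamma_simps vdiff_def)
qed

lemma hinner_Gamma_closed:
  assumes c: "\<xi> \<in> carrier \<Gamma>" "\<eta> \<in> carrier \<Gamma>" shows "hinner \<Gamma> \<xi> \<eta> \<in> C0 X"
proof -
  have "vanishes_at_infinity X (hinner \<Gamma> \<xi> \<eta>)"
  proof (rule vanishes_sum_squares[OF c, where C = 1])
    fix x assume x: "x \<in> topspace X"
    have "cmod (hinner \<Gamma> \<xi> \<eta> x) \<le> vnorm (\<xi> x) * vnorm (\<eta> x)"
      using metric_cauchy_schwarz[OF x Gamma_fiber[OF c(1) x] Gamma_fiber[OF c(2) x]] x by (simp add: Gamma_simps)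
    also have "\<dots> \<le> (vnorm (\<xi> x))\<^sup>2 + (vnorm (\<eta> x))\<^sup>2"
      using sum_squares_bound[of "vnorm (\<xi> x)" "vnorm (\<eta> x)"]
        mult_nonneg_nonneg[OF vnorm_nonneg[OF x Gamma_fiber[OF c(1) x]] vnorm_nonneg[OF x Gamma_fiber[OF c(2) x]]] by linarith
    finally show "cmod (hinner \<Gamma> \<xi> \<eta> x) \<le> 1 * ((vnorm (\<xi> x))\<^sup>2 + (vnorm (\<eta> x))\<^sup>2)" by simp
  qed
  moreover have "continuous_map X euclidean (hinner \<Gamma> \<xi> \<eta>)"
    by (rule continuous_map_eq[OF sec_metric_continuous[of \<xi> \<eta>]]) (use c in \<open>auto simp: carrier_Gamma Gamma_simps\<close>)
  ultimately show ?thesis by (simp add: C0_def Gamma_simps)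
qed

section \<open>Norm and completeness of the module of sections\<close>

lemma vnorm_le_hnorm_Gamma:
  assumes c: "\<xi> \<in> carrier \<Gamma>" and x: "x \<in> topspace X" shows "vnorm (\<xi> x) \<le> hnorm \<Gamma> \<xi>"
proof -
  have "Re (\<beta> (\<xi> x) (\<xi> x)) \<le> sup_norm (hinner \<Gamma> \<xi> \<xi>)"
    using norm_le_sup_norm[OF hinner_Gamma_closed[OF c c], of x] complex_Re_le_cmod[of "\<beta> (\<xi> x) (\<xi> x)"] x
    by (simp add: Gamma_simps)
  then show ?thesis by (simp add: vnorm_def hnorm_def)
qed

lemma hnorm_Gamma_le:
  assumes c: "\<xi> \<in> carrier \<Gamma>" and B: "\<And>x. x \<in> topspace X \<Longrightarrow> vnorm (\<xi> x) \<le> B" "0 \<le> B"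
  shows "hnorm \<Gamma> \<xi> \<le> B"
proof -
  have "sup_norm (hinner \<Gamma> \<xi> \<xi>) \<le> B\<^sup>2"
  proof (rule sup_norm_le)
    fix x show "cmod (hinner \<Gamma> \<xi> \<xi> x) \<le> B\<^sup>2"
    proof (cases "x \<in> topspace X")
      case True
      note f = Gamma_fiber[OF c True]
      show ?thesis using norm_metric_self[OF True f] power_mono[OF B(1)[OF True] vnorm_nonneg[OF True f], of 2] True
        by (simp add: Gamma_simps)
    qed (simp add: Gamma_simps)
  qed
  then show ?thesis using B(2) by (simp add: hnorm_def real_le_lsqrt)
qed

text \<open>By the lower bound the coordinates of a Cauchy sequence are Cauchy in the complex
  numbers. The vector with the limiting coordinates is a limit for the metric, because the squared
  distance is a finite polynomial expression in the coordinate differences and their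
  conjugates.\<close>

lemma fiber_limit:
  assumes x: "x \<in> topspace X" and s: "\<And>k. s k \<in> fiber V x"
    and cau: "\<And>e. e > 0 \<Longrightarrow> \<exists>N. \<forall>m\<ge>N. \<forall>k\<ge>N. vnorm (vdiff (s m) (s k)) < e"
  shows "\<exists>v. v \<in> fiber V x \<and> (\<lambda>k. vnorm (vdiff (s k) v)) \<longlonglongrightarrow> 0"
proof -
  obtain U n \<phi> \<psi> W \<delta> where T: "triv U n \<phi> \<psi>" and W: "openin X W" "x \<in> W" "W \<subseteq> U" "\<delta> > 0"
    and bd: "\<forall>x\<in>W. \<forall>v\<in>fiber V x. \<forall>i<n. \<delta> * cmod (snd (\<phi> v) i) \<le> vnorm v"
    using local_coordinate_bound[OF x] by blast
  have xU: "x \<in> U" using W by blast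
  have co: "snd (\<phi> (vdiff v w)) i = snd (\<phi> v) i - snd (\<phi> w) i"
    if "v \<in> fiber V x" "w \<in> fiber V x" "i < n" for v w i
    unfolding vdiff_def using that triv_add[OF T xU _ vscale_closed[OF x] that(3)] triv_scale[OF T xU _ that(3)] by simp
  define a where "a k i = snd (\<phi> (s k)) i" for k i
  have conv: "convergent (\<lambda>k. a k i)" if i: "i < n" for i
  proof -
    have "Cauchy (\<lambda>k. a k i)"
    proof (rule CauchyI)
      fix e :: real assume "e > 0"
      then have "\<delta> * e > 0" using W(4) by simp
      then obtain N where N: "\<forall>m\<ge>N. \<forall>k\<ge>N. vnorm (vdiff (s m) (s k)) < \<delta> * e" using cau by blast
      have "norm (a m i - a k i) < e" if mk: "m \<ge> N" "k \<ge> N" for m k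
      proof -
        have "\<delta> * cmod (snd (\<phi> (vdiff (s m) (s k))) i) \<le> vnorm (vdiff (s m) (s k))"
          using bd W(2) vdiff_closed[OF x s s] i by blast
        also have "\<dots> < \<delta> * e" using N mk by blast
        finally show ?thesis using W(4) co[OF s s i] by (simp add: a_def)
      qed
      then show "\<exists>M. \<forall>m\<ge>M. \<forall>n\<ge>M. norm (a m i - a n i) < e" by blast
    qed
    then show ?thesis by (rule Cauchy_convergent)
  qed
  define l where "l = (\<lambda>i\<in>{..<n}. lim (\<lambda>k. a k i))"
  have l: "l \<in> extensional {..<n}" by (simp add: l_def)
  have lim: "(\<lambda>k. a k i - l i) \<longlonglongrightarrow> 0" if i: "i < n" for i
  proof -
    have "(\<lambda>k. a k i) \<longlonglongrightarrow> l i" using conv[OF i] i by (simp add: l_def convergent_LIMSEQ_iff)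
    then show ?thesis by (simp add: LIM_zero)
  qed
  define v where "v = \<psi> (x, l)"
  have v: "v \<in> fiber V x" "snd (\<phi> v) = l" using triv_\<psi>[OF T xU l] by (simp_all add: v_def)
  define G where "G i j = \<beta> (\<psi> (x, unit n i)) (\<psi> (x, unit n j))" for i j
  have eq: "vnorm (vdiff (s k) v) = sqrt (Re (\<Sum>i<n. \<Sum>j<n. cnj (a k i - l i) * (a k j - l j) * G i j))" for k
  proof -
    have "\<beta> (vdiff (s k) v) (vdiff (s k) v) = sesq n G (snd (\<phi> (vdiff (s k) v)))"
      unfolding G_def by (rule metric_sesq[OF T xU vdiff_closed[OF x s v(1)]])
    also have "\<dots> = (\<Sum>i<n. \<Sum>j<n. cnj (a k i - l i) * (a k j - l j) * G i j)"
      unfolding sesq_def by (intro sum.cong) (auto simp: co[OF s v(1)] a_def v(2))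
    finally show ?thesis by (simp add: vnorm_def)
  qed
  have "(\<lambda>k. sqrt (Re (\<Sum>i<n. \<Sum>j<n. cnj (a k i - l i) * (a k j - l j) * G i j)))
      \<longlonglongrightarrow> sqrt (Re (\<Sum>i<n. \<Sum>j<n. cnj 0 * 0 * G i j))"
    by (intro tendsto_real_sqrt tendsto_Re tendsto_sum tendsto_mult tendsto_cnj lim tendsto_const) auto
  then have "(\<lambda>k. vnorm (vdiff (s k) v)) \<longlonglongrightarrow> 0" unfolding eq by simp
  then show ?thesis using v(1) by blast
qed

lemma Gamma_complete:
  assumes s: "\<And>k::nat. s k \<in> carrier \<Gamma>"
    and cau: "\<And>e. e > 0 \<Longrightarrow> \<exists>N. \<forall>m\<ge>N. \<forall>k\<ge>N. hnorm \<Gamma> (s m \<ominus>\<^bsub>\<Gamma>\<^esub> s k) < e"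
  shows "\<exists>\<xi>\<in>carrier \<Gamma>. (\<lambda>k. hnorm \<Gamma> (s k \<ominus>\<^bsub>\<Gamma>\<^esub> \<xi>)) \<longlonglongrightarrow> 0"
proof -
  interpret abelian_group \<Gamma> by (rule abelian_group_Gamma)
  have sf: "s k x \<in> fiber V x" if "x \<in> topspace X" for k x using Gamma_fiber[OF s that] .
  have unif: "\<exists>N. \<forall>m\<ge>N. \<forall>k\<ge>N. \<forall>x\<in>topspace X. vnorm (vdiff (s m x) (s k x)) < e" if e: "e > 0" for e
  proof -
    obtain N where N: "\<forall>m\<ge>N. \<forall>k\<ge>N. hnorm \<Gamma> (s m \<ominus>\<^bsub>\<Gamma>\<^esub> s k) < e" using cau[OF e] by blast
    have "vnorm (vdiff (s m x) (s k x)) < e" if "m \<ge> N" "k \<ge> N" "x \<in> topspace X" for m k x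
      using vnorm_le_hnorm_Gamma[OF minus_closed[OF s s] that(3), of m k] Gamma_diff[OF s s that(3), of m k] N that
      by (metis le_less_trans)
    then show ?thesis by blast
  qed
  define t where "t = (\<lambda>x\<in>topspace X. SOME v. v \<in> fiber V x \<and> (\<lambda>k. vnorm (vdiff (s k x) v)) \<longlonglongrightarrow> 0)"
  have t: "t x \<in> fiber V x \<and> (\<lambda>k. vnorm (vdiff (s k x) (t x))) \<longlonglongrightarrow> 0" if x: "x \<in> topspace X" for x
  proof -
    have cx: "\<exists>N. \<forall>m\<ge>N. \<forall>k\<ge>N. vnorm (vdiff (s m x) (s k x)) < e" if "e > 0" for e
      using unif[OF that] x by blast
    show ?thesis unfolding t_def restrict_apply'[OF x]
      by (rule someI_ex[OF fiber_limit[OF x sf[OF x] cx]])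
  qed
  \<comment> \<open>The uniform Cauchy estimate is compared with the pointwise limit through an
    intermediate index \<open>m\<close> that depends on \<open>x\<close>; the bound \<open>N\<close>
    does not.\<close>
  have close: "\<exists>N. \<forall>k\<ge>N. \<forall>x\<in>topspace X. vnorm (vdiff (s k x) (t x)) \<le> e" if e: "e > 0" for e
  proof -
    have "e/2 > 0" using e by simp
    then obtain N where N: "\<forall>m\<ge>N. \<forall>k\<ge>N. \<forall>x\<in>topspace X. vnorm (vdiff (s m x) (s k x)) < e/2" using unif by blast
    have "vnorm (vdiff (s k x) (t x)) \<le> e" if k: "k \<ge> N" and x: "x \<in> topspace X" for k x
    proof -
      have "(\<lambda>k. vnorm (vdiff (s k x) (t x))) \<longlonglongrightarrow> 0" using t[OF x] by blast
      from LIMSEQ_D[OF this \<open>e/2 > 0\<close>] obtain M where M: "\<forall>m\<ge>M. \<bar>vnorm (vdiff (s m x) (t x))\<bar> < e/2" by auto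
      define m where "m = max M N"
      have "vnorm (vdiff (s m x) (t x)) < e/2" using M by (auto simp: m_def dest!: spec[of _ m])
      moreover have "vnorm (vdiff (s k x) (s m x)) < e/2" using N k x by (simp add: m_def)
      moreover have "t x \<in> fiber V x" using t[OF x] by blast
      ultimately show ?thesis using vnorm_vdiff_triangle[OF x sf[OF x] sf[OF x], of "t x" k m] by simp
    qed
    then show ?thesis by blast
  qed
  have "continuous_map X (total V) t"
  proof (rule continuous_map_locally)
    fix x0 assume x0: "x0 \<in> topspace X"
    obtain U n \<phi> \<psi> W \<delta> where T: "triv U n \<phi> \<psi>" and W: "openin X W" "x0 \<in> W" "W \<subseteq> U" "\<delta> > 0"
      and bd: "\<forall>x\<in>W. \<forall>v\<in>fiber V x. \<forall>i<n. \<delta> * cmod (snd (\<phi> v) i) \<le> vnorm v"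
      using local_coordinate_bound[OF x0] by blast
    have WX: "W \<subseteq> topspace X" using openin_subset[OF W(1)] .
    have "continuous_map (subtopology X W) (total V) t"
    proof (rule section_continuousI[OF T W(3)])
      show "t x \<in> fiber V x" if "x \<in> W" for x using t that WX by blast
      fix i assume i: "i < n"
      show "continuous_map (subtopology X W) euclidean (\<lambda>x. snd (\<phi> (t x)) i)"
      proof (rule continuous_map_uniform_approx)
        fix e :: real assume e: "e > 0"
        then have "\<delta> * (e/2) > 0" using W(4) by simp
        then obtain N where N: "\<forall>k\<ge>N. \<forall>x\<in>topspace X. vnorm (vdiff (s k x) (t x)) \<le> \<delta> * (e/2)" using close by blast
        have "continuous_map (subtopology X U) euclidean (\<lambda>x. snd (\<phi> (s N x)) i)"
          by (rule sec_coord[OF T _ i]) (use s in \<open>simp add: carrier_Gamma\<close>)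
        then have c: "continuous_map (subtopology X W) euclidean (\<lambda>x. snd (\<phi> (s N x)) i)"
          using W(3) by (rule continuous_map_from_subtopology_mono)
        have "dist (snd (\<phi> (s N x)) i) (snd (\<phi> (t x)) i) < e" if xW: "x \<in> W" for x
        proof -
          have x: "x \<in> topspace X" "x \<in> U" using xW WX W(3) by blast+
          have tx: "t x \<in> fiber V x" using t[OF x(1)] by blast
          have "snd (\<phi> (vdiff (s N x) (t x))) i = snd (\<phi> (s N x)) i - snd (\<phi> (t x)) i"
            unfolding vdiff_def using triv_add[OF T x(2) sf[OF x(1)] vscale_closed[OF x(1) tx] i]
              triv_scale[OF T x(2) tx i] by simp
          moreover have "\<delta> * cmod (snd (\<phi> (vdiff (s N x) (t x))) i) \<le> vnorm (vdiff (s N x) (t x))"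
            using bd xW vdiff_closed[OF x(1) sf[OF x(1)] tx] i by blast
          moreover have "vnorm (vdiff (s N x) (t x)) \<le> \<delta> * (e/2)" using N x by blast
          ultimately have "\<delta> * cmod (snd (\<phi> (s N x)) i - snd (\<phi> (t x)) i) \<le> \<delta> * (e/2)" by simp
          then have "cmod (snd (\<phi> (s N x)) i - snd (\<phi> (t x)) i) \<le> e/2" using W(4) by simp
          then show ?thesis using e by (simp add: dist_norm)
        qed
        then show "\<exists>f. continuous_map (subtopology X W) euclidean f \<and>
            (\<forall>x\<in>topspace (subtopology X W). dist (f x) (snd (\<phi> (t x)) i) < e)"
          using c by (intro exI[of _ "\<lambda>x. snd (\<phi> (s N x)) i"]) auto
      qed
    qed
    then show "\<exists>U. openin X U \<and> x0 \<in> U \<and> continuous_map (subtopology X U) (total V) t" using W by blast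
  qed
  then have sect: "sec t" using t by (simp add: sec_def)
  have "vanishes_at_infinity X (\<lambda>x. \<beta> (t x) (t x))"
    unfolding vanishes_at_infinity_def
  proof (intro allI impI)
    fix e :: real assume e: "e > 0"
    \<comment> \<open>Off the compact set the section \<open>s N\<close> has norm below
      \<open>d\<close>, and \<open>t\<close> differs from it by at most \<open>d\<close>, so the
      squared norm of \<open>t\<close> is below \<open>(2 * d)\<^sup>2 = e\<close>.\<close>
    define d where "d = sqrt e / 2"
    have d: "d > 0" "(2 * d)\<^sup>2 = e" using e by (simp_all add: d_def)
    obtain N where N: "\<forall>k\<ge>N. \<forall>x\<in>topspace X. vnorm (vdiff (s k x) (t x)) \<le> d" using close[OF d(1)] by blast
    have "d\<^sup>2 > 0" using d by simp
    moreover have "vanishes_at_infinity X (\<lambda>x. \<beta> (s N x) (s N x))" using s by (simp add: carrier_Gamma)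
    ultimately obtain K where K: "compactin X K" "\<forall>x\<in>topspace X - K. cmod (\<beta> (s N x) (s N x)) < d\<^sup>2"
      unfolding vanishes_at_infinity_def by blast
    have "cmod (\<beta> (t x) (t x)) < e" if xK: "x \<in> topspace X - K" for x
    proof -
      have x: "x \<in> topspace X" using xK by blast
      have tx: "t x \<in> fiber V x" using t[OF x] by blast
      have "cmod (\<beta> (s N x) (s N x)) < d\<^sup>2" using K(2) xK by blast
      then have "(vnorm (s N x))\<^sup>2 < d\<^sup>2" unfolding norm_metric_self[OF x sf[OF x]] .
      then have "vnorm (s N x) < d" by (rule power2_less_imp_less) (use d(1) in simp)
      moreover have "vnorm (vdiff (t x) (s N x)) \<le> d"
        using N x vnorm_vdiff_commute[OF x tx sf[OF x]] by simp
      ultimately have "vnorm (t x) < 2 * d" using vnorm_le_vdiff[OF x tx sf[OF x], of N] by linarith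
      then have "(vnorm (t x))\<^sup>2 < (2 * d)\<^sup>2" using vnorm_nonneg[OF x tx] by (intro power_strict_mono) auto
      then show ?thesis using d(2) norm_metric_self[OF x tx] by simp
    qed
    then show "\<exists>K. compactin X K \<and> (\<forall>x\<in>topspace X - K. cmod (\<beta> (t x) (t x)) < e)" using K(1) by blast
  qed
  then have tc: "t \<in> carrier \<Gamma>" using sect by (simp add: carrier_Gamma t_def)
  have "(\<lambda>k. hnorm \<Gamma> (s k \<ominus>\<^bsub>\<Gamma>\<^esub> t)) \<longlonglongrightarrow> 0"
  proof (rule LIMSEQ_I)
    fix e :: real assume e: "e > 0"
    then have "e/2 > 0" by simp
    then obtain N where N: "\<forall>k\<ge>N. \<forall>x\<in>topspace X. vnorm (vdiff (s k x) (t x)) \<le> e/2" using close by blast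
    have "norm (hnorm \<Gamma> (s k \<ominus>\<^bsub>\<Gamma>\<^esub> t) - 0) < e" if k: "k \<ge> N" for k
    proof -
      have "hnorm \<Gamma> (s k \<ominus>\<^bsub>\<Gamma>\<^esub> t) \<le> e/2"
        by (rule hnorm_Gamma_le[OF minus_closed[OF s tc]]) (use N k e Gamma_diff[OF s tc] in auto)
      moreover have "0 \<le> hnorm \<Gamma> (s k \<ominus>\<^bsub>\<Gamma>\<^esub> t)"
        unfolding hnorm_def using sup_norm_nonneg[OF hinner_Gamma_closed[OF minus_closed[OF s tc] minus_closed[OF s tc]]] by simp
      ultimately show ?thesis using e by simp
    qed
    then show "\<exists>N. \<forall>k\<ge>N. norm (hnorm \<Gamma> (s k \<ominus>\<^bsub>\<Gamma>\<^esub> t) - 0) < e" by blast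
  qed
  then show ?thesis using tc by blast
qed

lemma hilbert_module_Gamma: "hilbert_module X \<Gamma>"
proof (intro hilbert_module.intro abelian_group_Gamma hilbert_module_axioms.intro)
  interpret abelian_group \<Gamma> by (rule abelian_group_Gamma)
  note cl = Gamma_cscale_closed Gamma_act_closed Gamma_fiber
  show "cvector_space (carrier \<Gamma>) (add \<Gamma>) \<zero>\<^bsub>\<Gamma>\<^esub> (cscale \<Gamma>)"
    unfolding cvector_space_def
  proof (rule moduleI[OF cring_complex_ring], goal_cases)
    case 1
    show ?case
    proof (rule abelian_groupI, goal_cases)
      case (6 \<xi>)
      then have "\<ominus>\<^bsub>\<Gamma>\<^esub> \<xi> \<in> carrier \<Gamma>" "\<ominus>\<^bsub>\<Gamma>\<^esub> \<xi> \<oplus>\<^bsub>\<Gamma>\<^esub> \<xi> = \<zero>\<^bsub>\<Gamma>\<^esub>" using l_neg by auto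
      then show ?case by auto
    qed (auto simp: a_ac)
  next
    case (2 c \<xi>) then show ?case using Gamma_cscale_closed by simp
  next
    case (3 c d \<xi>) then show ?case
      by (auto simp: Gamma_simps vscale_add_left Gamma_fiber intro!: restrict_ext)
  next
    case (4 c \<xi> \<eta>) then show ?case
      by (auto simp: Gamma_simps vscale_add_right Gamma_fiber intro!: restrict_ext)
  next
    case (5 c d \<xi>) then show ?case
      by (auto simp: Gamma_simps vscale_mult Gamma_fiber intro!: restrict_ext)
  next
    case (6 \<xi>)
    then have "\<xi> \<in> carrier \<Gamma>" by simp
    then have "cscale \<Gamma> 1 \<xi> = \<xi>"
      by (intro Gamma_ext) (auto simp: Gamma_simps vscale_one Gamma_fiber carrier_Gamma)
    then show ?case by simp
  qed
  fix f g \<xi> \<eta> \<zeta> c x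
  show "f \<in> C0 X \<Longrightarrow> \<xi> \<in> carrier \<Gamma> \<Longrightarrow> f \<odot>\<^bsub>\<Gamma>\<^esub> \<xi> \<in> carrier \<Gamma>" using Gamma_act_closed by blast
  show "\<xi> \<in> carrier \<Gamma> \<Longrightarrow> (\<lambda>x. f x + g x) \<odot>\<^bsub>\<Gamma>\<^esub> \<xi> = f \<odot>\<^bsub>\<Gamma>\<^esub> \<xi> \<oplus>\<^bsub>\<Gamma>\<^esub> g \<odot>\<^bsub>\<Gamma>\<^esub> \<xi>"
    by (auto simp: Gamma_simps vscale_add_left Gamma_fiber intro!: restrict_ext)
  show "\<xi> \<in> carrier \<Gamma> \<Longrightarrow> \<eta> \<in> carrier \<Gamma> \<Longrightarrow> f \<odot>\<^bsub>\<Gamma>\<^esub> (\<xi> \<oplus>\<^bsub>\<Gamma>\<^esub> \<eta>) = f \<odot>\<^bsub>\<Gamma>\<^esub> \<xi> \<oplus>\<^bsub>\<Gamma>\<^esub> f \<odot>\<^bsub>\<Gamma>\<^esub> \<eta>"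
    by (auto simp: Gamma_simps vscale_add_right Gamma_fiber intro!: restrict_ext)
  show "\<xi> \<in> carrier \<Gamma> \<Longrightarrow> (\<lambda>x. f x * g x) \<odot>\<^bsub>\<Gamma>\<^esub> \<xi> = f \<odot>\<^bsub>\<Gamma>\<^esub> (g \<odot>\<^bsub>\<Gamma>\<^esub> \<xi>)"
    by (auto simp: Gamma_simps vscale_mult Gamma_fiber intro!: restrict_ext)
  show "\<xi> \<in> carrier \<Gamma> \<Longrightarrow> (\<lambda>x. c * f x) \<odot>\<^bsub>\<Gamma>\<^esub> \<xi> = cscale \<Gamma> c (f \<odot>\<^bsub>\<Gamma>\<^esub> \<xi>)"
    by (auto simp: Gamma_simps vscale_mult Gamma_fiber intro!: restrict_ext)
  show "f \<odot>\<^bsub>\<Gamma>\<^esub> cscale \<Gamma> c \<xi> = cscale \<Gamma> c (f \<odot>\<^bsub>\<Gamma>\<^esub> \<xi>)" if "\<xi> \<in> carrier \<Gamma>"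
  proof (rule Gamma_ext)
    fix x assume x: "x \<in> topspace X"
    note v = Gamma_fiber[OF that x]
    show "(f \<odot>\<^bsub>\<Gamma>\<^esub> cscale \<Gamma> c \<xi>) x = cscale \<Gamma> c (f \<odot>\<^bsub>\<Gamma>\<^esub> \<xi>) x"
      using x vscale_mult[OF x v, of "f x" c] vscale_mult[OF x v, of c "f x"] by (simp add: Gamma_simps mult.commute)
  qed (simp_all add: Gamma_simps)
  show "\<xi> \<in> carrier \<Gamma> \<Longrightarrow> \<eta> \<in> carrier \<Gamma> \<Longrightarrow> hinner \<Gamma> \<xi> \<eta> \<in> C0 X" by (rule hinner_Gamma_closed)
  show "\<xi> \<in> carrier \<Gamma> \<Longrightarrow> \<eta> \<in> carrier \<Gamma> \<Longrightarrow> \<zeta> \<in> carrier \<Gamma> \<Longrightarrow>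
      hinner \<Gamma> \<xi> (\<eta> \<oplus>\<^bsub>\<Gamma>\<^esub> \<zeta>) x = hinner \<Gamma> \<xi> \<eta> x + hinner \<Gamma> \<xi> \<zeta> x"
    using metric_rules(1)[of x "\<xi> x" "\<eta> x" "\<zeta> x"] by (simp add: Gamma_simps Gamma_fiber)
  show "\<xi> \<in> carrier \<Gamma> \<Longrightarrow> \<eta> \<in> carrier \<Gamma> \<Longrightarrow> hinner \<Gamma> \<xi> (cscale \<Gamma> c \<eta>) x = c * hinner \<Gamma> \<xi> \<eta> x"
    using metric_rules(2)[of x "\<xi> x" "\<eta> x" "\<eta> x"] by (simp add: Gamma_simps Gamma_fiber)
  show "\<xi> \<in> carrier \<Gamma> \<Longrightarrow> \<eta> \<in> carrier \<Gamma> \<Longrightarrow> hinner \<Gamma> \<xi> (f \<odot>\<^bsub>\<Gamma>\<^esub> \<eta>) x = hinner \<Gamma> \<xi> \<eta> x * f x"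
    using metric_rules(2)[of x "\<xi> x" "\<eta> x" "\<eta> x"] by (simp add: Gamma_simps Gamma_fiber)
  show "\<xi> \<in> carrier \<Gamma> \<Longrightarrow> \<eta> \<in> carrier \<Gamma> \<Longrightarrow> hinner \<Gamma> \<eta> \<xi> x = cnj (hinner \<Gamma> \<xi> \<eta> x)"
    using metric_rules(3)[of x "\<xi> x" "\<eta> x" "\<eta> x"] by (simp add: Gamma_simps Gamma_fiber)
  show "\<xi> \<in> carrier \<Gamma> \<Longrightarrow> hinner \<Gamma> \<xi> \<xi> x \<in> \<real> \<and> 0 \<le> Re (hinner \<Gamma> \<xi> \<xi> x)"
    using metric_self[of x "\<xi> x"] by (simp add: Gamma_simps Gamma_fiber)
next
  fix \<xi> assume c: "\<xi> \<in> carrier \<Gamma>" and 0: "\<And>x. hinner \<Gamma> \<xi> \<xi> x = 0"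
  show "\<xi> = \<zero>\<^bsub>\<Gamma>\<^esub>"
  proof (rule Gamma_ext)
    fix x assume x: "x \<in> topspace X"
    then have "vnorm (\<xi> x) = 0" using 0[of x] by (simp add: vnorm_def Gamma_simps)
    then show "\<xi> x = \<zero>\<^bsub>\<Gamma>\<^esub> x" using vnorm_eq_0[OF x Gamma_fiber[OF c x]] x by (simp add: Gamma_simps)
  qed (use c in \<open>auto simp: carrier_Gamma Gamma_simps\<close>)
next
  fix s :: "nat \<Rightarrow> 'a \<Rightarrow> 't"
  assume "\<And>k. s k \<in> carrier \<Gamma>" "\<And>e. e > 0 \<Longrightarrow> \<exists>N. \<forall>m\<ge>N. \<forall>n\<ge>N. hnorm \<Gamma> (s m \<ominus>\<^bsub>\<Gamma>\<^esub> s n) < e"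
  then show "\<exists>\<xi>\<in>carrier \<Gamma>. (\<lambda>n. hnorm \<Gamma> (s n \<ominus>\<^bsub>\<Gamma>\<^esub> \<xi>)) \<longlonglongrightarrow> 0" by (rule Gamma_complete)
qed

end

section \<open>Restrictions of the module of sections\<close>

context hermitian_bundle
begin

context
  fixes U n \<phi> \<psi> r L
  assumes T: "triv U n \<phi> \<psi>" and r: "continuous_map X euclidean (r :: 'a \<Rightarrow> real)"
    and L: "compactin X L" "L \<subseteq> U" and r0: "\<And>x. x \<notin> L \<Longrightarrow> r x = 0"
begin

lemma compl_open: "openin X (topspace X - L)"
  using compactin_imp_closedin[OF Hausdorff L(1)] by blast

text \<open>Extension by zero is continuous because \<open>U\<close> and the complement of the
  compact set \<open>L \<subseteq> U\<close> are open and cover \<open>X\<close>: on the first the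
  section has explicit coordinates, on the second it is the zero section.\<close>

lemma cutoff_section:
  "(\<lambda>x\<in>topspace X. if x \<in> U then vscale V (of_real (r x)) (\<psi> (x, unit n i)) else vzero V x) \<in> carrier \<Gamma>"
  (is "?\<eta> \<in> _")
proof -
  note u = triv_\<psi>[OF T _ unit_ext[OF T]]
  have UX: "U \<subseteq> topspace X" by (rule triv_subset[OF T])
  have fib: "?\<eta> x \<in> fiber V x" if "x \<in> topspace X" for x
    using that u(1) by (simp add: vscale_closed vzero_closed)
  have off: "?\<eta> x = vzero V x" if "x \<in> topspace X - L" for x
    using that r0[of x] u(1)[of x i] vscale_zero[of x] by simp
  have "continuous_map X (total V) ?\<eta>"
  proof (rule continuous_map_locally)
    fix x assume x: "x \<in> topspace X"
    show "\<exists>W. openin X W \<and> x \<in> W \<and> continuous_map (subtopology X W) (total V) ?\<eta>"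
    proof (cases "x \<in> U")
      case True
      have "continuous_map (subtopology X U) (total V) ?\<eta>"
      proof (rule section_continuousI[OF T subset_refl])
        show "?\<eta> y \<in> fiber V y" if "y \<in> U" for y using fib that UX by blast
        fix j assume j: "j < n"
        have "continuous_map (subtopology X U) euclidean (\<lambda>y. complex_of_real (r y) * unit n i j)"
          by (intro continuous_map_mult continuous_map_of_real continuous_map_from_subtopology r) auto
        then show "continuous_map (subtopology X U) euclidean (\<lambda>y. snd (\<phi> (?\<eta> y)) j)"
          by (rule continuous_map_eq) (use UX u triv_scale[OF T _ u(1) j] in auto)
      qed
      then show ?thesis using True triv_open[OF T] by blast
    next
      case False
      have "continuous_map (subtopology X (topspace X - L)) (total V) (\<lambda>x\<in>topspace X. vzero V x)"
        using sec_zero by (simp add: sec_def continuous_map_from_subtopology)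
      then have "continuous_map (subtopology X (topspace X - L)) (total V) ?\<eta>"
        by (rule continuous_map_eq) (use off in auto)
      then show ?thesis using False x L(2) compl_open by blast
    qed
  qed
  moreover have "vanishes_at_infinity X (\<lambda>x. \<beta> (?\<eta> x) (?\<eta> x))"
  proof -
    have "\<beta> (?\<eta> x) (?\<eta> x) = 0" if "x \<in> topspace X - L" for x
      using off[OF that] that metric_zero_right[of x] vzero_closed[of x] by (simp only:) simp
    then show ?thesis unfolding vanishes_at_infinity_def using L(1) by (intro allI impI exI[of _ L]) simp
  qed
  ultimately show ?thesis using fib by (simp add: carrier_Gamma sec_def)
qed

text \<open>The cover by \<open>U\<close> and the complement of \<open>L\<close> again; the cutoff
  turns a coordinate defined over \<open>U\<close> only into a global continuous function.\<close>

lemma cutoff_coordinate: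
  assumes s: "sec \<zeta>" and i: "i < n"
  shows "continuous_map X euclidean (\<lambda>x. if x \<in> U then of_real (r x) * snd (\<phi> (\<zeta> x)) i else 0)"
    (is "continuous_map X euclidean ?g")
proof (rule continuous_map_locally)
  fix x assume x: "x \<in> topspace X"
  show "\<exists>W. openin X W \<and> x \<in> W \<and> continuous_map (subtopology X W) euclidean ?g"
  proof (cases "x \<in> U")
    case True
    have "continuous_map (subtopology X U) euclidean (\<lambda>y. complex_of_real (r y) * snd (\<phi> (\<zeta> y)) i)"
      by (intro continuous_map_mult continuous_map_of_real continuous_map_from_subtopology r sec_coord[OF T s i])
    then have "continuous_map (subtopology X U) euclidean ?g" by (rule continuous_map_eq) auto
    then show ?thesis using True triv_open[OF T] by blast
  next
    case False
    have "continuous_map (subtopology X (topspace X - L)) euclidean ?g"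
      by (rule continuous_map_eq[where f = "\<lambda>_. 0"]) (use r0 in auto)
    then show ?thesis using False x L(2) compl_open by blast
  qed
qed

end

lemma restriction_finitely_generated_projective:
  assumes K: "compactin X K"
  shows "finitely_generated (subtopology X K) (restrict_hmodule X \<Gamma> K)"
    and "projective (C_ring (subtopology X K)) (restrict_hmodule X \<Gamma> K)"
proof -
  interpret H: hilbert_module_restriction X \<Gamma> K
    by (intro hilbert_module_restriction.intro hilbert_module_Gamma hilbert_module_restriction_axioms.intro
      locally_compact Hausdorff K)
  have KX: "K \<subseteq> topspace X" using compactin_subset_topspace[OF K] .
  have "\<forall>p\<in>K. \<exists>q. triv (fst q) (fst (snd q)) (fst (snd (snd q))) (snd (snd (snd q))) \<and> p \<in> fst q"
  proof
    fix p assume "p \<in> K"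
    then obtain U n \<phi> \<psi> where "triv U n \<phi> \<psi> \<and> p \<in> U" using triv_exists KX by blast
    then show "\<exists>q. triv (fst q) (fst (snd q)) (fst (snd (snd q))) (snd (snd (snd q))) \<and> p \<in> fst q"
      by (intro exI[of _ "(U, n, \<phi>, \<psi>)"]) simp
  qed
  from bchoice[OF this] obtain q where
    q: "\<forall>p\<in>K. triv (fst (q p)) (fst (snd (q p))) (fst (snd (snd (q p)))) (snd (snd (snd (q p)))) \<and> p \<in> fst (q p)"
    by blast
  define U where "U p = fst (q p)" for p
  define n where "n p = fst (snd (q p))" for p
  define \<phi> where "\<phi> p = fst (snd (snd (q p)))" for p
  define \<psi> where "\<psi> p = snd (snd (snd (q p)))" for p
  have T: "triv (U p) (n p) (\<phi> p) (\<psi> p)" and pU: "p \<in> U p" if "p \<in> K" for p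
    using q that by (simp_all add: U_def n_def \<phi>_def \<psi>_def)
  have W: "openin X (U p) \<and> p \<in> U p" if "p \<in> K" for p using triv_open[OF T[OF that]] pU[OF that] by blast
  obtain P \<rho> L where P: "finite P" "P \<subseteq> K"
    "\<forall>p\<in>P. continuous_map X euclidean (\<rho> p)" "\<forall>p x. 0 \<le> (\<rho> p x :: real)"
    "\<forall>p\<in>P. compactin X (L p) \<and> L p \<subseteq> U p \<and> (\<forall>x. x \<notin> L p \<longrightarrow> \<rho> p x = 0)"
    "\<forall>x. (\<Sum>p\<in>P. \<rho> p x) \<le> 1" "\<forall>x\<in>K. (\<Sum>p\<in>P. \<rho> p x) = 1"
    using partition_on_compact[OF locally_compact Hausdorff K W] by blast
  \<comment> \<open>Both the frame vectors \<open>\<eta>\<close> and the coordinates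
    \<open>s\<close> are only defined over \<open>U p\<close> and need a cutoff. Each receives one
    root, so that their product carries \<open>\<rho> p\<close> and the sum over \<open>p\<close> is
    \<open>1\<close> on \<open>K\<close>.\<close>
  define r where "r p x = sqrt (\<rho> p x)" for p x
  have TP: "triv (U p) (n p) (\<phi> p) (\<psi> p)" and rc: "continuous_map X euclidean (r p)"
    and Lp: "compactin X (L p)" "L p \<subseteq> U p" and r0: "\<And>x. x \<notin> L p \<Longrightarrow> r p x = 0" if "p \<in> P" for p
    using that P T by (auto simp: r_def[abs_def] intro!: continuous_map_sqrt)
  \<comment> \<open>A dependent sum, because the rank \<open>n p\<close> is only locally
    constant.\<close>
  define I where "I = Sigma P (\<lambda>p. {..<n p})"
  define \<eta> where "\<eta> k = (\<lambda>x\<in>topspace X. if x \<in> U (fst k)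
    then vscale V (of_real (r (fst k) x)) (\<psi> (fst k) (x, unit (n (fst k)) (snd k))) else vzero V x)" for k
  define s where "s k \<zeta> x = (if x \<in> U (fst k) then of_real (r (fst k) x) * snd (\<phi> (fst k) (\<zeta> x)) (snd k) else 0)"
    for k \<zeta> x
  have IP: "fst k \<in> P" "snd k < n (fst k)" if "k \<in> I" for k using that by (auto simp: I_def)
  have finI: "finite I" using P(1) by (simp add: I_def)
  have \<eta>I: "\<eta> \<in> I \<rightarrow> carrier \<Gamma>"
    unfolding \<eta>_def using cutoff_section[OF TP rc Lp r0, OF IP(1) IP(1) IP(1) IP(1) IP(1)] by (intro funcsetI) blast
  have s_cont: "continuous_map (subtopology X K) euclidean (s k \<zeta>)" if k: "k \<in> I" and z: "\<zeta> \<in> carrier \<Gamma>" for k \<zeta>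
  proof -
    note p = IP(1)[OF k]
    have "sec \<zeta>" using z by (simp add: carrier_Gamma)
    then have "continuous_map X euclidean (s k \<zeta>)" unfolding s_def[abs_def]
      using cutoff_coordinate[OF TP[OF p] rc[OF p] Lp[OF p] r0[OF p] _ IP(2)[OF k], of \<zeta>] by blast
    then show ?thesis by (rule continuous_map_from_subtopology)
  qed
  have s_add: "s k (\<zeta> \<oplus>\<^bsub>\<Gamma>\<^esub> \<zeta>') x = s k \<zeta> x + s k \<zeta>' x"
    if k: "k \<in> I" and z: "\<zeta> \<in> carrier \<Gamma>" "\<zeta>' \<in> carrier \<Gamma>" and x: "x \<in> K" for k \<zeta> \<zeta>' x
    using triv_add[OF TP[OF IP(1)[OF k]] _ Gamma_fiber[OF z(1)] Gamma_fiber[OF z(2)] IP(2)[OF k]] x KX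
    by (auto simp: s_def Gamma_simps distrib_left subset_iff)
  have s_act: "s k (f \<odot>\<^bsub>\<Gamma>\<^esub> \<zeta>) x = f x * s k \<zeta> x"
    if k: "k \<in> I" and z: "\<zeta> \<in> carrier \<Gamma>" and x: "x \<in> K" for k \<zeta> f x
    using triv_scale[OF TP[OF IP(1)[OF k]] _ Gamma_fiber[OF z] IP(2)[OF k]] x KX
    by (auto simp: s_def Gamma_simps subset_iff)
  have rec: "hinner \<Gamma> \<xi> \<zeta> x = (\<Sum>k\<in>I. s k \<zeta> x * hinner \<Gamma> \<xi> (\<eta> k) x)"
    if z: "\<xi> \<in> carrier \<Gamma>" "\<zeta> \<in> carrier \<Gamma>" and x: "x \<in> K" for \<xi> \<zeta> x
  proof -
    have xX: "x \<in> topspace X" using x KX by blast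
    note f = Gamma_fiber[OF z(1) xX] Gamma_fiber[OF z(2) xX]
    have inner: "(\<Sum>i<n p. s (p, i) \<zeta> x * hinner \<Gamma> \<xi> (\<eta> (p, i)) x) = complex_of_real (\<rho> p x) * \<beta> (\<xi> x) (\<zeta> x)"
      if p: "p \<in> P" for p
    proof (cases "x \<in> U p")
      case True
      note u = triv_\<psi>(1)[OF TP[OF p] True unit_ext[OF TP[OF p]]]
      have "(\<Sum>i<n p. s (p, i) \<zeta> x * hinner \<Gamma> \<xi> (\<eta> (p, i)) x) =
        (\<Sum>i<n p. (of_real (r p x) * of_real (r p x)) * (snd (\<phi> p (\<zeta> x)) i * \<beta> (\<xi> x) (\<psi> p (x, unit (n p) i))))"
        using True xX metric_rules(2)[OF xX f(1) u u] by (intro sum.cong) (auto simp: s_def \<eta>_def Gamma_simps mult_ac)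
      also have "\<dots> = (of_real (r p x) * of_real (r p x)) * \<beta> (\<xi> x) (\<zeta> x)"
        unfolding sum_distrib_left[symmetric] metric_expand[OF TP[OF p] True f] ..
      also have "complex_of_real (r p x) * of_real (r p x) = of_real (\<rho> p x)"
        using P(4) by (simp add: r_def flip: of_real_mult)
      finally show ?thesis .
    next
      case False
      then have "\<rho> p x = 0" using P(5) p by blast
      then show ?thesis using False by (simp add: s_def)
    qed
    have "(\<Sum>k\<in>I. s k \<zeta> x * hinner \<Gamma> \<xi> (\<eta> k) x) = (\<Sum>p\<in>P. \<Sum>i<n p. s (p, i) \<zeta> x * hinner \<Gamma> \<xi> (\<eta> (p, i)) x)"
      unfolding I_def by (subst sum.Sigma) (use P(1) in \<open>auto simp: case_prod_unfold\<close>)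
    also have "\<dots> = (\<Sum>p\<in>P. complex_of_real (\<rho> p x) * \<beta> (\<xi> x) (\<zeta> x))" by (intro sum.cong inner refl)
    also have "\<dots> = complex_of_real (\<Sum>p\<in>P. \<rho> p x) * \<beta> (\<xi> x) (\<zeta> x)" by (simp add: sum_distrib_right)
    also have "\<dots> = hinner \<Gamma> \<xi> \<zeta> x" using P(7) x xX by (simp add: Gamma_simps)
    finally show ?thesis by simp
  qed
  show "finitely_generated (subtopology X K) (restrict_hmodule X \<Gamma> K)"
    by (rule H.frame_imp_finitely_generated_projective(1)[OF finI \<eta>I, of s]) (use s_cont s_add s_act rec in auto)
  show "projective (C_ring (subtopology X K)) (restrict_hmodule X \<Gamma> K)"
    by (rule H.frame_imp_finitely_generated_projective(2)[OF finI \<eta>I, of s]) (use s_cont s_add s_act rec in auto)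
qed

end

section \<open>Local frames of \<open>\<sigma>\<close>-finitely generated \<open>\<sigma>\<close>-projective modules\<close>

locale full_sigma_module = hilbert_module X E
  for X :: "'a topology" and E :: "('a, 'e, 'm) hmodule_scheme" (structure) +
  assumes locally_compact: "locally_compact_space X" and Hausdorff: "Hausdorff_space X"
    and full: "full X E"
    and sigma_fg: "sigma_finitely_generated X E" and sigma_projective: "sigma_projective X E"
begin

definition lincomb :: "nat \<Rightarrow> (nat \<Rightarrow> 'e) \<Rightarrow> (nat \<Rightarrow> complex) \<Rightarrow> 'e" where
  "lincomb n v a = finsum E (\<lambda>i. cscale E (a i) (v i)) {..<n}"

lemma lincomb_carrier: "v \<in> {..<n} \<rightarrow> carrier E \<Longrightarrow> lincomb n v a \<in> carrier E"
  unfolding lincomb_def by (rule lincomb_closed)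

lemma hinner_lincomb_right: "v \<in> {..<n} \<rightarrow> carrier E \<Longrightarrow> \<zeta> \<in> carrier E \<Longrightarrow>
    hinner E \<zeta> (lincomb n v a) x = (\<Sum>i<n. a i * hinner E \<zeta> (v i) x)"
  unfolding lincomb_def by (rule hinner_lincomb) auto

text \<open>Identifies the form of the Gram matrix with a squared seminorm, so that positive
  definiteness becomes linear independence at the point.\<close>

lemma pnorm_lincomb:
  assumes v: "v \<in> {..<n} \<rightarrow> carrier E"
  shows "(pnorm E (lincomb n v a) x)\<^sup>2 = Re (sesq n (\<lambda>i j. hinner E (v i) (v j) x) a)"
proof -
  note l = lincomb_carrier[OF v]
  have "hinner E (lincomb n v a) (v j) x = (\<Sum>i<n. cnj (a i) * hinner E (v i) (v j) x)" if j: "j < n" for j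
  proof -
    have vj: "v j \<in> carrier E" using v j by auto
    have "hinner E (lincomb n v a) (v j) x = cnj (\<Sum>i<n. a i * hinner E (v j) (v i) x)"
      using hinner_commute[OF vj l, of a x] hinner_lincomb_right[OF v vj] by simp
    also have "\<dots> = (\<Sum>i<n. cnj (a i) * hinner E (v i) (v j) x)"
      using v vj hinner_commute[OF vj] by (auto simp: Pi_iff intro!: sum.cong)
    finally show ?thesis .
  qed
  then have "hinner E (lincomb n v a) (lincomb n v a) x = (\<Sum>j<n. \<Sum>i<n. a j * (cnj (a i) * hinner E (v i) (v j) x))"
    using hinner_lincomb_right[OF v l] by (simp add: sum_distrib_left)
  also have "\<dots> = sesq n (\<lambda>i j. hinner E (v i) (v j) x) a"
    unfolding sesq_def by (subst sum.swap) (simp add: mult_ac)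
  finally show ?thesis using pnorm_sq[OF l] by simp
qed

text \<open>Membership in the span within the fibre at \<open>x\<close>, tested by pairings since
  the fibre has not been constructed yet. The index type is free: it is an abstract frame at first
  and an initial segment of the naturals after reindexing.\<close>

definition spans :: "'i set \<Rightarrow> ('i \<Rightarrow> 'e) \<Rightarrow> 'a \<Rightarrow> 'e \<Rightarrow> bool" where
  "spans B v x \<xi> \<longleftrightarrow> (\<exists>c. \<forall>\<zeta>\<in>carrier E. hinner E \<zeta> \<xi> x = (\<Sum>b\<in>B. c b * hinner E \<zeta> (v b) x))"

text \<open>
  Nakayama's argument at \<open>x\<^sub>0\<close>: the differences \<open>z\<^sub>j\<close> between the generators \<open>\<eta>\<^sub>j\<close> and their
  expansions at \<open>x\<^sub>0\<close> have coordinates vanishing at \<open>x\<^sub>0\<close>, hence small ones nearby, so that the parts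
  of the \<open>z\<^sub>j(x)\<close> orthogonal to the span of the \<open>v\<^sub>i(x)\<close> satisfy a contractive linear system.
\<close>

lemma local_spanning:
  fixes F :: "'i set" and n :: nat
  assumes F: "finite F" and \<eta>: "\<eta> \<in> F \<rightarrow> carrier E" and v: "v \<in> {..<n} \<rightarrow> carrier E"
    and U: "openin X U" "x0 \<in> U"
    and s_cont: "\<And>i \<zeta>. i \<in> F \<Longrightarrow> \<zeta> \<in> carrier E \<Longrightarrow> continuous_map (subtopology X U) euclidean (s i \<zeta>)"
    and s_null: "\<And>i \<zeta>. i \<in> F \<Longrightarrow> \<zeta> \<in> carrier E \<Longrightarrow> pnorm E \<zeta> x0 = 0 \<Longrightarrow> s i \<zeta> x0 = 0"
    and rec: "\<And>\<xi> \<zeta> x. \<xi> \<in> carrier E \<Longrightarrow> \<zeta> \<in> carrier E \<Longrightarrow> x \<in> U \<Longrightarrow>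
      hinner E \<xi> \<zeta> x = (\<Sum>i\<in>F. s i \<zeta> x * hinner E \<xi> (\<eta> i) x)"
    and sp: "\<And>j. j \<in> F \<Longrightarrow> spans {..<n} v x0 (\<eta> j)"
  shows "\<exists>W. openin X W \<and> x0 \<in> W \<and> W \<subseteq> U \<and> (\<forall>x\<in>W. \<forall>\<xi>\<in>carrier E. spans {..<n} v x \<xi>)"
proof -
  have "\<forall>j\<in>F. \<exists>c. \<forall>\<zeta>\<in>carrier E. hinner E \<zeta> (\<eta> j) x0 = (\<Sum>i<n. c i * hinner E \<zeta> (v i) x0)"
    using sp unfolding spans_def by blast
  from bchoice[OF this] obtain c where
    c: "\<forall>j\<in>F. \<forall>\<zeta>\<in>carrier E. hinner E \<zeta> (\<eta> j) x0 = (\<Sum>i<n. c j i * hinner E \<zeta> (v i) x0)" by blast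
  note l = lincomb_carrier[OF v]
  define z where "z j = \<eta> j \<ominus> lincomb n v (c j)" for j
  have \<eta>c: "\<eta> j \<in> carrier E" if "j \<in> F" for j using \<eta> that by auto
  have zc: "z j \<in> carrier E" if "j \<in> F" for j using \<eta>c[OF that] l by (simp add: z_def)
  have z0: "pnorm E (z j) x0 = 0" if j: "j \<in> F" for j
    unfolding z_def using pnorm_diff_eq_0_iff[OF \<eta>c[OF j] l] c j by (auto simp: hinner_lincomb_right[OF v])
  \<comment> \<open>The entrywise size of the matrix that expresses the \<open>z j\<close> by the
    frame. It vanishes at \<open>x0\<close> because the \<open>z j\<close> do; the neighbourhood is
    the one on which it stays below \<open>1\<close>.\<close>
  define m where "m x = (\<Sum>i\<in>F. \<Sum>j\<in>F. cmod (s i (z j) x))" for x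
  have mc: "continuous_map (subtopology X U) euclidean m" unfolding m_def[abs_def]
    by (intro continuous_map_sum continuous_map_norm s_cont F zc)
  have m0: "m x0 = 0" unfolding m_def using s_null[OF _ zc z0] by simp
  have x0: "x0 \<in> topspace (subtopology X U)" using U openin_subset[OF U(1)] by auto
  obtain W where W: "openin (subtopology X U) W" "x0 \<in> W" "\<forall>y\<in>W. dist (m y) (m x0) < 1"
    using continuous_map_eps[THEN iffD1, rule_format, OF mc x0 zero_less_one] by blast
  have WU: "W \<subseteq> U" "openin X W" using openin_subset[OF W(1)] openin_trans_full[OF W(1) U(1)] by auto
  have "spans {..<n} v x \<xi>" if x: "x \<in> W" and \<xi>: "\<xi> \<in> carrier E" for x \<xi>
  proof -
    have xU: "x \<in> U" using x WU by blast
    have m1: "m x < 1" using W(3) x m0 by (auto simp: dist_real_def)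
    have "\<forall>j\<in>F. \<exists>d. \<forall>i\<in>{..<n}. hinner E (v i) (z j \<ominus> lincomb n v d) x = 0"
      unfolding lincomb_def using orthogonal_projection[OF finite_lessThan v zc] by blast
    from bchoice[OF this] obtain d where
      d: "\<forall>j\<in>F. \<forall>i\<in>{..<n}. hinner E (v i) (z j \<ominus> lincomb n v (d j)) x = 0" by blast
    define w where "w j = z j \<ominus> lincomb n v (d j)" for j
    have wc: "w j \<in> carrier E" if "j \<in> F" for j using zc[OF that] l by (simp add: w_def)
    have wl: "hinner E (w j) (lincomb n v a) x = 0" if j: "j \<in> F" for j a
    proof -
      have "hinner E (w j) (v i) x = 0" if "i < n" for i
      proof -
        have "v i \<in> carrier E" using v that by auto
        from hinner_commute[OF this wc[OF j], of x] show ?thesis using d j that by (simp add: w_def)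
      qed
      then show ?thesis by (simp add: hinner_lincomb_right[OF v wc[OF j]])
    qed
    \<comment> \<open>\<open>\<eta> i\<close> and \<open>w i\<close> differ by combinations of the
      \<open>v i\<close>, to which \<open>w j\<close> is orthogonal at \<open>x\<close>. Hence the
      expansion of \<open>z j\<close> in the frame, paired with \<open>w j\<close>, involves only
      the \<open>w i\<close>: the system closes up.\<close>
    have w\<eta>: "hinner E (w j) (\<eta> i) x = hinner E (w j) (w i) x" if j: "j \<in> F" and i: "i \<in> F" for i j
    proof -
      have "hinner E (w j) (w i) x = hinner E (w j) (z i) x"
        unfolding w_def[of i] using hinner_diff_right[OF wc[OF j] zc[OF i] l] wl[OF j] by simp
      also have "\<dots> = hinner E (w j) (\<eta> i) x"
        unfolding z_def using hinner_diff_right[OF wc[OF j] \<eta>c[OF i] l] wl[OF j] by simp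
      finally show ?thesis by simp
    qed
    define t where "t j = pnorm E (w j) x" for j
    have t0: "0 \<le> t j" if "j \<in> F" for j unfolding t_def using wc[OF that] by simp
    define \<tau> where "\<tau> = (\<Sum>j\<in>F. t j)"
    have t_le: "t j \<le> (\<Sum>i\<in>F. cmod (s i (z j) x)) * \<tau>" if j: "j \<in> F" for j
    proof -
      have "hinner E (w j) (w j) x = hinner E (w j) (z j) x"
        using hinner_diff_right[OF wc[OF j] zc[OF j] l, of "d j" x] wl[OF j] by (simp add: w_def[symmetric])
      also have "\<dots> = (\<Sum>i\<in>F. s i (z j) x * hinner E (w j) (w i) x)"
        using rec[OF wc[OF j] zc[OF j] xU] w\<eta>[OF j] by simp
      finally have eq: "complex_of_real ((t j)\<^sup>2) = (\<Sum>i\<in>F. s i (z j) x * hinner E (w j) (w i) x)"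
        using hinner_self[OF wc[OF j]] by (simp add: t_def)
      have "(t j)\<^sup>2 = cmod (complex_of_real ((t j)\<^sup>2))" by (simp only: norm_of_real) simp
      also have "\<dots> \<le> (\<Sum>i\<in>F. cmod (s i (z j) x) * (t j * \<tau>))"
        unfolding eq
      proof (intro order_trans[OF norm_sum] sum_mono)
        fix i assume i: "i \<in> F"
        have "cmod (hinner E (w j) (w i) x) \<le> t j * t i" unfolding t_def by (rule cauchy_schwarz[OF wc[OF j] wc[OF i]])
        also have "\<dots> \<le> t j * \<tau>" unfolding \<tau>_def
          by (intro mult_left_mono member_le_sum t0 j i F) (use t0 in auto)
        finally show "cmod (s i (z j) x * hinner E (w j) (w i) x) \<le> cmod (s i (z j) x) * (t j * \<tau>)"
          by (simp add: norm_mult mult_left_mono)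
      qed
      also have "\<dots> = t j * ((\<Sum>i\<in>F. cmod (s i (z j) x)) * \<tau>)" by (simp add: sum_distrib_right sum_distrib_left mult_ac)
      finally have "t j * t j \<le> t j * ((\<Sum>i\<in>F. cmod (s i (z j) x)) * \<tau>)" by (simp add: power2_eq_square)
      moreover have "0 \<le> (\<Sum>i\<in>F. cmod (s i (z j) x)) * \<tau>"
        unfolding \<tau>_def by (intro mult_nonneg_nonneg sum_nonneg t0) auto
      ultimately show ?thesis using t0[OF j] by (cases "t j = 0") auto
    qed
    \<comment> \<open>Summing the estimates gives \<open>\<tau> \<le> m x * \<tau>\<close> with
      \<open>m x < 1\<close>, which forces \<open>\<tau> = 0\<close>: nothing of the
      \<open>z j\<close> remains outside the span.\<close>
    have "\<tau> \<le> (\<Sum>j\<in>F. (\<Sum>i\<in>F. cmod (s i (z j) x)) * \<tau>)" unfolding \<tau>_def by (intro sum_mono) (use t_le \<tau>_def in simp)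
    also have "\<dots> = m x * \<tau>" unfolding m_def sum_distrib_right[symmetric] by (subst sum.swap) simp
    finally have "\<tau> * (1 - m x) \<le> 0" by (simp add: algebra_simps)
    then have "\<tau> \<le> 0" using m1 by (simp add: mult_le_0_iff)
    then have "t j = 0" if "j \<in> F" for j
      using t0 sum_nonneg_eq_0_iff[OF F, of t] sum_nonneg[of F t] that unfolding \<tau>_def by force
    then have exp: "hinner E \<zeta> (\<eta> j) x = (\<Sum>i<n. (c j i + d j i) * hinner E \<zeta> (v i) x)"
      if j: "j \<in> F" and \<zeta>: "\<zeta> \<in> carrier E" for j \<zeta>
    proof -
      have "pnorm E (z j \<ominus> lincomb n v (d j)) x = 0" using \<open>\<And>j. j \<in> F \<Longrightarrow> t j = 0\<close>[OF j] by (simp add: t_def w_def)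
      then have "hinner E \<zeta> (z j) x = hinner E \<zeta> (lincomb n v (d j)) x"
        using pnorm_diff_eq_0_iff[OF zc[OF j] l] \<zeta> by blast
      then have "hinner E \<zeta> (\<eta> j) x = hinner E \<zeta> (lincomb n v (c j)) x + hinner E \<zeta> (lincomb n v (d j)) x"
        unfolding z_def using hinner_diff_right[OF \<zeta> \<eta>c[OF j] l] by (simp add: algebra_simps)
      then show ?thesis by (simp add: hinner_lincomb_right[OF v \<zeta>] distrib_right sum.distrib)
    qed
    have "hinner E \<zeta> \<xi> x = (\<Sum>i<n. (\<Sum>j\<in>F. s j \<xi> x * (c j i + d j i)) * hinner E \<zeta> (v i) x)" if \<zeta>: "\<zeta> \<in> carrier E" for \<zeta>
    proof -
      have "hinner E \<zeta> \<xi> x = (\<Sum>j\<in>F. s j \<xi> x * (\<Sum>i<n. (c j i + d j i) * hinner E \<zeta> (v i) x))"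
        using rec[OF \<zeta> \<xi> xU] exp[OF _ \<zeta>] by simp
      also have "\<dots> = (\<Sum>i<n. (\<Sum>j\<in>F. s j \<xi> x * (c j i + d j i)) * hinner E \<zeta> (v i) x)"
        unfolding sum_distrib_left sum_distrib_right by (subst sum.swap) (simp add: mult.assoc)
      finally show ?thesis .
    qed
    then show ?thesis unfolding spans_def by (intro exI[of _ "\<lambda>i. \<Sum>j\<in>F. s j \<xi> x * (c j i + d j i)"]) blast
  qed
  then show ?thesis using W(2) WU by blast
qed

text \<open>Choose a spanning subfamily of least cardinality. A relation with a nonzero coefficient
  at \<open>b0\<close> would allow \<open>b0\<close> to be eliminated, contradicting
  minimality.\<close>

lemma minimal_spanning_independent:
  fixes F :: "'i set"
  assumes F: "finite F" and \<eta>: "\<eta> \<in> F \<rightarrow> carrier E"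
  shows "\<exists>B\<subseteq>F. (\<forall>j\<in>F. spans B \<eta> x (\<eta> j)) \<and>
    (\<forall>a. (\<forall>\<zeta>\<in>carrier E. (\<Sum>b\<in>B. a b * hinner E \<zeta> (\<eta> b) x) = 0) \<longrightarrow> (\<forall>b\<in>B. a b = 0))"
proof -
  let ?P = "\<lambda>B. B \<subseteq> F \<and> (\<forall>j\<in>F. spans B \<eta> x (\<eta> j))"
  have "spans F \<eta> x (\<eta> j)" if "j \<in> F" for j
    unfolding spans_def
  proof (intro exI[of _ "\<lambda>b. if b = j then 1 else 0"] ballI)
    fix \<zeta>
    have "(\<Sum>b\<in>F. (if b = j then 1 else 0) * hinner E \<zeta> (\<eta> b) x) = (\<Sum>b\<in>F. if b = j then hinner E \<zeta> (\<eta> b) x else 0)"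
      by (intro sum.cong) auto
    then show "hinner E \<zeta> (\<eta> j) x = (\<Sum>b\<in>F. (if b = j then 1 else 0) * hinner E \<zeta> (\<eta> b) x)" using F that by simp
  qed
  then have "?P F" by blast
  from ex_has_least_nat[of ?P, OF this, of card] obtain B where B: "?P B" and min: "\<And>B'. ?P B' \<Longrightarrow> card B \<le> card B'"
    by blast
  have finB: "finite B" using B F finite_subset by blast
  have "a b0 = 0" if a: "\<forall>\<zeta>\<in>carrier E. (\<Sum>b\<in>B. a b * hinner E \<zeta> (\<eta> b) x) = 0" and b0: "b0 \<in> B" for a b0
  proof (rule ccontr)
    assume nz: "a b0 \<noteq> 0"
    have "spans (B - {b0}) \<eta> x (\<eta> j)" if j: "j \<in> F" for j
    proof -
      obtain c where c: "\<forall>\<zeta>\<in>carrier E. hinner E \<zeta> (\<eta> j) x = (\<Sum>b\<in>B. c b * hinner E \<zeta> (\<eta> b) x)"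
        using B j unfolding spans_def by blast
      \<comment> \<open>The multiple \<open>c b0 / a b0\<close> of the relation is subtracted, which
        cancels the coefficient of \<open>b0\<close>.\<close>
      have "hinner E \<zeta> (\<eta> j) x = (\<Sum>b\<in>B - {b0}. (c b - c b0 / a b0 * a b) * hinner E \<zeta> (\<eta> b) x)"
        if \<zeta>: "\<zeta> \<in> carrier E" for \<zeta>
      proof -
        have "hinner E \<zeta> (\<eta> j) x = (\<Sum>b\<in>B. c b * hinner E \<zeta> (\<eta> b) x) - c b0 / a b0 * (\<Sum>b\<in>B. a b * hinner E \<zeta> (\<eta> b) x)"
          using c a \<zeta> by simp
        also have "\<dots> = (\<Sum>b\<in>B. (c b - c b0 / a b0 * a b) * hinner E \<zeta> (\<eta> b) x)"
          by (simp add: sum_distrib_left sum_subtractf left_diff_distrib mult.assoc)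
        also have "\<dots> = (\<Sum>b\<in>B - {b0}. (c b - c b0 / a b0 * a b) * hinner E \<zeta> (\<eta> b) x)"
          using nz by (subst sum.remove[OF finB b0]) simp
        finally show ?thesis .
      qed
      then show ?thesis unfolding spans_def by (intro exI[of _ "\<lambda>b. c b - c b0 / a b0 * a b"]) blast
    qed
    then have "card B \<le> card (B - {b0})" using B by (intro min) blast
    then show False using finB b0 by (meson card_Diff1_less leD)
  qed
  then show ?thesis using B by blast
qed

text \<open>Independence is delivered in the quantitative form with \<open>\<delta>\<close>, because
  the trivialization needs coordinates that are not only unique but also continuous over a whole
  neighbourhood.\<close>

lemma local_frame:
  assumes x0: "x0 \<in> topspace X"
  shows "\<exists>n v W \<delta>. n \<ge> 1 \<and> v \<in> {..<n} \<rightarrow> carrier E \<and> openin X W \<and> x0 \<in> W \<and> \<delta> > 0 \<and>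
    (\<forall>x\<in>W. \<forall>a. \<delta> * (\<Sum>i<n. (cmod (a i))\<^sup>2) \<le> (pnorm E (lincomb n v a) x)\<^sup>2) \<and>
    (\<forall>x\<in>W. \<forall>\<xi>\<in>carrier E. spans {..<n} v x \<xi>)"
proof -
  have "neighbourhood_base_of (\<lambda>C. compactin X C \<and> closedin X C) X"
    using locally_compact Hausdorff locally_compact_space_neighbourhood_base_closedin by blast
  \<comment> \<open>The hypotheses speak about compact sets while local triviality asks for an open
    one; the frame is taken over \<open>K\<close> and used on \<open>U\<close>.\<close>
  then obtain U K where U: "openin X U" "x0 \<in> U" "U \<subseteq> K" and K: "compactin X K"
    using x0 openin_topspace unfolding neighbourhood_base_of by meson
  interpret R: hilbert_module_restriction X E K
    by unfold_locales (rule locally_compact Hausdorff K)+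
  obtain F :: "'e set set" and \<eta> s where F: "finite F" and \<eta>: "\<eta> \<in> F \<rightarrow> carrier E"
    and s_cont: "\<forall>i\<in>F. \<forall>\<zeta>\<in>carrier E. continuous_map (subtopology X K) euclidean (s i \<zeta>)"
    and s_null: "\<forall>i\<in>F. \<forall>\<zeta>\<in>carrier E. \<forall>x\<in>K. pnorm E \<zeta> x = 0 \<longrightarrow> s i \<zeta> x = 0"
    and rec: "\<forall>\<xi>\<in>carrier E. \<forall>\<zeta>\<in>carrier E. \<forall>x\<in>K. hinner E \<xi> \<zeta> x = (\<Sum>i\<in>F. s i \<zeta> x * hinner E \<xi> (\<eta> i) x)"
    using R.finitely_generated_projective_imp_frame sigma_fg sigma_projective K
    unfolding sigma_finitely_generated_def sigma_projective_def by blast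
  obtain B where B: "B \<subseteq> F" and spB: "\<forall>j\<in>F. spans B \<eta> x0 (\<eta> j)"
    and ind: "\<forall>a. (\<forall>\<zeta>\<in>carrier E. (\<Sum>b\<in>B. a b * hinner E \<zeta> (\<eta> b) x0) = 0) \<longrightarrow> (\<forall>b\<in>B. a b = 0)"
    using minimal_spanning_independent[OF F \<eta>, of x0] by blast
  have finB: "finite B" using B F finite_subset by blast
  define n where "n = card B"
  obtain h where h: "bij_betw h {..<n} B"
    using ex_bij_betw_nat_finite[OF finB] unfolding n_def atLeast0LessThan by blast
  define v where "v i = \<eta> (h i)" for i
  have v: "v \<in> {..<n} \<rightarrow> carrier E"
  proof
    fix i assume "i \<in> {..<n}"
    then have "h i \<in> F" using bij_betwE[OF h] B by blast
    then show "v i \<in> carrier E" using \<eta> by (auto simp: v_def)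
  qed
  have reindex: "(\<Sum>b\<in>B. c b * hinner E \<zeta> (\<eta> b) x) = (\<Sum>i<n. c (h i) * hinner E \<zeta> (v i) x)" for c \<zeta> x
    unfolding v_def by (rule sum.reindex_bij_betw[OF h, symmetric])
  have sp: "spans {..<n} v x0 (\<eta> j)" if "j \<in> F" for j
  proof -
    obtain c where "\<forall>\<zeta>\<in>carrier E. hinner E \<zeta> (\<eta> j) x0 = (\<Sum>b\<in>B. c b * hinner E \<zeta> (\<eta> b) x0)"
      using spB \<open>j \<in> F\<close> unfolding spans_def by blast
    then show ?thesis unfolding spans_def reindex by (intro exI[of _ "\<lambda>i. c (h i)"])
  qed
  obtain W1 where W1: "openin X W1" "x0 \<in> W1" "W1 \<subseteq> U" "\<forall>x\<in>W1. \<forall>\<xi>\<in>carrier E. spans {..<n} v x \<xi>"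
  proof -
    have "\<exists>W. openin X W \<and> x0 \<in> W \<and> W \<subseteq> U \<and> (\<forall>x\<in>W. \<forall>\<xi>\<in>carrier E. spans {..<n} v x \<xi>)"
    proof (rule local_spanning[OF F \<eta> v U(1,2)])
      show "continuous_map (subtopology X U) euclidean (s i \<zeta>)" if "i \<in> F" "\<zeta> \<in> carrier E" for i \<zeta>
        by (rule continuous_map_from_subtopology_mono[OF _ U(3)]) (use s_cont that in blast)
      show "s i \<zeta> x0 = 0" if "i \<in> F" "\<zeta> \<in> carrier E" "pnorm E \<zeta> x0 = 0" for i \<zeta>
        using s_null that U by blast
      show "hinner E \<xi> \<zeta> x = (\<Sum>i\<in>F. s i \<zeta> x * hinner E \<xi> (\<eta> i) x)"
        if "\<xi> \<in> carrier E" "\<zeta> \<in> carrier E" "x \<in> U" for \<xi> \<zeta> x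
        using rec that U(3) by blast
    qed (rule sp)
    then show ?thesis using that by blast
  qed
  define G where "G i j = hinner E (v i) (v j)" for i j
  have Gc: "continuous_map (subtopology X W1) euclidean (G i j)" if "i < n" "j < n" for i j
  proof -
    have "hinner E (v i) (v j) \<in> C0 X" using v that by (intro hinner_closed) auto
    then show ?thesis by (simp add: C0_def G_def continuous_map_from_subtopology)
  qed
  have Gp: "0 < Re (sesq n (\<lambda>i j. G i j x0) a)" if a: "\<exists>i<n. a i \<noteq> 0" for a
  proof (rule ccontr)
    assume "\<not> 0 < Re (sesq n (\<lambda>i j. G i j x0) a)"
    then have "(pnorm E (lincomb n v a) x0)\<^sup>2 \<le> 0" unfolding pnorm_lincomb[OF v] G_def by simp
    then have p0: "pnorm E (lincomb n v a) x0 = 0" by simp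
    \<comment> \<open>Independence is known for the family indexed by \<open>B\<close>, so the
      coefficients are carried back along the enumeration \<open>h\<close>.\<close>
    define a' where "a' b = a (inv_into {..<n} h b)" for b
    have a'h: "a' (h i) = a i" if "i < n" for i
      using h that by (simp add: a'_def bij_betw_def)
    have "(\<Sum>b\<in>B. a' b * hinner E \<zeta> (\<eta> b) x0) = 0" if \<zeta>: "\<zeta> \<in> carrier E" for \<zeta>
    proof -
      have "(\<Sum>b\<in>B. a' b * hinner E \<zeta> (\<eta> b) x0) = hinner E \<zeta> (lincomb n v a) x0"
        unfolding reindex hinner_lincomb_right[OF v \<zeta>] by (intro sum.cong) (auto simp: a'h)
      then show ?thesis using cauchy_schwarz[OF \<zeta> lincomb_carrier[OF v], of a x0] p0 by simp
    qed
    then have "\<forall>b\<in>B. a' b = 0" using ind by blast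
    then have "a i = 0" if "i < n" for i using a'h[OF that] bij_betwE[OF h] that by (metis lessThan_iff)
    then show False using a by blast
  qed
  obtain W \<delta> where W: "openin X W" "x0 \<in> W" "W \<subseteq> W1" "\<delta> > 0"
      "\<forall>x\<in>W. \<forall>a. \<delta> * (\<Sum>i<n. (cmod (a i))\<^sup>2) \<le> Re (sesq n (\<lambda>i j. G i j x) a)"
    using posdef_lower_bound_nbhd[OF W1(1,2) Gc Gp] by blast
  \<comment> \<open>This is where fullness enters. If \<open>n = 0\<close>, every pairing vanishes
    at \<open>x0\<close>; but a bump function with value \<open>1\<close> there is within
    \<open>1/2\<close> of a combination of pairings.\<close>
  have n1: "n \<ge> 1"
  proof (rule ccontr)
    assume "\<not> n \<ge> 1"
    then have n: "n = 0" by simp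
    have z: "hinner E \<zeta> \<xi> x0 = 0" if "\<zeta> \<in> carrier E" "\<xi> \<in> carrier E" for \<zeta> \<xi>
    proof -
      have "spans {..<n} v x0 \<xi>" using W1(2,4) that by blast
      then show ?thesis using that unfolding spans_def n by simp
    qed
    obtain f L where f: "continuous_map X euclidean (f :: 'a \<Rightarrow> real)" "f x0 = 1" "compactin X L" "\<forall>y. y \<notin> L \<longrightarrow> f y = 0"
      using bump_function[OF locally_compact Hausdorff openin_topspace x0] by blast
    have fC: "(\<lambda>x. complex_of_real (f x)) \<in> C0 X"
      by (rule C0_compact_support[OF continuous_map_of_real[OF f(1)] f(3)]) (use f(4) in simp)
    have half: "(1/2::real) > 0" by simp
    obtain k :: nat and c \<xi> \<zeta> where k: "\<forall>i<k. \<xi> i \<in> carrier E \<and> \<zeta> i \<in> carrier E"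
      "sup_norm (\<lambda>x. complex_of_real (f x) - (\<Sum>i<k. c i * hinner E (\<xi> i) (\<zeta> i) x)) < 1/2"
      using full[unfolded full_def, rule_format, OF fC half] by blast
    have "(\<lambda>x. complex_of_real (f x) - (\<Sum>i<k. c i * hinner E (\<xi> i) (\<zeta> i) x)) \<in> C0 X"
      by (intro C0_diff fC C0_sum C0_cmult hinner_closed) (use k in auto)
    from norm_le_sup_norm[OF this, of x0] k(2)
    have "cmod (complex_of_real (f x0) - (\<Sum>i<k. c i * hinner E (\<xi> i) (\<zeta> i) x0)) < 1/2" by linarith
    moreover have "(\<Sum>i<k. c i * hinner E (\<xi> i) (\<zeta> i) x0) = 0" using z k by simp
    ultimately show False using f(2) by simp
  qed
  have "\<forall>x\<in>W. \<forall>a. \<delta> * (\<Sum>i<n. (cmod (a i))\<^sup>2) \<le> (pnorm E (lincomb n v a) x)\<^sup>2"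
    using W(5) unfolding pnorm_lincomb[OF v] G_def .
  then show ?thesis using n1 v W(1-4) W1(4)
    by (intro exI[of _ n] exI[of _ v] exI[of _ W] exI[of _ \<delta>] conjI) blast+
qed

end

section \<open>The vector bundle of a module\<close>

context full_sigma_module
begin

text \<open>
  The fibre over \<open>x\<close> is the quotient of \<open>E\<close> by \<open>E C\<^sub>0(X - {x})\<close>, which by the factorization
  consists of the elements with \<open>pnorm E \<xi> x = 0\<close>; \<open>cls x \<xi>\<close> is the class of \<open>\<xi>\<close> in it.
\<close>

definition cls :: "'a \<Rightarrow> 'e \<Rightarrow> 'a \<times> 'e set" where
  "cls x \<xi> = (x, {\<eta> \<in> carrier E. pnorm E (\<eta> \<ominus> \<xi>) x = 0})"

definition rep :: "'a \<times> 'e set \<Rightarrow> 'e" where "rep p = (SOME \<xi>. \<xi> \<in> snd p)"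

definition points :: "('a \<times> 'e set) set" where
  "points = {cls x \<xi> | x \<xi>. x \<in> topspace X \<and> \<xi> \<in> carrier E}"

text \<open>Distances in different fibres are compared by transporting a point along an element
  \<open>\<xi>\<close> of \<open>E\<close> that represents it. A set is open if around each of its
  points it contains a tube: the points over a neighbourhood whose fibre distance to
  \<open>\<xi>\<close> is below a fixed \<open>e\<close>.\<close>

definition open_set :: "('a \<times> 'e set) set \<Rightarrow> bool" where
  "open_set O' \<longleftrightarrow> O' \<subseteq> points \<and> (\<forall>x\<in>topspace X. \<forall>\<xi>\<in>carrier E. cls x \<xi> \<in> O' \<longrightarrow>
     (\<exists>U e. openin X U \<and> x \<in> U \<and> e > 0 \<and> (\<forall>y\<in>U. \<forall>\<eta>\<in>carrier E. pnorm E (\<eta> \<ominus> \<xi>) y < e \<longrightarrow> cls y \<eta> \<in> O')))"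

definition module_bundle :: "('a, 'a \<times> 'e set) vbundle" where
  "module_bundle = \<lparr>total = topology open_set, proj = fst,
     vadd = (\<lambda>p q. cls (fst p) (rep p \<oplus> rep q)), vzero = (\<lambda>x. cls x \<zero>),
     vscale = (\<lambda>c p. cls (fst p) (cscale E c (rep p)))\<rparr>"

definition module_metric :: "'a \<times> 'e set \<Rightarrow> 'a \<times> 'e set \<Rightarrow> complex" where
  "module_metric p q = hinner E (rep p) (rep q) (fst p)"

section \<open>Classes at a point and the operations on them\<close>

lemma fst_cls [simp]: "fst (cls x \<xi>) = x"
  by (simp add: cls_def)

lemma cls_eqI:
  assumes "\<xi> \<in> carrier E" "\<eta> \<in> carrier E" "\<And>\<zeta>. \<zeta> \<in> carrier E \<Longrightarrow> hinner E \<zeta> \<xi> x = hinner E \<zeta> \<eta> x"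
  shows "cls x \<xi> = cls x \<eta>"
proof -
  have "pnorm E (\<omega> \<ominus> \<xi>) x = 0 \<longleftrightarrow> pnorm E (\<omega> \<ominus> \<eta>) x = 0" if "\<omega> \<in> carrier E" for \<omega>
    using pnorm_diff_eq_0_iff[OF that assms(1)] pnorm_diff_eq_0_iff[OF that assms(2)] assms(3) by simp
  then show ?thesis unfolding cls_def by blast
qed

lemma self_mem_cls: "\<xi> \<in> carrier E \<Longrightarrow> \<xi> \<in> snd (cls x \<xi>)"
  using pnorm_diff_eq_0_iff[of \<xi> \<xi>] by (simp add: cls_def)

lemma cls_eqD:
  assumes "\<xi> \<in> carrier E" "\<eta> \<in> carrier E" "cls x \<xi> = cls y \<eta>"
  shows "x = y" "pnorm E (\<xi> \<ominus> \<eta>) x = 0"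
proof -
  show "x = y" using assms(3) by (simp add: cls_def)
  then have "\<xi> \<in> snd (cls x \<eta>)" using self_mem_cls[OF assms(1), of x] assms(3) by simp
  then show "pnorm E (\<xi> \<ominus> \<eta>) x = 0" by (simp add: cls_def)
qed

lemma cls_eq_iff:
  assumes "\<xi> \<in> carrier E" "\<eta> \<in> carrier E"
  shows "cls x \<xi> = cls x \<eta> \<longleftrightarrow> pnorm E (\<xi> \<ominus> \<eta>) x = 0"
  using cls_eqD(2)[OF assms] cls_eqI[OF assms] pnorm_diff_eq_0_iff[OF assms] by blast

lemma rep_cls:
  assumes "\<xi> \<in> carrier E" shows "rep (cls x \<xi>) \<in> carrier E" "cls x (rep (cls x \<xi>)) = cls x \<xi>"
proof -
  have "rep (cls x \<xi>) \<in> snd (cls x \<xi>)" unfolding rep_def using self_mem_cls[OF assms] by (rule someI)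
  then have r: "rep (cls x \<xi>) \<in> carrier E" "pnorm E (rep (cls x \<xi>) \<ominus> \<xi>) x = 0" by (simp_all add: cls_def)
  show "rep (cls x \<xi>) \<in> carrier E" by (rule r(1))
  show "cls x (rep (cls x \<xi>)) = cls x \<xi>" using r assms cls_eq_iff by blast
qed

lemma hinner_rep_right:
  assumes "\<xi> \<in> carrier E" "\<zeta> \<in> carrier E" shows "hinner E \<zeta> (rep (cls x \<xi>)) x = hinner E \<zeta> \<xi> x"
  using pnorm_diff_eq_0_iff[OF rep_cls(1)[OF assms(1)] assms(1)] cls_eq_iff[OF rep_cls(1)[OF assms(1)] assms(1)]
    rep_cls(2)[OF assms(1)] assms(2) by blast

lemma hinner_rep_left:
  assumes "\<xi> \<in> carrier E" "\<zeta> \<in> carrier E" shows "hinner E (rep (cls x \<xi>)) \<zeta> x = hinner E \<xi> \<zeta> x"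
  using hinner_rep_right[OF assms, of x] hinner_commute[OF assms(2) rep_cls(1)[OF assms(1)], of x x]
    hinner_commute[OF assms(2,1), of x] by simp

lemma module_metric_cls:
  assumes "\<xi> \<in> carrier E" "\<eta> \<in> carrier E" shows "module_metric (cls x \<xi>) (cls x \<eta>) = hinner E \<xi> \<eta> x"
  using hinner_rep_right[OF assms(2) rep_cls(1)[OF assms(1)]] hinner_rep_left[OF assms]
  by (simp add: module_metric_def)

text \<open>At \<open>x\<close> the chosen representatives have the same pairings as
  \<open>\<xi>\<close> and \<open>\<eta>\<close>, so the choice in \<open>rep\<close> does not
  affect the class of the sum.\<close>

lemma vadd_cls:
  assumes "\<xi> \<in> carrier E" "\<eta> \<in> carrier E"
  shows "vadd module_bundle (cls x \<xi>) (cls x \<eta>) = cls x (\<xi> \<oplus> \<eta>)"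
  unfolding module_bundle_def using assms rep_cls(1)
  by (auto intro!: cls_eqI simp: hinner_add hinner_rep_right)

lemma vscale_cls:
  assumes "\<xi> \<in> carrier E" shows "vscale module_bundle c (cls x \<xi>) = cls x (cscale E c \<xi>)"
  unfolding module_bundle_def using assms rep_cls(1)
  by (auto intro!: cls_eqI simp: hinner_cscale hinner_rep_right)

lemma vzero_module [simp]: "vzero module_bundle x = cls x \<zero>" and proj_module [simp]: "proj module_bundle = fst"
  by (simp_all add: module_bundle_def)

section \<open>The topology of the total space\<close>

lemma istopology_open_set: "istopology open_set"
  unfolding istopology_def
proof (intro conjI allI impI)
  fix S T assume S: "open_set S" and T: "open_set T"
  show "open_set (S \<inter> T)"
    unfolding open_set_def
  proof (intro conjI ballI impI)
    show "S \<inter> T \<subseteq> points" using S by (auto simp: open_set_def)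
    fix x \<xi> assume x: "x \<in> topspace X" "\<xi> \<in> carrier E" "cls x \<xi> \<in> S \<inter> T"
    obtain U e where U: "openin X U" "x \<in> U" "e > 0" "\<forall>y\<in>U. \<forall>\<eta>\<in>carrier E. pnorm E (\<eta> \<ominus> \<xi>) y < e \<longrightarrow> cls y \<eta> \<in> S"
      using S x unfolding open_set_def by blast
    obtain U' e' where U': "openin X U'" "x \<in> U'" "e' > 0" "\<forall>y\<in>U'. \<forall>\<eta>\<in>carrier E. pnorm E (\<eta> \<ominus> \<xi>) y < e' \<longrightarrow> cls y \<eta> \<in> T"
      using T x unfolding open_set_def by blast
    show "\<exists>U e. openin X U \<and> x \<in> U \<and> e > 0 \<and> (\<forall>y\<in>U. \<forall>\<eta>\<in>carrier E. pnorm E (\<eta> \<ominus> \<xi>) y < e \<longrightarrow> cls y \<eta> \<in> S \<inter> T)"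
      by (intro exI[of _ "U \<inter> U'"] exI[of _ "min e e'"]) (use U U' in auto)
  qed
next
  fix \<K> assume K: "\<forall>S\<in>\<K>. open_set S"
  show "open_set (\<Union>\<K>)"
    unfolding open_set_def
  proof (intro conjI ballI impI)
    show "\<Union>\<K> \<subseteq> points" using K by (auto simp: open_set_def)
    fix x \<xi> assume x: "x \<in> topspace X" "\<xi> \<in> carrier E" "cls x \<xi> \<in> \<Union>\<K>"
    then obtain S where S: "S \<in> \<K>" "cls x \<xi> \<in> S" by blast
    then have "open_set S" using K by blast
    then obtain U e where "openin X U" "x \<in> U" "e > 0" "\<forall>y\<in>U. \<forall>\<eta>\<in>carrier E. pnorm E (\<eta> \<ominus> \<xi>) y < e \<longrightarrow> cls y \<eta> \<in> S"
      using S(2) x(1,2) unfolding open_set_def by blast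
    then show "\<exists>U e. openin X U \<and> x \<in> U \<and> e > 0 \<and> (\<forall>y\<in>U. \<forall>\<eta>\<in>carrier E. pnorm E (\<eta> \<ominus> \<xi>) y < e \<longrightarrow> cls y \<eta> \<in> \<Union>\<K>)"
      using S(1) by (intro exI[of _ U] exI[of _ e]) auto
  qed
qed

lemma openin_total: "openin (total module_bundle) O' \<longleftrightarrow> open_set O'"
  by (simp add: module_bundle_def topology_inverse'[OF istopology_open_set])

lemma open_preimage_proj:
  assumes "openin X U" shows "open_set {p \<in> points. fst p \<in> U}"
  unfolding open_set_def
proof (intro conjI ballI impI)
  fix x \<xi> assume "x \<in> topspace X" "\<xi> \<in> carrier E" "cls x \<xi> \<in> {p \<in> points. fst p \<in> U}"
  then show "\<exists>U' e. openin X U' \<and> x \<in> U' \<and> e > 0 \<and>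
      (\<forall>y\<in>U'. \<forall>\<eta>\<in>carrier E. pnorm E (\<eta> \<ominus> \<xi>) y < e \<longrightarrow> cls y \<eta> \<in> {p \<in> points. fst p \<in> U})"
    using assms openin_subset[OF assms] by (intro exI[of _ U] exI[of _ 1]) (auto simp: points_def)
qed auto

lemma topspace_total [simp]: "topspace (total module_bundle) = points"
proof -
  have "{p \<in> points. fst p \<in> topspace X} = points" by (auto simp: points_def)
  then have "open_set points" using open_preimage_proj[OF openin_topspace] by simp
  moreover have "O' \<subseteq> points" if "open_set O'" for O' using that by (simp add: open_set_def)
  ultimately show ?thesis unfolding topspace_def openin_total by blast
qed

lemma proj_continuous: "continuous_map (total module_bundle) X fst"
  unfolding continuous_map_def using open_preimage_proj by (auto simp: openin_total points_def)

text \<open>The basic open sets: by \<open>openin_tube\<close> they are open, and the definition of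
  \<open>open_set\<close> places one inside every open set around each of its points.\<close>

definition tube :: "'a set \<Rightarrow> 'e \<Rightarrow> real \<Rightarrow> ('a \<times> 'e set) set" where
  "tube U \<xi> e = {cls y \<eta> | y \<eta>. y \<in> U \<and> \<eta> \<in> carrier E \<and> pnorm E (\<eta> \<ominus> \<xi>) y < e}"

lemma cls_in_tube:
  assumes "\<eta> \<in> carrier E" "\<xi> \<in> carrier E"
  shows "cls y \<eta> \<in> tube U \<xi> e \<longleftrightarrow> y \<in> U \<and> pnorm E (\<eta> \<ominus> \<xi>) y < e"
proof
  assume "cls y \<eta> \<in> tube U \<xi> e"
  then obtain z \<omega> where z: "cls y \<eta> = cls z \<omega>" "z \<in> U" "\<omega> \<in> carrier E" "pnorm E (\<omega> \<ominus> \<xi>) z < e"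
    unfolding tube_def by blast
  from cls_eqD[OF assms(1) z(3) z(1)] have "y = z" "pnorm E (\<eta> \<ominus> \<omega>) y = 0" by auto
  then show "y \<in> U \<and> pnorm E (\<eta> \<ominus> \<xi>) y < e"
    using z pnorm_triangle_diff[OF assms(1) z(3) assms(2), of y] by simp
qed (use assms in \<open>auto simp: tube_def\<close>)

lemma openin_pnorm_less:
  assumes "openin X U" "\<xi> \<in> carrier E" shows "openin X {y \<in> U. pnorm E \<xi> y < e}"
proof -
  have "openin X {y \<in> topspace X. pnorm E \<xi> y \<in> {..<e}}"
    by (rule openin_continuous_map_preimage[OF pnorm_continuous[OF assms(2)]]) simp
  then have "openin X (U \<inter> {y \<in> topspace X. pnorm E \<xi> y \<in> {..<e}})" using assms(1) by (rule openin_Int[rotated])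
  moreover have "U \<inter> {y \<in> topspace X. pnorm E \<xi> y \<in> {..<e}} = {y \<in> U. pnorm E \<xi> y < e}"
    using openin_subset[OF assms(1)] by auto
  ultimately show ?thesis by simp
qed

lemma openin_tube:
  assumes U: "openin X U" and \<xi>: "\<xi> \<in> carrier E" shows "openin (total module_bundle) (tube U \<xi> e)"
  unfolding openin_total open_set_def
proof (intro conjI ballI impI)
  show "tube U \<xi> e \<subseteq> points" using openin_subset[OF U] by (auto simp: tube_def points_def)
  fix x \<zeta> assume x: "x \<in> topspace X" and \<zeta>: "\<zeta> \<in> carrier E" and "cls x \<zeta> \<in> tube U \<xi> e"
  then have xU: "x \<in> U" "pnorm E (\<zeta> \<ominus> \<xi>) x < e" using cls_in_tube[OF \<zeta> \<xi>] by auto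
  \<comment> \<open>Half of the slack at \<open>x\<close>. One half is spent on moving the base
    point, where the seminorm of \<open>\<zeta> \<ominus> \<xi>\<close> varies continuously, the
    other on moving within the fibre.\<close>
  define d where "d = (e - pnorm E (\<zeta> \<ominus> \<xi>) x) / 2"
  have d: "d > 0" "pnorm E (\<zeta> \<ominus> \<xi>) x < e - d" using xU(2) by (auto simp: d_def field_simps)
  have "cls y \<eta> \<in> tube U \<xi> e"
    if "y \<in> {y \<in> U. pnorm E (\<zeta> \<ominus> \<xi>) y < e - d}" "\<eta> \<in> carrier E" "pnorm E (\<eta> \<ominus> \<zeta>) y < d" for y \<eta>
    using that pnorm_triangle_diff[OF that(2) \<zeta> \<xi>, of y] cls_in_tube[OF that(2) \<xi>] by auto
  then show "\<exists>U' e'. openin X U' \<and> x \<in> U' \<and> e' > 0 \<and>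
      (\<forall>y\<in>U'. \<forall>\<eta>\<in>carrier E. pnorm E (\<eta> \<ominus> \<zeta>) y < e' \<longrightarrow> cls y \<eta> \<in> tube U \<xi> e)"
    using openin_pnorm_less[OF U minus_closed[OF \<zeta> \<xi>], of "e - d"] xU d
    by (intro exI[of _ "{y \<in> U. pnorm E (\<zeta> \<ominus> \<xi>) y < e - d}"] exI[of _ d]) blast
qed

text \<open>The representing element may vary with \<open>y\<close>, but near \<open>y1\<close> it
  is compared with the fixed element \<open>\<sigma> y1\<close> in the fibre over
  \<open>b y\<close>. With varying \<open>\<sigma>\<close> this gives continuity of the inverse
  trivialization, with constant \<open>\<sigma>\<close> that of the section defined by an
  element.\<close>

lemma continuous_into_total:
  assumes b: "continuous_map Y X b" and \<sigma>: "\<And>y. y \<in> topspace Y \<Longrightarrow> \<sigma> y \<in> carrier E"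
    and app: "\<And>y1 e. y1 \<in> topspace Y \<Longrightarrow> e > 0 \<Longrightarrow>
      \<exists>N. openin Y N \<and> y1 \<in> N \<and> (\<forall>y\<in>N. pnorm E (\<sigma> y \<ominus> \<sigma> y1) (b y) < e)"
  shows "continuous_map Y (total module_bundle) (\<lambda>y. cls (b y) (\<sigma> y))"
  unfolding continuous_map_def
proof (intro conjI allI impI)
  have bX: "b y \<in> topspace X" if "y \<in> topspace Y" for y using b that by (auto simp: continuous_map_def)
  show "(\<lambda>y. cls (b y) (\<sigma> y)) \<in> topspace Y \<rightarrow> topspace (total module_bundle)"
    using bX \<sigma> by (auto simp: points_def)
  fix O' assume O': "openin (total module_bundle) O'"
  show "openin Y {y \<in> topspace Y. cls (b y) (\<sigma> y) \<in> O'}"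
  proof (subst openin_subopen, intro ballI)
    fix y1 assume "y1 \<in> {y \<in> topspace Y. cls (b y) (\<sigma> y) \<in> O'}"
    then have y1: "y1 \<in> topspace Y" "cls (b y1) (\<sigma> y1) \<in> O'" by auto
    then obtain U e where U: "openin X U" "b y1 \<in> U" "e > 0"
        "\<forall>y\<in>U. \<forall>\<eta>\<in>carrier E. pnorm E (\<eta> \<ominus> \<sigma> y1) y < e \<longrightarrow> cls y \<eta> \<in> O'"
      using O' bX[OF y1(1)] \<sigma>[OF y1(1)] unfolding openin_total open_set_def by blast
    obtain N where N: "openin Y N" "y1 \<in> N" "\<forall>y\<in>N. pnorm E (\<sigma> y \<ominus> \<sigma> y1) (b y) < e"
      using app[OF y1(1) U(3)] by blast
    have "openin Y {y \<in> topspace Y. b y \<in> U}" by (rule openin_continuous_map_preimage[OF b U(1)])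
    then have "openin Y (N \<inter> {y \<in> topspace Y. b y \<in> U})" using N(1) by (rule openin_Int[rotated])
    moreover have "y1 \<in> N \<inter> {y \<in> topspace Y. b y \<in> U}" using N(2) y1 U(2) by blast
    moreover have "N \<inter> {y \<in> topspace Y. b y \<in> U} \<subseteq> {y \<in> topspace Y. cls (b y) (\<sigma> y) \<in> O'}"
      using N(3) U(4) \<sigma> by blast
    ultimately show "\<exists>T. openin Y T \<and> y1 \<in> T \<and> T \<subseteq> {y \<in> topspace Y. cls (b y) (\<sigma> y) \<in> O'}" by blast
  qed
qed

section \<open>Fibres, metric and local triviality\<close>

lemma fiber_module_bundle:
  assumes "x \<in> topspace X" shows "fiber module_bundle x = cls x ` carrier E"
  unfolding fiber_def topspace_total points_def proj_module using assms by auto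

lemma cvector_space_fiber:
  assumes x: "x \<in> topspace X"
  shows "cvector_space (fiber module_bundle x) (vadd module_bundle) (vzero module_bundle x) (vscale module_bundle)"
  unfolding cvector_space_def fiber_module_bundle[OF x]
proof (rule moduleI[OF cring_complex_ring], goal_cases)
  case 1
  show ?case
  proof (rule abelian_groupI, goal_cases)
    case (6 p)
    then obtain \<xi> where \<xi>: "\<xi> \<in> carrier E" "p = cls x \<xi>" by auto
    then show ?case by (intro bexI[of _ "cls x (\<ominus> \<xi>)"]) (auto simp: vadd_cls l_neg)
  qed (auto simp: vadd_cls a_ac)
next
  case (2 c p) then show ?case by (auto simp: vscale_cls)
next
  case (3 c d p)
  then obtain \<xi> where \<xi>: "\<xi> \<in> carrier E" "p = cls x \<xi>" by auto
  then have "cls x (cscale E (c + d) \<xi>) = cls x (cscale E c \<xi> \<oplus> cscale E d \<xi>)"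
    by (intro cls_eqI) (auto simp: hinner_simps algebra_simps)
  then show ?case using \<xi> by (simp add: vscale_cls vadd_cls)
next
  case (4 c p q)
  then obtain \<xi> \<eta> where \<xi>: "\<xi> \<in> carrier E" "p = cls x \<xi>" "\<eta> \<in> carrier E" "q = cls x \<eta>" by auto
  then have "cls x (cscale E c (\<xi> \<oplus> \<eta>)) = cls x (cscale E c \<xi> \<oplus> cscale E c \<eta>)"
    by (intro cls_eqI) (auto simp: hinner_simps algebra_simps)
  then show ?case using \<xi> by (simp add: vscale_cls vadd_cls)
next
  case (5 c d p)
  then obtain \<xi> where \<xi>: "\<xi> \<in> carrier E" "p = cls x \<xi>" by auto
  then have "cls x (cscale E (c * d) \<xi>) = cls x (cscale E c (cscale E d \<xi>))"
    by (intro cls_eqI) (auto simp: hinner_simps algebra_simps)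
  then show ?case using \<xi> by (simp add: vscale_cls)
next
  case (6 p)
  then obtain \<xi> where \<xi>: "\<xi> \<in> carrier E" "p = cls x \<xi>" by auto
  then have "cls x (cscale E 1 \<xi>) = cls x \<xi>"
    by (intro cls_eqI) (auto simp: hinner_simps)
  then show ?case using \<xi> by (simp add: vscale_cls)
qed

lemma hermitian_metric_module: "hermitian_metric X module_bundle module_metric"
  unfolding hermitian_metric_def
proof (intro conjI)
  let ?T = "total module_bundle"
  let ?Y = "subtopology (prod_topology ?T ?T) {(v, w). proj module_bundle v = proj module_bundle w}"
  show "continuous_map ?Y euclidean (\<lambda>(v, w). module_metric v w)"
    unfolding continuous_map_eps
  proof (intro ballI allI impI)
    fix pq and e :: real assume "pq \<in> topspace ?Y" and e: "e > 0"
    then obtain p q where pq: "pq = (p, q)" "p \<in> points" "q \<in> points" "fst p = fst q" by auto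
    then obtain x \<xi> \<eta> where x: "x \<in> topspace X" and \<xi>: "\<xi> \<in> carrier E" "p = cls x \<xi>"
      and \<eta>: "\<eta> \<in> carrier E" "q = cls x \<eta>" by (auto simp: points_def)
    define A where "A = pnorm E \<xi> x + 1"
    define B where "B = pnorm E \<eta> x + 1"
    have AB: "A > 0" "B > 0" using \<xi> \<eta> by (auto simp: A_def B_def add_nonneg_pos)
    \<comment> \<open>On \<open>U\<close> the norms of \<open>\<xi>\<close> and
      \<open>\<eta>\<close> stay below \<open>A\<close> and \<open>B\<close>;
      \<open>d \<le> 1\<close> bounds the norm of a perturbed \<open>\<eta>\<close> by
      \<open>B + 1\<close>, and the other bound keeps the total error
      \<open>d * (B + 1) + A * d\<close> below \<open>e / 2\<close>. The remaining half is for
      moving the base point.\<close>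
    define d where "d = min 1 (e / (4 * (A + B + 1)))"
    have d: "d > 0" "d \<le> 1" using AB e by (auto simp: d_def)
    have "d \<le> e / (4 * (A + B + 1))" by (simp add: d_def)
    then have "d * (4 * (A + B + 1)) \<le> e" using AB by (subst (asm) pos_le_divide_eq) auto
    then have dAB: "d * (B + 1) + A * d < e / 2" using AB e d by (simp add: algebra_simps)
    have hc: "continuous_map X euclidean (hinner E \<xi> \<eta>)" using hinner_closed[OF \<xi>(1) \<eta>(1)] by (simp add: C0_def)
    have "e/2 > 0" using e by simp
    from continuous_map_eps[THEN iffD1, rule_format, OF hc x this]
    obtain U1 where U1: "openin X U1" "x \<in> U1" "\<forall>y\<in>U1. dist (hinner E \<xi> \<eta> y) (hinner E \<xi> \<eta> x) < e/2" by blast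
    define U where "U = {y \<in> {y \<in> U1. pnorm E \<xi> y < A}. pnorm E \<eta> y < B}"
    have U: "openin X U" unfolding U_def by (intro openin_pnorm_less U1 \<xi> \<eta>)
    have xU: "x \<in> U" using U1 by (simp add: U_def A_def B_def)
    define N where "N = (tube U \<xi> d \<times> tube U \<eta> d) \<inter> {(v, w). proj module_bundle v = proj module_bundle w}"
    have "openin (prod_topology ?T ?T) (tube U \<xi> d \<times> tube U \<eta> d)"
      using openin_tube[OF U \<xi>(1)] openin_tube[OF U \<eta>(1)] by (simp add: openin_prod_Times_iff)
    then have N: "openin ?Y N" unfolding N_def openin_subtopology by blast
    have "pnorm E (\<xi> \<ominus> \<xi>) x = 0" "pnorm E (\<eta> \<ominus> \<eta>) x = 0" using pnorm_diff_eq_0_iff \<xi> \<eta> by auto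
    then have "pq \<in> N" unfolding N_def pq(1) using \<xi> \<eta> xU d(1) by (simp add: cls_in_tube)
    moreover have "dist (case pq' of (v, w) \<Rightarrow> module_metric v w) (case pq of (v, w) \<Rightarrow> module_metric v w) < e"
      if pq': "pq' \<in> N" for pq'
    proof -
      obtain y \<xi>' y' \<eta>' where y: "pq' = (cls y \<xi>', cls y' \<eta>')" "\<xi>' \<in> carrier E" "\<eta>' \<in> carrier E"
        "y \<in> U" "pnorm E (\<xi>' \<ominus> \<xi>) y < d" "pnorm E (\<eta>' \<ominus> \<eta>) y' < d" "y = y'"
        using pq' unfolding N_def tube_def by auto
      have "hinner E \<xi>' \<eta>' y - hinner E \<xi> \<eta> y = hinner E (\<xi>' \<ominus> \<xi>) \<eta>' y + hinner E \<xi> (\<eta>' \<ominus> \<eta>) y"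
        using y \<xi> \<eta> by (simp add: hinner_diff_left hinner_diff_right)
      then have "cmod (hinner E \<xi>' \<eta>' y - hinner E \<xi> \<eta> y)
          \<le> pnorm E (\<xi>' \<ominus> \<xi>) y * pnorm E \<eta>' y + pnorm E \<xi> y * pnorm E (\<eta>' \<ominus> \<eta>) y"
        using cauchy_schwarz[of "\<xi>' \<ominus> \<xi>" \<eta>' y] cauchy_schwarz[of \<xi> "\<eta>' \<ominus> \<eta>" y] y \<xi> \<eta>
          norm_triangle_ineq[of "hinner E (\<xi>' \<ominus> \<xi>) \<eta>' y" "hinner E \<xi> (\<eta>' \<ominus> \<eta>) y"] by simp
      also have "\<dots> \<le> d * (B + 1) + A * d"
      proof (intro add_mono mult_mono)
        show "pnorm E \<eta>' y \<le> B + 1"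
          using pnorm_le_add_diff[OF y(3) \<eta>(1), of y] y d(2) by (simp add: U_def)
      qed (use y \<xi> \<eta> AB d in \<open>auto simp: U_def\<close>)
      also have "\<dots> < e/2" by (rule dAB)
      finally have "cmod (hinner E \<xi>' \<eta>' y - hinner E \<xi> \<eta> y) < e/2" .
      moreover have "cmod (hinner E \<xi> \<eta> y - hinner E \<xi> \<eta> x) < e/2" using U1(3) y(4) by (simp add: U_def dist_norm)
      ultimately have "cmod (hinner E \<xi>' \<eta>' y - hinner E \<xi> \<eta> x) < e"
        using norm_triangle_ineq[of "hinner E \<xi>' \<eta>' y - hinner E \<xi> \<eta> y" "hinner E \<xi> \<eta> y - hinner E \<xi> \<eta> x"] by simp
      then show ?thesis using y \<xi> \<eta> pq(1) by (simp add: module_metric_cls dist_norm)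
    qed
    ultimately show "\<exists>U. openin ?Y U \<and> pq \<in> U \<and>
        (\<forall>y\<in>U. dist (case y of (v, w) \<Rightarrow> module_metric v w) (case pq of (v, w) \<Rightarrow> module_metric v w) < e)"
      using N by blast
  qed
  show "\<forall>x\<in>topspace X. \<forall>u\<in>fiber module_bundle x. \<forall>v\<in>fiber module_bundle x. \<forall>w\<in>fiber module_bundle x. \<forall>c.
        module_metric u (vadd module_bundle v w) = module_metric u v + module_metric u w \<and>
        module_metric u (vscale module_bundle c v) = c * module_metric u v \<and>
        module_metric v u = cnj (module_metric u v)"
  proof (intro ballI allI)
    fix x u v w c assume x: "x \<in> topspace X"
      and "u \<in> fiber module_bundle x" "v \<in> fiber module_bundle x" "w \<in> fiber module_bundle x"
    then obtain \<xi> \<eta> \<zeta> where "\<xi> \<in> carrier E" "u = cls x \<xi>" "\<eta> \<in> carrier E" "v = cls x \<eta>"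
      "\<zeta> \<in> carrier E" "w = cls x \<zeta>" unfolding fiber_module_bundle[OF x] by blast
    then show "module_metric u (vadd module_bundle v w) = module_metric u v + module_metric u w \<and>
        module_metric u (vscale module_bundle c v) = c * module_metric u v \<and>
        module_metric v u = cnj (module_metric u v)"
      using hinner_commute[of \<xi> \<eta> x] by (simp add: vadd_cls vscale_cls module_metric_cls hinner_add hinner_cscale)
  qed
  show "\<forall>x\<in>topspace X. \<forall>v\<in>fiber module_bundle x. v \<noteq> vzero module_bundle x \<longrightarrow>
      module_metric v v \<in> \<real> \<and> 0 < Re (module_metric v v)"
  proof (intro ballI impI)
    fix x v assume x: "x \<in> topspace X" and "v \<in> fiber module_bundle x" and v0: "v \<noteq> vzero module_bundle x"
    then obtain \<xi> where \<xi>: "\<xi> \<in> carrier E" "v = cls x \<xi>" unfolding fiber_module_bundle[OF x] by blast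
    have "pnorm E \<xi> x \<noteq> 0"
    proof
      assume "pnorm E \<xi> x = 0"
      moreover have "\<xi> \<ominus> \<zero> = \<xi>" using \<xi>(1) by (intro hinner_ext) (simp_all add: hinner_simps)
      ultimately have "cls x \<xi> = cls x \<zero>" using cls_eq_iff[OF \<xi>(1) zero_closed] by simp
      then show False using v0 \<xi>(2) by simp
    qed
    then show "module_metric v v \<in> \<real> \<and> 0 < Re (module_metric v v)"
      unfolding \<xi>(2) module_metric_cls[OF \<xi>(1) \<xi>(1)] hinner_self[OF \<xi>(1)] by simp
  qed
qed

lemma lincomb_diff:
  assumes v: "v \<in> {..<n} \<rightarrow> carrier E"
  shows "lincomb n v a \<ominus> lincomb n v b = lincomb n v (\<lambda>i. a i - b i)"
  by (rule hinner_ext) (use lincomb_carrier[OF v] in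
    \<open>auto simp: hinner_diff_right hinner_lincomb_right[OF v] left_diff_distrib sum_subtractf\<close>)

text \<open>Spanning provides coordinates and the lower bound makes them unique. The same bound
  shows that they depend on the class in a Lipschitz manner with constant
  \<open>1 / sqrt \<delta>\<close>, which is the continuity of the trivialization.\<close>

lemma local_trivialization_module:
  assumes v: "v \<in> {..<n} \<rightarrow> carrier E" and W: "openin X W" and \<delta>: "\<delta> > 0"
    and low: "\<forall>x\<in>W. \<forall>a. \<delta> * (\<Sum>i<n. (cmod (a i))\<^sup>2) \<le> (pnorm E (lincomb n v a) x)\<^sup>2"
    and sp: "\<forall>x\<in>W. \<forall>\<xi>\<in>carrier E. spans {..<n} v x \<xi>"
  shows "\<exists>\<phi>. local_trivialization X module_bundle W n \<phi>"
proof -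
  note l = lincomb_carrier[OF v]
  have WX: "W \<subseteq> topspace X" by (rule openin_subset[OF W])
  let ?Z = "subtopology (total module_bundle) {p. proj module_bundle p \<in> W}"
  let ?Y = "prod_topology (subtopology X W) (complex_space n)"
  \<comment> \<open>Some coefficient vector of \<open>p\<close>, cut down to a point of
    \<open>complex_space n\<close>; \<open>uniq\<close> shows that over \<open>W\<close> there is
    only one below \<open>n\<close>.\<close>
  define co where "co p = (\<lambda>i\<in>{..<n}. (SOME a. cls (fst p) (lincomb n v a) = p) i)" for p
  have co_ext: "co p \<in> extensional {..<n}" for p by (simp add: co_def)
  have lin_co: "lincomb n v (restrict a {..<n}) = lincomb n v a" for a
    by (rule hinner_ext[OF l l]) (simp add: hinner_lincomb_right[OF v])
  have co: "cls x (lincomb n v (co (cls x \<xi>))) = cls x \<xi>" if x: "x \<in> W" and \<xi>: "\<xi> \<in> carrier E" for x \<xi>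
  proof -
    obtain a where "\<forall>\<zeta>\<in>carrier E. hinner E \<zeta> \<xi> x = (\<Sum>i<n. a i * hinner E \<zeta> (v i) x)"
      using sp x \<xi> unfolding spans_def by blast
    then have "cls x (lincomb n v a) = cls x \<xi>"
      using \<xi> l by (intro cls_eqI) (auto simp: hinner_lincomb_right[OF v])
    then have "\<exists>a. cls (fst (cls x \<xi>)) (lincomb n v a) = cls x \<xi>" by auto
    from someI_ex[OF this] show ?thesis unfolding co_def lin_co by simp
  qed
  have low1: "sqrt \<delta> * cmod (a i - b i) \<le> pnorm E (lincomb n v a \<ominus> lincomb n v b) x"
    if x: "x \<in> W" and i: "i < n" for x a b i
  proof -
    have "\<delta> * (cmod (a i - b i))\<^sup>2 \<le> \<delta> * (\<Sum>i<n. (cmod (a i - b i))\<^sup>2)"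
      using \<delta> i by (intro mult_left_mono member_le_sum) auto
    also have "\<dots> \<le> (pnorm E (lincomb n v a \<ominus> lincomb n v b) x)\<^sup>2"
      unfolding lincomb_diff[OF v] by (rule low[rule_format, OF x])
    finally have "sqrt (\<delta> * (cmod (a i - b i))\<^sup>2) \<le> pnorm E (lincomb n v a \<ominus> lincomb n v b) x"
      using l by (intro real_le_lsqrt) auto
    then show ?thesis by (simp add: real_sqrt_mult)
  qed
  have uniq: "a i = b i" if x: "x \<in> W" and eq: "cls x (lincomb n v a) = cls x (lincomb n v b)" and i: "i < n" for x a b i
    using low1[OF x i, of a b] cls_eqD(2)[OF l l eq] \<delta> by (simp add: mult_le_0_iff)
  have points_W: "\<exists>x \<xi>. p = cls x \<xi> \<and> x \<in> W \<and> \<xi> \<in> carrier E" if "p \<in> topspace ?Z" for p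
  proof -
    have "p \<in> points" "fst p \<in> W" using that by auto
    then obtain x \<xi> where "p = cls x \<xi>" "\<xi> \<in> carrier E" unfolding points_def by blast
    then show ?thesis using \<open>fst p \<in> W\<close> by (intro exI[of _ x] exI[of _ \<xi>]) simp
  qed
  define \<phi> where "\<phi> p = (fst p, co p)" for p
  define \<psi> where "\<psi> q = cls (fst q) (lincomb n v (snd q))" for q
  have topY: "topspace ?Y = W \<times> extensional {..<n}"
    using WX by (auto simp: complex_space_def PiE_def)
  have contproj: "continuous_map ?Y euclidean (\<lambda>y. snd y i)" if "i < n" for i
  proof -
    have "continuous_map (complex_space n) euclidean (\<lambda>a. a i)"
      unfolding complex_space_def using continuous_map_product_projection[of i "{..<n}" "\<lambda>_. euclidean"] that by simp
    from continuous_map_compose[OF continuous_map_snd this] show ?thesis by (simp add: o_def)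
  qed
  have fstY: "continuous_map ?Y X fst"
    by (rule continuous_map_into_fulltopology[OF continuous_map_fst])
  have cont\<psi>: "continuous_map ?Y (total module_bundle) \<psi>"
    unfolding \<psi>_def
  proof (rule continuous_into_total[OF fstY])
    show "lincomb n v (snd y) \<in> carrier E" for y by (rule l)
    fix y1 and e :: real assume y1: "y1 \<in> topspace ?Y" and e: "e > 0"
    define g where "g y = (\<Sum>i<n. cmod (snd y i - snd y1 i) * pnorm E (v i) (fst y))" for y
    have "continuous_map ?Y euclidean (\<lambda>y. pnorm E (v i) (fst y))" if "i < n" for i
    proof -
      have "v i \<in> carrier E" using v that by auto
      from continuous_map_compose[OF fstY pnorm_continuous[OF this]] show ?thesis by (simp add: o_def)
    qed
    then have "continuous_map ?Y euclidean g" unfolding g_def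
      by (intro continuous_map_sum continuous_map_mult continuous_map_norm continuous_map_diff contproj) auto
    from continuous_map_eps[THEN iffD1, rule_format, OF this y1 e]
    obtain N where N: "openin ?Y N" "y1 \<in> N" "\<forall>y\<in>N. dist (g y) (g y1) < e" by blast
    have "pnorm E (lincomb n v (snd y) \<ominus> lincomb n v (snd y1)) (fst y) < e" if y: "y \<in> N" for y
    proof -
      have "pnorm E (lincomb n v (snd y) \<ominus> lincomb n v (snd y1)) (fst y)
          \<le> (\<Sum>i<n. pnorm E (cscale E (snd y i - snd y1 i) (v i)) (fst y))"
        unfolding lincomb_diff[OF v] unfolding lincomb_def by (rule pnorm_finsum_le) (use v in auto)
      also have "\<dots> = g y" unfolding g_def using v by (intro sum.cong) (auto simp: pnorm_cscale Pi_iff)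
      also have "g y < e" using N(3) y by (auto simp: dist_real_def g_def)
      finally show ?thesis .
    qed
    then show "\<exists>N. openin ?Y N \<and> y1 \<in> N \<and> (\<forall>y\<in>N. pnorm E (lincomb n v (snd y) \<ominus> lincomb n v (snd y1)) (fst y) < e)"
      using N by blast
  qed
  have cont_co: "continuous_map ?Z euclidean (\<lambda>p. co p i)" if i: "i < n" for i
    unfolding continuous_map_eps
  proof (intro ballI allI impI)
    fix p1 and e :: real assume p1: "p1 \<in> topspace ?Z" and e: "e > 0"
    obtain x1 \<xi>1 where x1: "p1 = cls x1 \<xi>1" "x1 \<in> W" "\<xi>1 \<in> carrier E" using points_W[OF p1] by blast
    define \<xi> where "\<xi> = lincomb n v (co p1)"
    have \<xi>: "\<xi> \<in> carrier E" unfolding \<xi>_def by (rule l)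
    have p1\<xi>: "p1 = cls x1 \<xi>" unfolding \<xi>_def x1(1) by (rule co[OF x1(2,3), symmetric])
    \<comment> \<open>The radius is matched to \<open>low1\<close>: a fibre distance below
      \<open>sqrt \<delta> * e\<close> keeps each coordinate within \<open>e\<close>. The centre is
      the combination with constant coefficients \<open>co p1\<close>, whose coordinates do not move
      along the base.\<close>
    define N where "N = tube W \<xi> (sqrt \<delta> * e) \<inter> {p. proj module_bundle p \<in> W}"
    have "openin ?Z N" unfolding N_def openin_subtopology using openin_tube[OF W \<xi>] by blast
    moreover have "p1 \<in> N"
    proof -
      have "pnorm E (\<xi> \<ominus> \<xi>) x1 = 0" using pnorm_diff_eq_0_iff \<xi> by auto
      then show ?thesis unfolding N_def p1\<xi> using \<xi> x1(2) e \<delta> by (simp add: cls_in_tube)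
    qed
    moreover have "dist (co p i) (co p1 i) < e" if p: "p \<in> N" for p
    proof -
      obtain x \<eta> where x: "p = cls x \<eta>" "x \<in> W" "\<eta> \<in> carrier E" "pnorm E (\<eta> \<ominus> \<xi>) x < sqrt \<delta> * e"
        using p unfolding N_def tube_def by blast
      have "pnorm E (lincomb n v (co p) \<ominus> \<eta>) x = 0"
        unfolding x(1) using cls_eq_iff[OF l x(3)] co[OF x(2,3)] by blast
      then have "pnorm E (lincomb n v (co p) \<ominus> \<xi>) x < sqrt \<delta> * e"
        using pnorm_triangle_diff[OF l x(3) \<xi>, of "co p" x] x(4) by simp
      then have "sqrt \<delta> * cmod (co p i - co p1 i) < sqrt \<delta> * e"
        using low1[OF x(2) i, of "co p" "co p1"] unfolding \<xi>_def by linarith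
      then show ?thesis using \<delta> by (simp add: dist_norm)
    qed
    ultimately show "\<exists>U. openin ?Z U \<and> p1 \<in> U \<and> (\<forall>p\<in>U. dist (co p i) (co p1 i) < e)" by blast
  qed
  have "homeomorphic_maps ?Z ?Y \<phi> \<psi>"
    unfolding homeomorphic_maps_def
  proof (intro conjI ballI)
    have "continuous_map ?Z (subtopology X W) fst"
      using proj_continuous by (auto simp: continuous_map_in_subtopology continuous_map_from_subtopology)
    moreover have "continuous_map ?Z (complex_space n) co"
      unfolding complex_space_def continuous_map_componentwise using co_ext cont_co by auto
    ultimately show "continuous_map ?Z ?Y \<phi>" unfolding \<phi>_def by (rule continuous_map_pairedI)
    show "continuous_map ?Y ?Z \<psi>"
      unfolding continuous_map_in_subtopology using cont\<psi> topY by (auto simp: \<psi>_def)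
    show "\<psi> (\<phi> p) = p" if p: "p \<in> topspace ?Z" for p
    proof -
      obtain x \<xi> where x: "p = cls x \<xi>" "x \<in> W" "\<xi> \<in> carrier E" using points_W[OF p] by blast
      show ?thesis using co[OF x(2,3)] by (simp add: \<phi>_def \<psi>_def x(1))
    qed
    show "\<phi> (\<psi> q) = q" if qY: "q \<in> topspace ?Y" for q
    proof -
      obtain x a where q: "q = (x, a)" "x \<in> W" "a \<in> extensional {..<n}"
        using qY unfolding topY by blast
      have "co (\<psi> q) = a"
      proof (rule extensionalityI[OF co_ext q(3)])
        fix i assume "i \<in> {..<n}"
        then show "co (\<psi> q) i = a i" using uniq[OF q(2) co[OF q(2) l]] by (simp add: \<psi>_def q(1))
      qed
      then show ?thesis by (simp add: \<phi>_def q(1)) (simp add: \<psi>_def)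
    qed
  qed
  then have "homeomorphic_map ?Z ?Y \<phi>" unfolding homeomorphic_map_maps by blast
  moreover have "fst (\<phi> p) = x" if "x \<in> W" "p \<in> fiber module_bundle x" for x p
    using that by (simp add: \<phi>_def fiber_def)
  moreover have "snd (\<phi> (vadd module_bundle p q)) i = snd (\<phi> p) i + snd (\<phi> q) i"
    if x: "x \<in> W" and pq: "p \<in> fiber module_bundle x" "q \<in> fiber module_bundle x" and i: "i < n" for x p q i
  proof -
    have xX: "x \<in> topspace X" using x WX by blast
    obtain \<xi> \<eta> where \<xi>: "\<xi> \<in> carrier E" "p = cls x \<xi>" and \<eta>: "\<eta> \<in> carrier E" "q = cls x \<eta>"
      using pq unfolding fiber_module_bundle[OF xX] by blast
    have 1: "pnorm E (lincomb n v (co p) \<ominus> \<xi>) x = 0" "pnorm E (lincomb n v (co q) \<ominus> \<eta>) x = 0"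
      unfolding \<xi>(2) \<eta>(2) using co[OF x \<xi>(1)] co[OF x \<eta>(1)] cls_eq_iff[OF l \<xi>(1)] cls_eq_iff[OF l \<eta>(1)] by blast+
    have "cls x (lincomb n v (\<lambda>i. co p i + co q i)) = cls x (\<xi> \<oplus> \<eta>)"
    proof (rule cls_eqI[OF l])
      fix \<zeta> assume \<zeta>: "\<zeta> \<in> carrier E"
      have "hinner E \<zeta> (lincomb n v (\<lambda>i. co p i + co q i)) x = hinner E \<zeta> (lincomb n v (co p)) x + hinner E \<zeta> (lincomb n v (co q)) x"
        by (simp add: hinner_lincomb_right[OF v \<zeta>] distrib_right sum.distrib)
      also have "\<dots> = hinner E \<zeta> (\<xi> \<oplus> \<eta>) x"
        using 1 \<zeta> \<xi> \<eta> l by (simp add: pnorm_diff_eq_0_iff hinner_add)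
      finally show "hinner E \<zeta> (lincomb n v (\<lambda>i. co p i + co q i)) x = hinner E \<zeta> (\<xi> \<oplus> \<eta>) x" .
    qed (use \<xi> \<eta> in auto)
    also have "\<dots> = cls x (lincomb n v (co (cls x (\<xi> \<oplus> \<eta>))))" using co[OF x, of "\<xi> \<oplus> \<eta>"] \<xi> \<eta> by simp
    finally have "co p i + co q i = co (cls x (\<xi> \<oplus> \<eta>)) i" by (rule uniq[OF x _ i])
    then show ?thesis by (simp add: \<phi>_def \<xi> \<eta> vadd_cls)
  qed
  moreover have "snd (\<phi> (vscale module_bundle c p)) i = c * snd (\<phi> p) i"
    if x: "x \<in> W" and p: "p \<in> fiber module_bundle x" and i: "i < n" for x p c i
  proof -
    have xX: "x \<in> topspace X" using x WX by blast
    obtain \<xi> where \<xi>: "\<xi> \<in> carrier E" "p = cls x \<xi>" using p unfolding fiber_module_bundle[OF xX] by blast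
    have 1: "pnorm E (lincomb n v (co p) \<ominus> \<xi>) x = 0"
      unfolding \<xi>(2) using co[OF x \<xi>(1)] cls_eq_iff[OF l \<xi>(1)] by blast
    have "cls x (lincomb n v (\<lambda>i. c * co p i)) = cls x (cscale E c \<xi>)"
    proof (rule cls_eqI[OF l])
      fix \<zeta> assume \<zeta>: "\<zeta> \<in> carrier E"
      have "hinner E \<zeta> (lincomb n v (\<lambda>i. c * co p i)) x = c * hinner E \<zeta> (lincomb n v (co p)) x"
        by (simp add: hinner_lincomb_right[OF v \<zeta>] sum_distrib_left mult.assoc)
      also have "\<dots> = hinner E \<zeta> (cscale E c \<xi>) x"
        using 1 \<zeta> \<xi> l by (simp add: pnorm_diff_eq_0_iff hinner_cscale)
      finally show "hinner E \<zeta> (lincomb n v (\<lambda>i. c * co p i)) x = hinner E \<zeta> (cscale E c \<xi>) x" .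
    qed (use \<xi> in auto)
    also have "\<dots> = cls x (lincomb n v (co (cls x (cscale E c \<xi>))))" using co[OF x, of "cscale E c \<xi>"] \<xi> by simp
    finally have "c * co p i = co (cls x (cscale E c \<xi>)) i" by (rule uniq[OF x _ i])
    then show ?thesis by (simp add: \<phi>_def \<xi> vscale_cls)
  qed
  ultimately show ?thesis unfolding local_trivialization_def by (intro exI[of _ \<phi>]) blast
qed

lemma vector_bundle_module: "vector_bundle X module_bundle"
  unfolding vector_bundle_def
proof (intro conjI ballI)
  show "continuous_map (total module_bundle) X (proj module_bundle)" using proj_continuous by simp
  fix x assume x: "x \<in> topspace X"
  show "cvector_space (fiber module_bundle x) (vadd module_bundle) (vzero module_bundle x) (vscale module_bundle)"
    by (rule cvector_space_fiber[OF x])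
  obtain n v W \<delta> where f: "n \<ge> 1" "v \<in> {..<n} \<rightarrow> carrier E" "openin X W" "x \<in> W" "\<delta> > 0"
    "\<forall>x\<in>W. \<forall>a. \<delta> * (\<Sum>i<n. (cmod (a i))\<^sup>2) \<le> (pnorm E (lincomb n v a) x)\<^sup>2"
    "\<forall>x\<in>W. \<forall>\<xi>\<in>carrier E. spans {..<n} v x \<xi>"
    using local_frame[OF x] by blast
  obtain \<phi> where "local_trivialization X module_bundle W n \<phi>"
    using local_trivialization_module[OF f(2,3,5,6,7)] by blast
  then show "\<exists>U n \<phi>. openin X U \<and> x \<in> U \<and> n \<ge> 1 \<and> local_trivialization X module_bundle U n \<phi>"
    using f by blast
qed

end

sublocale full_sigma_module \<subseteq> B: hermitian_bundle X module_bundle module_metric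
  by (intro hermitian_bundle.intro locally_compact Hausdorff vector_bundle_module hermitian_metric_module)

sublocale full_sigma_module \<subseteq> G: hilbert_module X "Gamma0 X module_bundle module_metric"
  by (rule B.hilbert_module_Gamma)

context full_sigma_module
begin

abbreviation module_sections :: "('a, 'a \<Rightarrow> 'a \<times> 'e set) hmodule" ("\<Gamma>") where
  "\<Gamma> \<equiv> Gamma0 X module_bundle module_metric"

section \<open>The isometry from the module onto the sections of its bundle\<close>

definition hat :: "'e \<Rightarrow> 'a \<Rightarrow> 'a \<times> 'e set" where "hat \<xi> = (\<lambda>x\<in>topspace X. cls x \<xi>)"

lemma hinner_hat:
  assumes "\<xi> \<in> carrier E" "\<eta> \<in> carrier E" shows "hinner \<Gamma> (hat \<xi>) (hat \<eta>) = hinner E \<xi> \<eta>"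
  using assms by (auto simp: B.Gamma_simps hat_def module_metric_cls hinner_outside fun_eq_iff)

lemma hat_closed:
  assumes \<xi>: "\<xi> \<in> carrier E" shows "hat \<xi> \<in> carrier \<Gamma>"
proof -
  have "continuous_map X (total module_bundle) (\<lambda>x. cls x \<xi>)"
  proof (rule continuous_into_total)
    fix x and e :: real assume "x \<in> topspace X" "e > 0"
    moreover have "pnorm E (\<xi> \<ominus> \<xi>) y = 0" for y using pnorm_diff_eq_0_iff \<xi> by auto
    ultimately show "\<exists>N. openin X N \<and> x \<in> N \<and> (\<forall>y\<in>N. pnorm E (\<xi> \<ominus> \<xi>) y < e)"
      by (intro exI[of _ "topspace X"]) auto
  qed (use \<xi> in auto)
  then have "continuous_map X (total module_bundle) (hat \<xi>)"
    by (rule continuous_map_eq) (simp add: hat_def)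
  moreover have "vanishes_at_infinity X (\<lambda>x. module_metric (hat \<xi> x) (hat \<xi> x))"
    by (rule vanishes_at_infinity_mono[where f = "hinner E \<xi> \<xi>"])
      (use hinner_closed[OF \<xi> \<xi>] \<xi> in \<open>auto simp: C0_def hat_def module_metric_cls\<close>)
  moreover have "hat \<xi> x \<in> fiber module_bundle x" if "x \<in> topspace X" for x
    using that \<xi> by (simp add: hat_def fiber_module_bundle)
  ultimately show ?thesis by (simp add: B.carrier_Gamma B.sec_def) (simp add: hat_def)
qed

lemma pnorm_hat_diff:
  assumes "\<xi> \<in> carrier E" "\<eta> \<in> carrier E"
  shows "pnorm \<Gamma> (hat \<xi> \<ominus>\<^bsub>\<Gamma>\<^esub> hat \<eta>) x = pnorm E (\<xi> \<ominus> \<eta>) x"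
  unfolding pnorm_def using assms hat_closed
  by (simp add: G.hinner_diff_left G.hinner_diff_right hinner_diff_left hinner_diff_right hinner_hat)

text \<open>Each value \<open>\<sigma> p\<close> is attained by an element \<open>\<omega> p\<close>
  of \<open>E\<close>, which approximates \<open>\<sigma>\<close> within \<open>e\<close> on a
  neighbourhood of \<open>p\<close>. These are glued over the compact set \<open>L\<close> off which
  \<open>\<sigma>\<close> itself is smaller than \<open>e\<close>, so the zero element is good
  enough there.\<close>

lemma approximate_section:
  assumes \<sigma>: "\<sigma> \<in> carrier \<Gamma>" and e: "e > 0"
  shows "\<exists>\<xi>\<in>carrier E. \<forall>x. pnorm \<Gamma> (\<sigma> \<ominus>\<^bsub>\<Gamma>\<^esub> hat \<xi>) x \<le> e"
proof -
  have "e\<^sup>2 > 0" using e by simp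
  obtain L where L: "compactin X L" "\<forall>x\<in>topspace X - L. cmod (hinner \<Gamma> \<sigma> \<sigma> x) < e\<^sup>2"
  proof -
    have "vanishes_at_infinity X (hinner \<Gamma> \<sigma> \<sigma>)" using G.hinner_closed[OF \<sigma> \<sigma>] by (simp add: C0_def)
    from this[unfolded vanishes_at_infinity_def, rule_format, OF \<open>e\<^sup>2 > 0\<close>] show ?thesis using that by blast
  qed
  have LX: "L \<subseteq> topspace X" using compactin_subset_topspace[OF L(1)] .
  define \<omega> where "\<omega> p = rep (\<sigma> p)" for p
  have \<omega>: "\<omega> p \<in> carrier E \<and> \<sigma> p = cls p (\<omega> p)" if p: "p \<in> L" for p
  proof -
    have pX: "p \<in> topspace X" using p LX by blast
    have "\<sigma> p \<in> cls p ` carrier E" using B.Gamma_fiber[OF \<sigma> pX] unfolding fiber_module_bundle[OF pX] .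
    then obtain \<xi> where \<xi>: "\<xi> \<in> carrier E" "\<sigma> p = cls p \<xi>" by blast
    then show ?thesis using rep_cls[OF \<xi>(1), of p] by (simp add: \<omega>_def)
  qed
  define W where "W p = {x \<in> topspace X. pnorm \<Gamma> (\<sigma> \<ominus>\<^bsub>\<Gamma>\<^esub> hat (\<omega> p)) x \<in> {..<e}}" for p
  have W: "openin X (W p) \<and> p \<in> W p" if p: "p \<in> L" for p
  proof
    have h: "hat (\<omega> p) \<in> carrier \<Gamma>" using hat_closed \<omega>[OF p] by blast
    show "openin X (W p)" unfolding W_def
      by (rule openin_continuous_map_preimage[OF G.pnorm_continuous[OF G.minus_closed[OF \<sigma> h]]]) simp
    have "hinner \<Gamma> \<zeta> \<sigma> p = hinner \<Gamma> \<zeta> (hat (\<omega> p)) p" for \<zeta>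
      using \<omega>[OF p] by (simp add: B.Gamma_simps hat_def)
    then have "pnorm \<Gamma> (\<sigma> \<ominus>\<^bsub>\<Gamma>\<^esub> hat (\<omega> p)) p = 0" using G.pnorm_diff_eq_0_iff[OF \<sigma> h] by blast
    then show "p \<in> W p" using p LX e by (auto simp: W_def)
  qed
  obtain P \<rho> C where P: "finite P" "P \<subseteq> L"
    "\<forall>p\<in>P. continuous_map X euclidean (\<rho> p)" "\<forall>p x. 0 \<le> (\<rho> p x :: real)"
    "\<forall>p\<in>P. compactin X (C p) \<and> C p \<subseteq> W p \<and> (\<forall>x. x \<notin> C p \<longrightarrow> \<rho> p x = 0)"
    "\<forall>x. (\<Sum>p\<in>P. \<rho> p x) \<le> 1" "\<forall>x\<in>L. (\<Sum>p\<in>P. \<rho> p x) = 1"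
    using partition_on_compact[OF locally_compact Hausdorff L(1) W] by blast
  define f where "f p x = complex_of_real (\<rho> p x)" for p x
  have fC: "f p \<in> C0 X" if "p \<in> P" for p
    using P(3,5) that unfolding f_def[abs_def]
    by (intro C0_compact_support[of X _ "C p"] continuous_map_of_real) auto
  have \<omega>P: "\<omega> p \<in> carrier E" if "p \<in> P" for p using \<omega> P(2) that by blast
  define \<xi> where "\<xi> = finsum E (\<lambda>p. f p \<odot> \<omega> p) P"
  have g: "(\<lambda>p. f p \<odot> \<omega> p) \<in> P \<rightarrow> carrier E" using fC \<omega>P by auto
  have \<xi>: "\<xi> \<in> carrier E" unfolding \<xi>_def by (rule finsum_closed[OF g])
  have hat_\<xi>: "hinner \<Gamma> \<zeta> (hat \<xi>) x = (\<Sum>p\<in>P. f p x * hinner \<Gamma> \<zeta> (hat (\<omega> p)) x)"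
    if \<zeta>: "\<zeta> \<in> carrier \<Gamma>" and x: "x \<in> topspace X" for \<zeta> x
  proof -
    have "\<zeta> x \<in> cls x ` carrier E" using B.Gamma_fiber[OF \<zeta> x] unfolding fiber_module_bundle[OF x] .
    then obtain z where z: "z \<in> carrier E" "\<zeta> x = cls x z" by blast
    have "hinner \<Gamma> \<zeta> (hat \<eta>) x = hinner E z \<eta> x" if "\<eta> \<in> carrier E" for \<eta>
      using x z that by (simp add: B.Gamma_simps hat_def module_metric_cls)
    moreover have "hinner E z \<xi> x = (\<Sum>p\<in>P. f p x * hinner E z (\<omega> p) x)"
    proof -
      have "hinner E z \<xi> x = (\<Sum>p\<in>P. hinner E z (f p \<odot> \<omega> p) x)"
        unfolding \<xi>_def by (rule hinner_finsum[OF P(1) g z(1)])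
      also have "\<dots> = (\<Sum>p\<in>P. f p x * hinner E z (\<omega> p) x)"
        using fC \<omega>P z(1) by (intro sum.cong) (auto simp: hinner_act)
      finally show ?thesis .
    qed
    ultimately show ?thesis using \<xi> \<omega>P by simp
  qed
  define D where "D = \<sigma> \<ominus>\<^bsub>\<Gamma>\<^esub> hat \<xi>"
  have D: "D \<in> carrier \<Gamma>" unfolding D_def using \<sigma> hat_closed[OF \<xi>] by simp
  have "pnorm \<Gamma> D x \<le> e" for x
  proof (cases "x \<in> topspace X")
    case False
    then show ?thesis using e by (simp add: pnorm_def B.Gamma_simps)
  next
    case x: True
    define S where "S = (\<Sum>p\<in>P. \<rho> p x)"
    have S: "0 \<le> S" "S \<le> 1" using P(4,6) by (auto simp: S_def intro: sum_nonneg)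
    note D0 = G.pnorm_nonneg[OF D, of x]
    have "hinner \<Gamma> D D x = hinner \<Gamma> D \<sigma> x - (\<Sum>p\<in>P. f p x * hinner \<Gamma> D (hat (\<omega> p)) x)"
      using G.hinner_diff_right[OF D \<sigma> hat_closed[OF \<xi>], of x] hat_\<xi>[OF D x] by (simp add: D_def[symmetric])
    \<comment> \<open>The error \<open>D\<close> is a convex combination at \<open>x\<close>: the
      terms \<open>\<sigma> - \<omega> p\<close> with weights \<open>\<rho> p x\<close>, and
      \<open>\<sigma>\<close> with the missing weight \<open>1 - S\<close>. The missing weight is
      zero on \<open>L\<close>, so every term with nonzero weight has norm at most \<open>e\<close>;
      pairing with \<open>D\<close> bounds the norm of \<open>D\<close> itself by
      \<open>e\<close>.\<close>
    also have "\<dots> = (\<Sum>p\<in>P. f p x * hinner \<Gamma> D (\<sigma> \<ominus>\<^bsub>\<Gamma>\<^esub> hat (\<omega> p)) x) + complex_of_real (1 - S) * hinner \<Gamma> D \<sigma> x"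
    proof -
      have "(\<Sum>p\<in>P. f p x * hinner \<Gamma> D (\<sigma> \<ominus>\<^bsub>\<Gamma>\<^esub> hat (\<omega> p)) x)
          = (\<Sum>p\<in>P. f p x * hinner \<Gamma> D \<sigma> x - f p x * hinner \<Gamma> D (hat (\<omega> p)) x)"
        using G.hinner_diff_right[OF D \<sigma> hat_closed[OF \<omega>P]] by (intro sum.cong) (auto simp: right_diff_distrib)
      also have "\<dots> = complex_of_real S * hinner \<Gamma> D \<sigma> x - (\<Sum>p\<in>P. f p x * hinner \<Gamma> D (hat (\<omega> p)) x)"
        by (simp add: sum_subtractf S_def f_def sum_distrib_right)
      finally show ?thesis by (simp add: algebra_simps)
    qed
    finally have eq: "hinner \<Gamma> D D x = (\<Sum>p\<in>P. f p x * hinner \<Gamma> D (\<sigma> \<ominus>\<^bsub>\<Gamma>\<^esub> hat (\<omega> p)) x) + complex_of_real (1 - S) * hinner \<Gamma> D \<sigma> x" .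
    have 1: "cmod (\<Sum>p\<in>P. f p x * hinner \<Gamma> D (\<sigma> \<ominus>\<^bsub>\<Gamma>\<^esub> hat (\<omega> p)) x) \<le> (\<Sum>p\<in>P. \<rho> p x * (pnorm \<Gamma> D x * e))"
    proof (intro order_trans[OF norm_sum] sum_mono)
      fix p assume p: "p \<in> P"
      show "cmod (f p x * hinner \<Gamma> D (\<sigma> \<ominus>\<^bsub>\<Gamma>\<^esub> hat (\<omega> p)) x) \<le> \<rho> p x * (pnorm \<Gamma> D x * e)"
      proof (cases "\<rho> p x = 0")
        case False
        then have "x \<in> W p" using P(5) p by blast
        then have "pnorm \<Gamma> (\<sigma> \<ominus>\<^bsub>\<Gamma>\<^esub> hat (\<omega> p)) x \<le> e" by (simp add: W_def)
        moreover have "cmod (hinner \<Gamma> D (\<sigma> \<ominus>\<^bsub>\<Gamma>\<^esub> hat (\<omega> p)) x) \<le> pnorm \<Gamma> D x * pnorm \<Gamma> (\<sigma> \<ominus>\<^bsub>\<Gamma>\<^esub> hat (\<omega> p)) x"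
          by (rule G.cauchy_schwarz[OF D G.minus_closed[OF \<sigma> hat_closed[OF \<omega>P[OF p]]]])
        ultimately have "cmod (hinner \<Gamma> D (\<sigma> \<ominus>\<^bsub>\<Gamma>\<^esub> hat (\<omega> p)) x) \<le> pnorm \<Gamma> D x * e"
          using mult_left_mono[OF _ D0] order_trans by blast
        then show ?thesis using P(4) by (simp add: f_def norm_mult mult_left_mono)
      qed (simp add: f_def)
    qed
    have 2: "cmod (complex_of_real (1 - S) * hinner \<Gamma> D \<sigma> x) \<le> (1 - S) * (pnorm \<Gamma> D x * e)"
    proof (cases "x \<in> L")
      case True
      then have "S = 1" using P(7) by (simp add: S_def)
      then show ?thesis by simp
    next
      case False
      then have "cmod (hinner \<Gamma> \<sigma> \<sigma> x) < e\<^sup>2" using L(2) x by blast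
      then have "(pnorm \<Gamma> \<sigma> x)\<^sup>2 < e\<^sup>2" unfolding G.hinner_self[OF \<sigma>] norm_of_real by simp
      then have "pnorm \<Gamma> \<sigma> x < e" by (rule power2_less_imp_less) (use e in simp)
      then have "pnorm \<Gamma> D x * pnorm \<Gamma> \<sigma> x \<le> pnorm \<Gamma> D x * e" by (intro mult_left_mono[OF _ D0]) simp
      then have "cmod (hinner \<Gamma> D \<sigma> x) \<le> pnorm \<Gamma> D x * e" using G.cauchy_schwarz[OF D \<sigma>, of x] by linarith
      then show ?thesis unfolding norm_mult norm_of_real using S by (simp add: mult_left_mono)
    qed
    have "(pnorm \<Gamma> D x)\<^sup>2 = cmod (hinner \<Gamma> D D x)" unfolding G.hinner_self[OF D] norm_of_real by simp
    also have "\<dots> \<le> (\<Sum>p\<in>P. \<rho> p x * (pnorm \<Gamma> D x * e)) + (1 - S) * (pnorm \<Gamma> D x * e)"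
      unfolding eq by (rule order_trans[OF norm_triangle_ineq add_mono[OF 1 2]])
    also have "\<dots> = pnorm \<Gamma> D x * e"
      unfolding sum_distrib_right[symmetric] S_def[symmetric] by (simp add: algebra_simps)
    finally have "pnorm \<Gamma> D x * pnorm \<Gamma> D x \<le> pnorm \<Gamma> D x * e" by (simp add: power2_eq_square)
    then show ?thesis using D0 e by (cases "pnorm \<Gamma> D x = 0") auto
  qed
  then show ?thesis using \<xi> unfolding D_def by blast
qed

text \<open>Approximants of \<open>\<sigma>\<close> form a Cauchy sequence in \<open>E\<close>,
  because \<open>hat\<close> preserves the pointwise seminorms of differences; the image of their
  limit has distance zero from \<open>\<sigma>\<close> everywhere.\<close>

lemma hat_surj:
  assumes \<sigma>: "\<sigma> \<in> carrier \<Gamma>" shows "\<exists>\<xi>\<in>carrier E. hat \<xi> = \<sigma>"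
proof -
  define d where "d k = 1 / real (Suc k)" for k
  have d: "d k > 0" for k by (simp add: d_def)
  have d0: "d \<longlonglongrightarrow> 0" unfolding d_def by (rule LIMSEQ_Suc[OF lim_1_over_n])
  have "\<forall>k. \<exists>\<xi>. \<xi> \<in> carrier E \<and> (\<forall>x. pnorm \<Gamma> (\<sigma> \<ominus>\<^bsub>\<Gamma>\<^esub> hat \<xi>) x \<le> d k)"
    using approximate_section[OF \<sigma> d] by blast
  from choice[OF this] obtain s where
    ss: "\<forall>k. s k \<in> carrier E \<and> (\<forall>x. pnorm \<Gamma> (\<sigma> \<ominus>\<^bsub>\<Gamma>\<^esub> hat (s k)) x \<le> d k)" ..
  then have s: "s k \<in> carrier E" and sd: "pnorm \<Gamma> (\<sigma> \<ominus>\<^bsub>\<Gamma>\<^esub> hat (s k)) x \<le> d k" for k x by simp_all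
  note hs = hat_closed[OF s]
  have diff: "pnorm E (s m \<ominus> s k) x \<le> d m + d k" for m k x
  proof -
    have "pnorm E (s m \<ominus> s k) x \<le> pnorm \<Gamma> (hat (s m) \<ominus>\<^bsub>\<Gamma>\<^esub> \<sigma>) x + pnorm \<Gamma> (\<sigma> \<ominus>\<^bsub>\<Gamma>\<^esub> hat (s k)) x"
      unfolding pnorm_hat_diff[OF s s, symmetric] by (rule G.pnorm_triangle_diff[OF hs \<sigma> hs])
    then show ?thesis using sd[of m x] sd[of k x] G.pnorm_diff_commute[OF hs \<sigma>, of m x] by linarith
  qed
  have "\<exists>N. \<forall>m\<ge>N. \<forall>k\<ge>N. hnorm E (s m \<ominus> s k) < e" if e: "e > 0" for e
  proof -
    from e have "e/3 > 0" by simp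
    from LIMSEQ_D[OF d0 this] obtain N where N: "\<And>n. n \<ge> N \<Longrightarrow> \<bar>d n\<bar> < e/3" by auto
    show ?thesis
    proof (intro exI[of _ N] allI impI)
      fix m k assume "N \<le> m" "N \<le> k"
      then have "d m + d k \<le> 2*e/3" using N[of m] N[of k] by linarith
      then have "hnorm E (s m \<ominus> s k) \<le> 2*e/3" by (rule hnorm_le[OF minus_closed[OF s s] order_trans[OF diff]])
      then show "hnorm E (s m \<ominus> s k) < e" using e by linarith
    qed
  qed
  then obtain \<xi> where \<xi>: "\<xi> \<in> carrier E" and lim: "(\<lambda>k. hnorm E (s k \<ominus> \<xi>)) \<longlonglongrightarrow> 0"
    using complete[of s] s by blast
  have "pnorm \<Gamma> (hat \<xi> \<ominus>\<^bsub>\<Gamma>\<^esub> \<sigma>) x = 0" for x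
  proof -
    note hx = hat_closed[OF \<xi>]
    have "pnorm \<Gamma> (hat \<xi> \<ominus>\<^bsub>\<Gamma>\<^esub> \<sigma>) x \<le> d k + hnorm E (s k \<ominus> \<xi>)" for k
    proof -
      have "pnorm \<Gamma> (\<sigma> \<ominus>\<^bsub>\<Gamma>\<^esub> hat \<xi>) x \<le> pnorm \<Gamma> (\<sigma> \<ominus>\<^bsub>\<Gamma>\<^esub> hat (s k)) x + pnorm \<Gamma> (hat (s k) \<ominus>\<^bsub>\<Gamma>\<^esub> hat \<xi>) x"
        by (rule G.pnorm_triangle_diff[OF \<sigma> hs hx])
      then show ?thesis
        using sd[of k x] pnorm_le_hnorm[OF minus_closed[OF s \<xi>], of k x] pnorm_hat_diff[OF s \<xi>, of k x]
          G.pnorm_diff_commute[OF \<sigma> hx, of x] by linarith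
    qed
    moreover have "(\<lambda>k. d k + hnorm E (s k \<ominus> \<xi>)) \<longlonglongrightarrow> 0 + 0" by (intro tendsto_add d0 lim)
    ultimately have "pnorm \<Gamma> (hat \<xi> \<ominus>\<^bsub>\<Gamma>\<^esub> \<sigma>) x \<le> 0" by (intro LIMSEQ_le_const[of _ 0]) auto
    then show ?thesis using G.pnorm_nonneg[OF G.minus_closed[OF hx \<sigma>], of x] by linarith
  qed
  then have "hat \<xi> = \<sigma>"
    using G.pnorm_diff_eq_0_iff[OF hat_closed[OF \<xi>] \<sigma>] by (intro G.hinner_ext hat_closed \<xi> \<sigma>) blast
  then show ?thesis using \<xi> by blast
qed

lemma hmodule_iso_hat: "hmodule_iso X E \<Gamma>"
  unfolding hmodule_iso_def
proof (intro exI[of _ hat] conjI ballI allI)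
  have "inj_on hat (carrier E)"
  proof (rule inj_onI)
    fix \<xi> \<eta> assume c: "\<xi> \<in> carrier E" "\<eta> \<in> carrier E" and eq: "hat \<xi> = hat \<eta>"
    show "\<xi> = \<eta>"
    proof (rule hinner_ext[OF c])
      fix \<zeta> x assume "\<zeta> \<in> carrier E"
      then show "hinner E \<zeta> \<xi> x = hinner E \<zeta> \<eta> x"
        using hinner_hat[OF _ c(1), of \<zeta>] hinner_hat[OF _ c(2), of \<zeta>] eq by simp
    qed
  qed
  then show "bij_betw hat (carrier E) (carrier \<Gamma>)"
    unfolding bij_betw_def using hat_closed hat_surj by blast
  fix \<xi> assume \<xi>: "\<xi> \<in> carrier E"
  show "hat (cscale E c \<xi>) = cscale \<Gamma> c (hat \<xi>)" for c
    using \<xi> by (auto simp: hat_def B.Gamma_simps vscale_cls intro!: restrict_ext)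
  show "hat (\<xi> \<oplus> \<eta>) = hat \<xi> \<oplus>\<^bsub>\<Gamma>\<^esub> hat \<eta>" if "\<eta> \<in> carrier E" for \<eta>
    using \<xi> that by (auto simp: hat_def B.Gamma_simps vadd_cls intro!: restrict_ext)
  show "hinner \<Gamma> (hat \<xi>) (hat \<eta>) = hinner E \<xi> \<eta>" if "\<eta> \<in> carrier E" for \<eta>
    by (rule hinner_hat[OF \<xi> that])
next
  fix f \<xi> assume f: "f \<in> C0 X" and \<xi>: "\<xi> \<in> carrier E"
  have "cls x (f \<odot> \<xi>) = cls x (cscale E (f x) \<xi>)" for x
    using f \<xi> by (intro cls_eqI) (auto simp: hinner_act hinner_cscale)
  then show "hat (f \<odot> \<xi>) = f \<odot>\<^bsub>\<Gamma>\<^esub> hat \<xi>"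
    using \<xi> by (auto simp: hat_def B.Gamma_simps vscale_cls intro!: restrict_ext)
qed

end

theorem theorem3p4:
  fixes X :: "'a topology"
  assumes "locally_compact_space X" and "Hausdorff_space X"
  shows "(\<forall>(V :: ('a, 't) vbundle) \<beta>.
            vector_bundle X V \<longrightarrow> hermitian_metric X V \<beta> \<longrightarrow>
              hilbert_module X (Gamma0 X V \<beta>) \<and>
              sigma_finitely_generated X (Gamma0 X V \<beta>) \<and>
              sigma_projective X (Gamma0 X V \<beta>)) \<and>
         (\<forall>E :: ('a, 'e) hmodule.
            hilbert_module X E \<longrightarrow> full X E \<longrightarrow>
            sigma_finitely_generated X E \<longrightarrow> sigma_projective X E \<longrightarrow>
              (\<exists>(V :: ('a, 'a \<times> 'e set) vbundle) \<beta>.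
                 vector_bundle X V \<and> hermitian_metric X V \<beta> \<and> hmodule_iso X E (Gamma0 X V \<beta>)))"
  proof (intro conjI allI impI)
  fix V :: "('a, 't) vbundle" and \<beta>
  assume "vector_bundle X V" "hermitian_metric X V \<beta>"
  then interpret hermitian_bundle X V \<beta>
    using assms by (intro hermitian_bundle.intro)
  show "hilbert_module X (Gamma0 X V \<beta>)" by (rule hilbert_module_Gamma)
  show "sigma_finitely_generated X (Gamma0 X V \<beta>)"
    unfolding sigma_finitely_generated_def using restriction_finitely_generated_projective(1) by blast
  show "sigma_projective X (Gamma0 X V \<beta>)"
    unfolding sigma_projective_def using restriction_finitely_generated_projective(2) by blast
next
  fix E :: "('a, 'e) hmodule"
  assume "hilbert_module X E" "full X E" "sigma_finitely_generated X E" "sigma_projective X E"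
  then interpret full_sigma_module X E
    using assms by (intro full_sigma_module.intro full_sigma_module_axioms.intro)
  show "\<exists>(V :: ('a, 'a \<times> 'e set) vbundle) \<beta>.
      vector_bundle X V \<and> hermitian_metric X V \<beta> \<and> hmodule_iso X E (Gamma0 X V \<beta>)"
    using vector_bundle_module hermitian_metric_module hmodule_iso_hat by blast
qed

end
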